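(* Let $D\subset\mathbb R^m$ be a domain, $\varnothing\ne H\subset\mathrm{sbh}_*(D)$, $\nu\ne0$ a positive Borel measure with compact support in $D$, and $F\in L^1_{\mathrm{loc}}(D,\lambda)$ an extended real-valued function. Assume condition (c): for every compact $K\subset D$ and every constant $c\in\mathbb R$ there is $h\in H$ with $h\le c$ on $K$; and one of: (a) for every sequence $(h_k)\subset H$ locally uniformly bounded above on $D$ with $\limsup_kh_k\not\equiv-\infty$, the upper semicontinuous regularization $\limsup_k^*h_k$ belongs to $H$; (b) $H$ is sequentially closed in $L^1_{\mathrm{loc}}(D)$. Let $U_0$ be a domain with $\operatorname{supp}\nu\subset U_0\Subset D$ and let $\mathcal M$ be the set of positive measures $\mu$ on $D$ having a $C^\infty$ density with respect to Lebesgue measure $\lambda$ and compact support contained in $D\setminus U_0$. I. If $H$ is a convex cone containing a function $\le0$ and $$-\infty<\inf\Big\{\int F\,d\mu:\ \mu\in\mathcal M,\ \nu\prec\mu\Big\},$$ then for every positive function $r$ on $D$ locally bounded away from zero with $r(x)<\operatorname{dist}(x,\partial D)$ there exist a strictly positive $C^\infty$ function $\hat r\le r$ on $D$, a constant $C\in\mathbb R$ and $h\in H$ with $h(x)\le F^{*\hat r}(x)+C$ for all $x\in D$. II. If $H$ is convex, $0\in H$, and $$-\infty<\inf\Big\{\int F\,d\mu+c:\ \mu\in\mathcal M,\ c\ge0,\ \nu\curlyeqprec\mu+c\Big\},$$ then the same conclusion as in I holds.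
   Context: $\mathrm{sbh}(D)$ is the cone of subharmonic functions on $D$ (including $-\infty$), $\mathrm{sbh}_*(D)=\mathrm{sbh}(D)\setminus\{-\infty\}$. For measures $\nu,\mu$ (positive, compactly supported in $D$): $\nu\prec\mu$ (linear sweeping relative to $H$) means $\int h\,d\nu\le\int h\,d\mu$ for all $h\in H$; $\nu\curlyeqprec\mu+c$ (affine sweeping) means $\int h\,d\nu\le\int h\,d\mu+c$ for all $h\in H$. A positive function $r$ is locally bounded away from zero if $\inf_Kr>0$ for every compact $K\subset D$. Fix a radial function $a\in C^\infty(\mathbb R^m)$, $a\ge0$, $a(x)=0$ for $|x|\ge1$, $\int a\,d\lambda=1$; for $\rho>0$ let $a_\rho(x)=c_\rho a(x/\rho)$ with $c_\rho$ chosen so that $\int a_\rho\,d\lambda=1$. For a positive function $\hat r$ on $D$, $F^{*\hat r}(x)=\int_{|y|<\hat r(x)}F(x+y)a_{\hat r(x)}(y)\,d\lambda(y)$. *)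

theory Defs
  imports "HOL-Analysis.Analysis"
begin

section \<open>Smoothness (C^k, C^infinity) on an open set\<close>

fun Ck_on :: "nat \<Rightarrow> 'a::euclidean_space set \<Rightarrow> ('a \<Rightarrow> real) \<Rightarrow> bool" where
  "Ck_on 0 S f = continuous_on S f"
| "Ck_on (Suc k) S f =
     ((\<forall>x\<in>S. f differentiable (at x)) \<and>
      (\<forall>i\<in>Basis. Ck_on k S (\<lambda>x. frechet_derivative f (at x) i)))"

definition smooth_on :: "'a::euclidean_space set \<Rightarrow> ('a \<Rightarrow> real) \<Rightarrow> bool" where
  "smooth_on S f \<longleftrightarrow> (\<forall>k. Ck_on k S f)"

section \<open>Extended-real integrals, supports of measures\<close>

text \<open>Integral of an extended-real function: positive part minus negative part.\<close>
definition ereal_integral :: "'a measure \<Rightarrow> ('a \<Rightarrow> ereal) \<Rightarrow> ereal" where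
  "ereal_integral M f =
     enn2ereal (\<integral>\<^sup>+ x. e2ennreal (f x) \<partial>M) - enn2ereal (\<integral>\<^sup>+ x. e2ennreal (- f x) \<partial>M)"

text \<open>Support of a measure: points all of whose ball-neighbourhoods have positive measure.\<close>
definition measure_support :: "'a::metric_space measure \<Rightarrow> 'a set" where
  "measure_support M = {x. \<forall>e>0. emeasure M (ball x e) > 0}"

section \<open>Subharmonic functions\<close>

definition usc_on :: "'a::topological_space set \<Rightarrow> ('a \<Rightarrow> ereal) \<Rightarrow> bool" where
  "usc_on D u \<longleftrightarrow> (\<forall>x\<in>D. \<forall>c. u x < c \<longrightarrow> eventually (\<lambda>y. u y < c) (at x))"

text \<open>Subharmonic on the open set D: values in [-infinity, infinity), upper semicontinuous,
  sub-mean-value property over every closed ball contained in D. Includes the constant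
  -infinity. Convention: functions are extensional, i.e. equal to 0 outside D.\<close>
definition subharmonic_on :: "'a::euclidean_space set \<Rightarrow> ('a \<Rightarrow> ereal) \<Rightarrow> bool" where
  "subharmonic_on D u \<longleftrightarrow>
     (\<forall>x\<in>D. u x \<noteq> \<infinity>) \<and> usc_on D u \<and>
     (\<forall>x r. 0 < r \<and> cball x r \<subseteq> D \<longrightarrow>
        u x \<le> ereal_integral (restrict_space lebesgue (ball x r)) u
               / ereal (measure lebesgue (ball x r)))"

definition sbh :: "'a::euclidean_space set \<Rightarrow> ('a \<Rightarrow> ereal) set" where
  "sbh D = {u. subharmonic_on D u \<and> (\<forall>x. x \<notin> D \<longrightarrow> u x = 0)}"

text \<open>sbh_*(D): subharmonic functions not identically -infinity on D.\<close>
definition sbh_star :: "'a::euclidean_space set \<Rightarrow> ('a \<Rightarrow> ereal) set" where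
  "sbh_star D = {u \<in> sbh D. \<exists>x\<in>D. u x \<noteq> -\<infinity>}"

section \<open>Local integrability and L^1_loc convergence\<close>

definition L1loc :: "'a::euclidean_space set \<Rightarrow> ('a \<Rightarrow> ereal) \<Rightarrow> bool" where
  "L1loc D f \<longleftrightarrow>
     (\<lambda>x. if x \<in> D then f x else 0) \<in> borel_measurable lebesgue \<and>
     (\<forall>K. compact K \<and> K \<subseteq> D \<longrightarrow>
        (\<integral>\<^sup>+ x. e2ennreal \<bar>f x\<bar> * indicator K x \<partial>lebesgue) < \<infinity>)"

text \<open>Convergence in L^1_loc(D) (functions are a.e. finite, so real parts suffice).\<close>
definition L1loc_tendsto :: "'a::euclidean_space set \<Rightarrow> (nat \<Rightarrow> 'a \<Rightarrow> ereal) \<Rightarrow> ('a \<Rightarrow> ereal) \<Rightarrow> bool" where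
  "L1loc_tendsto D hs g \<longleftrightarrow>
     (\<forall>K. compact K \<and> K \<subseteq> D \<longrightarrow>
        ((\<lambda>k. \<integral>\<^sup>+ x. ennreal \<bar>real_of_ereal (hs k x) - real_of_ereal (g x)\<bar> * indicator K x \<partial>lebesgue)
           \<longlonglongrightarrow> 0))"

section \<open>Upper semicontinuous regularization\<close>

definition usc_reg :: "('a::topological_space \<Rightarrow> ereal) \<Rightarrow> 'a \<Rightarrow> ereal" where
  "usc_reg u x = Limsup (nhds x) u"

section \<open>Sweeping\<close>

definition lin_sweep :: "('a \<Rightarrow> ereal) set \<Rightarrow> 'a measure \<Rightarrow> 'a measure \<Rightarrow> bool" where
  "lin_sweep H \<nu> \<mu> \<longleftrightarrow> (\<forall>h\<in>H. ereal_integral \<nu> h \<le> ereal_integral \<mu> h)"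

definition aff_sweep :: "('a \<Rightarrow> ereal) set \<Rightarrow> 'a measure \<Rightarrow> 'a measure \<Rightarrow> real \<Rightarrow> bool" where
  "aff_sweep H \<nu> \<mu> c \<longleftrightarrow> (\<forall>h\<in>H. ereal_integral \<nu> h \<le> ereal_integral \<mu> h + ereal c)"

section \<open>Mollifier and averaging\<close>

definition mollifier :: "('a::euclidean_space \<Rightarrow> real) \<Rightarrow> bool" where
  "mollifier a \<longleftrightarrow> smooth_on UNIV a \<and> (\<forall>x. 0 \<le> a x) \<and>
     (\<forall>x y. norm x = norm y \<longrightarrow> a x = a y) \<and>
     (\<forall>x. 1 \<le> norm x \<longrightarrow> a x = 0) \<and>
     integrable lebesgue a \<and> integral\<^sup>L lebesgue a = 1"

definition scaled_moll :: "('a::euclidean_space \<Rightarrow> real) \<Rightarrow> real \<Rightarrow> 'a \<Rightarrow> real" where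
  "scaled_moll a \<rho> x = (1 / integral\<^sup>L lebesgue (\<lambda>y. a (y /\<^sub>R \<rho>))) * a (x /\<^sub>R \<rho>)"

text \<open>F^{*r}(x) = integral over |y| < r(x) of F(x+y) a_{r(x)}(y).\<close>
definition moll_avg :: "('a::euclidean_space \<Rightarrow> real) \<Rightarrow> ('a \<Rightarrow> ereal) \<Rightarrow> ('a \<Rightarrow> real) \<Rightarrow> 'a \<Rightarrow> real" where
  "moll_avg a F r x =
     integral\<^sup>L lebesgue (\<lambda>y. indicator (ball 0 (r x)) y * real_of_ereal (F (x + y)) * scaled_moll a (r x) y)"

section \<open>The class M of test measures\<close>

definition test_measures :: "'a::euclidean_space set \<Rightarrow> 'a set \<Rightarrow> 'a measure set" where
  "test_measures D U0 =
     {\<mu>. \<exists>g. smooth_on D g \<and> (\<forall>x\<in>D. 0 \<le> g x) \<and>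
           \<mu> = density lebesgue (\<lambda>x. indicator D x * ennreal (g x)) \<and>
           compact (measure_support \<mu>) \<and> measure_support \<mu> \<subseteq> D - U0}"

end

(* Let f be the average of F over balls of variable radius rh <= r. On each compact K one looks for h in H with
   h <= f + C on K while the integral of h against nu stays bounded below. The functions "average of h minus f" on K,
   combined with the integral of h against nu, form a convex set of bounded functions; were no such h available,
   separation in L2 would give a nonnegative density, and averaging that density a smooth test measure sweeping nu
   (affinely) with too small an integral of F. The part of nu carried by U0 is handled by sweeping nu out to a smooth
   density outside a neighbourhood of the closure of U0, as the exit law of a random walk. Subharmonic functions lie
   below their radial averages, which turns the L2 bound into a pointwise one; near the closure of U0 the maximum
   principle extends the bound. Finally K exhausts D, and the lower bound on the integrals keeps the sequence of
   solutions away from -infinity, so closedness of H under limits provides one h on all of D. *)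

theory Submission
  imports Defs "HOL-Complex_Analysis.Great_Picard"
begin

text \<open>The separating functional has to become a smooth density of compact support. L2 of a
  bounded set is therefore the right space: there the functional is a nonnegative integrable
  function, not a general measure. The integral against \<nu> enters as a constant value on
  \<open>U0\<close>, disjoint from \<open>X\<close>, so that one function carries both requirements.
  The functional may ignore that value; no normalisation then produces a swept measure, and the
  swept density \<open>g0\<close> is needed as a base to which arbitrarily large multiples can be
  added. The analytic obstacle is that \<open>a\<close> is radial but need not decrease, so sub-mean
  values on balls do not compare directly with averages by \<open>a\<close>. Monotonicity of these
  averages in the radius is obtained from the weak form of "Laplacian \<ge> 0", tested with a
  function whose gradient at \<open>x\<close> is \<open>- a x *\<^sub>R x\<close>. It yields both
  the domination of \<open>h\<close> by its averages and the decreasing limits behind compactness in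
  L1. The constant \<open>C\<close> must be independent of the compact set, otherwise nothing would
  survive the exhaustion.\<close>

section \<open>Smooth superpositions of bumps\<close>

lemma Ck_on_mono: "Ck_on k T f \<Longrightarrow> S \<subseteq> T \<Longrightarrow> Ck_on k S f"
proof (induction k arbitrary: f)
  case 0
  thus ?case by (auto intro: continuous_on_subset)
next
  case (Suc k)
  thus ?case by auto
qed

lemma Ck_on_imp_continuous_on: "Ck_on k S f \<Longrightarrow> continuous_on S f"
  by (cases k) (auto intro!: continuous_at_imp_continuous_on differentiable_imp_continuous_within)

lemma derivative_eq_sum_Basis:
  fixes f' :: "'a::euclidean_space \<Rightarrow> real"
  assumes "linear f'"
  shows "f' h = (\<Sum>i\<in>Basis. (h \<bullet> i) * f' i)"
proof -
  have "f' h = f' (\<Sum>i\<in>Basis. (h \<bullet> i) *\<^sub>R i)"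
    by (simp add: euclidean_representation)
  also have "\<dots> = (\<Sum>i\<in>Basis. (h \<bullet> i) * f' i)"
    using assms by (simp add: linear_sum linear_cmul)
  finally show ?thesis .
qed

text \<open>The factor \<open>DIM('a)\<close> comes from bounding each coordinate of
  \<open>h\<close> by \<open>norm h\<close>; the crude form is enough because only some Lipschitz
  constant is wanted, for domination.\<close>

lemma derivative_lipschitz:
  fixes f :: "'a::euclidean_space \<Rightarrow> real"
  assumes der: "\<And>x. (f has_derivative f' x) (at x)"
    and B: "\<And>x i. i \<in> Basis \<Longrightarrow> \<bar>f' x i\<bar> \<le> B"
  shows "\<bar>f (x + h) - f x\<bar> \<le> real DIM('a) * B * norm h"
    and "\<bar>f' x h\<bar> \<le> real DIM('a) * B * norm h"
proof -
  have bd: "\<bar>f' x h\<bar> \<le> real DIM('a) * B * norm h" for x h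
  proof -
    have "linear (f' x)" by (rule has_derivative_linear[OF der])
    hence "\<bar>f' x h\<bar> = \<bar>\<Sum>i\<in>Basis. (h \<bullet> i) * f' x i\<bar>"
      by (subst derivative_eq_sum_Basis) auto
    also have "\<dots> \<le> (\<Sum>i\<in>(Basis::'a set). norm h * B)"
      by (intro order.trans[OF sum_abs] sum_mono)
         (auto simp: abs_mult intro!: mult_mono B Basis_le_norm)
    finally show ?thesis by (simp add: algebra_simps)
  qed
  thus "\<bar>f' x h\<bar> \<le> real DIM('a) * B * norm h" .
  obtain i :: 'a where "i \<in> Basis" using nonempty_Basis by blast
  hence B0: "0 \<le> B" using B[of i x] by linarith
  have "norm (f (x + h) - f x) \<le> real DIM('a) * B * norm ((x + h) - x)"
  proof (rule differentiable_bound[of UNIV f f'])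
    show "onorm (f' x) \<le> real DIM('a) * B" for x
      using bd B0 by (intro onorm_bound mult_nonneg_nonneg) auto
  qed (use der in auto)
  thus "\<bar>f (x + h) - f x\<bar> \<le> real DIM('a) * B * norm h" by simp
qed

lemma bounded_support_bound:
  fixes b :: "'a::euclidean_space \<Rightarrow> real"
  assumes "continuous_on UNIV b" and "\<And>x. norm x > 1 \<Longrightarrow> b x = 0"
  obtains B where "B \<ge> 0" "\<And>x. \<bar>b x\<bar> \<le> B"
proof -
  have "compact (b ` cball 0 1)"
    by (intro compact_continuous_image continuous_on_subset[OF assms(1)]) auto
  then obtain B where B: "\<forall>y\<in>b ` cball 0 1. norm y \<le> B"
    using compact_imp_bounded bounded_iff by blast
  have "\<bar>b x\<bar> \<le> max B 0" for x
    using B assms(2)[of x] by (cases "norm x \<le> 1") (auto simp: le_max_iff_disj)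
  thus ?thesis by (intro that[of "max B 0"]) auto
qed

text \<open>Translates, dilates, convolutions and locally finite superpositions of bumps are all
  instances of the following superposition, with counting measures or \<open>lborel\<close> as \<open>M\<close>.\<close>

lemma Ck_on_superposition:
  fixes b :: "'a::euclidean_space \<Rightarrow> real" and T al :: "'b \<Rightarrow> real" and be :: "'b \<Rightarrow> 'a"
  assumes meas: "T \<in> borel_measurable M" "al \<in> borel_measurable M" "be \<in> borel_measurable M"
    and T: "\<And>n. integrable M (\<lambda>x. \<bar>T x\<bar> * \<bar>al x\<bar> ^ n)"
    and b: "Ck_on k UNIV b" and supp: "\<And>x. norm x > 1 \<Longrightarrow> b x = 0"
  shows "Ck_on k UNIV (\<lambda>y. \<integral>x. T x * b (al x *\<^sub>R y + be x) \<partial>M)"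
  using meas(1) T b supp
proof (induction k arbitrary: T b)
  case (0 T b)
  note [measurable] = meas(2,3) 0(1)
  have cont: "continuous_on UNIV b" using 0 by simp
  hence [measurable]: "b \<in> borel_measurable borel" by (rule borel_measurable_continuous_onI)
  obtain B where B: "\<And>x. \<bar>b x\<bar> \<le> B" using bounded_support_bound[OF cont 0(4)] by metis
  have "continuous (at y) (\<lambda>y. \<integral>x. T x * b (al x *\<^sub>R y + be x) \<partial>M)" for y
    unfolding continuous_at_sequentially comp_def
  proof safe
    fix z assume z: "z \<longlonglongrightarrow> y"
    show "(\<lambda>n. \<integral>x. T x * b (al x *\<^sub>R z n + be x) \<partial>M) \<longlonglongrightarrow> (\<integral>x. T x * b (al x *\<^sub>R y + be x) \<partial>M)"
    proof (rule integral_dominated_convergence[where w="\<lambda>x. \<bar>T x\<bar> * B"])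
      show "integrable M (\<lambda>x. \<bar>T x\<bar> * B)" using 0(2)[of 0] by simp
      show "AE x in M. (\<lambda>n. T x * b (al x *\<^sub>R z n + be x)) \<longlonglongrightarrow> T x * b (al x *\<^sub>R y + be x)"
        by (intro AE_I2 tendsto_mult tendsto_const continuous_on_tendsto_compose[OF cont])
           (auto intro!: tendsto_intros z)
      show "AE x in M. norm (T x * b (al x *\<^sub>R z n + be x)) \<le> \<bar>T x\<bar> * B" for n
        using B by (auto simp: abs_mult intro!: mult_left_mono)
    qed auto
  qed
  thus ?case by (simp add: continuous_at_imp_continuous_on)
next
  case (Suc k T b)
  note [measurable] = meas(2,3) Suc.prems(1)
  have cont: "continuous_on UNIV b" using Suc.prems(3) by (rule Ck_on_imp_continuous_on)
  hence [measurable]: "b \<in> borel_measurable borel" by (rule borel_measurable_continuous_onI)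
  define b' where "b' = (\<lambda>i p. frechet_derivative b (at p) i)"
  have der: "(b has_derivative frechet_derivative b (at p)) (at p)" for p
    using Suc.prems(3) frechet_derivative_works by auto
  have Ck': "Ck_on k UNIV (b' i)" if "i \<in> Basis" for i
    using Suc.prems(3) that by (auto simp: b'_def)
  \<comment> \<open>The support condition uses the strict inequality \<open>norm p > 1\<close>,
    which describes an open set; it therefore passes to partial derivatives and the induction
    hypothesis applies to them.\<close>
  have supp': "b' i p = 0" if "norm p > 1" for i p
  proof -
    have "(b has_derivative (\<lambda>h. 0)) (at p)"
    proof (rule has_derivative_transform_within_open[of "\<lambda>_. 0"])
      show "open {p::'a. 1 < norm p}" by (intro open_Collect_less continuous_intros)
    qed (use that Suc.prems(4) in auto)
    thus ?thesis unfolding b'_def by (simp add: frechet_derivative_at[symmetric])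
  qed
  have "\<exists>B\<ge>0. \<forall>x. \<bar>b' i x\<bar> \<le> B" if "i \<in> Basis" for i
    using bounded_support_bound[OF Ck_on_imp_continuous_on[OF Ck'[OF that]] supp'] by metis
  then obtain Bf where Bf: "\<And>i. i \<in> Basis \<Longrightarrow> Bf i \<ge> 0 \<and> (\<forall>x. \<bar>b' i x\<bar> \<le> Bf i)" by metis
  define B where "B = (\<Sum>i\<in>Basis. Bf i)"
  have B: "\<bar>b' i x\<bar> \<le> B" if "i \<in> Basis" for i x
  proof -
    have "Bf i \<le> B" using Bf that unfolding B_def by (intro member_le_sum) auto
    thus ?thesis using Bf[OF that] order.trans by blast
  qed
  note lip = derivative_lipschitz[of b "\<lambda>p. frechet_derivative b (at p)" B, OF der B[unfolded b'_def]]
  define L where "L = real DIM('a) * B"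
  have lip1: "\<bar>b (x + h) - b x\<bar> \<le> L * norm h" for x h using lip(1) by (simp add: L_def)
  have lip2: "\<bar>frechet_derivative b (at x) h\<bar> \<le> L * norm h" for x h using lip(2) by (simp add: L_def)
  obtain Bb where Bb: "\<And>x. \<bar>b x\<bar> \<le> Bb" using bounded_support_bound[OF cont Suc.prems(4)] by metis
  \<comment> \<open>Differentiation in \<open>y\<close> produces one factor \<open>al x\<close>,
    absorbed into the weight. This is why all moments of \<open>al\<close> are assumed integrable
    against \<open>T\<close>: the assumption is stable under replacing \<open>T\<close> by
    \<open>T * al\<close>.\<close>
  have mT': "(\<lambda>x. T x * al x) \<in> borel_measurable M" by measurable
  have iT': "integrable M (\<lambda>x. \<bar>T x * al x\<bar> * \<bar>al x\<bar> ^ n)" for n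
    using Suc.prems(2)[of "Suc n"] by (simp add: abs_mult mult_ac)
  define g where "g = (\<lambda>y. \<integral>x. T x * b (al x *\<^sub>R y + be x) \<partial>M)"
  define g' where "g' = (\<lambda>i y. \<integral>x. (T x * al x) * b' i (al x *\<^sub>R y + be x) \<partial>M)"
  have Ckg': "Ck_on k UNIV (g' i)" if "i \<in> Basis" for i
    unfolding g'_def by (rule Suc.IH[OF mT' iT' Ck'[OF that] supp'])
  have [measurable]: "b' i \<in> borel_measurable borel" if "i \<in> Basis" for i
    using Ck_on_imp_continuous_on[OF Ck'[OF that]] by (rule borel_measurable_continuous_onI)
  have int1: "integrable M (\<lambda>x. T x * b (al x *\<^sub>R y + be x))" for y
  proof (rule Bochner_Integration.integrable_bound)
    show "integrable M (\<lambda>x. \<bar>T x\<bar> * Bb)" using Suc.prems(2)[of 0] by simp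
    show "AE x in M. norm (T x * b (al x *\<^sub>R y + be x)) \<le> norm (\<bar>T x\<bar> * Bb)"
      by (intro AE_I2) (auto simp: abs_mult intro!: mult_left_mono order.trans[OF Bb abs_ge_self])
  qed auto
  have int2: "integrable M (\<lambda>x. (T x * al x) * b' i (al x *\<^sub>R y + be x))" if "i \<in> Basis" for i y
  proof (rule Bochner_Integration.integrable_bound)
    show "integrable M (\<lambda>x. \<bar>T x * al x\<bar> * B)" using iT'[of 0] by simp
    show "AE x in M. norm (T x * al x * b' i (al x *\<^sub>R y + be x)) \<le> norm (\<bar>T x * al x\<bar> * B)"
      by (intro AE_I2) (auto simp: abs_mult intro!: mult_left_mono order.trans[OF B[OF that] abs_ge_self])
  qed (use that in auto)
  define g1 where "g1 = (\<lambda>y h. \<Sum>i\<in>Basis. (h \<bullet> i) * g' i y)"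
  have fr: "frechet_derivative b (at p) h = (\<Sum>i\<in>Basis. (h \<bullet> i) * b' i p)" for p h
    unfolding b'_def by (rule derivative_eq_sum_Basis[OF has_derivative_linear[OF der]])
  have g1: "g1 y h = (\<integral>x. T x * frechet_derivative b (at (al x *\<^sub>R y + be x)) (al x *\<^sub>R h) \<partial>M)" 
    and int3: "integrable M (\<lambda>x. T x * frechet_derivative b (at (al x *\<^sub>R y + be x)) (al x *\<^sub>R h))" for y h
  proof -
    have *: "T x * frechet_derivative b (at (al x *\<^sub>R y + be x)) (al x *\<^sub>R h)
       = (\<Sum>i\<in>Basis. (h \<bullet> i) * ((T x * al x) * b' i (al x *\<^sub>R y + be x)))" for x
      by (simp add: fr sum_distrib_left mult_ac)
    show "integrable M (\<lambda>x. T x * frechet_derivative b (at (al x *\<^sub>R y + be x)) (al x *\<^sub>R h))"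
      unfolding * using int2 by auto
    show "g1 y h = (\<integral>x. T x * frechet_derivative b (at (al x *\<^sub>R y + be x)) (al x *\<^sub>R h) \<partial>M)"
      unfolding * g1_def g'_def using int2 by (subst Bochner_Integration.integral_sum) auto
  qed
  have derg: "(g has_derivative g1 y) (at y)" for y
    unfolding has_derivative_at
  proof
    show "bounded_linear (g1 y)" unfolding g1_def
      by (intro bounded_linear_sum bounded_linear_mult_left bounded_linear_inner_left
           bounded_linear_compose[OF bounded_linear_mult_left bounded_linear_inner_left])
    show "(\<lambda>h. norm (g (y + h) - g y - g1 y h) / norm h) \<midarrow>0\<rightarrow> 0"
      unfolding tendsto_at_iff_sequentially comp_def
    proof safe
      fix X :: "nat \<Rightarrow> 'a" assume X: "\<forall>i. X i \<in> UNIV - {0}" "X \<longlonglongrightarrow> 0"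
      define R where "R = (\<lambda>x n. T x * ((b (al x *\<^sub>R (y + X n) + be x) - b (al x *\<^sub>R y + be x)
            - frechet_derivative b (at (al x *\<^sub>R y + be x)) (al x *\<^sub>R X n)) / norm (X n)))"
      have Rint: "(g (y + X n) - g y - g1 y (X n)) / norm (X n) = (\<integral>x. R x n \<partial>M)" for n
      proof -
        have "(\<integral>x. R x n \<partial>M) = (\<integral>x. (T x * b (al x *\<^sub>R (y + X n) + be x) - T x * b (al x *\<^sub>R y + be x)
            - T x * frechet_derivative b (at (al x *\<^sub>R y + be x)) (al x *\<^sub>R X n)) / norm (X n) \<partial>M)"
          by (simp add: R_def diff_divide_distrib right_diff_distrib)
        also have "\<dots> = (g (y + X n) - g y - g1 y (X n)) / norm (X n)"
          unfolding g_def g1 using int1 int3 by simp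
        finally show ?thesis by simp
      qed
      \<comment> \<open>The difference quotient and the linear term are each at most
        \<open>L * \<bar>al x\<bar>\<close>, hence the dominating function with the factor
        \<open>2 * L\<close>.\<close>
      have "(\<lambda>n. \<integral>x. R x n \<partial>M) \<longlonglongrightarrow> (\<integral>x. 0 \<partial>M)"
      proof (rule integral_dominated_convergence[where w="\<lambda>x. \<bar>T x\<bar> * \<bar>al x\<bar> ^ 1 * (2 * L)"])
        show "integrable M (\<lambda>x. \<bar>T x\<bar> * \<bar>al x\<bar> ^ 1 * (2 * L))" using Suc.prems(2)[of 1] by auto
        show "(\<lambda>x. R x n) \<in> borel_measurable M" for n
        proof -
          have "(\<lambda>x. T x * frechet_derivative b (at (al x *\<^sub>R y + be x)) (al x *\<^sub>R X n)) \<in> borel_measurable M"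
            using int3 by auto
          moreover have "R x n = (T x * (b (al x *\<^sub>R (y + X n) + be x) - b (al x *\<^sub>R y + be x))
            - T x * frechet_derivative b (at (al x *\<^sub>R y + be x)) (al x *\<^sub>R X n)) / norm (X n)" for x
            by (simp add: R_def algebra_simps diff_divide_distrib)
          ultimately show ?thesis by simp
        qed
        show "AE x in M. (\<lambda>n. R x n) \<longlonglongrightarrow> 0"
        proof (rule AE_I2)
          fix x
          have "((\<lambda>y. b (al x *\<^sub>R y + be x)) has_derivative
             (\<lambda>h. frechet_derivative b (at (al x *\<^sub>R y + be x)) (al x *\<^sub>R h))) (at y)"
            by (rule has_derivative_compose[OF _ der]) (auto intro!: derivative_eq_intros)
          hence "(\<lambda>h. norm (b (al x *\<^sub>R (y + h) + be x) - b (al x *\<^sub>R y + be x)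
            - frechet_derivative b (at (al x *\<^sub>R y + be x)) (al x *\<^sub>R h)) / norm h) \<midarrow>0\<rightarrow> 0"
            unfolding has_derivative_at by simp
          hence "(\<lambda>n. norm (b (al x *\<^sub>R (y + X n) + be x) - b (al x *\<^sub>R y + be x)
            - frechet_derivative b (at (al x *\<^sub>R y + be x)) (al x *\<^sub>R X n)) / norm (X n)) \<longlonglongrightarrow> 0"
            using X unfolding tendsto_at_iff_sequentially comp_def by blast
          hence "(\<lambda>n. \<bar>T x\<bar> * (norm (b (al x *\<^sub>R (y + X n) + be x) - b (al x *\<^sub>R y + be x)
            - frechet_derivative b (at (al x *\<^sub>R y + be x)) (al x *\<^sub>R X n)) / norm (X n))) \<longlonglongrightarrow> \<bar>T x\<bar> * 0"
            by (intro tendsto_intros)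
          hence "(\<lambda>n. \<bar>R x n\<bar>) \<longlonglongrightarrow> 0" by (simp add: R_def abs_mult)
          thus "(\<lambda>n. R x n) \<longlonglongrightarrow> 0" by (simp add: tendsto_rabs_zero_iff)
        qed
        show "AE x in M. norm (R x n) \<le> \<bar>T x\<bar> * \<bar>al x\<bar> ^ 1 * (2 * L)" for n
        proof (rule AE_I2)
          fix x
          have Xn: "norm (X n) > 0" using X by auto
          have "\<bar>b (al x *\<^sub>R (y + X n) + be x) - b (al x *\<^sub>R y + be x)
            - frechet_derivative b (at (al x *\<^sub>R y + be x)) (al x *\<^sub>R X n)\<bar>
            \<le> L * norm (al x *\<^sub>R X n) + L * norm (al x *\<^sub>R X n)"
            using lip1[of "al x *\<^sub>R y + be x" "al x *\<^sub>R X n"] lip2[of "al x *\<^sub>R y + be x" "al x *\<^sub>R X n"]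
            by (simp add: algebra_simps)
          hence "\<bar>b (al x *\<^sub>R (y + X n) + be x) - b (al x *\<^sub>R y + be x)
            - frechet_derivative b (at (al x *\<^sub>R y + be x)) (al x *\<^sub>R X n)\<bar> / norm (X n) \<le> \<bar>al x\<bar> * (2 * L)"
            using Xn by (simp add: field_simps)
          hence "\<bar>T x\<bar> * (\<bar>b (al x *\<^sub>R (y + X n) + be x) - b (al x *\<^sub>R y + be x)
            - frechet_derivative b (at (al x *\<^sub>R y + be x)) (al x *\<^sub>R X n)\<bar> / norm (X n)) \<le> \<bar>T x\<bar> * (\<bar>al x\<bar> * (2 * L))"
            by (rule mult_left_mono) simp
          thus "norm (R x n) \<le> \<bar>T x\<bar> * \<bar>al x\<bar> ^ 1 * (2 * L)"
            by (simp add: R_def abs_mult mult_ac)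
        qed
      qed auto
      hence "(\<lambda>n. \<bar>(g (y + X n) - g y - g1 y (X n)) / norm (X n)\<bar>) \<longlonglongrightarrow> 0"
        unfolding Rint by (simp add: tendsto_rabs_zero)
      thus "(\<lambda>n. norm (g (y + X n) - g y - g1 y (X n)) / norm (X n)) \<longlonglongrightarrow> 0" by simp
    qed
  qed
  have "g differentiable (at y)" for y using derg by (auto simp: differentiable_def)
  moreover have "(\<lambda>y. frechet_derivative g (at y) i) = g' i" if "i \<in> Basis" for i
  proof
    fix y
    have "frechet_derivative g (at y) = g1 y" using frechet_derivative_at[OF derg] by simp
    hence "frechet_derivative g (at y) i = (\<Sum>j\<in>Basis. (i \<bullet> j) * g' j y)" by (simp add: g1_def)
    also have "\<dots> = (\<Sum>j\<in>Basis. if j = i then g' j y else 0)"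
      using that by (intro sum.cong) (auto simp: inner_Basis)
    also have "\<dots> = g' i y" using that by simp
    finally show "frechet_derivative g (at y) i = g' i y" .
  qed
  ultimately have "Ck_on (Suc k) UNIV g" using Ckg' by simp
  thus ?case unfolding g_def .
qed


subsection \<open>Averaging kernels\<close>

lemma
  fixes f :: "'a::euclidean_space \<Rightarrow> real"
  assumes [measurable]: "f \<in> borel_measurable borel" and c: "c \<noteq> 0"
  shows lborel_integral_affine: "(LBINT x. f x) = \<bar>c\<bar> ^ DIM('a) * (LBINT x. f (t + c *\<^sub>R x))"
    and lborel_integrable_affine_iff: "integrable lborel (\<lambda>x. f (t + c *\<^sub>R x)) \<longleftrightarrow> integrable lborel f"
proof -
  have *: "(LBINT x. f x) = (\<integral>x. f x \<partial>density (distr lborel borel (\<lambda>x. t + c *\<^sub>R x)) (\<lambda>_. \<bar>c\<bar> ^ DIM('a)))"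
    using lborel_affine[OF c, of t] by simp
  show "(LBINT x. f x) = \<bar>c\<bar> ^ DIM('a) * (LBINT x. f (t + c *\<^sub>R x))"
    unfolding * by (subst integral_density) (auto simp: integral_distr)
  have "integrable lborel f \<longleftrightarrow> integrable (density (distr lborel borel (\<lambda>x. t + c *\<^sub>R x)) (\<lambda>_. \<bar>c\<bar> ^ DIM('a))) f"
    using lborel_affine[OF c, of t] by simp
  also have "\<dots> \<longleftrightarrow> integrable lborel (\<lambda>x. f (t + c *\<^sub>R x))"
    using c by (subst integrable_density) (auto simp: integrable_distr_eq)
  finally show "integrable lborel (\<lambda>x. f (t + c *\<^sub>R x)) \<longleftrightarrow> integrable lborel f" by simp
qed

text \<open>\<open>cv b \<rho> u x\<close> is the average of \<open>u\<close> around \<open>x\<close> with the kernel \<open>b\<close> scaled to radius \<open>\<rho>\<close>, so that the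
  paper's averages are \<open>cv a (r x) F x\<close>; \<open>locint\<close> asks for Borel functions, not just Lebesgue measurable ones.\<close>

definition kern :: "('a::euclidean_space \<Rightarrow> real) \<Rightarrow> bool" where
  "kern b \<longleftrightarrow> continuous_on UNIV b \<and> (\<forall>x. 0 \<le> b x) \<and> (\<forall>x. 1 \<le> norm x \<longrightarrow> b x = 0) \<and>
     (\<forall>x. b (- x) = b x) \<and> integral\<^sup>L lborel b = 1"

definition sck :: "('a::euclidean_space \<Rightarrow> real) \<Rightarrow> real \<Rightarrow> 'a \<Rightarrow> real" where
  "sck b \<rho> z = b (z /\<^sub>R \<rho>) / \<rho> ^ DIM('a)"

definition cv :: "('a::euclidean_space \<Rightarrow> real) \<Rightarrow> real \<Rightarrow> ('a \<Rightarrow> real) \<Rightarrow> 'a \<Rightarrow> real" where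
  "cv b \<rho> u x = (LBINT y. u y * sck b \<rho> (y - x))"

definition locint :: "'a::euclidean_space set \<Rightarrow> ('a \<Rightarrow> real) \<Rightarrow> bool" where
  "locint D u \<longleftrightarrow> u \<in> borel_measurable borel \<and>
     (\<forall>K. compact K \<and> K \<subseteq> D \<longrightarrow> integrable lborel (\<lambda>y. indicator K y * u y))"

lemma kernD:
  assumes "kern b"
  shows "continuous_on UNIV b" "0 \<le> b x" "1 \<le> norm x \<Longrightarrow> b x = 0" "b (- x) = b x"
    "integral\<^sup>L lborel b = 1" "b \<in> borel_measurable borel"
  using assms by (auto simp: kern_def intro: borel_measurable_continuous_onI)

lemma kern_bound:
  assumes "kern b"
  obtains B where "B > 0" "\<And>x. b x \<le> B"
proof -
  obtain B where B: "B \<ge> 0" "\<And>x. \<bar>b x\<bar> \<le> B"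
    using bounded_support_bound[OF kernD(1)[OF assms] kernD(3)[OF assms]] by (metis less_imp_le)
  have "b x \<le> B + 1" for x using B(2)[of x] by linarith
  with B(1) show ?thesis by (intro that[of "B + 1"]) auto
qed

lemma mollifier_kern:
  assumes "mollifier a"
  shows "kern a"
proof -
  have "Ck_on 0 UNIV a" using assms unfolding mollifier_def smooth_on_def by blast
  hence c: "continuous_on UNIV a" by simp
  hence "a \<in> borel_measurable borel" by (rule borel_measurable_continuous_onI)
  hence "integral\<^sup>L lebesgue a = integral\<^sup>L lborel a" by (intro integral_completion) auto
  moreover have "a (- x) = a x" for x using assms unfolding mollifier_def by (metis norm_minus_cancel)
  ultimately show ?thesis using assms c unfolding mollifier_def kern_def by metis
qed

lemma sck_measurable:
  assumes "kern b"
  shows "sck b \<rho> \<in> borel_measurable borel"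
  using kernD(6)[OF assms] unfolding sck_def[abs_def] by measurable

lemma sck_nonneg: "kern b \<Longrightarrow> \<rho> > 0 \<Longrightarrow> 0 \<le> sck b \<rho> z"
  by (auto simp: sck_def kernD)

lemma sck_zero: "kern b \<Longrightarrow> \<rho> > 0 \<Longrightarrow> \<rho> \<le> norm z \<Longrightarrow> sck b \<rho> z = 0"
  using kernD(3)[of b "z /\<^sub>R \<rho>"] by (auto simp: sck_def field_simps)

lemma sck_minus: "kern b \<Longrightarrow> sck b \<rho> (- z) = sck b \<rho> z"
  using kernD(4)[of b "z /\<^sub>R \<rho>"] by (simp add: sck_def)

lemma sck_commute:
  assumes "kern b"
  shows "sck b \<rho> (x - y) = sck b \<rho> (y - x)"
  using sck_minus[OF assms, of \<rho> "x - y"] unfolding minus_diff_eq by (rule sym)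

lemma sck_continuous:
  assumes "kern b" "\<rho> > 0"
  shows "continuous_on UNIV (sck b \<rho>)"
  using assms(2) unfolding sck_def[abs_def]
  by (intro continuous_intros continuous_on_compose2[OF kernD(1)[OF assms(1)]]) auto

lemma cv_eq:
  assumes "kern b" "\<rho> > 0" and [measurable]: "u \<in> borel_measurable borel"
  shows "cv b \<rho> u x = (LBINT z. b z * u (x + \<rho> *\<^sub>R z))"
proof -
  note [measurable] = sck_measurable[OF assms(1)]
  have "cv b \<rho> u x = \<bar>\<rho>\<bar> ^ DIM('a) * (LBINT z. u (x + \<rho> *\<^sub>R z) * sck b \<rho> (x + \<rho> *\<^sub>R z - x))"
    unfolding cv_def using assms(2) by (intro lborel_integral_affine) auto
  also have "\<dots> = (LBINT z. b z * u (x + \<rho> *\<^sub>R z))"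
    using assms(2) by (subst Bochner_Integration.integral_mult_right_zero[symmetric])
      (auto simp: sck_def intro!: Bochner_Integration.integral_cong)
  finally show ?thesis .
qed

lemma kern_integrable: "kern b \<Longrightarrow> integrable lborel b"
  using kernD(5) not_integrable_integral_eq by fastforce

lemma sck_integral:
  fixes b :: "'a::euclidean_space \<Rightarrow> real"
  assumes "kern b" "\<rho> > 0"
  shows "(LBINT y. sck b \<rho> (y - x)) = 1" "integrable lborel (\<lambda>y. sck b \<rho> (y - x))"
proof -
  show *: "(LBINT y. sck b \<rho> (y - x)) = 1"
    using cv_eq[OF assms, of "\<lambda>_. 1" x] kernD(5)[OF assms(1)] by (simp add: cv_def)
  show "integrable lborel (\<lambda>y. sck b \<rho> (y - x))"
    using * not_integrable_integral_eq by fastforce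
qed

text \<open>Since \<open>a\<close> has integral 1, the normalising constant is a power of the
  radius, and \<open>sck\<close> is the kernel of the theorem.\<close>

lemma scaled_moll_eq_sck:
  assumes "mollifier a" "\<rho> > 0"
  shows "scaled_moll a \<rho> = sck a \<rho>"
proof -
  note k = mollifier_kern[OF assms(1)]
  note [measurable] = kernD(6)[OF k]
  have "integral\<^sup>L lebesgue (\<lambda>y. a (y /\<^sub>R \<rho>)) = integral\<^sup>L lborel (\<lambda>y. a (y /\<^sub>R \<rho>))"
    by (intro integral_completion) auto
  also have "\<dots> = \<rho> ^ DIM('a)"
    using sck_integral(1)[OF k assms(2), of 0] assms(2) by (simp add: sck_def field_simps)
  finally show ?thesis by (auto simp: scaled_moll_def sck_def)
qed

text \<open>Serves the pairings of a locally integrable function with kernels and test densities;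
  the second bound says that the pairing is continuous in the sup norm of the weight.\<close>

lemma locint_mult:
  assumes "locint D u" and K: "compact K" "K \<subseteq> D" and [measurable]: "w \<in> borel_measurable borel"
    and w: "\<And>y. \<bar>w y\<bar> \<le> B" "\<And>y. y \<notin> K \<Longrightarrow> w y = 0"
  shows "integrable lborel (\<lambda>y. u y * w y)"
    and "\<bar>\<integral>y. u y * w y \<partial>lborel\<bar> \<le> B * (LBINT y. indicator K y * \<bar>u y\<bar>)"
proof -
  have [measurable]: "u \<in> borel_measurable borel" and i: "integrable lborel (\<lambda>y. indicator K y * u y)"
    using assms(1) K by (auto simp: locint_def)
  have i2: "integrable lborel (\<lambda>y. B * (indicator K y * \<bar>u y\<bar>))"
    using integrable_abs[OF i] by (simp add: abs_mult)
  have le: "\<bar>u y * w y\<bar> \<le> B * (indicator K y * \<bar>u y\<bar>)" for y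
    using mult_left_mono[OF w(1)[of y] abs_ge_zero[of "u y"]] w(2)[of y]
    by (cases "y \<in> K") (auto simp: abs_mult mult_ac)
  show i3: "integrable lborel (\<lambda>y. u y * w y)"
    by (rule Bochner_Integration.integrable_bound[OF i2])
       (auto intro!: AE_I2 order.trans[OF le abs_ge_self])
  have "\<bar>\<integral>y. u y * w y \<partial>lborel\<bar> \<le> (LBINT y. \<bar>u y * w y\<bar>)"
    by (rule integral_abs_bound)
  also have "\<dots> \<le> (LBINT y. B * (indicator K y * \<bar>u y\<bar>))"
    using i2 i3 le by (intro integral_mono) auto
  finally show "\<bar>\<integral>y. u y * w y \<partial>lborel\<bar> \<le> B * (LBINT y. indicator K y * \<bar>u y\<bar>)" by simp
qed

lemma sck_bound:
  fixes b :: "'a::euclidean_space \<Rightarrow> real"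
  assumes "kern b" "\<rho> > 0" "\<And>x. b x \<le> B"
  shows "\<bar>sck b \<rho> z\<bar> \<le> B / \<rho> ^ DIM('a)"
  using assms(3)[of "z /\<^sub>R \<rho>"] sck_nonneg[OF assms(1,2), of z] assms(2)
    kernD(2)[OF assms(1), of "z /\<^sub>R \<rho>"]
  by (auto simp: sck_def intro!: divide_right_mono)

lemma cv_integrable:
  assumes "locint D u" "kern b" "\<rho> > 0" "cball x \<rho> \<subseteq> D"
  shows "integrable lborel (\<lambda>y. u y * sck b \<rho> (y - x))"
proof -
  obtain B where B: "\<And>x. b x \<le> B" using kern_bound[OF assms(2)] by metis
  note [measurable] = sck_measurable[OF assms(2)]
  show ?thesis
    using assms by (intro locint_mult(1)[OF assms(1) compact_cball assms(4) _ sck_bound[OF assms(2,3) B]] sck_zero)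
      (auto simp: dist_norm norm_minus_commute)
qed

text \<open>A point \<open>z\<close> beyond the ball lies within \<open>e\<close> of its radial
  projection \<open>y\<close> onto the sphere of radius \<open>\<rho>\<close>, so a uniform margin
  around the compact ball is also a margin in the radius.\<close>

lemma cball_enlarge:
  fixes x :: "'a::euclidean_space"
  assumes "open D" "cball x \<rho> \<subseteq> D" "0 \<le> \<rho>"
  obtains e where "e > 0" "cball x (\<rho> + e) \<subseteq> D"
proof -
  have comp: "compact (cball x \<rho>)" by simp
  obtain e where e: "e > 0" "(\<Union>y\<in>cball x \<rho>. cball y e) \<subseteq> D"
    using compact_subset_open_imp_cball_epsilon_subset[OF comp assms(1,2)] by metis
  have "cball x (\<rho> + e) \<subseteq> D"
  proof
    fix z assume z: "z \<in> cball x (\<rho> + e)"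
    show "z \<in> D"
    proof (cases "dist x z \<le> \<rho>")
      case True thus ?thesis using assms(2) by auto
    next
      case False
      define y where "y = x + (\<rho> / norm (z - x)) *\<^sub>R (z - x)"
      have nz: "norm (z - x) > \<rho>" "norm (z - x) > 0" "z \<noteq> x"
        using False assms(3) by (auto simp: dist_norm norm_minus_commute)
      have "dist x y = \<rho>" using nz assms(3) by (simp add: y_def dist_norm)
      moreover have "z - y = (1 - \<rho> / norm (z - x)) *\<^sub>R (z - x)" by (simp add: y_def algebra_simps)
      hence "dist y z = \<bar>1 - \<rho> / norm (z - x)\<bar> * norm (z - x)"
        by (simp add: dist_norm norm_minus_commute[of y z])
      moreover have "\<bar>1 - \<rho> / norm (z - x)\<bar> = 1 - \<rho> / norm (z - x)"
        using nz by (intro abs_of_nonneg) simp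
      moreover have "(1 - \<rho> / norm (z - x)) * norm (z - x) = norm (z - x) - \<rho>"
        using nz by (simp add: left_diff_distrib)
      ultimately have "dist x y = \<rho>" "dist y z = norm (z - x) - \<rho>" by simp_all
      moreover have "norm (z - x) \<le> \<rho> + e" using z by (simp add: dist_norm norm_minus_commute)
      ultimately have "y \<in> cball x \<rho>" "z \<in> cball y e" by auto
      thus ?thesis using e(2) by blast
    qed
  qed
  with e(1) show ?thesis by (rule that)
qed

text \<open>Dominated convergence: near \<open>x\<close> all kernels live on one slightly larger
  ball in \<open>D\<close> and are bounded by one constant.\<close>

lemma continuous_on_cv:
  fixes b :: "'a::euclidean_space \<Rightarrow> real"
  assumes "open D" "locint D u" "kern b" "continuous_on D \<rho>"
    and \<rho>: "\<And>x. x \<in> D \<Longrightarrow> 0 < \<rho> x \<and> cball x (\<rho> x) \<subseteq> D"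
  shows "continuous_on D (\<lambda>x. cv b (\<rho> x) u x)"
  unfolding continuous_on_sequentially comp_def
proof safe
  fix X x assume x: "x \<in> D" and XD: "\<forall>n. X n \<in> D" and X: "X \<longlonglongrightarrow> x"
  note [measurable] = sck_measurable[OF assms(3)]
  have [measurable]: "u \<in> borel_measurable borel" using assms(2) by (auto simp: locint_def)
  have \<rho>X: "(\<lambda>n. \<rho> (X n)) \<longlonglongrightarrow> \<rho> x"
    using continuous_on_tendsto_compose[OF assms(4) X x] XD by auto
  obtain e where e: "e > 0" and sub: "cball x (\<rho> x + e) \<subseteq> D"
    using cball_enlarge[OF assms(1)] \<rho>[OF x] by (metis less_imp_le)
  obtain B where B: "\<And>x. b x \<le> B" "B > 0" using kern_bound[OF assms(3)] by metis
  \<comment> \<open>Height of the kernel at half the limiting radius; it bounds every kernel with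
    radius above \<open>\<rho> x / 2\<close>.\<close>
  define c where "c = B / (\<rho> x / 2) ^ DIM('a)"
  have "eventually (\<lambda>n. dist (X n) x < e / 2) sequentially"
    using X e by (intro tendstoD) auto
  moreover have "eventually (\<lambda>n. dist (\<rho> (X n)) (\<rho> x) < min (e / 2) (\<rho> x / 2)) sequentially"
    using \<rho>X e \<rho>[OF x] by (intro tendstoD) auto
  ultimately have "eventually (\<lambda>n. \<forall>y. \<bar>sck b (\<rho> (X n)) (y - X n)\<bar> \<le> c * indicator (cball x (\<rho> x + e)) y) sequentially"
  proof eventually_elim
    case (elim n)
    have "\<bar>\<rho> (X n) - \<rho> x\<bar> < e / 2" "\<bar>\<rho> (X n) - \<rho> x\<bar> < \<rho> x / 2"
      using elim by (auto simp: dist_real_def)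
    hence \<rho>n: "\<rho> (X n) > \<rho> x / 2" "\<rho> (X n) < \<rho> x + e / 2" "\<rho> x > 0"
      using \<rho>[OF x] by linarith+
    have "\<bar>sck b (\<rho> (X n)) (y - X n)\<bar> \<le> c" for y
    proof -
      have "\<bar>sck b (\<rho> (X n)) (y - X n)\<bar> \<le> B / \<rho> (X n) ^ DIM('a)"
        using \<rho>n by (intro sck_bound assms B) auto
      also have "\<dots> \<le> c" unfolding c_def using \<rho>n B(2) by (intro divide_left_mono power_mono) auto
      finally show ?thesis .
    qed
    moreover have "sck b (\<rho> (X n)) (y - X n) = 0" if "y \<notin> cball x (\<rho> x + e)" for y
    proof (rule sck_zero[OF assms(3)])
      have "dist x y \<le> dist (X n) x + norm (y - X n)"
        by (metis dist_commute dist_norm dist_triangle add.commute)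
      thus "\<rho> (X n) \<le> norm (y - X n)" using that elim \<rho>n by auto
    qed (use \<rho>n in auto)
    ultimately show ?case by (auto simp: indicator_def)
  qed
  then obtain N where N: "\<And>n y. n \<ge> N \<Longrightarrow> \<bar>sck b (\<rho> (X n)) (y - X n)\<bar> \<le> c * indicator (cball x (\<rho> x + e)) y"
    unfolding eventually_sequentially by metis
  have "(\<lambda>n. cv b (\<rho> (X (n + N))) u (X (n + N))) \<longlonglongrightarrow> cv b (\<rho> x) u x"
    unfolding cv_def
  proof (rule integral_dominated_convergence[where w="\<lambda>y. c * \<bar>indicator (cball x (\<rho> x + e)) y * u y\<bar>"])
    show "integrable lborel (\<lambda>y. c * \<bar>indicator (cball x (\<rho> x + e)) y * u y\<bar>)"
      using assms(2) sub by (intro integrable_mult_right integrable_abs) (auto simp: locint_def)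
    show "AE y in lborel. (\<lambda>n. u y * sck b (\<rho> (X (n + N))) (y - X (n + N))) \<longlonglongrightarrow> u y * sck b (\<rho> x) (y - x)"
      unfolding sck_def using \<rho>[OF x]
      by (intro AE_I2 tendsto_intros continuous_on_tendsto_compose[OF kernD(1)[OF assms(3)]]
            LIMSEQ_ignore_initial_segment[OF X] LIMSEQ_ignore_initial_segment[OF \<rho>X]) auto
    show "AE y in lborel. norm (u y * sck b (\<rho> (X (n + N))) (y - X (n + N)))
            \<le> c * \<bar>indicator (cball x (\<rho> x + e)) y * u y\<bar>" for n
    proof (rule AE_I2)
      fix y
      show "norm (u y * sck b (\<rho> (X (n + N))) (y - X (n + N))) \<le> c * \<bar>indicator (cball x (\<rho> x + e)) y * u y\<bar>"
        using mult_left_mono[OF N[of "n + N" y] abs_ge_zero[of "u y"]] by (simp add: abs_mult mult_ac)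
    qed
  qed auto
  thus "(\<lambda>n. cv b (\<rho> (X n)) u (X n)) \<longlonglongrightarrow> cv b (\<rho> x) u x"
    by (rule LIMSEQ_offset)
qed

subsection \<open>A smooth positive minorant\<close>

text \<open>Countably many bumps whose positivity sets cover \<open>D\<close> are summed with
  rapidly decreasing coefficients, which keep the sum below \<open>r\<close> and all derivative
  series summable.\<close>

lemma smooth_minorant:
  fixes D :: "'a::euclidean_space set"
  assumes moll: "mollifier (a :: 'a \<Rightarrow> real)" and D: "open D" "D \<noteq> {}"
    and rpos: "\<And>x. x \<in> D \<Longrightarrow> 0 < r x"
    and rloc: "\<And>K. compact K \<Longrightarrow> K \<subseteq> D \<Longrightarrow> \<exists>e>0. \<forall>x\<in>K. e \<le> r x"
  obtains rh where "smooth_on UNIV rh" "\<And>x. x \<in> D \<Longrightarrow> 0 < rh x \<and> rh x \<le> r x"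
proof -
  note k = mollifier_kern[OF moll]
  obtain B where B: "\<And>x. a x \<le> B" "B > 0" using kern_bound[OF k] by metis
  \<comment> \<open>The kernel may vanish at the origin, so the bumps are shifted by a point
    \<open>y0\<close> where \<open>a\<close> is positive; \<open>\<phi> x\<close> is then positive
    at its centre \<open>x\<close> and lives in the ball of radius
    \<open>2 * \<rho> x\<close>.\<close>
  have "\<exists>y0. a y0 \<noteq> 0"
  proof (rule ccontr)
    assume "\<not> ?thesis"
    hence "a = (\<lambda>_. 0)" by auto
    thus False using kernD(5)[OF k] by simp
  qed
  then obtain y0 where y0: "a y0 > 0" using kernD(2)[OF k] by (metis less_eq_real_def)
  have ny0: "norm y0 < 1" using y0 kernD(3)[OF k, of y0] by (cases "norm y0 < 1") auto
  have "\<exists>\<rho>. 0 < \<rho> \<and> \<rho> \<le> 1 \<and> cball x (2 * \<rho>) \<subseteq> D" if "x \<in> D" for x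
  proof -
    obtain e where e: "e > 0" "cball x e \<subseteq> D" using D(1) \<open>x \<in> D\<close> open_contains_cball by blast
    have "cball x (2 * min 1 (e / 2)) \<subseteq> cball x e" by (intro subset_cball) auto
    with e show ?thesis by (intro exI[of _ "min 1 (e / 2)"]) auto
  qed
  then obtain \<rho> where \<rho>: "\<And>x. x \<in> D \<Longrightarrow> 0 < \<rho> x \<and> \<rho> x \<le> 1 \<and> cball x (2 * \<rho> x) \<subseteq> D" by metis
  have "\<exists>e. 0 < e \<and> (\<forall>y\<in>cball x (2 * \<rho> x). e \<le> r y)" if "x \<in> D" for x
    using rloc[of "cball x (2 * \<rho> x)"] \<rho>[OF that] by auto
  then obtain e where e: "\<And>x. x \<in> D \<Longrightarrow> 0 < e x \<and> (\<forall>y\<in>cball x (2 * \<rho> x). e x \<le> r y)" by metis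
  define \<phi> where "\<phi> = (\<lambda>x y. a ((1 / \<rho> x) *\<^sub>R y + (y0 - (1 / \<rho> x) *\<^sub>R x)))"
  have \<phi>_eq: "\<phi> x y = a (y0 + (y - x) /\<^sub>R \<rho> x)" for x y
    by (simp add: \<phi>_def algebra_simps divide_inverse)
  have \<phi>_near: "dist x y \<le> 2 * \<rho> x" if "x \<in> D" "\<phi> x y \<noteq> 0" for x y
  proof -
    have "norm (y0 + (y - x) /\<^sub>R \<rho> x) < 1"
      using that(2) kernD(3)[OF k] unfolding \<phi>_eq by (meson not_le)
    hence "norm ((y - x) /\<^sub>R \<rho> x) < 2"
      using ny0 norm_triangle_ineq4[of "y0 + (y - x) /\<^sub>R \<rho> x" y0] by simp
    hence "inverse (\<rho> x) * norm (y - x) < 2" using \<rho>[OF that(1)] by simp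
    hence "norm (y - x) < 2 * \<rho> x" using \<rho>[OF that(1)] by (simp add: inverse_eq_divide pos_divide_less_eq)
    thus ?thesis by (simp add: dist_norm norm_minus_commute)
  qed
  define S where "S = (\<lambda>x. {y. 0 < \<phi> x y})"
  have "open (S x)" for x
    unfolding S_def \<phi>_def
    by (intro open_Collect_less continuous_intros continuous_on_compose2[OF kernD(1)[OF k]]) auto
  then obtain \<F> where \<F>: "\<F> \<subseteq> S ` D" "countable \<F>" "\<Union>\<F> = \<Union>(S ` D)"
    using Lindelof[of "S ` D"] by (metis imageE)
  then obtain I where I: "countable I" "I \<subseteq> D" "\<F> = S ` I"
    using countable_subset_image[of \<F> S D] by auto
  have cover: "\<exists>i\<in>I. y \<in> S i" if "y \<in> D" for y
  proof -
    have "y \<in> S y" using y0 by (simp add: S_def \<phi>_eq)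
    thus ?thesis using \<F>(3) that I(3) by blast
  qed
  have "I \<noteq> {}" using cover D(2) by auto
  define q where "q = from_nat_into I"
  have qD: "q j \<in> D" for j using from_nat_into[OF \<open>I \<noteq> {}\<close>] I(2) by (auto simp: q_def)
  have qc: "\<exists>j. y \<in> S (q j)" if "y \<in> D" for y
    using cover[OF that] from_nat_into_surj[OF I(1)] unfolding q_def by metis
  \<comment> \<open>\<open>(1/2) ^ Suc j\<close> sums to 1, \<open>min 1 (e (q j))\<close> keeps the
    term below \<open>r\<close> on its support, division by \<open>B\<close> normalises the bump,
    and \<open>\<rho> (q j) ^ j\<close> cancels the factor \<open>(1 / \<rho> (q j)) ^ n\<close> of
    an n-th derivative as soon as \<open>n \<le> j\<close>.\<close>
  define T where "T = (\<lambda>j. (1/2) ^ Suc j * \<rho> (q j) ^ j * min 1 (e (q j)) / B)"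
  have Tpos: "T j > 0" for j using \<rho>[OF qD] e[OF qD] B(2) by (simp add: T_def)
  have summ: "summable (\<lambda>j. \<bar>T j\<bar> * \<bar>1 / \<rho> (q j)\<bar> ^ n)" for n
  proof (rule summable_comparison_test_ev)
    show "summable (\<lambda>j. (1/2) ^ Suc j / B)"
      using summable_geometric[of "1/2 :: real"] by (intro summable_divide) (simp add: summable_Suc_iff)
    show "eventually (\<lambda>j. norm (\<bar>T j\<bar> * \<bar>1 / \<rho> (q j)\<bar> ^ n) \<le> (1/2) ^ Suc j / B) sequentially"
      using eventually_ge_at_top[of n]
    proof eventually_elim
      case (elim j)
      have p: "0 < \<rho> (q j)" "\<rho> (q j) \<le> 1" "0 < e (q j)" using \<rho>[OF qD] e[OF qD] by auto
      have "\<rho> (q j) ^ j * (1 / \<rho> (q j)) ^ n = \<rho> (q j) ^ (j - n)"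
        using elim p by (simp add: power_diff power_divide)
      hence le1: "\<rho> (q j) ^ j * (1 / \<rho> (q j)) ^ n \<le> 1" using p by (simp add: power_le_one)
      have "norm (\<bar>T j\<bar> * \<bar>1 / \<rho> (q j)\<bar> ^ n) = (1/2) ^ Suc j / B * ((\<rho> (q j) ^ j * (1 / \<rho> (q j)) ^ n) * min 1 (e (q j)))"
        using Tpos[of j] p B(2) by (simp add: abs_mult T_def)
      also have "\<dots> \<le> (1/2) ^ Suc j / B * (1 * 1)"
        using le1 p B(2) by (intro mult_left_mono mult_mono) auto
      finally show ?case by simp
    qed
  qed
  \<comment> \<open>The series is written as an integral over counting measure, so that the
    superposition lemma gives smoothness on the whole space.\<close>
  define rh where "rh = (\<lambda>y. \<integral>j. T j * a ((1 / \<rho> (q j)) *\<^sub>R y + (y0 - (1 / \<rho> (q j)) *\<^sub>R q j)) \<partial>count_space UNIV)"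
  have sm: "smooth_on UNIV rh"
    unfolding smooth_on_def rh_def
  proof
    fix n
    show "Ck_on n UNIV (\<lambda>y. \<integral>j. T j * a ((1 / \<rho> (q j)) *\<^sub>R y + (y0 - (1 / \<rho> (q j)) *\<^sub>R q j)) \<partial>count_space UNIV)"
    proof (rule Ck_on_superposition)
      show "Ck_on n UNIV a" using moll by (simp add: mollifier_def smooth_on_def)
      show "integrable (count_space UNIV) (\<lambda>j. \<bar>T j\<bar> * \<bar>1 / \<rho> (q j)\<bar> ^ n)" for n
        using summ[of n] unfolding integrable_count_space_nat_iff by (simp add: abs_mult power_abs)
      show "a x = 0" if "norm x > 1" for x using kernD(3)[OF k] that by auto
    qed auto
  qed
  have term_le: "T j * \<phi> (q j) y \<le> (1/2) ^ Suc j * r y" and term_nn: "0 \<le> T j * \<phi> (q j) y" if "y \<in> D" for j y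
  proof -
    have \<phi>nn: "0 \<le> \<phi> (q j) y" "\<phi> (q j) y \<le> B" using kernD(2)[OF k] B by (auto simp: \<phi>_def)
    show "0 \<le> T j * \<phi> (q j) y" using \<phi>nn Tpos[of j] by simp
    show "T j * \<phi> (q j) y \<le> (1/2) ^ Suc j * r y"
    proof (cases "\<phi> (q j) y = 0")
      case True thus ?thesis using rpos[OF that] by simp
    next
      case False
      hence er: "e (q j) \<le> r y" using e[OF qD] \<phi>_near[OF qD False] by auto
      have p: "0 < \<rho> (q j)" "\<rho> (q j) \<le> 1" "0 < e (q j)" using \<rho>[OF qD] e[OF qD] by auto
      have "T j * \<phi> (q j) y = (1/2) ^ Suc j * ((\<rho> (q j) ^ j * (\<phi> (q j) y / B)) * min 1 (e (q j)))"
        by (simp add: T_def)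
      also have "\<dots> \<le> (1/2) ^ Suc j * ((1 * 1) * r y)"
        using p \<phi>nn B(2) er by (intro mult_left_mono mult_mono power_le_one) auto
      finally show ?thesis by simp
    qed
  qed
  have sumhalf: "(\<lambda>j. (1/2) ^ Suc j * r y) sums r y" for y
    using sums_mult2[OF power_half_series, of "r y"] by simp
  have "0 < rh y \<and> rh y \<le> r y" if y: "y \<in> D" for y
  proof -
    have s: "summable (\<lambda>j. T j * \<phi> (q j) y)"
      by (rule summable_comparison_test'[OF sums_summable[OF sumhalf[of y]], of 0]) (use term_le[OF y] term_nn[OF y] in auto)
    hence "integrable (count_space UNIV) (\<lambda>j. T j * \<phi> (q j) y)"
      using term_nn[OF y] unfolding integrable_count_space_nat_iff by simp
    hence "rh y = (\<Sum>j. T j * \<phi> (q j) y)" unfolding rh_def \<phi>_def by (rule integral_count_space_nat)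
    moreover have "(\<Sum>j. T j * \<phi> (q j) y) \<le> (\<Sum>j. (1/2) ^ Suc j * r y)"
      using s sums_summable[OF sumhalf[of y]] term_le[OF y] by (intro suminf_le) auto
    moreover have "0 < (\<Sum>j. T j * \<phi> (q j) y)"
    proof -
      obtain j where "0 < \<phi> (q j) y" using qc[OF y] by (auto simp: S_def)
      hence "0 < T j * \<phi> (q j) y" using Tpos[of j] by simp
      thus ?thesis using s term_nn[OF y] by (intro suminf_pos2) auto
    qed
    ultimately show ?thesis using sumhalf[of y] by (simp add: sums_iff)
  qed
  with sm show ?thesis by (intro that) auto
qed

subsection \<open>Integrals of extended real functions\<close>

lemma ereal_integral_eq:
  assumes AE: "AE x in M. f x = ereal (g x)" and g: "integrable M g"
  shows "ereal_integral M f = ereal (\<integral>x. g x \<partial>M)"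
proof -
  have "(\<integral>\<^sup>+ x. e2ennreal (f x) \<partial>M) = (\<integral>\<^sup>+ x. ennreal (g x) \<partial>M)"
    using AE by (intro nn_integral_cong_AE) (auto elim!: eventually_mono)
  moreover have "(\<integral>\<^sup>+ x. e2ennreal (- f x) \<partial>M) = (\<integral>\<^sup>+ x. ennreal (- g x) \<partial>M)"
    using AE by (intro nn_integral_cong_AE) (auto elim!: eventually_mono)
  moreover have fin: "(\<integral>\<^sup>+ x. ennreal (g x) \<partial>M) < \<infinity>" "(\<integral>\<^sup>+ x. ennreal (- g x) \<partial>M) < \<infinity>"
  proof -
    have "(\<integral>\<^sup>+ x. ennreal (norm (g x)) \<partial>M) < \<infinity>" using g by (simp add: integrable_iff_bounded)
    moreover have "(\<integral>\<^sup>+ x. ennreal (g x) \<partial>M) \<le> (\<integral>\<^sup>+ x. ennreal (norm (g x)) \<partial>M)"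
      "(\<integral>\<^sup>+ x. ennreal (- g x) \<partial>M) \<le> (\<integral>\<^sup>+ x. ennreal (norm (g x)) \<partial>M)"
      by (auto intro!: nn_integral_mono ennreal_leI)
    ultimately show "(\<integral>\<^sup>+ x. ennreal (g x) \<partial>M) < \<infinity>" "(\<integral>\<^sup>+ x. ennreal (- g x) \<partial>M) < \<infinity>"
      by (auto intro: le_less_trans)
  qed
  moreover have "enn2ereal p = ereal (enn2real p)" if "p < \<infinity>" for p
    using that by (cases p) auto
  ultimately show ?thesis
    by (simp add: ereal_integral_def real_lebesgue_integral_def[OF g])
qed

text \<open>With a finite positive part the difference of the two parts is never of the form
  infinity minus infinity: either the negative part is infinite or everything reduces to a Bochner
  integral.\<close>

lemma ereal_integral_cases:
  assumes [measurable]: "f \<in> borel_measurable M" and pos: "(\<integral>\<^sup>+ x. e2ennreal (f x) \<partial>M) < \<infinity>"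
  shows "ereal_integral M f = - \<infinity> \<or>
    ((AE x in M. \<bar>f x\<bar> \<noteq> \<infinity>) \<and> integrable M (\<lambda>x. real_of_ereal (f x)) \<and>
     ereal_integral M f = ereal (\<integral>x. real_of_ereal (f x) \<partial>M))"
proof (cases "(\<integral>\<^sup>+ x. e2ennreal (- f x) \<partial>M) = \<infinity>")
  case True
  obtain p where p: "(\<integral>\<^sup>+ x. e2ennreal (f x) \<partial>M) = ennreal p" "p \<ge> 0"
    using pos by (cases "\<integral>\<^sup>+ x. e2ennreal (f x) \<partial>M") auto
  have "ereal_integral M f = ereal p - \<infinity>"
    unfolding ereal_integral_def True p(1) using p(2) by (simp add: enn2ereal_ennreal)
  thus ?thesis by simp
next
  case False
  have "AE x in M. e2ennreal (f x) \<noteq> \<infinity>" using pos by (intro nn_integral_PInf_AE) auto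
  moreover have "AE x in M. e2ennreal (- f x) \<noteq> \<infinity>" using False by (intro nn_integral_PInf_AE) auto
  ultimately have AE: "AE x in M. \<bar>f x\<bar> \<noteq> \<infinity>"
  proof eventually_elim
    case (elim x) thus ?case by (cases "f x") auto
  qed
  have "(\<integral>\<^sup>+ x. ennreal (norm (real_of_ereal (f x))) \<partial>M) \<le> (\<integral>\<^sup>+ x. e2ennreal (f x) + e2ennreal (- f x) \<partial>M)"
  proof (rule nn_integral_mono)
    fix x
    show "ennreal (norm (real_of_ereal (f x))) \<le> e2ennreal (f x) + e2ennreal (- f x)"
    proof (cases "f x")
      case (real r)
      thus ?thesis by (cases "r \<ge> 0") (auto simp: ennreal_neg)
    qed auto
  qed
  also have "\<dots> = (\<integral>\<^sup>+ x. e2ennreal (f x) \<partial>M) + (\<integral>\<^sup>+ x. e2ennreal (- f x) \<partial>M)"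
    by (intro nn_integral_add) auto
  also have "\<dots> < \<infinity>" using pos False by (simp add: less_top)
  finally have int: "integrable M (\<lambda>x. real_of_ereal (f x))"
    by (intro integrableI_bounded) auto
  have "AE x in M. f x = ereal (real_of_ereal (f x))"
    using AE by eventually_elim (auto simp: ereal_real)
  hence "ereal_integral M f = ereal (\<integral>x. real_of_ereal (f x) \<partial>M)"
    using int by (rule ereal_integral_eq)
  with AE int show ?thesis by blast
qed

subsection \<open>Subharmonic functions: measurability and local integrability\<close>

text \<open>Infinite values become 0, so a statement about \<open>rl u\<close> says little about
  \<open>u\<close> unless almost everywhere finiteness is known as well.\<close>

abbreviation rl :: "('a \<Rightarrow> ereal) \<Rightarrow> 'a \<Rightarrow> real" where
  "rl u \<equiv> (\<lambda>x. real_of_ereal (u x))"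

lemma sbhD:
  assumes "u \<in> sbh D"
  shows "x \<in> D \<Longrightarrow> u x \<noteq> \<infinity>" "usc_on D u" "x \<notin> D \<Longrightarrow> u x = 0"
    "0 < r \<Longrightarrow> cball x r \<subseteq> D \<Longrightarrow> u x \<le> ereal_integral (restrict_space lebesgue (ball x r)) u
               / ereal (measure lebesgue (ball x r))"
  using assms unfolding sbh_def subharmonic_on_def by blast+

text \<open>\<open>usc_on\<close> speaks of punctured neighbourhoods; the centre itself is covered
  because it already lies in the sublevel set.\<close>

lemma usc_on_open:
  assumes "usc_on D u" "open D"
  shows "open {x\<in>D. u x < c}"
proof (subst open_subopen, intro ballI)
  fix x assume x: "x \<in> {x\<in>D. u x < c}"
  hence "eventually (\<lambda>y. u y < c) (at x)" using assms(1) unfolding usc_on_def by blast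
  then obtain S where S: "open S" "x \<in> S" "\<forall>y\<in>S. y \<noteq> x \<longrightarrow> u y < c"
    unfolding eventually_at_topological by blast
  thus "\<exists>T. open T \<and> x \<in> T \<and> T \<subseteq> {x\<in>D. u x < c}"
    using x assms(2) by (intro exI[of _ "S \<inter> D"]) auto
qed

text \<open>The convention that \<open>u\<close> vanishes off \<open>D\<close> makes each strict
  sublevel set an open set, enlarged by the closed complement of \<open>D\<close> when
  \<open>0 < c\<close>.\<close>

lemma sbh_borel:
  assumes "u \<in> sbh D" "open D"
  shows "u \<in> borel_measurable borel"
proof (rule borel_measurableI_less)
  fix c
  have "{x. u x < c} = {x\<in>D. u x < c} \<union> (if 0 < c then - D else {})"
  proof -
    have "x \<notin> D \<Longrightarrow> u x = 0" for x by (rule sbhD(3)[OF assms(1)])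
    hence "x \<in> D \<or> u x = 0" for x by blast
    thus ?thesis by auto (metis less_irrefl)+
  qed
  moreover have "open {x\<in>D. u x < c}" by (rule usc_on_open[OF sbhD(2)[OF assms(1)] assms(2)])
  ultimately show "{x\<in>space borel. u x < c} \<in> sets borel" using assms(2) by auto
qed

text \<open>The strict sublevel sets of integer height are open and cover \<open>K\<close>, as the
  value infinity is excluded.\<close>

lemma sbh_bounded_above:
  assumes "u \<in> sbh D" "open D" "compact K" "K \<subseteq> D"
  obtains M where "\<And>x. x \<in> K \<Longrightarrow> u x \<le> ereal M"
proof -
  have op: "open {x\<in>D. u x < ereal (real n)}" for n :: nat
    by (rule usc_on_open[OF sbhD(2)[OF assms(1)] assms(2)])
  have cov: "K \<subseteq> (\<Union>n\<in>UNIV. {x\<in>D. u x < ereal (real n)})"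
  proof
    fix x assume "x \<in> K"
    hence "x \<in> D" "u x \<noteq> \<infinity>" using assms(4) sbhD(1)[OF assms(1)] by auto
    moreover have "\<exists>n::nat. u x < ereal (real n)"
    proof (cases "u x")
      case (real r)
      thus ?thesis using reals_Archimedean2[of r] by auto
    next
      case MInf
      thus ?thesis by auto
    qed (use \<open>u x \<noteq> \<infinity>\<close> in auto)
    ultimately show "x \<in> (\<Union>n\<in>UNIV. {x\<in>D. u x < ereal (real n)})" by auto
  qed
  obtain N where N: "N \<subseteq> UNIV" "finite N" "K \<subseteq> (\<Union>n\<in>N. {x\<in>D. u x < ereal (real n)})"
    by (rule compactE_image[OF assms(3) op cov]) (rule that)
  have "u x \<le> ereal (real (Max (insert 0 N)))" if xK: "x \<in> K" for x
  proof -
    obtain n where n: "n \<in> N" "u x < ereal (real n)" using N(3) xK by auto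
    hence "n \<le> Max (insert 0 N)" using N(2) by (intro Max_ge) auto
    hence "ereal (real n) \<le> ereal (real (Max (insert 0 N)))" by simp
    with n(2) show ?thesis by (meson less_imp_le order.trans)
  qed
  thus ?thesis by (rule that)
qed

text \<open>Because \<open>u\<close> is bounded above on the closed ball, its integral can fail to
  be finite only by being minus infinity, and a finite value at the centre excludes that.
  Integrability and almost everywhere finiteness are thus consequences of the sub-mean value
  inequality.\<close>

lemma sbh_ball_mean:
  fixes u :: "'a::euclidean_space \<Rightarrow> ereal"
  assumes u: "u \<in> sbh D" and D: "open D" and r: "0 < r" "cball x r \<subseteq> D" and fin: "u x \<noteq> - \<infinity>"
  shows "AE y in lborel. y \<in> ball x r \<longrightarrow> \<bar>u y\<bar> \<noteq> \<infinity>"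
    and "integrable lborel (\<lambda>y. indicator (ball x r) y * rl u y)"
    and "rl u x * measure lborel (ball x r) \<le> (LBINT y. indicator (ball x r) y * rl u y)"
proof -
  let ?M = "restrict_space lebesgue (ball x r)"
  note [measurable] = sbh_borel[OF u D]
  have m: "(\<lambda>y. indicator (ball x r) y * rl u y) \<in> borel_measurable borel"
    by (intro borel_measurable_times borel_measurable_indicator borel_measurable_real_of_ereal) auto
  have meas: "u \<in> borel_measurable ?M" by (intro measurable_restrict_space1 measurable_completion) simp
  obtain M where M: "\<And>y. y \<in> cball x r \<Longrightarrow> u y \<le> ereal M" using sbh_bounded_above[OF u D _ r(2)] by auto
  have sp: "space ?M = ball x r" by (simp add: space_restrict_space)
  have em: "emeasure ?M (space ?M) < \<infinity>"
    unfolding sp using emeasure_lborel_ball_finite[of x r] by (subst emeasure_restrict_space) auto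
  have "(\<integral>\<^sup>+ y. e2ennreal (u y) \<partial>?M) \<le> (\<integral>\<^sup>+ y. ennreal M \<partial>?M)"
  proof (rule nn_integral_mono)
    fix y assume "y \<in> space ?M"
    hence "u y \<le> ereal M" using M sp by auto
    thus "e2ennreal (u y) \<le> ennreal M" by (metis e2ennreal_mono e2ennreal_ereal)
  qed
  also have "\<dots> < \<infinity>" using em by (simp add: ennreal_mult_less_top less_top)
  finally have pos: "(\<integral>\<^sup>+ y. e2ennreal (u y) \<partial>?M) < \<infinity>" .
  have xD: "x \<in> D" using r by auto
  then obtain ux where ux: "u x = ereal ux" using sbhD(1)[OF u xD] fin by (cases "u x") auto
  have mpos: "measure lebesgue (ball x r) > 0" using r(1) by (simp add: content_ball_pos)
  have mean: "u x \<le> ereal_integral ?M u / ereal (measure lebesgue (ball x r))" by (rule sbhD(4)[OF u r])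
  have "ereal_integral ?M u \<noteq> - \<infinity>" using mean ux mpos by auto
  hence *: "AE y in ?M. \<bar>u y\<bar> \<noteq> \<infinity>" "integrable ?M (rl u)" "ereal_integral ?M u = ereal (\<integral>y. rl u y \<partial>?M)"
    using ereal_integral_cases[OF meas pos] by auto
  have bl: "ball x r \<inter> space lebesgue \<in> sets lebesgue" by auto
  have "AE y in lebesgue. y \<in> ball x r \<longrightarrow> \<bar>u y\<bar> \<noteq> \<infinity>"
    using *(1) AE_restrict_space_iff[OF bl] by simp
  thus "AE y in lborel. y \<in> ball x r \<longrightarrow> \<bar>u y\<bar> \<noteq> \<infinity>"
    by (subst (asm) AE_completion_iff) auto
  have "integrable lebesgue (\<lambda>y. indicator (ball x r) y * rl u y)"
    using *(2) integrable_restrict_space[OF bl, of "rl u"] by simp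
  thus int: "integrable lborel (\<lambda>y. indicator (ball x r) y * rl u y)"
    using m by (simp add: integrable_completion)
  have "(\<integral>y. rl u y \<partial>?M) = (\<integral>y. indicator (ball x r) y * rl u y \<partial>lebesgue)"
    using integral_restrict_space[OF bl, of "rl u"] by simp
  also have "\<dots> = (LBINT y. indicator (ball x r) y * rl u y)"
    using m by (intro integral_completion) simp
  finally have "ereal ux \<le> ereal ((LBINT y. indicator (ball x r) y * rl u y) / measure lebesgue (ball x r))"
    using mean unfolding *(3) ux using mpos by simp
  thus "rl u x * measure lborel (ball x r) \<le> (LBINT y. indicator (ball x r) y * rl u y)"
    using mpos ux by (simp add: pos_le_divide_eq)
qed

section \<open>Uniform L1 bounds for families of subharmonic functions\<close>

text \<open>Finiteness almost everywhere is included because a bound for \<open>rl u\<close> alone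
  would not notice a set where \<open>u\<close> is infinite.\<close>

definition L1on :: "'a::euclidean_space set \<Rightarrow> real \<Rightarrow> ('a \<Rightarrow> ereal) \<Rightarrow> bool" where
  "L1on S B u \<longleftrightarrow> (AE y\<in>S in lborel. \<bar>u y\<bar> \<noteq> \<infinity>) \<and>
     integrable lborel (\<lambda>y. indicator S y * rl u y) \<and> (LBINT y. indicator S y * \<bar>rl u y\<bar>) \<le> B"

definition unif_L1 :: "('a::euclidean_space \<Rightarrow> ereal) set \<Rightarrow> 'a set \<Rightarrow> bool" where
  "unif_L1 \<F> S \<longleftrightarrow> (\<exists>B. \<forall>u\<in>\<F>. L1on S B u)"

lemma L1onI:
  assumes "AE y\<in>S in lborel. \<bar>u y\<bar> \<noteq> \<infinity>" "integrable lborel (\<lambda>y. indicator S y * rl u y)"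
    "(LBINT y. indicator S y * \<bar>rl u y\<bar>) \<le> B"
  shows "L1on S B u"
  using assms by (simp add: L1on_def)

lemma L1onD:
  assumes "L1on S B u"
  shows "AE y\<in>S in lborel. \<bar>u y\<bar> \<noteq> \<infinity>" "integrable lborel (\<lambda>y. indicator S y * rl u y)"
    "(LBINT y. indicator S y * \<bar>rl u y\<bar>) \<le> B" "integrable lborel (\<lambda>y. indicator S y * \<bar>rl u y\<bar>)"
  using assms integrable_abs[of lborel "\<lambda>y. indicator S y * rl u y"] by (simp_all add: L1on_def abs_mult)

lemma L1on_subset:
  assumes "L1on S B u" "T \<subseteq> S" and [measurable]: "T \<in> sets borel"
  shows "L1on T B u"
proof (rule L1onI)
  show "AE y\<in>T in lborel. \<bar>u y\<bar> \<noteq> \<infinity>"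
    using L1onD(1)[OF assms(1)] assms(2) by (auto elim!: eventually_mono)
  have "integrable lborel (\<lambda>y. indicator T y *\<^sub>R (indicator S y * rl u y))"
    using L1onD(2)[OF assms(1)] by (intro integrable_mult_indicator) auto
  moreover have "(\<lambda>y. indicator T y *\<^sub>R (indicator S y * rl u y)) = (\<lambda>y. indicator T y * rl u y)"
    using assms(2) by (auto simp: indicator_def fun_eq_iff)
  ultimately show int: "integrable lborel (\<lambda>y. indicator T y * rl u y)" by metis
  have "(LBINT y. indicator T y * \<bar>rl u y\<bar>) \<le> (LBINT y. indicator S y * \<bar>rl u y\<bar>)"
  proof (rule integral_mono[OF _ L1onD(4)[OF assms(1)]])
    show "integrable lborel (\<lambda>y. indicator T y * \<bar>rl u y\<bar>)"
      using integrable_abs[OF int] by (simp add: abs_mult)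
  qed (use assms(2) in \<open>auto simp: indicator_def real_of_ereal_pos\<close>)
  thus "(LBINT y. indicator T y * \<bar>rl u y\<bar>) \<le> B" using L1onD(3)[OF assms(1)] by linarith
qed

lemma unif_L1_subset: "unif_L1 \<F> S \<Longrightarrow> T \<subseteq> S \<Longrightarrow> T \<in> sets borel \<Longrightarrow> unif_L1 \<F> T"
  unfolding unif_L1_def using L1on_subset by blast

lemma L1on_mono: "L1on S A u \<Longrightarrow> A \<le> B \<Longrightarrow> L1on S B u"
  by (auto simp: L1on_def)

lemma unif_L1_Un:
  assumes "unif_L1 \<F> S" "unif_L1 \<F> T" and ST[measurable]: "S \<in> sets borel" "T \<in> sets borel"
  shows "unif_L1 \<F> (S \<union> T)"
proof -
  obtain A where A: "\<forall>u\<in>\<F>. L1on S A u" using assms(1) unfolding unif_L1_def by blast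
  have "unif_L1 \<F> (T - S)" by (rule unif_L1_subset[OF assms(2)]) auto
  then obtain B where B: "\<forall>u\<in>\<F>. L1on (T - S) B u" unfolding unif_L1_def by blast
  have ind: "indicator (S \<union> T) y = (indicator S y + indicator (T - S) y :: real)" for y
    by (auto simp: indicator_def)
  have "L1on (S \<union> T) (A + B) u" if u: "u \<in> \<F>" for u
  proof (rule L1onI)
    have u1: "L1on S A u" and u2: "L1on (T - S) B u" using A B u by auto
    show "AE y in lborel. y \<in> S \<union> T \<longrightarrow> \<bar>u y\<bar> \<noteq> \<infinity>"
      using L1onD(1)[OF u1] L1onD(1)[OF u2] by eventually_elim auto
    show "integrable lborel (\<lambda>y. indicator (S \<union> T) y * rl u y)"
      unfolding ind distrib_right using L1onD(2)[OF u1] L1onD(2)[OF u2] by (rule Bochner_Integration.integrable_add)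
    show "(LBINT y. indicator (S \<union> T) y * \<bar>rl u y\<bar>) \<le> A + B"
      unfolding ind distrib_right Bochner_Integration.integral_add[OF L1onD(4)[OF u1] L1onD(4)[OF u2]]
      using L1onD(3)[OF u1] L1onD(3)[OF u2] by linarith
  qed
  thus ?thesis unfolding unif_L1_def by blast
qed

lemma unif_L1_family_Un:
  assumes "unif_L1 \<F> S" "unif_L1 \<G> S"
  shows "unif_L1 (\<F> \<union> \<G>) S"
proof -
  obtain A B where "\<forall>u\<in>\<F>. L1on S A u" "\<forall>u\<in>\<G>. L1on S B u"
    using assms unfolding unif_L1_def by blast
  hence "\<forall>u\<in>\<F> \<union> \<G>. L1on S (max A B) u" using L1on_mono by (metis Un_iff max.cobounded1 max.cobounded2)
  thus ?thesis unfolding unif_L1_def by blast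
qed

text \<open>Where \<open>u \<le> M\<close> it satisfies
  \<open>\<bar>u\<bar> \<le> 2 * \<bar>M\<bar> - u\<close>, and the mean of \<open>u\<close> over a
  ball about \<open>z\<close> is at least \<open>u z \<ge> - B\<close>. The radius
  \<open>2 * R\<close> is taken at \<open>z\<close> so that this ball covers \<open>ball x R\<close>
  wherever \<open>z\<close> lies in it.\<close>

lemma unif_L1_ballI:
  fixes x :: "'a::euclidean_space"
  assumes D: "open D" and \<F>: "\<F> \<subseteq> sbh D" and R: "0 < R" "cball x (4 * R) \<subseteq> D"
    and M: "\<And>u y. u \<in> \<F> \<Longrightarrow> y \<in> cball x (4 * R) \<Longrightarrow> u y \<le> ereal M"
    and low: "\<And>u. u \<in> \<F> \<Longrightarrow> \<exists>z\<in>ball x R. ereal (- B) \<le> u z"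
  shows "unif_L1 \<F> (ball x R)"
  unfolding unif_L1_def
proof (intro exI[of _ "(2 * \<bar>M\<bar> + B) * measure lborel (ball (0::'a) (2 * R))"] ballI)
  fix u assume u: "u \<in> \<F>"
  hence us: "u \<in> sbh D" using \<F> by auto
  obtain z where z: "z \<in> ball x R" "ereal (- B) \<le> u z" using low[OF u] by auto
  have sub1: "ball x R \<subseteq> ball z (2 * R)"
  proof
    fix y assume "y \<in> ball x R"
    thus "y \<in> ball z (2 * R)" using z(1) dist_triangle[of z y x] by (auto simp: dist_commute)
  qed
  have sub2: "cball z (2 * R) \<subseteq> cball x (4 * R)"
  proof
    fix y assume "y \<in> cball z (2 * R)"
    thus "y \<in> cball x (4 * R)" using z(1) dist_triangle[of x y z] R(1) by auto
  qed
  have zfin: "u z \<noteq> - \<infinity>" using z(2) by auto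
  have "z \<in> cball x (4 * R)" using z(1) R(1) by auto
  hence "u z \<noteq> \<infinity>" using sbhD(1)[OF us] R(2) by auto
  hence zr: "- B \<le> rl u z" using z(2) zfin by (cases "u z") auto
  have R2: "0 < 2 * R" "cball z (2 * R) \<subseteq> D" using R sub2 by auto
  note bm = sbh_ball_mean[OF us D R2 zfin]
  have vol: "measure lborel (ball z (2 * R)) = measure lborel (ball (0::'a) (2 * R))"
    using R(1) by (simp add: content_ball)
  let ?i = "indicator (ball z (2 * R)) :: 'a \<Rightarrow> real"
  have absint: "integrable lborel (\<lambda>y. ?i y * \<bar>rl u y\<bar>)"
    using integrable_abs[OF bm(2)] by (simp add: abs_mult)
  have cint: "integrable lborel (\<lambda>y. ?i y * (2 * \<bar>M\<bar>))"
    using emeasure_lborel_ball_finite by (intro integrable_mult_left integrable_real_indicator) auto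
  have "(LBINT y. ?i y * \<bar>rl u y\<bar>) \<le> (LBINT y. ?i y * (2 * \<bar>M\<bar>) - ?i y * rl u y)"
  proof (rule integral_mono_AE[OF absint])
    show "integrable lborel (\<lambda>y. ?i y * (2 * \<bar>M\<bar>) - ?i y * rl u y)" using cint bm(2) by auto
    show "AE y in lborel. ?i y * \<bar>rl u y\<bar> \<le> ?i y * (2 * \<bar>M\<bar>) - ?i y * rl u y"
      using bm(1)
    proof eventually_elim
      case (elim y)
      show ?case
      proof (cases "y \<in> ball z (2 * R)")
        case True
        hence "y \<in> cball x (4 * R)" using sub2 ball_subset_cball by blast
        hence "u y \<le> ereal M" using M[OF u] by auto
        hence "rl u y \<le> M" using elim True by (cases "u y") auto
        thus ?thesis using True by (auto simp: abs_if)
      qed auto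
    qed
  qed
  also have "\<dots> = 2 * \<bar>M\<bar> * measure lborel (ball (0::'a) (2 * R)) - (LBINT y. ?i y * rl u y)"
    using cint bm(2) vol by simp
  also have "\<dots> \<le> 2 * \<bar>M\<bar> * measure lborel (ball (0::'a) (2 * R)) - rl u z * measure lborel (ball (0::'a) (2 * R))"
    using bm(3) vol by simp
  also have "\<dots> \<le> (2 * \<bar>M\<bar> + B) * measure lborel (ball (0::'a) (2 * R))"
    using mult_right_mono[OF zr, of "measure lborel (ball (0::'a) (2 * R))"] by (simp add: algebra_simps)
  finally have bnd: "(LBINT y. ?i y * \<bar>rl u y\<bar>) \<le> (2 * \<bar>M\<bar> + B) * measure lborel (ball (0::'a) (2 * R))" .
  have "L1on (ball z (2 * R)) ((2 * \<bar>M\<bar> + B) * measure lborel (ball (0::'a) (2 * R))) u"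
    using bm(1,2) bnd by (rule L1onI)
  thus "L1on (ball x R) ((2 * \<bar>M\<bar> + B) * measure lborel (ball (0::'a) (2 * R))) u"
    using sub1 by (rule L1on_subset) auto
qed

text \<open>Converse direction: if \<open>u\<close> were below \<open>- ((B + 1) / v)\<close> on the
  whole ball of volume \<open>v\<close>, the integral of its absolute value would be at least
  \<open>B + 1\<close>. Both directions together let a bound travel from ball to ball.\<close>

lemma unif_L1_ballD:
  fixes y :: "'a::euclidean_space"
  assumes "unif_L1 \<F> (ball y s)" "0 < s"
  shows "\<exists>B. \<forall>u\<in>\<F>. \<exists>z\<in>ball y s. ereal (- B) \<le> u z"
proof -
  obtain B where B: "\<And>u. u \<in> \<F> \<Longrightarrow> L1on (ball y s) B u"
    using assms(1) unfolding unif_L1_def by blast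
  define v where "v = measure lborel (ball y s)"
  have v: "v > 0" using assms(2) by (simp add: v_def content_ball_pos)
  have "\<exists>z\<in>ball y s. ereal (- ((B + 1) / v)) \<le> u z" if u: "u \<in> \<F>" for u
  proof (rule ccontr)
    assume neg: "\<not> ?thesis"
    have i1: "integrable lborel (\<lambda>z. indicator (ball y s) z * \<bar>rl u z\<bar>)"
      using L1onD(4)[OF B[OF u]] .
    have i2: "integrable lborel (\<lambda>z. indicator (ball y s) z * ((B + 1) / v))"
      using emeasure_lborel_ball_finite by (intro integrable_mult_left integrable_real_indicator) auto
    note AE = L1onD(1)[OF B[OF u]]
    have "(LBINT z. indicator (ball y s) z * ((B + 1) / v)) \<le> (LBINT z. indicator (ball y s) z * \<bar>rl u z\<bar>)"
    proof (rule integral_mono_AE[OF i2 i1])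
      show "AE z in lborel. indicator (ball y s) z * ((B + 1) / v) \<le> indicator (ball y s) z * \<bar>rl u z\<bar>"
        using AE
      proof eventually_elim
        case (elim z)
        show ?case
        proof (cases "z \<in> ball y s")
          case True
          hence "u z < ereal (- ((B + 1) / v))" using neg not_le by blast
          hence "rl u z < - ((B + 1) / v)" using elim True by (cases "u z") auto
          hence "(B + 1) / v \<le> \<bar>rl u z\<bar>" by linarith
          thus ?thesis using True by (simp del: abs_real_of_ereal)
        qed auto
      qed
    qed
    also have "\<dots> \<le> B" by (rule L1onD(3)[OF B[OF u]])
    finally show False using v by (simp add: v_def)
  qed
  thus ?thesis by blast
qed

text \<open>Having a uniform L1 bound near a point spreads to all nearby points, hence over the
  connected set \<open>D\<close>; finitely many balls then cover \<open>K\<close>. The witness in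
  \<open>S\<close> depends on \<open>u\<close>, so the family is split according to the ball that
  contains it.\<close>

lemma unif_L1_compact:
  fixes D :: "'a::euclidean_space set"
  assumes D: "open D" "connected D" and \<F>: "\<F> \<subseteq> sbh D"
    and M: "\<And>K. compact K \<Longrightarrow> K \<subseteq> D \<Longrightarrow> \<exists>M. \<forall>u\<in>\<F>. \<forall>y\<in>K. u y \<le> ereal M"
    and S: "compact S" "S \<subseteq> D" and low: "\<And>u. u \<in> \<F> \<Longrightarrow> \<exists>z\<in>S. ereal (- B) \<le> u z"
    and K: "compact K" "K \<subseteq> D"
  shows "unif_L1 \<F> K"
proof -
  have main: "unif_L1 \<G> K" if \<G>: "\<G> \<subseteq> \<F>" and R0: "0 < R0" "cball x0 (4 * R0) \<subseteq> D"
    and low0: "\<And>u. u \<in> \<G> \<Longrightarrow> \<exists>z\<in>ball x0 R0. ereal (- B) \<le> u z" for \<G> x0 R0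
  proof -
    have st: "unif_L1 \<G> (ball x R)" if R: "0 < R" "cball x (4 * R) \<subseteq> D"
      and lw: "\<And>u. u \<in> \<G> \<Longrightarrow> \<exists>z\<in>ball x R. ereal (- B') \<le> u z" for x R B'
    proof -
      obtain M' where M': "\<forall>u\<in>\<F>. \<forall>y\<in>cball x (4 * R). u y \<le> ereal M'"
        using M[OF compact_cball R(2)] by blast
      show ?thesis using \<F> \<G> M' by (intro unif_L1_ballI[OF D(1) _ R _ lw, where M=M']) auto
    qed
    have step: "\<exists>T. openin (top_of_set D) T \<and> p \<in> T \<and>
        (\<forall>x\<in>T. \<forall>y\<in>T. (\<exists>\<rho>>0. unif_L1 \<G> (ball x \<rho>)) \<longrightarrow> (\<exists>\<rho>>0. unif_L1 \<G> (ball y \<rho>)))" if pD: "p \<in> D" for p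
    proof -
      obtain e where e: "e > 0" "cball p e \<subseteq> D" using open_contains_cball[THEN iffD1, rule_format, OF D(1) pD] by blast
      \<comment> \<open>Each \<open>y\<close> in \<open>ball p R\<close> requires a ball of radius
        \<open>4 * (2 * R)\<close> inside \<open>D\<close>; together with
        \<open>dist p y < R\<close> this explains the factor 9.\<close>
      define R where "R = e / 9"
      have R: "R > 0" "cball p (9 * R) \<subseteq> D" using e by (auto simp: R_def)
      have "\<exists>\<rho>>0. unif_L1 \<G> (ball y \<rho>)" if xy: "x \<in> ball p R" "y \<in> ball p R" and "\<rho> > 0" "unif_L1 \<G> (ball x \<rho>)" for x y \<rho>
      proof -
        have dxy: "dist x y < 2 * R" using xy dist_triangle[of x y p] by (auto simp: dist_commute)
        \<comment> \<open>With this radius \<open>ball x s\<close> stays both in the ball where the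
          bound is known and in \<open>ball y (2 * R)\<close>, so the same witnesses serve at
          \<open>y\<close>.\<close>
        define s where "s = min \<rho> (2 * R - dist x y)"
        have s: "s > 0" using dxy that(3) by (simp add: s_def)
        have "unif_L1 \<G> (ball x s)" by (rule unif_L1_subset[OF that(4)]) (auto simp: s_def)
        then obtain B' where B': "\<And>u. u \<in> \<G> \<Longrightarrow> \<exists>z\<in>ball x s. ereal (- B') \<le> u z"
          using unif_L1_ballD[OF _ s] by blast
        have sub: "ball x s \<subseteq> ball y (2 * R)"
        proof
          fix z assume "z \<in> ball x s"
          thus "z \<in> ball y (2 * R)" using dist_triangle[of y z x] by (auto simp: s_def dist_commute)
        qed
        have "cball y (4 * (2 * R)) \<subseteq> cball p (9 * R)"
        proof
          fix z assume "z \<in> cball y (4 * (2 * R))"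
          thus "z \<in> cball p (9 * R)" using xy(2) dist_triangle[of p z y] by auto
        qed
        hence sub2: "cball y (4 * (2 * R)) \<subseteq> D" using R(2) by (rule subset_trans)
        have R2: "0 < 2 * R" using R(1) by simp
        have "unif_L1 \<G> (ball y (2 * R))"
        proof (rule st[OF R2 sub2])
          show "\<exists>z\<in>ball y (2 * R). ereal (- B') \<le> u z" if "u \<in> \<G>" for u using B'[OF that] sub by blast
        qed
        thus ?thesis using R by (intro exI[of _ "2 * R"]) auto
      qed
      moreover have "ball p R \<subseteq> D" using R by (auto intro!: subsetD[OF R(2)])
      hence "openin (top_of_set D) (ball p R)" using D(1) by (simp add: openin_open_eq)
      ultimately show ?thesis using R(1) by (intro exI[of _ "ball p R"]) auto
    qed
    have x0: "x0 \<in> D" using R0 by auto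
    have P0: "\<exists>\<rho>>0. unif_L1 \<G> (ball x0 \<rho>)" using st[OF R0 low0] R0(1) by blast
    have P: "\<exists>\<rho>>0. unif_L1 \<G> (ball x \<rho>)" if "x \<in> D" for x
      by (rule connected_induction_simple[where P="\<lambda>x. \<exists>\<rho>>0. unif_L1 \<G> (ball x \<rho>)",
            OF D(2) x0 that P0 step]) 
    then obtain \<rho> where \<rho>: "\<And>x. x \<in> D \<Longrightarrow> \<rho> x > 0 \<and> unif_L1 \<G> (ball x (\<rho> x))" by metis
    have op: "open (ball x (\<rho> x))" for x by simp
    have cov: "K \<subseteq> (\<Union>x\<in>K. ball x (\<rho> x))" using \<rho> K(2) by force
    obtain I where I: "I \<subseteq> K" "finite I" "K \<subseteq> (\<Union>x\<in>I. ball x (\<rho> x))"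
      by (rule compactE_image[OF K(1) op cov]) auto
    have "unif_L1 \<G> (\<Union>x\<in>I. ball x (\<rho> x))"
      using I(2,1)
    proof (induction I rule: finite_induct)
      case empty
      thus ?case by (auto simp: unif_L1_def L1on_def intro!: exI[of _ 0])
    next
      case (insert x I)
      have "unif_L1 \<G> (ball x (\<rho> x))" using \<rho> insert K(2) by auto
      moreover have "unif_L1 \<G> (\<Union>x\<in>I. ball x (\<rho> x))" using insert by auto
      moreover have "(\<Union>x\<in>I. ball x (\<rho> x)) \<in> sets borel" by (intro borel_open open_UN) auto
      ultimately have "unif_L1 \<G> (ball x (\<rho> x) \<union> (\<Union>x\<in>I. ball x (\<rho> x)))" by (intro unif_L1_Un) auto
      thus ?case by simp
    qed
    thus ?thesis by (rule unif_L1_subset[OF _ I(3)]) (rule borel_compact[OF K(1)])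
  qed
  have "\<exists>R>0. cball x (4 * R) \<subseteq> D" if xD: "x \<in> D" for x
  proof -
    obtain e where e: "e > 0" "cball x e \<subseteq> D" using open_contains_cball[THEN iffD1, rule_format, OF D(1) xD] by blast
    thus ?thesis by (intro exI[of _ "e / 4"]) auto
  qed
  then obtain R where R: "\<And>x. x \<in> D \<Longrightarrow> R x > 0 \<and> cball x (4 * R x) \<subseteq> D" by metis
  have op: "open (ball x (R x))" for x by simp
  have cov: "S \<subseteq> (\<Union>x\<in>S. ball x (R x))" using R S(2) by force
  obtain I where I: "I \<subseteq> S" "finite I" "S \<subseteq> (\<Union>x\<in>I. ball x (R x))"
    by (rule compactE_image[OF S(1) op cov]) auto
  \<comment> \<open>Finitely many of these subfamilies exhaust the family, each with its witnesses
    in one fixed ball.\<close>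
  define \<G> where "\<G> = (\<lambda>x. {u\<in>\<F>. \<exists>z\<in>ball x (R x). ereal (- B) \<le> u z})"
  have "\<F> \<subseteq> (\<Union>x\<in>I. \<G> x)"
  proof
    fix u assume u: "u \<in> \<F>"
    obtain z where z: "z \<in> S" "ereal (- B) \<le> u z" using low[OF u] by blast
    then obtain x where "x \<in> I" "z \<in> ball x (R x)" using I(3) by blast
    thus "u \<in> (\<Union>x\<in>I. \<G> x)" using z u unfolding \<G>_def by blast
  qed
  hence eq: "\<F> = (\<Union>x\<in>I. \<G> x)" unfolding \<G>_def by blast
  have "unif_L1 (\<Union>x\<in>I. \<G> x) K"
    using I(2,1)
  proof (induction I rule: finite_induct)
    case empty
    thus ?case by (auto simp: unif_L1_def)
  next
    case (insert x I)
    have xD: "x \<in> D" using insert S(2) by auto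
    have "unif_L1 (\<G> x) K" by (rule main[of "\<G> x" "R x" x]) (use R[OF xD] in \<open>auto simp: \<G>_def\<close>)
    moreover have "unif_L1 (\<Union>x\<in>I. \<G> x) K" using insert by auto
    ultimately show ?case by (simp add: unif_L1_family_Un)
  qed
  thus ?thesis using eq by simp
qed

text \<open>The one-element family \<open>{u}\<close> has the single witness \<open>z\<close>, a
  point where \<open>u\<close> is finite; a countable compact exhaustion collects the null
  sets.\<close>

lemma sbh_star_locint:
  fixes D :: "'a::euclidean_space set"
  assumes D: "open D" "connected D" and u: "u \<in> sbh_star D"
  shows "locint D (rl u)" and "AE x\<in>D in lborel. \<bar>u x\<bar> \<noteq> \<infinity>"
proof -
  have us: "u \<in> sbh D" using u by (simp add: sbh_star_def)
  obtain z where z: "z \<in> D" "u z \<noteq> - \<infinity>" using u by (auto simp: sbh_star_def)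
  have zz: "ereal (- (- rl u z)) \<le> u z" using z sbhD(1)[OF us z(1)] by (cases "u z") auto
  have L: "unif_L1 {u} K" if "compact K" "K \<subseteq> D" for K
  proof (rule unif_L1_compact[OF D, where S="{z}" and B="- rl u z"])
    show "\<exists>M. \<forall>v\<in>{u}. \<forall>y\<in>K. v y \<le> ereal M" if "compact K" "K \<subseteq> D" for K
      by (rule sbh_bounded_above[OF us D(1) that]) auto
  qed (use us z zz that in auto)
  note [measurable] = sbh_borel[OF us D(1)]
  show "locint D (rl u)" using L L1onD(2) unfolding locint_def unif_L1_def by auto
  obtain C :: "nat \<Rightarrow> 'a set" where C: "\<And>n. compact (C n)" "\<And>n. C n \<subseteq> D" "\<Union>(range C) = D"
    using open_Union_compact_subsets[OF D(1)] by metis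
  have ae: "AE x in lborel. x \<in> C n \<longrightarrow> \<bar>u x\<bar> \<noteq> \<infinity>" for n
    using L[OF C(1,2)] L1onD(1) unfolding unif_L1_def by blast
  hence "AE x in lborel. \<forall>n. x \<in> C n \<longrightarrow> \<bar>u x\<bar> \<noteq> \<infinity>" by (intro AE_all_countable[THEN iffD2] allI ae)
  thus "AE x\<in>D in lborel. \<bar>u x\<bar> \<noteq> \<infinity>"
    by eventually_elim (use C(3) in auto)
qed

subsection \<open>Fubini for dominated kernels\<close>

text \<open>Domination by a product of integrable functions of one variable each makes the integrand
  integrable on the product. Integrals of kernels are exchanged in this form.\<close>

lemma fubini_dominated:
  fixes f :: "'b \<Rightarrow> 'c \<Rightarrow> real"
  assumes M: "sigma_finite_measure M1" "sigma_finite_measure M2"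
    and f: "case_prod f \<in> borel_measurable (M1 \<Otimes>\<^sub>M M2)"
    and g: "integrable M1 g" and h: "integrable M2 h"
    and dom: "\<And>x y. \<bar>f x y\<bar> \<le> g x * h y"
  shows "(\<integral>x. \<integral>y. f x y \<partial>M2 \<partial>M1) = (\<integral>y. \<integral>x. f x y \<partial>M1 \<partial>M2)"
    and "integrable M1 (\<lambda>x. \<integral>y. f x y \<partial>M2)" and "integrable M2 (\<lambda>y. \<integral>x. f x y \<partial>M1)"
proof -
  interpret pair_sigma_finite M1 M2 using M by (simp add: pair_sigma_finite_def)
  have [measurable]: "g \<in> borel_measurable M1" "h \<in> borel_measurable M2" using g h by auto
  note [measurable] = f
  have h2: "integrable M2 (\<lambda>y. g x * h y)" for x using h by simp
  have i2: "integrable M2 (\<lambda>y. f x y)" if "x \<in> space M1" for x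
    using that by (intro Bochner_Integration.integrable_bound[OF h2[of x]])
      (auto intro!: AE_I2 order.trans[OF dom abs_ge_self])
  have "integrable (M1 \<Otimes>\<^sub>M M2) (case_prod f)"
  proof (rule Fubini_integrable[OF f])
    show "AE x in M1. integrable M2 (\<lambda>y. case_prod f (x, y))" using i2 by (intro AE_I2) simp
    show "integrable M1 (\<lambda>x. \<integral>y. norm (case_prod f (x, y)) \<partial>M2)"
    proof (rule Bochner_Integration.integrable_bound)
      show "integrable M1 (\<lambda>x. g x * (\<integral>y. h y \<partial>M2))" using g by simp
      show "AE x in M1. norm (\<integral>y. norm (case_prod f (x, y)) \<partial>M2) \<le> norm (g x * (\<integral>y. h y \<partial>M2))"
      proof (rule AE_I2)
        fix x assume x: "x \<in> space M1"
        have "(\<integral>y. norm (case_prod f (x, y)) \<partial>M2) \<le> (\<integral>y. g x * h y \<partial>M2)"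
          using i2[OF x] h2 dom by (intro integral_mono) auto
        moreover have "0 \<le> (\<integral>y. norm (case_prod f (x, y)) \<partial>M2)" by (intro integral_nonneg_AE) auto
        ultimately show "norm (\<integral>y. norm (case_prod f (x, y)) \<partial>M2) \<le> norm (g x * (\<integral>y. h y \<partial>M2))" by simp
      qed
    qed measurable
  qed
  thus "(\<integral>x. \<integral>y. f x y \<partial>M2 \<partial>M1) = (\<integral>y. \<integral>x. f x y \<partial>M1 \<partial>M2)"
    "integrable M1 (\<lambda>x. \<integral>y. f x y \<partial>M2)" "integrable M2 (\<lambda>y. \<integral>x. f x y \<partial>M1)"
    using Fubini_integral[of f] integrable_fst[of f] integrable_snd[of f] by auto
qed

lemma lborel_sigma_finite: "sigma_finite_measure lborel"
  by (rule sigma_finite_lborel)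

subsection \<open>Second moments of the ball\<close>

lemma lborel_integral_minus:
  fixes f :: "'a::euclidean_space \<Rightarrow> real"
  assumes "f \<in> borel_measurable borel"
  shows "(LBINT x. f (- x)) = (LBINT x. f x)"
  using lborel_integral_affine[OF assms, of "-1" 0] by simp

lemma lborel_integral_shift:
  fixes f :: "'a::euclidean_space \<Rightarrow> real"
  assumes "f \<in> borel_measurable borel"
  shows "(LBINT x. f (t + x)) = (LBINT x. f x)"
  using lborel_integral_affine[OF assms, of 1 t] by simp

text \<open>Coordinate reflections have Jacobian of absolute value 1. They remove the mixed second
  moments of the ball.\<close>

lemma lborel_integral_signs:
  fixes f :: "'a::euclidean_space \<Rightarrow> real" and c :: "'a \<Rightarrow> real"
  assumes [measurable]: "f \<in> borel_measurable borel" and c: "\<And>j. j \<in> Basis \<Longrightarrow> \<bar>c j\<bar> = 1"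
  shows "(LBINT x. f (\<Sum>j\<in>Basis. (c j * (x \<bullet> j)) *\<^sub>R j)) = (LBINT x. f x)"
proof -
  let ?T = "\<lambda>x::'a. 0 + (\<Sum>j\<in>Basis. (c j * (x \<bullet> j)) *\<^sub>R j)"
  have c0: "c j \<noteq> 0" if "j \<in> Basis" for j using c[OF that] by auto
  have "lborel = density (distr lborel borel ?T) (\<lambda>_. (\<Prod>j\<in>Basis. \<bar>c j\<bar>))"
    by (rule lborel_affine_euclidean[OF c0])
  also have "\<dots> = distr lborel borel ?T" using c by (simp add: density_1)
  finally have "(LBINT x. f x) = (\<integral>x. f x \<partial>distr lborel borel ?T)" by simp
  also have "\<dots> = (LBINT x. f (?T x))" by (intro integral_distr) auto
  finally show ?thesis by simp
qed

text \<open>A permutation of the coordinates maps boxes to boxes of the same volume, which already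
  identifies Lebesgue measure. It makes all diagonal moments of the ball equal.\<close>

lemma lborel_integral_swap:
  fixes f :: "'a::euclidean_space \<Rightarrow> real" and s :: "'a \<Rightarrow> 'a"
  assumes [measurable]: "f \<in> borel_measurable borel"
    and s: "\<And>b. b \<in> Basis \<Longrightarrow> s b \<in> Basis" "\<And>b. b \<in> Basis \<Longrightarrow> s (s b) = b"
  shows "(LBINT x. f (\<Sum>b\<in>Basis. (x \<bullet> s b) *\<^sub>R b)) = (LBINT x. f x)"
proof -
  let ?T = "\<lambda>x::'a. (\<Sum>b\<in>Basis. (x \<bullet> s b) *\<^sub>R b)"
  have T: "?T x \<bullet> b = x \<bullet> s b" if "b \<in> Basis" for x b using that by simp
  have bij: "bij_betw s Basis Basis" using s by (intro bij_betwI[where g=s]) auto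
  have "lborel = distr lborel borel ?T"
  proof (rule lborel_eqI)
    fix l u :: 'a assume lu: "\<And>b. b \<in> Basis \<Longrightarrow> l \<bullet> b \<le> u \<bullet> b"
    have "?T -` box l u = box (?T l) (?T u)"
    proof (intro set_eqI iffI)
      fix x assume x: "x \<in> ?T -` box l u"
      show "x \<in> box (?T l) (?T u)"
        unfolding mem_box
      proof
        fix b :: 'a assume b: "b \<in> Basis"
        have "l \<bullet> s b < ?T x \<bullet> s b \<and> ?T x \<bullet> s b < u \<bullet> s b"
          using x s(1)[OF b] unfolding vimage_eq mem_box by blast
        thus "?T l \<bullet> b < x \<bullet> b \<and> x \<bullet> b < ?T u \<bullet> b"
          unfolding T[OF b] T[OF s(1)[OF b]] s(2)[OF b] .
      qed
    next
      fix x assume x: "x \<in> box (?T l) (?T u)"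
      show "x \<in> ?T -` box l u"
        unfolding vimage_eq mem_box
      proof
        fix b :: 'a assume b: "b \<in> Basis"
        have "?T l \<bullet> s b < x \<bullet> s b \<and> x \<bullet> s b < ?T u \<bullet> s b"
          using x s(1)[OF b] unfolding mem_box by blast
        thus "l \<bullet> b < ?T x \<bullet> b \<and> ?T x \<bullet> b < u \<bullet> b"
          unfolding T[OF b] T[OF s(1)[OF b]] s(2)[OF b] .
      qed
    qed
    hence "emeasure (distr lborel borel ?T) (box l u) = emeasure lborel (box (?T l) (?T u))"
      by (subst emeasure_distr) auto
    also have "\<dots> = (\<Prod>b\<in>Basis. (?T u - ?T l) \<bullet> b)"
      using lu s(1) by (intro emeasure_lborel_box) (simp add: T)
    also have "(\<Prod>b\<in>Basis. (?T u - ?T l) \<bullet> b) = (\<Prod>b\<in>Basis. (u - l) \<bullet> s b)"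
      by (intro prod.cong) (auto simp: inner_diff_left T)
    also have "\<dots> = (\<Prod>b\<in>Basis. (u - l) \<bullet> b)"
      using prod.reindex_bij_betw[OF bij, of "\<lambda>b. (u - l) \<bullet> b"] by simp
    finally show "emeasure (distr lborel borel ?T) (box l u) = ennreal (\<Prod>b\<in>Basis. (u - l) \<bullet> b)" .
  qed simp
  hence "(LBINT x. f x) = (\<integral>x. f x \<partial>distr lborel borel ?T)" by simp
  also have "\<dots> = (LBINT x. f (?T x))" by (intro integral_distr) auto
  finally show ?thesis by simp
qed

lemma norm_eq_Basis:
  fixes x y :: "'a::euclidean_space"
  assumes "(\<Sum>b\<in>Basis. (x \<bullet> b)\<^sup>2) = (\<Sum>b\<in>Basis. (y \<bullet> b)\<^sup>2)"
  shows "norm x = norm y"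
  using assms unfolding norm_eq euclidean_inner[of x x] euclidean_inner[of y y] by (simp add: power2_eq_square)

abbreviation unit_ball_ind :: "'a::euclidean_space \<Rightarrow> real" where
  "unit_ball_ind \<equiv> indicator (ball 0 1)"

lemma ball_cball_sets [measurable]: "ball x r \<in> sets borel" "cball x r \<in> sets borel"
  by auto

lemma ball_moment_bounded: "\<bar>unit_ball_ind z * ((z \<bullet> i) * (z \<bullet> j))\<bar> \<le> unit_ball_ind z"
  if "i \<in> Basis" "j \<in> Basis" for z :: "'a::euclidean_space"
proof (cases "z \<in> ball 0 1")
  case True
  hence "\<bar>z \<bullet> i\<bar> \<le> 1" "\<bar>z \<bullet> j\<bar> \<le> 1"
    using Basis_le_norm[OF that(1), of z] Basis_le_norm[OF that(2), of z] by auto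
  hence "\<bar>z \<bullet> i\<bar> * \<bar>z \<bullet> j\<bar> \<le> 1 * 1" by (intro mult_mono) auto
  thus ?thesis using True by (simp add: abs_mult)
qed auto

lemma unit_ball_ind_integrable: "integrable lborel (unit_ball_ind :: 'a::euclidean_space \<Rightarrow> real)"
  using emeasure_lborel_ball_finite by (intro integrable_real_indicator) auto

lemma ball_moment_integrable:
  assumes "i \<in> Basis" "j \<in> Basis"
  shows "integrable lborel (\<lambda>z::'a::euclidean_space. unit_ball_ind z * ((z \<bullet> i) * (z \<bullet> j)))"
proof (rule Bochner_Integration.integrable_bound[OF unit_ball_ind_integrable])
  show "AE z::'a in lborel. norm (unit_ball_ind z * ((z \<bullet> i) * (z \<bullet> j))) \<le> norm (unit_ball_ind z :: real)"
    using ball_moment_bounded[OF assms] unfolding real_norm_def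
    by (intro AE_I2) (rule order.trans[OF _ abs_ge_self])
qed measurable

text \<open>Reflecting coordinate \<open>i\<close> changes the sign of a mixed moment, and
  exchanging two coordinates identifies the diagonal ones; these symmetries of the coordinate frame
  replace general rotations.\<close>

lemma ball_moments:
  obtains c where "c > 0" "\<And>i j :: 'a::euclidean_space. i \<in> Basis \<Longrightarrow> j \<in> Basis \<Longrightarrow>
     (LBINT z. unit_ball_ind z * ((z \<bullet> i) * (z \<bullet> j))) = (if i = j then c else 0)"
proof -
  define M where "M = (\<lambda>i j :: 'a. (LBINT z. unit_ball_ind z * ((z \<bullet> i) * (z \<bullet> j))))"
  obtain i0 :: 'a where i0: "i0 \<in> Basis" using nonempty_Basis by blast
  have off: "M i j = 0" if ij: "i \<in> Basis" "j \<in> Basis" "i \<noteq> j" for i j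
  proof -
    define f where "f = (\<lambda>z::'a. unit_ball_ind z * ((z \<bullet> i) * (z \<bullet> j)))"
    define c where "c = (\<lambda>b::'a. if b = i then -1 else 1 :: real)"
    have [measurable]: "f \<in> borel_measurable borel" unfolding f_def by measurable
    have eq: "f (\<Sum>b\<in>Basis. (c b * (z \<bullet> b)) *\<^sub>R b) = - f z" for z
    proof -
      let ?w = "\<Sum>b\<in>Basis. (c b * (z \<bullet> b)) *\<^sub>R b"
      have w: "?w \<bullet> b = c b * (z \<bullet> b)" if "b \<in> Basis" for b using that by simp
      have "(\<Sum>b\<in>Basis. (?w \<bullet> b)\<^sup>2) = (\<Sum>b\<in>Basis. (z \<bullet> b)\<^sup>2)"
        by (intro sum.cong) (auto simp: w c_def)
      hence "norm ?w = norm z" by (rule norm_eq_Basis)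
      hence "unit_ball_ind ?w = (unit_ball_ind z :: real)" by (simp add: indicator_def)
      thus ?thesis unfolding f_def w[OF ij(1)] w[OF ij(2)] using ij(3) by (simp add: c_def)
    qed
    have "(LBINT z. f (\<Sum>b\<in>Basis. (c b * (z \<bullet> b)) *\<^sub>R b)) = (LBINT z. f z)"
      by (rule lborel_integral_signs) (auto simp: c_def)
    thus ?thesis unfolding eq by (simp add: M_def f_def)
  qed
  have diag: "M i i = M i0 i0" if i: "i \<in> Basis" for i
  proof -
    define f where "f = (\<lambda>z::'a. unit_ball_ind z * ((z \<bullet> i0) * (z \<bullet> i0)))"
    define s where "s = (\<lambda>b::'a. if b = i then i0 else if b = i0 then i else b)"
    have [measurable]: "f \<in> borel_measurable borel" unfolding f_def by measurable
    have s: "s b \<in> Basis" "s (s b) = b" if "b \<in> Basis" for b using that i i0 by (auto simp: s_def)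
    have bij: "bij_betw s Basis Basis" using s by (intro bij_betwI[where g=s]) auto
    have eq: "f (\<Sum>b\<in>Basis. (z \<bullet> s b) *\<^sub>R b) = unit_ball_ind z * ((z \<bullet> i) * (z \<bullet> i))" for z
    proof -
      let ?w = "\<Sum>b\<in>Basis. (z \<bullet> s b) *\<^sub>R b"
      have w: "?w \<bullet> b = z \<bullet> s b" if "b \<in> Basis" for b using that by simp
      have "(\<Sum>b\<in>Basis. (?w \<bullet> b)\<^sup>2) = (\<Sum>b\<in>Basis. (z \<bullet> s b)\<^sup>2)"
        by (intro sum.cong) (auto simp: w)
      also have "\<dots> = (\<Sum>b\<in>Basis. (z \<bullet> b)\<^sup>2)"
        using sum.reindex_bij_betw[OF bij, of "\<lambda>b. (z \<bullet> b)\<^sup>2"] by simp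
      finally have "norm ?w = norm z" by (rule norm_eq_Basis)
      hence "unit_ball_ind ?w = (unit_ball_ind z :: real)" by (simp add: indicator_def)
      moreover have "s i0 = i" by (simp add: s_def)
      ultimately show ?thesis unfolding f_def w[OF i0] by simp
    qed
    have "(LBINT z. f (\<Sum>b\<in>Basis. (z \<bullet> s b) *\<^sub>R b)) = (LBINT z. f z)"
      using s by (intro lborel_integral_swap) auto
    thus ?thesis unfolding eq by (simp add: M_def f_def)
  qed
  have "M i0 i0 > 0"
  proof -
    \<comment> \<open>On this ball, contained in the unit ball, \<open>z \<bullet> i0\<close> is at
      least \<open>1/4\<close>, which gives the lower bound \<open>1/16\<close> for the
      integrand.\<close>
    let ?B = "ball ((1/2) *\<^sub>R i0) (1/4) :: 'a set"
    have n0: "norm i0 = 1" using i0 by simp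
    have le: "(1/16) * indicator ?B z \<le> unit_ball_ind z * ((z \<bullet> i0) * (z \<bullet> i0))" for z
    proof (cases "z \<in> ?B")
      case True
      hence d: "norm (z - (1/2) *\<^sub>R i0) < 1/4" by (simp add: dist_norm norm_minus_commute)
      have "norm z \<le> norm (z - (1/2) *\<^sub>R i0) + norm ((1/2) *\<^sub>R i0)" by norm
      hence zb: "z \<in> ball 0 1" using d n0 by simp
      have "\<bar>(z - (1/2) *\<^sub>R i0) \<bullet> i0\<bar> < 1/4" using Basis_le_norm[OF i0, of "z - (1/2) *\<^sub>R i0"] d by linarith
      moreover have "(z - (1/2) *\<^sub>R i0) \<bullet> i0 = z \<bullet> i0 - 1/2" using i0 by (simp add: inner_diff_left)
      ultimately have "1/4 \<le> z \<bullet> i0" by linarith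
      hence "(1/4) * (1/4) \<le> (z \<bullet> i0) * (z \<bullet> i0)" by (intro mult_mono) auto
      thus ?thesis using True zb by simp
    qed (auto simp: indicator_def)
    have "0 < measure lborel ?B" by (simp add: content_ball_pos)
    hence "0 < (LBINT z. (1/16 :: real) * indicator ?B z)" by simp
    also have "\<dots> \<le> M i0 i0" unfolding M_def
      using emeasure_lborel_ball_finite ball_moment_integrable[OF i0 i0] le
      by (intro integral_mono integrable_mult_right integrable_real_indicator) auto
    finally show ?thesis .
  qed
  thus ?thesis using off diag by (intro that[of "M i0 i0"]) (auto simp: M_def)
qed

subsection \<open>The Dirichlet form of functions with the sub-mean value property\<close>

text \<open>First order differences suffice: symmetrising the sub-mean value property of \<open>V\<close> against
  the weight \<open>b\<close> produces the product of the increments of \<open>V\<close> and \<open>b\<close>.\<close>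

lemma dirichlet_nonpos:
  fixes V b :: "'a::euclidean_space \<Rightarrow> real"
  assumes dV: "\<And>x. (V has_derivative V' x) (at x)" and V'B: "\<And>x i. i \<in> Basis \<Longrightarrow> \<bar>V' x i\<bar> \<le> B"
    and V'm: "\<And>i. i \<in> Basis \<Longrightarrow> (\<lambda>x. V' x i) \<in> borel_measurable borel"
    and db: "\<And>x. (b has_derivative b' x) (at x)" and b'B: "\<And>x i. i \<in> Basis \<Longrightarrow> \<bar>b' x i\<bar> \<le> B"
    and b'm: "\<And>i. i \<in> Basis \<Longrightarrow> (\<lambda>x. b' x i) \<in> borel_measurable borel"
    and b0: "\<And>x. norm x \<ge> 1 \<Longrightarrow> b x = 0" and bnn: "\<And>x. 0 \<le> b x"
    and d0: "\<delta>0 > 0" and sub: "\<And>y \<delta>. norm y \<le> 1 \<Longrightarrow> 0 < \<delta> \<Longrightarrow> \<delta> < \<delta>0 \<Longrightarrow>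
      0 \<le> (LBINT z. unit_ball_ind z * (V (y + \<delta> *\<^sub>R z) - V y))"
  shows "(LBINT y. (\<Sum>i\<in>Basis. V' y i * b' y i)) \<le> 0"
proof -
  define L where "L = real DIM('a) * B"
  have LV: "\<bar>V (x + h) - V x\<bar> \<le> L * norm h" and LV': "\<bar>V' x h\<bar> \<le> L * norm h" for x h
    using derivative_lipschitz[OF dV V'B] by (auto simp: L_def)
  have Lb: "\<bar>b (x + h) - b x\<bar> \<le> L * norm h" and Lb': "\<bar>b' x h\<bar> \<le> L * norm h" for x h
    using derivative_lipschitz[OF db b'B] by (auto simp: L_def)
  obtain i0 :: 'a where i0: "i0 \<in> Basis" using nonempty_Basis by blast
  have B0: "B \<ge> 0" using V'B[OF i0, of 0] by linarith
  hence L0: "L \<ge> 0" by (simp add: L_def)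
  have contV: "continuous_on UNIV V" using dV by (intro has_derivative_continuous_on) auto
  have contb: "continuous_on UNIV b" using db by (intro has_derivative_continuous_on) auto
  have [measurable]: "V \<in> borel_measurable borel" "b \<in> borel_measurable borel"
    using contV contb by (auto intro: borel_measurable_continuous_onI)
  obtain Bb where Bb: "Bb \<ge> 0" "\<And>x. \<bar>b x\<bar> \<le> Bb"
    using bounded_support_bound[OF contb b0] by (metis less_imp_le)
  have ic: "integrable lborel (\<lambda>y::'a. C * indicator (cball 0 r) y)" for C r :: real
    using emeasure_lborel_cball_finite by (intro integrable_mult_right integrable_real_indicator) auto
  have ib: "integrable lborel (\<lambda>z::'a. C * unit_ball_ind z)" for C :: real
    by (intro integrable_mult_right unit_ball_ind_integrable)
  define P where "P = (\<lambda>\<delta> z y. (b (y + \<delta> *\<^sub>R z) - b y) * (V (y + \<delta> *\<^sub>R z) - V y))"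
  have Pm[measurable]: "(\<lambda>(z, y). P \<delta> z y) \<in> borel_measurable (borel \<Otimes>\<^sub>M borel)" for \<delta> unfolding P_def by measurable
  have Pm2[measurable]: "P \<delta> z \<in> borel_measurable borel" for \<delta> z unfolding P_def by measurable
  \<comment> \<open>The sub-mean inequality integrated against the weight \<open>b\<close> says that
    the ball integral of \<open>J\<close> is nonnegative; adding the same with \<open>z\<close>
    replaced by \<open>- z\<close> turns the one-sided increment of \<open>V\<close> into a product
    of increments.\<close>
  have step: "(LBINT z. unit_ball_ind z * (LBINT y. P \<delta> z y)) \<le> 0" if \<delta>: "0 < \<delta>" "\<delta> < \<delta>0" for \<delta>
  proof -
    define A where "A = (\<lambda>z y. unit_ball_ind z * (b y * (V (y + \<delta> *\<^sub>R z) - V y)))"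
    have Adom: "\<bar>A z y\<bar> \<le> ((Bb * (L * \<delta>)) * unit_ball_ind z) * (1 * indicator (cball 0 1) y)" for z y
    proof (cases "z \<in> ball 0 1 \<and> y \<in> cball 0 1")
      case True
      hence "\<bar>V (y + \<delta> *\<^sub>R z) - V y\<bar> \<le> L * norm (\<delta> *\<^sub>R z)" by (intro LV)
      also have "\<dots> \<le> L * \<delta>" using True \<delta> L0 by (auto intro!: mult_left_mono simp: mult_le_one)
      finally have "\<bar>b y\<bar> * \<bar>V (y + \<delta> *\<^sub>R z) - V y\<bar> \<le> Bb * (L * \<delta>)" using Bb by (intro mult_mono) auto
      thus ?thesis using True by (simp add: A_def abs_mult)
    next
      case False
      hence "A z y = 0" using b0[of y] by (auto simp: A_def indicator_def)
      thus ?thesis using Bb(1) L0 \<delta> by simp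
    qed
    note fub = fubini_dominated[OF lborel_sigma_finite lborel_sigma_finite _ ib ic Adom]
    have Am: "(\<lambda>(z, y). A z y) \<in> borel_measurable (lborel \<Otimes>\<^sub>M lborel)" unfolding A_def by measurable
    define J where "J = (\<lambda>z. LBINT y. b y * (V (y + \<delta> *\<^sub>R z) - V y))"
    have J: "(LBINT y. A z y) = unit_ball_ind z * J z" for z by (simp add: A_def J_def)
    have nn: "0 \<le> (\<integral>y. \<integral>z. A z y \<partial>lborel \<partial>lborel)"
    proof (rule integral_nonneg_AE, rule AE_I2)
      fix y
      have "(LBINT z. A z y) = (LBINT z. b y * (unit_ball_ind z * (V (y + \<delta> *\<^sub>R z) - V y)))"
        by (simp add: A_def mult_ac)
      also have "\<dots> = b y * (LBINT z. unit_ball_ind z * (V (y + \<delta> *\<^sub>R z) - V y))" by simp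
      also have "\<dots> \<ge> 0" using sub[OF _ \<delta>, of y] bnn[of y] b0[of y] by (cases "norm y \<le> 1") auto
      finally show "0 \<le> (LBINT z. A z y)" .
    qed
    hence J1: "0 \<le> (LBINT z. unit_ball_ind z * J z)"
      using fub(1)[OF Am] unfolding J by simp
    have iJ: "integrable lborel (\<lambda>z. unit_ball_ind z * J z)" using fub(2)[OF Am] unfolding J .
    hence mJ: "(\<lambda>z. unit_ball_ind z * J z) \<in> borel_measurable borel" by auto
    have um: "unit_ball_ind (- z) = (unit_ball_ind z :: real)" for z :: 'a by (simp add: indicator_def)
    have J2: "(LBINT z. unit_ball_ind z * J (- z)) = (LBINT z. unit_ball_ind z * J z)"
      using lborel_integral_minus[OF mJ] unfolding um .
    have iJ2: "integrable lborel (\<lambda>z. unit_ball_ind z * J (- z))"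
      using lborel_integrable_affine_iff[OF mJ, of "-1" 0] iJ by (simp add: um)
    have ibV: "integrable lborel (\<lambda>y. b (y + w) * (V (y + p) - V (y + q)))" for w p q
    proof (rule Bochner_Integration.integrable_bound[OF ic[of "Bb * (L * norm (p - q))" "1 + norm w"]])
      show "AE y in lborel. norm (b (y + w) * (V (y + p) - V (y + q))) \<le> norm (Bb * (L * norm (p - q)) * indicator (cball 0 (1 + norm w)) y)"
      proof (rule AE_I2)
        fix y
        have v: "\<bar>V (y + p) - V (y + q)\<bar> \<le> L * norm (p - q)" using LV[of "y + q" "p - q"] by simp
        show "norm (b (y + w) * (V (y + p) - V (y + q))) \<le> norm (Bb * (L * norm (p - q)) * indicator (cball 0 (1 + norm w)) y)"
        proof (cases "y \<in> cball 0 (1 + norm w)")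
          case True
          thus ?thesis using Bb v L0 by (auto simp: abs_mult intro!: mult_mono)
        next
          case False
          have "norm y \<le> norm (y + w) + norm w" by norm
          hence "b (y + w) = 0" using False by (intro b0) auto
          thus ?thesis by simp
        qed
      qed
    qed measurable
    \<comment> \<open>A translation by \<open>\<delta> *\<^sub>R z\<close> in \<open>J (- z)\<close>
      moves the increment onto \<open>b\<close>: a discrete integration by parts.\<close>
    have JJ: "J z + J (- z) = - (LBINT y. P \<delta> z y)" for z
    proof -
      have "J (- z) = (LBINT y. b (\<delta> *\<^sub>R z + y) * (V (\<delta> *\<^sub>R z + y - \<delta> *\<^sub>R z) - V (\<delta> *\<^sub>R z + y)))"
        unfolding J_def by (subst lborel_integral_shift[of _ "\<delta> *\<^sub>R z", symmetric]) auto
      also have "\<dots> = (LBINT y. b (y + \<delta> *\<^sub>R z) * (V (y + 0) - V (y + \<delta> *\<^sub>R z)))" by (simp add: add.commute)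
      finally have Jm: "J (- z) = (LBINT y. b (y + \<delta> *\<^sub>R z) * (V (y + 0) - V (y + \<delta> *\<^sub>R z)))" .
      have Jp: "J z = (LBINT y. b (y + 0) * (V (y + \<delta> *\<^sub>R z) - V (y + 0)))" by (simp add: J_def)
      have "J z + J (- z) = (LBINT y. b (y + 0) * (V (y + \<delta> *\<^sub>R z) - V (y + 0)) + b (y + \<delta> *\<^sub>R z) * (V (y + 0) - V (y + \<delta> *\<^sub>R z)))"
        unfolding Jp Jm by (intro Bochner_Integration.integral_add[symmetric] ibV)
      also have "\<dots> = (LBINT y. - P \<delta> z y)"
        by (intro Bochner_Integration.integral_cong) (auto simp: P_def algebra_simps)
      finally show ?thesis by simp
    qed
    have "0 \<le> (LBINT z. unit_ball_ind z * J z + unit_ball_ind z * J (- z))"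
      using iJ iJ2 J1 J2 by simp
    also have "\<dots> = - (LBINT z. unit_ball_ind z * (LBINT y. P \<delta> z y))"
      using JJ by (simp add: distrib_left[symmetric])
    finally show ?thesis by simp
  qed
  define \<delta> where "\<delta> = (\<lambda>n. min \<delta>0 1 / (2 + real n))"
  have \<delta>: "0 < \<delta> n" "\<delta> n < \<delta>0" "\<delta> n \<le> 1" for n
  proof -
    show "0 < \<delta> n" using d0 by (simp add: \<delta>_def)
    have "\<delta> n \<le> min \<delta>0 1 / 2" unfolding \<delta>_def using d0 by (intro divide_left_mono) auto
    thus "\<delta> n < \<delta>0" "\<delta> n \<le> 1" using d0 by auto
  qed
  have \<delta>lim: "\<delta> \<longlonglongrightarrow> 0"
    unfolding \<delta>_def
    by (rule tendsto_divide_0[OF tendsto_const filterlim_at_top_imp_at_infinity[OF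
          filterlim_tendsto_add_at_top[OF tendsto_const filterlim_real_sequentially]]])
  \<comment> \<open>Both increments are of first order in the step, so division by its square has a
    limit involving first derivatives only.\<close>
  define Q where "Q = (\<lambda>n z y. P (\<delta> n) z y / (\<delta> n)\<^sup>2)"
  have Qdom: "\<bar>Q n z y\<bar> \<le> L\<^sup>2 * indicator (cball 0 2) y" if z: "z \<in> ball 0 1" for n z y
  proof (cases "y \<in> cball 0 2")
    case True
    have "\<bar>P (\<delta> n) z y\<bar> \<le> (L * norm (\<delta> n *\<^sub>R z)) * (L * norm (\<delta> n *\<^sub>R z))"
      unfolding P_def abs_mult using L0 by (intro mult_mono LV Lb) auto
    also have "\<dots> = L\<^sup>2 * (\<delta> n)\<^sup>2 * (norm z)\<^sup>2" using \<delta>(1)[of n] by (simp add: power2_eq_square)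
    also have "\<dots> \<le> L\<^sup>2 * (\<delta> n)\<^sup>2 * 1" using z by (intro mult_left_mono) (auto simp: power_le_one)
    finally show ?thesis using True \<delta>(1)[of n] by (simp add: Q_def pos_divide_le_eq)
  next
    case False
    have "norm y \<le> norm (y + \<delta> n *\<^sub>R z) + norm (\<delta> n *\<^sub>R z)"
      using norm_triangle_ineq4[of "y + \<delta> n *\<^sub>R z" "\<delta> n *\<^sub>R z"] by simp
    moreover have "norm (\<delta> n *\<^sub>R z) \<le> 1" using z \<delta>(1,3)[of n] by (auto intro!: mult_le_one)
    ultimately have "b (y + \<delta> n *\<^sub>R z) = 0" "b y = 0" using False by (auto intro!: b0)
    thus ?thesis by (simp add: Q_def P_def)
  qed
  have Qlim: "(\<lambda>n. Q n z y) \<longlonglongrightarrow> b' y z * V' y z" for z y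
  proof -
    have lim: "(\<lambda>n. (f (y + \<delta> n *\<^sub>R z) - f y) / \<delta> n) \<longlonglongrightarrow> f' z"
      if "(f has_derivative f') (at y)" for f :: "'a \<Rightarrow> real" and f'
    proof -
      have "((\<lambda>t. y + t *\<^sub>R z) has_derivative (\<lambda>t. t *\<^sub>R z)) (at 0)" by (auto intro!: derivative_eq_intros)
      moreover have "(f has_derivative f') (at (y + 0 *\<^sub>R z))" using that by simp
      ultimately have "((\<lambda>t. f (y + t *\<^sub>R z)) has_derivative (\<lambda>t. f' (t *\<^sub>R z))) (at 0)"
        by (rule has_derivative_compose)
      moreover have "f' (t *\<^sub>R z) = t * f' z" for t
        using has_derivative_linear[OF that] by (simp add: linear_cmul)
      ultimately have "((\<lambda>t. f (y + t *\<^sub>R z)) has_field_derivative f' z) (at 0)"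
        by (simp add: has_field_derivative_def mult_commute_abs)
      hence "(\<lambda>h. (f (y + h *\<^sub>R z) - f y) / h) \<midarrow>0\<rightarrow> f' z" by (simp add: DERIV_def)
      thus ?thesis
        using \<delta>lim \<delta>(1) unfolding tendsto_at_iff_sequentially comp_def by (auto dest!: spec[of _ \<delta>] simp: less_imp_neq[symmetric])
    qed
    have "(\<lambda>n. ((b (y + \<delta> n *\<^sub>R z) - b y) / \<delta> n) * ((V (y + \<delta> n *\<^sub>R z) - V y) / \<delta> n)) \<longlonglongrightarrow> b' y z * V' y z"
      by (intro tendsto_mult lim db dV)
    thus ?thesis by (simp add: Q_def P_def power2_eq_square)
  qed
  have b'meas: "(\<lambda>y. b' y z) \<in> borel_measurable borel" and V'meas: "(\<lambda>y. V' y z) \<in> borel_measurable borel" for z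
  proof -
    have "b' y z = (\<Sum>i\<in>Basis. (z \<bullet> i) * b' y i)" for y by (rule derivative_eq_sum_Basis[OF has_derivative_linear[OF db]])
    thus "(\<lambda>y. b' y z) \<in> borel_measurable borel" using b'm by simp
    have "V' y z = (\<Sum>i\<in>Basis. (z \<bullet> i) * V' y i)" for y by (rule derivative_eq_sum_Basis[OF has_derivative_linear[OF dV]])
    thus "(\<lambda>y. V' y z) \<in> borel_measurable borel" using V'm by simp
  qed
  define G where "G = (\<lambda>z. LBINT y. b' y z * V' y z)"
  have inner: "(\<lambda>n. LBINT y. Q n z y) \<longlonglongrightarrow> G z" if z: "z \<in> ball 0 1" for z
    unfolding G_def
  proof (rule integral_dominated_convergence[OF _ _ ic[of "L\<^sup>2" 2]])
    show "(\<lambda>y. b' y z * V' y z) \<in> borel_measurable lborel" using b'meas V'meas by simp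
    show "Q n z \<in> borel_measurable lborel" for n unfolding Q_def[abs_def] by measurable
  qed (use Qlim Qdom[OF z] in auto)
  have outer: "(\<lambda>n. LBINT z. unit_ball_ind z * (LBINT y. Q n z y)) \<longlonglongrightarrow> (LBINT z. unit_ball_ind z * G z)"
  proof (rule integral_dominated_convergence[OF _ _ ib[of "L\<^sup>2 * measure lborel (cball (0::'a) 2)"]])
    have lim: "(\<lambda>n. unit_ball_ind z * (LBINT y. Q n z y)) \<longlonglongrightarrow> unit_ball_ind z * G z" for z
      using inner[of z] by (cases "z \<in> ball 0 1") (auto intro: tendsto_mult)
    thus "AE z in lborel. (\<lambda>n. unit_ball_ind z * (LBINT y. Q n z y)) \<longlonglongrightarrow> unit_ball_ind z * G z" by simp
    have Qpm: "(\<lambda>(z, y). Q n z y) \<in> borel_measurable (borel \<Otimes>\<^sub>M lborel)" for n unfolding Q_def by measurable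
    have "(\<lambda>z. LBINT y. Q n z y) \<in> borel_measurable borel" for n
      by (rule lborel.borel_measurable_lebesgue_integral[OF Qpm])
    thus mm: "(\<lambda>z. unit_ball_ind z * (LBINT y. Q n z y)) \<in> borel_measurable lborel" for n by simp
    show "(\<lambda>z. unit_ball_ind z * G z) \<in> borel_measurable lborel"
      by (rule borel_measurable_LIMSEQ_metric[OF mm lim])
    show "AE z in lborel. norm (unit_ball_ind z * (LBINT y. Q n z y)) \<le> L\<^sup>2 * measure lborel (cball (0::'a) 2) * unit_ball_ind z" for n
    proof (rule AE_I2)
      fix z :: 'a
      show "norm (unit_ball_ind z * (LBINT y. Q n z y)) \<le> L\<^sup>2 * measure lborel (cball (0::'a) 2) * unit_ball_ind z"
      proof (cases "z \<in> ball 0 1")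
        case True
        have "integrable lborel (\<lambda>y. Q n z y)"
          by (rule Bochner_Integration.integrable_bound[OF ic[of "L\<^sup>2" 2]])
            (use Qdom[OF True] in \<open>auto simp: Q_def\<close>)
        hence "(LBINT y. norm (Q n z y)) \<le> (LBINT y. L\<^sup>2 * indicator (cball 0 2) (y::'a))"
          using Qdom[OF True] by (intro integral_mono integrable_norm ic) auto
        hence "norm (LBINT y. Q n z y) \<le> (LBINT y. L\<^sup>2 * indicator (cball 0 2) (y::'a))"
          using integral_norm_bound[of lborel "\<lambda>y. Q n z y"] by linarith
        thus ?thesis using True by simp
      qed auto
    qed
  qed
  have Qle: "(LBINT z. unit_ball_ind z * (LBINT y. Q n z y)) \<le> 0" for n
  proof -
    have "(LBINT z. unit_ball_ind z * (LBINT y. Q n z y)) = (LBINT z. unit_ball_ind z * (LBINT y. P (\<delta> n) z y)) / (\<delta> n)\<^sup>2"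
      by (simp add: Q_def)
    also have "\<dots> \<le> 0" using step[OF \<delta>(1,2)[of n]] by (intro divide_nonpos_nonneg) auto
    finally show ?thesis .
  qed
  have Gle: "(LBINT z. unit_ball_ind z * G z) \<le> 0"
    by (rule LIMSEQ_le_const2[OF outer]) (use Qle in auto)
  define W where "W = (\<lambda>i j. LBINT y. b' y i * V' y j)"
  have b'0: "b' y h = 0" if "norm y > 1" for y h
  proof -
    have "(b has_derivative (\<lambda>h. 0)) (at y)"
    proof (rule has_derivative_transform_within_open[of "\<lambda>_. 0"])
      show "open {p::'a. 1 < norm p}" by (intro open_Collect_less continuous_intros)
    qed (use that b0 in auto)
    thus ?thesis using has_derivative_unique[OF db[of y]] by metis
  qed
  have iW: "integrable lborel (\<lambda>y. b' y i * V' y j)" if "i \<in> Basis" "j \<in> Basis" for i j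
  proof (rule Bochner_Integration.integrable_bound[OF ic[of "B * B" 1]])
    show "(\<lambda>y. b' y i * V' y j) \<in> borel_measurable lborel" using b'meas V'meas by simp
    show "AE y in lborel. norm (b' y i * V' y j) \<le> norm (B * B * indicator (cball 0 1) y)"
    proof (rule AE_I2)
      fix y
      show "norm (b' y i * V' y j) \<le> norm (B * B * indicator (cball 0 1) y)"
        using b'B[OF that(1), of y] V'B[OF that(2), of y] b'0[of y i] B0
        by (cases "y \<in> cball 0 1") (auto simp: abs_mult intro!: mult_mono)
    qed
  qed
  \<comment> \<open>The limit is a quadratic form in \<open>z\<close>; integration over the ball
    leaves \<open>c\<close> times its trace by the moment formulas, and the trace is the integral in
    the claim.\<close>
  have G: "G z = (\<Sum>i\<in>Basis. \<Sum>j\<in>Basis. (z \<bullet> i) * (z \<bullet> j) * W i j)" for z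
  proof -
    have "b' y z * V' y z = (\<Sum>i\<in>Basis. \<Sum>j\<in>Basis. (z \<bullet> i) * (z \<bullet> j) * (b' y i * V' y j))" for y
    proof -
      have "b' y z * V' y z = (\<Sum>i\<in>Basis. (z \<bullet> i) * b' y i) * (\<Sum>j\<in>Basis. (z \<bullet> j) * V' y j)"
        using derivative_eq_sum_Basis[OF has_derivative_linear[OF db[of y]], of z]
          derivative_eq_sum_Basis[OF has_derivative_linear[OF dV[of y]], of z] by simp
      also have "\<dots> = (\<Sum>i\<in>Basis. \<Sum>j\<in>Basis. (z \<bullet> i) * (z \<bullet> j) * (b' y i * V' y j))"
        unfolding sum_product by (intro sum.cong refl) (simp add: mult_ac)
      finally show ?thesis .
    qed
    hence "G z = (LBINT y. (\<Sum>i\<in>Basis. \<Sum>j\<in>Basis. (z \<bullet> i) * (z \<bullet> j) * (b' y i * V' y j)))"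
      by (simp add: G_def)
    also have "\<dots> = (\<Sum>i\<in>Basis. \<Sum>j\<in>Basis. (z \<bullet> i) * (z \<bullet> j) * W i j)"
      unfolding W_def using iW
      by (subst Bochner_Integration.integral_sum; (intro Bochner_Integration.integrable_sum integrable_mult_right sum.cong refl)?)
         (auto simp: Bochner_Integration.integral_sum intro!: sum.cong)
    finally show ?thesis .
  qed
  obtain c where c: "c > 0" "\<And>i j :: 'a. i \<in> Basis \<Longrightarrow> j \<in> Basis \<Longrightarrow>
     (LBINT z. unit_ball_ind z * ((z \<bullet> i) * (z \<bullet> j))) = (if i = j then c else 0)"
    using ball_moments by blast
  have "(LBINT z. unit_ball_ind z * G z)
      = (LBINT z. (\<Sum>i\<in>Basis. \<Sum>j\<in>Basis. (unit_ball_ind z * ((z \<bullet> i) * (z \<bullet> j))) * W i j))"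
    unfolding G sum_distrib_left by (simp add: mult_ac)
  also have "\<dots> = (\<Sum>i\<in>Basis. \<Sum>j\<in>Basis. (LBINT z. unit_ball_ind z * ((z \<bullet> i) * (z \<bullet> j))) * W i j)"
  proof -
    have i: "integrable lborel (\<lambda>z. (unit_ball_ind z * ((z \<bullet> i) * (z \<bullet> j))) * W i j)"
      if "i \<in> Basis" "j \<in> Basis" for i j
      using ball_moment_integrable[OF that] by (rule integrable_mult_left)
    have "(LBINT z. (\<Sum>i\<in>Basis. \<Sum>j\<in>Basis. (unit_ball_ind z * ((z \<bullet> i) * (z \<bullet> j))) * W i j))
       = (\<Sum>i\<in>Basis. \<integral>z. (\<Sum>j\<in>Basis. (unit_ball_ind z * ((z \<bullet> i) * (z \<bullet> j))) * W i j) \<partial>lborel)"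
      by (intro Bochner_Integration.integral_sum Bochner_Integration.integrable_sum i)
    also have "\<dots> = (\<Sum>i\<in>Basis. \<Sum>j\<in>Basis. (LBINT z. unit_ball_ind z * ((z \<bullet> i) * (z \<bullet> j)) * W i j))"
      by (intro sum.cong refl Bochner_Integration.integral_sum i)
    finally show ?thesis by simp
  qed
  also have "\<dots> = (\<Sum>i\<in>Basis. \<Sum>j\<in>Basis. (if j = i then c * W i i else 0))"
    using c(2) by (intro sum.cong refl) auto
  also have "\<dots> = c * (\<Sum>i\<in>Basis. W i i)" by (simp add: sum_distrib_left)
  finally have "c * (\<Sum>i\<in>Basis. W i i) \<le> 0" using Gle by simp
  hence "(\<Sum>i\<in>Basis. W i i) \<le> 0" using c(1) by (simp add: mult_le_0_iff)
  moreover have "(LBINT y. (\<Sum>i\<in>Basis. V' y i * b' y i)) = (\<Sum>i\<in>Basis. W i i)"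
    unfolding W_def using iW by (subst Bochner_Integration.integral_sum) (auto simp: mult.commute)
  ultimately show ?thesis by simp
qed

subsection \<open>Radial potentials and decreasing kernels\<close>

text \<open>As weight in the Dirichlet form of \<open>V\<close>, a function with gradient
  \<open>- a x *\<^sub>R x\<close> produces, up to sign, the integral of \<open>a z\<close> times
  the derivative of \<open>V\<close> in the direction \<open>z\<close>. That is the derivative of a
  radial average with respect to its radius.\<close>

lemma radial_potential:
  fixes a :: "'a::euclidean_space \<Rightarrow> real"
  assumes a: "kern a" and rad: "\<And>x y. norm x = norm y \<Longrightarrow> a x = a y"
  obtains b :: "'a \<Rightarrow> real" where "\<And>x. 0 \<le> b x" "\<And>x. norm x \<ge> 1 \<Longrightarrow> b x = 0"
    "\<And>x. (b has_derivative (\<lambda>h. - a x * (x \<bullet> h))) (at x)"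
proof -
  obtain e :: 'a where e: "e \<in> Basis" using nonempty_Basis by blast
  \<comment> \<open>The profile of \<open>a\<close> as a function of the squared norm; with this
    variable the composition is differentiable at the origin as well.\<close>
  define A where "A = (\<lambda>s. a (sqrt \<bar>s\<bar> *\<^sub>R e))"
  have contA: "continuous_on S A" for S
    unfolding A_def by (intro continuous_on_compose2[OF kernD(1)[OF a]] continuous_intros) auto
  have aA: "a x = A (x \<bullet> x)" for x
    unfolding A_def using e by (intro rad) (simp add: norm_eq_sqrt_inner[of x])
  have Ann: "0 \<le> A s" for s using kernD(2)[OF a] by (simp add: A_def)
  have A0: "A s = 0" if "s \<ge> 1" for s
    unfolding A_def using that e by (intro kernD(3)[OF a]) auto
  \<comment> \<open>The interval contains 0 and all squares of norms below 2 in its interior, so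
    two-sided derivatives exist wherever \<open>b\<close> is given by \<open>Q\<close>.\<close>
  obtain Q where Q: "\<And>s. s \<in> {-1..9} \<Longrightarrow> (Q has_vector_derivative A s) (at s within {-1..9::real})"
    using antiderivative_continuous[OF contA] by blast
  have dQ: "DERIV Q s :> A s" if "-1 < s" "s < 9" for s
  proof -
    have "at s within {-1..9} = at s" using that by (intro at_within_interior) auto
    thus ?thesis using Q[of s] that by (simp add: has_real_derivative_iff_has_vector_derivative)
  qed
  have Qmono: "Q s \<le> Q t" if "-1 < s" "s \<le> t" "t < 9" for s t
  proof (rule DERIV_nonneg_imp_nondecreasing[OF that(2)])
    fix x assume x: "s \<le> x" "x \<le> t"
    hence "DERIV Q x :> A x" using that by (intro dQ) auto
    thus "\<exists>y. DERIV Q x :> y \<and> 0 \<le> y" using Ann by blast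
  qed
  have Qconst: "Q s = Q 1" if s: "1 \<le> s" "s < 9" for s
  proof (rule antisym)
    show "Q 1 \<le> Q s" using s by (intro Qmono) auto
    have "- Q 1 \<le> - Q s"
    proof (rule DERIV_nonneg_imp_nondecreasing[of 1 s "\<lambda>x. - Q x"])
      fix t assume t: "1 \<le> t" "t \<le> s"
      have "DERIV (\<lambda>x. - Q x) t :> - A t" using dQ[of t] t s by (intro DERIV_minus) auto
      thus "\<exists>y. DERIV (\<lambda>x. - Q x) t :> y \<and> 0 \<le> y" using A0[OF t(1)] by auto
    qed (use s in auto)
    thus "Q s \<le> Q 1" by simp
  qed
  \<comment> \<open>\<open>Q\<close> is constant on the values \<open>x \<bullet> x\<close> with
    \<open>1 \<le> norm x < 2\<close>, so \<open>b\<close> is already 0 there and the cut at 2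
    creates no jump.\<close>
  define b where "b = (\<lambda>x::'a. if norm x < 2 then (Q 1 - Q (x \<bullet> x)) / 2 else 0)"
  have nn: "x \<bullet> x = (norm x)\<^sup>2" for x :: 'a by (simp add: power2_norm_eq_inner)
  have sq4: "x \<bullet> x < 9" if "norm x < 2" for x :: 'a
    using power_strict_mono[OF that norm_ge_zero, of 2] by (simp add: nn)
  show ?thesis
  proof (rule that[of b])
    show z: "b x = 0" if "norm x \<ge> 1" for x
      using Qconst[of "x \<bullet> x"] sq4[of x] that one_le_power[OF that, of 2] by (auto simp: b_def nn)
    show "0 \<le> b x" for x
    proof (cases "norm x \<ge> 1")
      case False
      hence "x \<bullet> x \<le> 1" by (simp add: nn power_le_one)
      hence "Q (x \<bullet> x) \<le> Q 1" by (intro Qmono) (auto intro: less_le_trans[OF _ inner_ge_zero])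
      thus ?thesis by (simp add: b_def)
    qed (simp add: z)
    show "(b has_derivative (\<lambda>h. - a x * (x \<bullet> h))) (at x)" for x
    proof (cases "norm x < 2")
      case True
      have "-1 < x \<bullet> x" by (rule less_le_trans[OF _ inner_ge_zero]) simp
      hence "(Q has_derivative (\<lambda>t. A (x \<bullet> x) * t)) (at (x \<bullet> x))"
        using dQ[of "x \<bullet> x"] sq4[OF True] by (simp add: has_field_derivative_def)
      moreover have "((\<lambda>y. y \<bullet> y) has_derivative (\<lambda>h. x \<bullet> h + h \<bullet> x)) (at x)"
        by (auto intro!: derivative_eq_intros)
      ultimately have "((\<lambda>y. Q (y \<bullet> y)) has_derivative (\<lambda>h. A (x \<bullet> x) * (x \<bullet> h + h \<bullet> x))) (at x)"
        using has_derivative_compose by blast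
      hence "((\<lambda>y. (1/2) * (Q 1 - Q (y \<bullet> y))) has_derivative (\<lambda>h. (1/2) * (0 - A (x \<bullet> x) * (x \<bullet> h + h \<bullet> x)))) (at x)"
        by (intro has_derivative_mult_right has_derivative_diff has_derivative_const)
      moreover have "(1/2) * (0 - A (x \<bullet> x) * (x \<bullet> h + h \<bullet> x)) = - a x * (x \<bullet> h)" for h
        by (simp add: aA inner_commute)
      ultimately have d: "((\<lambda>y. (1/2) * (Q 1 - Q (y \<bullet> y))) has_derivative (\<lambda>h. - a x * (x \<bullet> h))) (at x)" by simp
      show ?thesis
      proof (rule has_derivative_transform_within_open[OF d])
        show "open {y::'a. norm y < 2}" by (intro open_Collect_less continuous_intros)
      qed (use True in \<open>auto simp: b_def\<close>)
    next
      case False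
      have a0: "a x = 0" using False by (intro kernD(3)[OF a]) auto
      have d: "((\<lambda>_. 0 :: real) has_derivative (\<lambda>h. - a x * (x \<bullet> h))) (at x)" by (simp add: a0)
      show ?thesis
      proof (rule has_derivative_transform_within_open[OF d])
        show "open {y::'a. 1 < norm y}" by (intro open_Collect_less continuous_intros)
      qed (use False z in auto)
    qed
  qed
qed

text \<open>The derivative at the kink is 0, which carries the kernel below smoothly across the unit
  sphere.\<close>

lemma DERIV_pos_part_sq: "DERIV (\<lambda>t::real. (max 0 t)\<^sup>2) x :> 2 * max 0 x"
proof -
  consider "x > 0" | "x < 0" | "x = 0" by linarith
  thus ?thesis
  proof cases
    case 1
    have "DERIV (\<lambda>t::real. t\<^sup>2) x :> 2 * max 0 x" using 1 by (auto intro!: derivative_eq_intros)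
    thus ?thesis
      by (rule has_field_derivative_transform_within_open[of _ _ _ "{0<..}"]) (use 1 in auto)
  next
    case 2
    have "DERIV (\<lambda>t::real. 0) x :> 2 * max 0 x" using 2 by (auto intro!: derivative_eq_intros)
    thus ?thesis
      by (rule has_field_derivative_transform_within_open[of _ _ _ "{..<0}"]) (use 2 in auto)
  next
    case 3
    have "(\<lambda>h::real. (max 0 h)\<^sup>2 / h) \<midarrow>0\<rightarrow> 0"
    proof (rule Lim_null_comparison[of _ "\<lambda>h. \<bar>h\<bar>"])
      show "eventually (\<lambda>h::real. norm ((max 0 h)\<^sup>2 / h) \<le> \<bar>h\<bar>) (at 0)"
        by (intro always_eventually allI) (auto simp: max_def power2_eq_square)
      show "((\<lambda>h::real. \<bar>h\<bar>) \<longlongrightarrow> 0) (at 0)" by (auto intro!: tendsto_eq_intros)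
    qed
    thus ?thesis using 3 by (simp add: DERIV_def)
  qed
qed

text \<open>A multiple of the squared positive part of \<open>1 - x \<bullet> x\<close>. It replaces
  \<open>a\<close> for regularisation, since a decreasing weight is a superposition of balls; one
  continuous derivative is what the Dirichlet form asks for.\<close>

lemma decreasing_C1_kernel:
  obtains j :: "'a::euclidean_space \<Rightarrow> real" where "kern j" "Ck_on 1 UNIV j" "\<And>x y. norm x \<le> norm y \<Longrightarrow> j y \<le> j x"
proof -
  define j0 where "j0 = (\<lambda>x::'a. (max 0 (1 - x \<bullet> x))\<^sup>2)"
  define N where "N = integral\<^sup>L lborel j0"
  have nn: "x \<bullet> x = (norm x)\<^sup>2" for x :: 'a by (simp add: power2_norm_eq_inner)
  have cont: "continuous_on UNIV j0" unfolding j0_def by (intro continuous_intros)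
  hence [measurable]: "j0 \<in> borel_measurable borel" by (rule borel_measurable_continuous_onI)
  have j00: "j0 x = 0" if "norm x \<ge> 1" for x
    using one_le_power[OF that, of 2] by (simp add: j0_def nn)
  have j0le: "j0 x \<le> 1" and j0nn: "0 \<le> j0 x" for x by (auto simp: j0_def intro!: power_le_one)
  have ib: "integrable lborel (indicator (cball 0 1) :: 'a \<Rightarrow> real)" "integrable lborel (\<lambda>x::'a. (1/4 :: real) * indicator (ball 0 (1/2)) x)"
    by (intro integrable_mult_right integrable_real_indicator emeasure_lborel_cball_finite emeasure_lborel_ball_finite; measurable)+
  have int: "integrable lborel j0"
  proof (rule Bochner_Integration.integrable_bound[OF ib(1)])
    show "AE x in lborel. norm (j0 x) \<le> norm (indicator (cball 0 1) x :: real)"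
    proof (rule AE_I2)
      fix x show "norm (j0 x) \<le> norm (indicator (cball 0 1) x :: real)"
        using j0le[of x] j0nn[of x] j00[of x] by (cases "x \<in> cball 0 1") auto
    qed
  qed measurable
  have low: "(1/4) * indicator (ball 0 (1/2)) x \<le> j0 x" for x
  proof (cases "x \<in> ball 0 (1/2)")
    case True
    hence "(norm x)\<^sup>2 \<le> (1/2)\<^sup>2" by (intro power_mono) auto
    hence "x \<bullet> x \<le> 1/4" unfolding nn by (simp add: power_divide)
    hence "1/2 \<le> max 0 (1 - x \<bullet> x)" unfolding le_max_iff_disj by linarith
    hence "(1/2)\<^sup>2 \<le> j0 x" unfolding j0_def by (rule power_mono) simp
    thus ?thesis using True by (simp add: power2_eq_square)
  qed (use j0nn in auto)
  have "0 < measure lborel (ball (0::'a) (1/2))" by (simp add: content_ball_pos)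
  hence "0 < (LBINT x. (1/4 :: real) * indicator (ball 0 (1/2)) (x::'a))" by simp
  also have "\<dots> \<le> N" unfolding N_def using ib(2) int low by (intro integral_mono) auto
  finally have N: "N > 0" .
  define j where "j = (\<lambda>x. j0 x / N)"
  have "kern j"
    unfolding kern_def j_def using cont N j00 j0nn
    by (auto intro!: continuous_intros simp: N_def[symmetric]) (auto simp: j0_def)
  moreover have "Ck_on 1 UNIV j"
  proof -
    have d0: "(j0 has_derivative (\<lambda>h. 2 * max 0 (1 - x \<bullet> x) * (- (x \<bullet> h + h \<bullet> x)))) (at x)" for x
    proof -
      have "((\<lambda>t::real. (max 0 t)\<^sup>2) has_derivative (\<lambda>t. 2 * max 0 (1 - x \<bullet> x) * t)) (at (1 - x \<bullet> x))"
        using DERIV_pos_part_sq[of "1 - x \<bullet> x"] by (simp add: has_field_derivative_def)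
      moreover have "((\<lambda>y. 1 - y \<bullet> y) has_derivative (\<lambda>h. - (x \<bullet> h + h \<bullet> x))) (at x)"
        by (auto intro!: derivative_eq_intros)
      ultimately show ?thesis unfolding j0_def using has_derivative_compose by blast
    qed
    have j_eq: "j = (\<lambda>x. (1 / N) * j0 x)" by (simp add: j_def)
    have d: "(j has_derivative (\<lambda>h. (1 / N) * (2 * max 0 (1 - x \<bullet> x) * (- (x \<bullet> h + h \<bullet> x))))) (at x)" for x
      unfolding j_eq by (intro has_derivative_mult_right d0) 
    have f: "frechet_derivative j (at x) = (\<lambda>h. (1 / N) * (2 * max 0 (1 - x \<bullet> x) * (- (x \<bullet> h + h \<bullet> x))))" for x
      using frechet_derivative_at[OF d] by simp
    have "j differentiable (at x)" for x using d by (auto simp: differentiable_def)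
    thus ?thesis
      by (simp add: f) (intro ballI continuous_intros; use N in simp)
  qed
  moreover have "j y \<le> j x" if "norm x \<le> norm y" for x y
  proof -
    have "(norm x)\<^sup>2 \<le> (norm y)\<^sup>2" using that by (intro power_mono) auto
    hence "max 0 (1 - (norm y)\<^sup>2) \<le> max 0 (1 - (norm x)\<^sup>2)" by (intro max.mono) auto
    hence "j0 y \<le> j0 x" unfolding j0_def nn by (intro power_mono) auto
    thus ?thesis using N by (simp add: j_def divide_right_mono)
  qed
  ultimately show ?thesis by (rule that)
qed

text \<open>Monotonicity in the norm makes the superlevel set a ball about the origin, and its
  openness makes this ball open: a point of the set can be moved outward a little, so its norm is
  strictly below the supremum.\<close>

lemma superlevel_ball:
  fixes j :: "'a::euclidean_space \<Rightarrow> real"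
  assumes j: "kern j" and dec: "\<And>x y. norm x \<le> norm y \<Longrightarrow> j y \<le> j x" and s: "0 \<le> s"
  shows "{z. s < j z} = {} \<or> (\<exists>R. 0 < R \<and> R \<le> 1 \<and> {z. s < j z} = ball 0 R)"
proof (cases "{z. s < j z} = {}")
  case False
  let ?S = "{z. s < j z}"
  have op: "open ?S" using kernD(1)[OF j] by (intro open_Collect_less continuous_intros) auto
  have lt1: "norm z < 1" if "z \<in> ?S" for z
    using kernD(3)[OF j, of z] that s by (cases "norm z < 1") auto
  have bdd: "bdd_above (norm ` ?S)" using lt1 by (intro bdd_aboveI[of _ 1]) (auto intro: less_imp_le)
  define R where "R = Sup (norm ` ?S)"
  have strict: "norm z < R" if z: "z \<in> ?S" for z
  proof -
    obtain e where e: "e > 0" "ball z e \<subseteq> ?S" using op z open_contains_ball by blast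
    obtain i :: 'a where i: "i \<in> Basis" using nonempty_Basis by blast
    define d where "d = (if z = 0 then i else z /\<^sub>R norm z)"
    have nd: "norm d = 1" using i by (auto simp: d_def)
    have "norm (z + (e/2) *\<^sub>R d) = norm z + e / 2"
    proof (cases "z = 0")
      case False
      hence "d = inverse (norm z) *\<^sub>R z" by (simp add: d_def)
      hence "z + (e/2) *\<^sub>R d = (1 + (e/2) / norm z) *\<^sub>R z"
        by (simp only: scaleR_add_left scaleR_one scaleR_scaleR divide_inverse)
      hence "norm (z + (e/2) *\<^sub>R d) = \<bar>1 + (e/2) / norm z\<bar> * norm z" by (metis norm_scaleR)
      also have "\<dots> = norm z + e / 2" using e(1) False by (simp add: distrib_right)
      finally show ?thesis .
    qed (use nd e in simp)
    moreover have "z + (e/2) *\<^sub>R d \<in> ?S" using e nd by (intro subsetD[OF e(2)]) (simp add: dist_norm)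
    hence "norm (z + (e/2) *\<^sub>R d) \<le> R" unfolding R_def using bdd by (intro cSup_upper) auto
    ultimately show ?thesis using e(1) by linarith
  qed
  have "?S = ball 0 R"
  proof (intro set_eqI iffI)
    fix z assume "z \<in> ?S" thus "z \<in> ball 0 R" using strict by simp
  next
    fix z :: 'a assume "z \<in> ball 0 R"
    hence "norm z < Sup (norm ` ?S)" by (simp add: R_def)
    then obtain y where y: "y \<in> ?S" "norm z < norm y"
      using less_cSup_iff[OF _ bdd] False by blast
    thus "z \<in> ?S" using dec[of z y] by simp
  qed
  moreover have "R \<le> 1" unfolding R_def using False lt1 by (intro cSup_least) (auto intro: less_imp_le)
  moreover have "0 < R" using False strict by (meson ex_in_conv le_less_trans norm_ge_zero)
  ultimately show ?thesis by blast
qed simp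

text \<open>Layer-cake decomposition of a radially decreasing weight into balls.\<close>

lemma radial_decreasing_integral_nonneg:
  fixes j w :: "'a::euclidean_space \<Rightarrow> real"
  assumes j: "kern j" and dec: "\<And>x y. norm x \<le> norm y \<Longrightarrow> j y \<le> j x"
    and [measurable]: "w \<in> borel_measurable borel"
    and w: "integrable lborel (\<lambda>z. unit_ball_ind z * w z)"
    and balls: "\<And>R. 0 < R \<Longrightarrow> R \<le> 1 \<Longrightarrow> 0 \<le> (LBINT z. indicator (ball 0 R) z * w z)"
  shows "0 \<le> (LBINT z. j z * w z)"
proof -
  note [measurable] = kernD(6)[OF j]
  obtain B where B: "\<And>x. j x \<le> B" "B > 0" using kern_bound[OF j] by metis
  \<comment> \<open>The variable \<open>s\<close> is the height of a layer: for fixed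
    \<open>z\<close> the layers integrate to the weight \<open>j z\<close>, for fixed
    \<open>s > 0\<close> the layer is a ball or empty.\<close>
  define f where "f = (\<lambda>(s::real) z. (if 0 < s \<and> s < j z then 1 else 0) * (unit_ball_ind z * w z))"
  have fm: "case_prod f \<in> borel_measurable (lborel \<Otimes>\<^sub>M lborel)" unfolding f_def by measurable
  have dom: "\<bar>f s z\<bar> \<le> indicator {0..B} s * \<bar>unit_ball_ind z * w z\<bar>" for s z
    using B(1)[of z] by (auto simp: f_def indicator_def)
  have ii: "integrable lborel (indicator {0..B} :: real \<Rightarrow> real)" using B(2) by (intro integrable_real_indicator) auto
  have iw: "integrable lborel (\<lambda>z. \<bar>unit_ball_ind z * w z\<bar>)" using w by (rule integrable_abs)
  have "(LBINT s. f s z) = j z * w z" for z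
  proof -
    have "(LBINT s. f s z) = (LBINT s. indicator {0<..<j z} s * (unit_ball_ind z * w z))"
      by (intro Bochner_Integration.integral_cong) (auto simp: f_def indicator_def)
    also have "\<dots> = j z * (unit_ball_ind z * w z)" using kernD(2)[OF j, of z] by simp
    also have "\<dots> = j z * w z" using kernD(3)[OF j, of z] by (cases "z \<in> ball 0 1") auto
    finally show ?thesis .
  qed
  hence "(LBINT z. j z * w z) = (\<integral>s. \<integral>z. f s z \<partial>lborel \<partial>lborel)"
    using fubini_dominated(1)[OF lborel_sigma_finite lborel_sigma_finite fm ii iw dom] by simp
  also have "\<dots> \<ge> 0"
  proof (rule integral_nonneg_AE, rule AE_I2)
    fix s :: real
    show "0 \<le> (LBINT z. f s z)"
    proof (cases "0 < s")
      case True
      consider "{z. s < j z} = {}" | R where "0 < R" "R \<le> 1" "{z. s < j z} = ball 0 R"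
        using superlevel_ball[OF j dec, of s] True by fastforce
      thus ?thesis
      proof cases
        case 1
        hence "f s = (\<lambda>z. 0)" by (auto simp: f_def)
        thus ?thesis by simp
      next
        case (2 R)
        have "f s z = indicator (ball 0 R) z * w z" for z
        proof -
          have "s < j z \<longleftrightarrow> z \<in> ball 0 R" using 2(3) by blast
          thus ?thesis using 2(2) True by (auto simp: f_def indicator_def)
        qed
        thus ?thesis using balls[OF 2(1,2)] by simp
      qed
    qed (simp add: f_def)
  qed
  finally show ?thesis .
qed

text \<open>The sub-mean value inequality in the form needed for the layers of a kernel: rescaled to
  the unit ball, written for the increment of \<open>u\<close>, and available for all smaller
  concentric balls with the same scale \<open>r\<close>.\<close>

lemma sbh_ball_mean_unit:
  fixes u :: "'a::euclidean_space \<Rightarrow> ereal"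
  assumes u: "u \<in> sbh D" and D: "open D" and r: "0 < r" "cball x r \<subseteq> D" and fin: "u x \<noteq> - \<infinity>"
  shows "integrable lborel (\<lambda>z. unit_ball_ind z * (rl u (x + r *\<^sub>R z) - rl u x))"
    and "\<And>s. 0 < s \<Longrightarrow> s \<le> 1 \<Longrightarrow> 0 \<le> (LBINT z. indicator (ball 0 s) z * (rl u (x + r *\<^sub>R z) - rl u x))"
proof -
  have [measurable]: "u \<in> borel_measurable borel" by (rule sbh_borel[OF u D])
  have [measurable]: "rl u \<in> borel_measurable borel" by (intro borel_measurable_real_of_ereal) simp
  have main: "integrable lborel (\<lambda>z. indicator (ball 0 s) z * rl u (x + r *\<^sub>R z)) \<and>
     rl u x * measure lborel (ball (0::'a) s) \<le> (LBINT z. indicator (ball 0 s) z * rl u (x + r *\<^sub>R z))"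
    if s: "0 < s" "s \<le> 1" for s
  proof -
    have rs: "0 < r * s" "cball x (r * s) \<subseteq> D"
      using r s mult_left_le[of s r] subset_cball[of "r * s" r x] by auto
    note bm = sbh_ball_mean[OF u D rs fin]
    have ind: "indicator (ball x (r * s)) (x + r *\<^sub>R z) = (indicator (ball 0 s) z :: real)" for z
      using r by (simp add: indicator_def dist_norm)
    have m: "(\<lambda>y. indicator (ball x (r * s)) y * rl u y) \<in> borel_measurable borel" by measurable
    have i1: "integrable lborel (\<lambda>z. indicator (ball 0 s) z * rl u (x + r *\<^sub>R z))"
      using lborel_integrable_affine_iff[OF m, of r x] bm(2) r(1) unfolding ind by simp
    have "(LBINT y. indicator (ball x (r * s)) y * rl u y) = r ^ DIM('a) * (LBINT z. indicator (ball 0 s) z * rl u (x + r *\<^sub>R z))"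
      using lborel_integral_affine[OF m, of r x] r(1) unfolding ind by simp
    moreover have "measure lborel (ball x (r * s)) = r ^ DIM('a) * measure lborel (ball (0::'a) s)"
      using r(1) s(1) by (simp add: content_ball power_mult_distrib)
    ultimately have "r ^ DIM('a) * (rl u x * measure lborel (ball (0::'a) s)) \<le> r ^ DIM('a) * (LBINT z. indicator (ball 0 s) z * rl u (x + r *\<^sub>R z))"
      using bm(3) by (simp add: mult_ac)
    thus ?thesis using i1 r(1) by simp
  qed
  have ib: "integrable lborel (\<lambda>z::'a. indicator (ball 0 s) z * rl u x)" for s :: real
    using emeasure_lborel_ball_finite by (intro integrable_mult_left integrable_real_indicator) auto
  show "integrable lborel (\<lambda>z. unit_ball_ind z * (rl u (x + r *\<^sub>R z) - rl u x))"
    unfolding right_diff_distrib using main[of 1] ib[of 1] by (intro Bochner_Integration.integrable_diff) auto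
  show "0 \<le> (LBINT z. indicator (ball 0 s) z * (rl u (x + r *\<^sub>R z) - rl u x))" if "0 < s" "s \<le> 1" for s
  proof -
    have "(LBINT z. indicator (ball 0 s) z * (rl u (x + r *\<^sub>R z) - rl u x))
       = (LBINT z. indicator (ball 0 s) z * rl u (x + r *\<^sub>R z)) - (LBINT z. indicator (ball (0::'a) s) z * rl u x)"
      unfolding right_diff_distrib using main[OF that] ib[of s] by (intro Bochner_Integration.integral_diff) auto
    thus ?thesis using main[OF that] by (simp add: mult.commute)
  qed
qed

text \<open>The layers of a decreasing kernel are balls, on each of which the increment of
  \<open>u\<close> has nonnegative integral; the kernel has total mass 1.\<close>

lemma sbh_le_cv_decreasing:
  fixes u :: "'a::euclidean_space \<Rightarrow> ereal"
  assumes u: "u \<in> sbh D" and D: "open D" and r: "0 < r" "cball x r \<subseteq> D" and fin: "u x \<noteq> - \<infinity>"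
    and j: "kern j" and dec: "\<And>x y. norm x \<le> norm y \<Longrightarrow> j y \<le> j x"
  shows "rl u x \<le> cv j r (rl u) x"
proof -
  have [measurable]: "u \<in> borel_measurable borel" by (rule sbh_borel[OF u D])
  have [measurable]: "rl u \<in> borel_measurable borel" by (intro borel_measurable_real_of_ereal) simp
  note [measurable] = kernD(6)[OF j]
  obtain B where B: "\<And>x. j x \<le> B" "B > 0" using kern_bound[OF j] by metis
  define w where "w = (\<lambda>z. rl u (x + r *\<^sub>R z) - rl u x)"
  have [measurable]: "w \<in> borel_measurable borel" unfolding w_def by measurable
  have m1: "integrable lborel (\<lambda>z. unit_ball_ind z * w z)"
    unfolding w_def by (rule sbh_ball_mean_unit(1)[OF u D r fin])
  have w0: "0 \<le> (LBINT z. j z * w z)"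
  proof (rule radial_decreasing_integral_nonneg[OF j dec])
    show "0 \<le> (LBINT z. indicator (ball 0 R) z * w z)" if "0 < R" "R \<le> 1" for R
      unfolding w_def by (rule sbh_ball_mean_unit(2)[OF u D r fin that])
  qed (use m1 in auto)
  have iBw: "integrable lborel (\<lambda>z. B * (unit_ball_ind z * w z))"
    by (intro integrable_mult_right m1)
  have ijw: "integrable lborel (\<lambda>z. j z * w z)"
  proof (rule Bochner_Integration.integrable_bound[OF iBw])
    show "AE z in lborel. norm (j z * w z) \<le> norm (B * (unit_ball_ind z * w z))"
    proof (rule AE_I2)
      fix z
      show "norm (j z * w z) \<le> norm (B * (unit_ball_ind z * w z))"
        using kernD(3)[OF j, of z] kernD(2)[OF j, of z] B(1)[of z] B(2)
        by (cases "z \<in> ball 0 1") (auto simp: abs_mult intro!: mult_right_mono)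
    qed
  qed measurable
  have "cv j r (rl u) x = (LBINT z. j z * w z + j z * rl u x)"
    using r(1) by (subst cv_eq[OF j]) (auto simp: w_def algebra_simps)
  also have "\<dots> = (LBINT z. j z * w z) + rl u x"
    using ijw kern_integrable[OF j] kernD(5)[OF j] by (subst Bochner_Integration.integral_add) auto
  finally show ?thesis using w0 by linarith
qed

subsection \<open>Duality and approximation for averages\<close>

text \<open>Averaging is self-adjoint because the kernel is even. One factor is integrable, the
  other bounded with bounded support.\<close>

lemma cv_adjoint:
  fixes w \<phi> :: "'a::euclidean_space \<Rightarrow> real"
  assumes w: "integrable lborel w" and [measurable]: "\<phi> \<in> borel_measurable borel"
    and \<phi>: "\<And>x. \<bar>\<phi> x\<bar> \<le> B" "\<And>x. x \<notin> cball c R \<Longrightarrow> \<phi> x = 0" and a: "kern a" and \<rho>: "\<rho> > 0"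
  shows "(LBINT x. \<phi> x * cv a \<rho> w x) = (LBINT y. w y * cv a \<rho> \<phi> y)"
    and "integrable lborel (\<lambda>x. \<phi> x * cv a \<rho> w x)" and "integrable lborel (\<lambda>y. w y * cv a \<rho> \<phi> y)"
proof -
  note [measurable] = sck_measurable[OF a]
  have [measurable]: "w \<in> borel_measurable borel" using w by auto
  obtain A where A: "\<And>x. a x \<le> A" "A > 0" using kern_bound[OF a] by metis
  define f where "f = (\<lambda>x y. \<phi> x * (w y * sck a \<rho> (y - x)))"
  have fm: "case_prod f \<in> borel_measurable (lborel \<Otimes>\<^sub>M lborel)" unfolding f_def by measurable
  have ig: "integrable lborel (\<lambda>x::'a. (B * (A / \<rho> ^ DIM('a))) * indicator (cball c R) x)"
    using emeasure_lborel_cball_finite by (intro integrable_mult_right integrable_real_indicator) auto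
  have B0: "0 \<le> B" using \<phi>(1)[of 0] by linarith
  have dom: "\<bar>f x y\<bar> \<le> ((B * (A / \<rho> ^ DIM('a))) * indicator (cball c R) x) * \<bar>w y\<bar>" for x y
  proof (cases "x \<in> cball c R")
    case True
    have "\<bar>\<phi> x\<bar> * \<bar>sck a \<rho> (y - x)\<bar> \<le> B * (A / \<rho> ^ DIM('a))"
      using B0 by (intro mult_mono \<phi> sck_bound[OF a \<rho> A(1)]) auto
    hence "(\<bar>\<phi> x\<bar> * \<bar>sck a \<rho> (y - x)\<bar>) * \<bar>w y\<bar> \<le> (B * (A / \<rho> ^ DIM('a))) * \<bar>w y\<bar>"
      by (rule mult_right_mono) simp
    thus ?thesis using True by (simp add: f_def abs_mult mult_ac)
  next
    case False thus ?thesis using \<phi>(2)[OF False] by (simp add: f_def)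
  qed
  note fub = fubini_dominated[OF lborel_sigma_finite lborel_sigma_finite fm ig integrable_abs[OF w] dom]
  have 1: "(LBINT y. f x y) = \<phi> x * cv a \<rho> w x" for x by (simp add: f_def cv_def)
  have 2: "(LBINT x. f x y) = w y * cv a \<rho> \<phi> y" for y
  proof -
    have "f x y = w y * (\<phi> x * sck a \<rho> (x - y))" for x
      unfolding f_def using sck_commute[OF a, of \<rho> y x] by simp
    thus ?thesis by (simp add: cv_def)
  qed
  show "(LBINT x. \<phi> x * cv a \<rho> w x) = (LBINT y. w y * cv a \<rho> \<phi> y)"
    "integrable lborel (\<lambda>x. \<phi> x * cv a \<rho> w x)" "integrable lborel (\<lambda>y. w y * cv a \<rho> \<phi> y)"
    using fub unfolding 1 2 by auto
qed

text \<open>The kernel is a probability density on the ball of radius \<open>\<rho>\<close>, so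
  averaging moves a value by no more than the oscillation on that ball.\<close>

lemma cv_approx:
  fixes \<phi> :: "'a::euclidean_space \<Rightarrow> real"
  assumes a: "kern a" and \<rho>: "\<rho> > 0" and [measurable]: "\<phi> \<in> borel_measurable borel"
    and \<omega>: "\<And>z. norm (z - x) < \<rho> \<Longrightarrow> \<bar>\<phi> z - \<phi> x\<bar> \<le> \<omega>"
  shows "\<bar>cv a \<rho> \<phi> x - \<phi> x\<bar> \<le> \<omega>"
proof -
  note [measurable] = sck_measurable[OF a]
  note si = sck_integral[OF a \<rho>, of x]
  have \<omega>0: "0 \<le> \<omega>" using \<omega>[of x] \<rho> by simp
  have dom: "\<bar>(\<phi> y - \<phi> x) * sck a \<rho> (y - x)\<bar> \<le> \<omega> * sck a \<rho> (y - x)" for y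
    using \<omega>[of y] sck_nonneg[OF a \<rho>, of "y - x"] sck_zero[OF a \<rho>, of "y - x"]
    by (cases "norm (y - x) < \<rho>") (auto simp: abs_mult intro!: mult_right_mono)
  have id: "integrable lborel (\<lambda>y. (\<phi> y - \<phi> x) * sck a \<rho> (y - x))"
    by (rule Bochner_Integration.integrable_bound[OF integrable_mult_right[OF si(2), of \<omega>]])
      (use dom in \<open>auto intro!: AE_I2 order.trans[OF _ abs_ge_self] simp del: abs_mult\<close>)
  have "cv a \<rho> \<phi> x = (LBINT y. (\<phi> y - \<phi> x) * sck a \<rho> (y - x) + \<phi> x * sck a \<rho> (y - x))"
    by (simp add: cv_def algebra_simps)
  also have "\<dots> = (LBINT y. (\<phi> y - \<phi> x) * sck a \<rho> (y - x)) + \<phi> x"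
    using id si by (subst Bochner_Integration.integral_add) auto
  finally have "\<bar>cv a \<rho> \<phi> x - \<phi> x\<bar> \<le> (LBINT y. \<bar>(\<phi> y - \<phi> x) * sck a \<rho> (y - x)\<bar>)"
    using integral_abs_bound[of lborel "\<lambda>y. (\<phi> y - \<phi> x) * sck a \<rho> (y - x)"] by simp
  also have "\<dots> \<le> (LBINT y. \<omega> * sck a \<rho> (y - x))"
    using id si dom by (intro integral_mono integrable_abs integrable_mult_right) auto
  also have "\<dots> = \<omega>" using si by simp
  finally show ?thesis .
qed

text \<open>Compactness of the ball of radius \<open>\<rho> + 1\<close> suffices: if
  \<open>p\<close> and \<open>q\<close> are closer than 1 and one of them lies outside that ball,
  both have norm at least \<open>\<rho>\<close> and both values are 0.\<close>

lemma sck_uniformly_continuous: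
  fixes a :: "'a::euclidean_space \<Rightarrow> real"
  assumes a: "kern a" and \<rho>: "\<rho> > 0" and \<omega>: "\<omega> > 0"
  obtains d where "d > 0" "\<And>p q. norm (p - q) < d \<Longrightarrow> \<bar>sck a \<rho> p - sck a \<rho> q\<bar> \<le> \<omega>"
proof -
  have "uniformly_continuous_on (cball 0 (\<rho> + 1)) (sck a \<rho>)"
    by (intro compact_uniformly_continuous continuous_on_subset[OF sck_continuous[OF a \<rho>]]) auto
  then obtain d where d: "d > 0" "\<And>p q. p \<in> cball 0 (\<rho> + 1) \<Longrightarrow> q \<in> cball 0 (\<rho> + 1) \<Longrightarrow> dist q p < d \<Longrightarrow> dist (sck a \<rho> q) (sck a \<rho> p) < \<omega>"
    unfolding uniformly_continuous_on_def using \<omega> by metis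
  show ?thesis
  proof (rule that[of "min d 1"])
    show "\<bar>sck a \<rho> p - sck a \<rho> q\<bar> \<le> \<omega>" if pq: "norm (p - q) < min d 1" for p q
    proof (cases "p \<in> cball 0 (\<rho> + 1) \<and> q \<in> cball 0 (\<rho> + 1)")
      case True
      thus ?thesis using d(2)[of q p] pq by (auto simp: dist_norm dist_real_def)
    next
      case False
      have "norm p \<le> norm (p - q) + norm q" "norm q \<le> norm (p - q) + norm p"
        using norm_triangle_ineq[of "p - q" q] norm_triangle_ineq4[of p "p - q"] by auto
      hence "norm p \<ge> \<rho>" "norm q \<ge> \<rho>" using False pq by auto
      thus ?thesis using \<omega> by (simp add: sck_zero[OF a \<rho>])
    qed
  qed (use d in auto)
qed

subsection \<open>Radial averages of subharmonic functions\<close>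

text \<open>The derivative is bounded on the whole space because \<open>w\<close> has bounded
  support. The three conclusions are the regularity assumptions of
  \<open>radial_average_mono_C1\<close>.\<close>

lemma cv_C1:
  fixes w :: "'a::euclidean_space \<Rightarrow> real"
  assumes w: "integrable lborel w" "\<forall>z. z \<notin> cball x R \<longrightarrow> w z = 0"
    and j: "kern j" "Ck_on 1 UNIV j" and \<epsilon>: "0 < \<epsilon>" "\<epsilon> \<le> 1"
  shows "\<exists>v' B. (\<forall>y. (cv j \<epsilon> w has_derivative v' y) (at y)) \<and>
    (\<forall>y. \<forall>i\<in>Basis. \<bar>v' y i\<bar> \<le> B) \<and> (\<forall>i\<in>Basis. (\<lambda>y. v' y i) \<in> borel_measurable borel)"
proof -
  define v where "v = cv j \<epsilon> w"
  have [measurable]: "w \<in> borel_measurable borel" using w by auto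
  have veq: "v = (\<lambda>y. LBINT z. (w z / \<epsilon> ^ DIM('a)) * j ((- 1 / \<epsilon>) *\<^sub>R y + z /\<^sub>R \<epsilon>))"
    unfolding v_def cv_def sck_def by (simp add: scaleR_diff_right divide_inverse mult_ac)
  have C: "Ck_on 1 UNIV v"
    unfolding veq
  proof (rule Ck_on_superposition[OF _ _ _ _ j(2)])
    show "integrable lborel (\<lambda>z. \<bar>w z / \<epsilon> ^ DIM('a)\<bar> * \<bar>- 1 / \<epsilon>\<bar> ^ n)" for n
      using w(1) by (intro integrable_mult_left integrable_abs integrable_divide)
    show "j z = 0" if "norm z > 1" for z using kernD(3)[OF j(1)] that by auto
  qed auto
  define v' where "v' = (\<lambda>y. frechet_derivative v (at y))"
  have d: "(v has_derivative v' y) (at y)" for y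
    using C frechet_derivative_works unfolding v'_def by auto
  have c: "continuous_on UNIV (\<lambda>y. v' y i)" if "i \<in> Basis" for i using C that by (auto simp: v'_def)
  have v0: "v y = 0" if y: "R + 1 < norm (y - x)" for y
  proof -
    have z0: "w z * sck j \<epsilon> (z - y) = 0" for z
    proof (cases "z \<in> cball x R")
      case True
      have "norm (y - x) \<le> norm (z - y) + norm (z - x)"
        using norm_triangle_ineq4[of "z - x" "z - y"] by simp
      hence "\<epsilon> \<le> norm (z - y)" using True y \<epsilon> by (auto simp: dist_norm norm_minus_commute)
      thus ?thesis using sck_zero[OF j(1) \<epsilon>(1)] by simp
    qed (simp add: w(2))
    show ?thesis unfolding v_def cv_def z0 by simp
  qed
  have v'0: "v' y h = 0" if "R + 1 < norm (y - x)" for y h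
  proof -
    have "(v has_derivative (\<lambda>h. 0)) (at y)"
    proof (rule has_derivative_transform_within_open[of "\<lambda>_. 0"])
      show "open {p::'a. R + 1 < norm (p - x)}" by (intro open_Collect_less continuous_intros)
    qed (use that v0 in auto)
    thus ?thesis using has_derivative_unique[OF d[of y]] by metis
  qed
  have "\<exists>B\<ge>0. \<forall>y. \<bar>v' y i\<bar> \<le> B" if i: "i \<in> Basis" for i
  proof -
    have "compact ((\<lambda>y. v' y i) ` cball x (R + 1))"
      by (intro compact_continuous_image continuous_on_subset[OF c[OF i]]) auto
    then obtain B where B: "\<forall>t\<in>(\<lambda>y. v' y i) ` cball x (R + 1). norm t \<le> B"
      using compact_imp_bounded bounded_iff by blast
    have "\<bar>v' y i\<bar> \<le> max B 0" for y
      using B v'0[of y i] by (cases "y \<in> cball x (R + 1)") (auto simp: dist_norm norm_minus_commute le_max_iff_disj)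
    thus ?thesis by (intro exI[of _ "max B 0"]) auto
  qed
  then obtain Bf where Bf: "\<And>i. i \<in> Basis \<Longrightarrow> Bf i \<ge> 0 \<and> (\<forall>x. \<bar>v' x i\<bar> \<le> Bf i)" by metis
  have "\<bar>v' y i\<bar> \<le> (\<Sum>i\<in>Basis. Bf i)" if "i \<in> Basis" for i y
  proof -
    have "Bf i \<le> (\<Sum>i\<in>Basis. Bf i)" using Bf that by (intro member_le_sum) auto
    thus ?thesis using Bf[OF that] order.trans by blast
  qed
  thus ?thesis
    using d c unfolding v_def
    by (intro exI[of _ v'] exI[of _ "\<Sum>i\<in>Basis. Bf i"]) (auto simp: v'_def v_def intro: borel_measurable_continuous_onI)
qed

text \<open>Ball means commute with convolution, so the regularised function inherits the sub-mean
  value inequality of \<open>u\<close>. The condition on \<open>R\<close> keeps all points involved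
  inside the ball to which \<open>u\<close> is cut off.\<close>

lemma cv_submean:
  fixes u :: "'a::euclidean_space \<Rightarrow> ereal"
  assumes u: "u \<in> sbh D" and D: "open D" and L: "locint D (rl u)" and AE: "AE z\<in>D in lborel. \<bar>u z\<bar> \<noteq> \<infinity>"
    and R: "cball x R \<subseteq> D" and j: "kern j" and \<epsilon>: "0 < \<epsilon>" and \<delta>: "0 < \<delta>" and y: "norm (y - x) + \<epsilon> + \<delta> \<le> R"
  defines "w \<equiv> \<lambda>z. indicator (cball x R) z * rl u z"
  shows "0 \<le> (LBINT q. unit_ball_ind q * (cv j \<epsilon> w (y + \<delta> *\<^sub>R q) - cv j \<epsilon> w y))"
proof -
  let ?m = "DIM('a)"
  note [measurable] = sck_measurable[OF j]
  have um: "rl u \<in> borel_measurable borel" using L by (simp add: locint_def)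
  have wm[measurable]: "w \<in> borel_measurable borel" unfolding w_def by (intro borel_measurable_times um) measurable
  have wi: "integrable lborel w" using L R unfolding w_def locint_def by auto
  obtain A where A: "\<And>x. j x \<le> A" "A > 0" using kern_bound[OF j] by metis
  define J where "J = sck j \<epsilon>"
  have Jm[measurable]: "J \<in> borel_measurable borel" by (simp add: J_def)
  have Jb: "\<bar>J z\<bar> \<le> A / \<epsilon> ^ ?m" for z unfolding J_def by (rule sck_bound[OF j \<epsilon> A(1)])
  have Jnn: "0 \<le> J z" for z unfolding J_def by (rule sck_nonneg[OF j \<epsilon>])
  have J0: "J z = 0" if "\<epsilon> \<le> norm z" for z unfolding J_def using sck_zero[OF j \<epsilon> that] .
  \<comment> \<open>\<open>\<Lambda>\<close> is the kernel averaged over a ball and \<open>E\<close>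
    the ball mean of \<open>w\<close>, both without the factor \<open>1 / vol\<close>. Either order
    of averaging is reduced to the integral of \<open>w z * \<Lambda> z\<close>.\<close>
  define \<Lambda> where "\<Lambda> = (\<lambda>z. LBINT q. unit_ball_ind q * J (z - (y + \<delta> *\<^sub>R q)))"
  define E where "E = (\<lambda>z. LBINT q. unit_ball_ind q * w (z + \<delta> *\<^sub>R q))"
  define vol where "vol = measure lborel (ball (0::'a) 1)"
  define f where "f = (\<lambda>q z. unit_ball_ind q * (w z * J (z - (y + \<delta> *\<^sub>R q))))"
  have fm: "case_prod f \<in> borel_measurable (lborel \<Otimes>\<^sub>M lborel)" unfolding f_def by measurable
  have ig: "integrable lborel (\<lambda>q::'a. (A / \<epsilon> ^ ?m) * unit_ball_ind q)"
    by (intro integrable_mult_right unit_ball_ind_integrable)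
  have fdom: "\<bar>f q z\<bar> \<le> ((A / \<epsilon> ^ ?m) * unit_ball_ind q) * \<bar>w z\<bar>" for q z
    using mult_right_mono[OF Jb[of "z - (y + \<delta> *\<^sub>R q)"] abs_ge_zero[of "w z"]]
    by (cases "q \<in> ball 0 1") (auto simp: f_def abs_mult mult_ac)
  note fub = fubini_dominated[OF lborel_sigma_finite lborel_sigma_finite fm ig integrable_abs[OF wi] fdom]
  have f1: "(LBINT z. f q z) = unit_ball_ind q * cv j \<epsilon> w (y + \<delta> *\<^sub>R q)" for q
    by (simp add: f_def cv_def J_def)
  have f2: "(LBINT q. f q z) = w z * \<Lambda> z" for z
    by (simp add: f_def \<Lambda>_def mult.left_commute[of _ "w z"])
  have left: "(LBINT q. unit_ball_ind q * cv j \<epsilon> w (y + \<delta> *\<^sub>R q)) = (LBINT z. w z * \<Lambda> z)"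
    and lefti: "integrable lborel (\<lambda>q. unit_ball_ind q * cv j \<epsilon> w (y + \<delta> *\<^sub>R q))"
    using fub(1,2) unfolding f1 f2 by auto
  define g where "g = (\<lambda>z p. J (z - y) * (indicator (ball z \<delta>) p * w p))"
  have gm: "case_prod g \<in> borel_measurable (lborel \<Otimes>\<^sub>M lborel)"
  proof -
    have "g = (\<lambda>z p. J (z - y) * ((if dist z p < \<delta> then 1 else 0) * w p))"
      by (auto simp: g_def indicator_def fun_eq_iff)
    thus ?thesis by simp
  qed
  have iJ: "integrable lborel (\<lambda>z. J (z - y))" unfolding J_def by (rule sck_integral(2)[OF j \<epsilon>])
  have gdom: "\<bar>g z p\<bar> \<le> J (z - y) * \<bar>w p\<bar>" for z p
    using Jnn[of "z - y"] by (auto simp: g_def abs_mult indicator_def)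
  note gub = fubini_dominated[OF lborel_sigma_finite lborel_sigma_finite gm iJ integrable_abs[OF wi] gdom]
  have g1: "(LBINT p. g z p) = \<delta> ^ ?m * (J (z - y) * E z)" for z
  proof -
    have m: "(\<lambda>p. indicator (ball z \<delta>) p * w p) \<in> borel_measurable borel" by measurable
    have "(LBINT p. indicator (ball z \<delta>) p * w p) = \<delta> ^ ?m * (LBINT q. indicator (ball z \<delta>) (z + \<delta> *\<^sub>R q) * w (z + \<delta> *\<^sub>R q))"
      using lborel_integral_affine[OF m, of \<delta> z] \<delta> by simp
    also have "(\<lambda>q. indicator (ball z \<delta>) (z + \<delta> *\<^sub>R q) * w (z + \<delta> *\<^sub>R q)) = (\<lambda>q. unit_ball_ind q * w (z + \<delta> *\<^sub>R q))"
      using \<delta> by (auto simp: indicator_def dist_norm)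
    finally show ?thesis by (simp add: g_def E_def)
  qed
  have g2: "(LBINT z. g z p) = \<delta> ^ ?m * (w p * \<Lambda> p)" for p
  proof -
    have m: "(\<lambda>z. J (z - y) * indicator (ball p \<delta>) z) \<in> borel_measurable borel" by measurable
    \<comment> \<open>The substitution uses \<open>- \<delta>\<close> so that the argument of
      \<open>J\<close> becomes \<open>p - (y + \<delta> *\<^sub>R q)\<close>, as in
      \<open>\<Lambda>\<close>.\<close>
    have "(LBINT z. J (z - y) * indicator (ball p \<delta>) z) = \<delta> ^ ?m * (LBINT q. J (p + (- \<delta>) *\<^sub>R q - y) * indicator (ball p \<delta>) (p + (- \<delta>) *\<^sub>R q))"
      using lborel_integral_affine[OF m, of "- \<delta>" p] \<delta> by simp
    also have "(\<lambda>q. J (p + (- \<delta>) *\<^sub>R q - y) * indicator (ball p \<delta>) (p + (- \<delta>) *\<^sub>R q)) = (\<lambda>q. unit_ball_ind q * J (p - (y + \<delta> *\<^sub>R q)))"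
      using \<delta> by (auto simp: indicator_def dist_norm algebra_simps)
    finally have *: "(LBINT z. J (z - y) * indicator (ball p \<delta>) z) = \<delta> ^ ?m * \<Lambda> p" by (simp add: \<Lambda>_def)
    have "g z p = w p * (J (z - y) * indicator (ball p \<delta>) z)" for z
      by (auto simp: g_def indicator_def dist_commute)
    thus ?thesis using * by simp
  qed
  have right: "(LBINT z. J (z - y) * E z) = (LBINT z. w z * \<Lambda> z)"
    and righti: "integrable lborel (\<lambda>z. J (z - y) * E z)"
    using gub(1,2) \<delta> unfolding g1 g2 by auto
  have cvi: "integrable lborel (\<lambda>z. w z * J (z - y))"
  proof (rule Bochner_Integration.integrable_bound)
    show "integrable lborel (\<lambda>z. (A / \<epsilon> ^ ?m) * \<bar>w z\<bar>)" using wi by (intro integrable_mult_right integrable_abs)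
    show "AE z in lborel. norm (w z * J (z - y)) \<le> norm ((A / \<epsilon> ^ ?m) * \<bar>w z\<bar>)"
    proof (rule AE_I2)
      fix z show "norm (w z * J (z - y)) \<le> norm ((A / \<epsilon> ^ ?m) * \<bar>w z\<bar>)"
        using mult_right_mono[OF Jb[of "z - y"] abs_ge_zero[of "w z"]] A(2) \<epsilon> by (simp add: abs_mult mult_ac)
    qed
  qed measurable
  have "vol * cv j \<epsilon> w y = (LBINT z. vol * (w z * J (z - y)))" by (simp add: cv_def J_def)
  also have "\<dots> \<le> (LBINT z. J (z - y) * E z)"
  proof (rule integral_mono_AE[OF integrable_mult_right[OF cvi] righti])
    show "AE z in lborel. vol * (w z * J (z - y)) \<le> J (z - y) * E z"
      using AE
    proof eventually_elim
      case (elim z)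
      show ?case
      proof (cases "norm (z - y) < \<epsilon>")
        case True
        have zx: "norm (z - x) \<le> norm (z - y) + norm (y - x)" using norm_triangle_ineq[of "z - y" "y - x"] by simp
        have sub: "cball z \<delta> \<subseteq> cball x R"
        proof
          fix p assume "p \<in> cball z \<delta>"
          hence "norm (p - z) \<le> \<delta>" by (simp add: dist_norm norm_minus_commute)
          moreover have "norm (p - x) \<le> norm (p - z) + norm (z - x)" using norm_triangle_ineq[of "p - z" "z - x"] by simp
          ultimately have "norm (p - x) \<le> R" using zx True y by linarith
          thus "p \<in> cball x R" by (simp add: dist_norm norm_minus_commute)
        qed
        have zc: "z \<in> cball x R" using \<delta> by (intro subsetD[OF sub]) auto
        hence "\<bar>u z\<bar> \<noteq> \<infinity>" using elim R by auto
        hence fin: "u z \<noteq> - \<infinity>" by auto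
        have zD: "cball z \<delta> \<subseteq> D" using sub R by blast
        have eq: "unit_ball_ind q * (rl u (z + \<delta> *\<^sub>R q) - rl u z) = unit_ball_ind q * w (z + \<delta> *\<^sub>R q) - unit_ball_ind q * rl u z" for q
        proof (cases "q \<in> ball 0 1")
          case True
          hence "z + \<delta> *\<^sub>R q \<in> cball z \<delta>" using \<delta> by (auto simp: dist_norm)
          hence "z + \<delta> *\<^sub>R q \<in> cball x R" using sub by blast
          hence "w (z + \<delta> *\<^sub>R q) = rl u (z + \<delta> *\<^sub>R q)" by (simp add: w_def)
          thus ?thesis by (simp only: right_diff_distrib)
        qed simp
        note bm = sbh_ball_mean_unit[OF u D \<delta> zD fin]
        have iu: "integrable lborel (\<lambda>q::'a. unit_ball_ind q * rl u z)"
          by (intro integrable_mult_left unit_ball_ind_integrable)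
        have iw: "integrable lborel (\<lambda>q. unit_ball_ind q * w (z + \<delta> *\<^sub>R q))"
          using Bochner_Integration.integrable_add[OF bm(1) iu] unfolding eq by simp
        have "0 \<le> (LBINT q. unit_ball_ind q * w (z + \<delta> *\<^sub>R q) - unit_ball_ind q * rl u z)"
          using bm(2)[of 1] unfolding eq by simp
        also have "\<dots> = E z - vol * rl u z"
          using iw iu by (subst Bochner_Integration.integral_diff) (auto simp: E_def vol_def)
        finally have "vol * w z \<le> E z" using zc by (simp add: w_def)
        hence "J (z - y) * (vol * w z) \<le> J (z - y) * E z" using Jnn by (rule mult_left_mono)
        thus ?thesis by (simp add: mult_ac)
      next
        case False
        thus ?thesis using J0[of "z - y"] by simp
      qed
    qed
  qed
  also have "\<dots> = (LBINT q. unit_ball_ind q * cv j \<epsilon> w (y + \<delta> *\<^sub>R q))" using left right by simp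
  finally have *: "vol * cv j \<epsilon> w y \<le> (LBINT q. unit_ball_ind q * cv j \<epsilon> w (y + \<delta> *\<^sub>R q))" .
  have iu: "integrable lborel (\<lambda>q::'a. unit_ball_ind q * cv j \<epsilon> w y)"
    by (intro integrable_mult_left unit_ball_ind_integrable)
  show ?thesis
    unfolding right_diff_distrib using lefti iu * 
    by (subst Bochner_Integration.integral_diff) (auto simp: vol_def)
qed

lemma radial_average_mono_C1:
  fixes v :: "'a::euclidean_space \<Rightarrow> real"
  assumes a: "kern a" and rad: "\<And>x y. norm x = norm y \<Longrightarrow> a x = a y"
    and dv: "\<And>y. (v has_derivative v' y) (at y)" and v'B: "\<And>y i. i \<in> Basis \<Longrightarrow> \<bar>v' y i\<bar> \<le> B"
    and v'm: "\<And>i. i \<in> Basis \<Longrightarrow> (\<lambda>y. v' y i) \<in> borel_measurable borel"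
    and S: "S > 0" and sub: "\<And>y \<delta>. norm (y - x) \<le> r \<Longrightarrow> 0 < \<delta> \<Longrightarrow> \<delta> < S \<Longrightarrow>
      0 \<le> (LBINT z. unit_ball_ind z * (v (y + \<delta> *\<^sub>R z) - v y))"
    and \<rho>: "0 \<le> \<rho>1" "\<rho>1 \<le> \<rho>2" "\<rho>2 \<le> r"
  shows "(LBINT z. a z * v (x + \<rho>1 *\<^sub>R z)) \<le> (LBINT z. a z * v (x + \<rho>2 *\<^sub>R z))"
proof -
  define L where "L = real DIM('a) * B"
  have Lv: "\<bar>v (y + h) - v y\<bar> \<le> L * norm h" and Lv': "\<bar>v' y h\<bar> \<le> L * norm h" for y h
    using derivative_lipschitz[OF dv v'B] by (auto simp: L_def)
  obtain i0 :: 'a where i0: "i0 \<in> Basis" using nonempty_Basis by blast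
  have B0: "B \<ge> 0" using v'B[OF i0, of 0] by linarith
  hence L0: "L \<ge> 0" by (simp add: L_def)
  have "continuous_on UNIV v" using dv by (intro has_derivative_continuous_on) auto
  hence [measurable]: "v \<in> borel_measurable borel" by (rule borel_measurable_continuous_onI)
  note [measurable] = kernD(6)[OF a]
  note ai = kern_integrable[OF a]
  have v'sum: "v' y z = (\<Sum>i\<in>Basis. (z \<bullet> i) * v' y i)" for y z
    by (rule derivative_eq_sum_Basis[OF has_derivative_linear[OF dv]])
  have v'm2: "(\<lambda>z. v' (x + \<rho> *\<^sub>R z) z) \<in> borel_measurable borel" for \<rho>
  proof -
    have "(\<lambda>z. v' (x + \<rho> *\<^sub>R z) i) \<in> borel_measurable borel" if "i \<in> Basis" for i
      by (rule measurable_compose[OF _ v'm[OF that]]) measurable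
    hence "(\<lambda>z. \<Sum>i\<in>Basis. (z \<bullet> i) * v' (x + \<rho> *\<^sub>R z) i) \<in> borel_measurable borel" by measurable
    moreover have "(\<lambda>z. v' (x + \<rho> *\<^sub>R z) z) = (\<lambda>z. \<Sum>i\<in>Basis. (z \<bullet> i) * v' (x + \<rho> *\<^sub>R z) i)"
      by (rule ext, rule v'sum)
    ultimately show ?thesis by metis
  qed
  define \<psi> where "\<psi> = (\<lambda>\<rho>. \<integral>z. a z * v (x + \<rho> *\<^sub>R z) \<partial>lborel)"
  define \<psi>' where "\<psi>' = (\<lambda>\<rho>. \<integral>z. a z * v' (x + \<rho> *\<^sub>R z) z \<partial>lborel)"
  have avi: "integrable lborel (\<lambda>z. a z * v (x + \<rho> *\<^sub>R z))" for \<rho>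
  proof (rule Bochner_Integration.integrable_bound)
    show "integrable lborel (\<lambda>z. a z * (\<bar>v x\<bar> + L * \<bar>\<rho>\<bar>))" using ai by (intro integrable_mult_left)
    show "AE z in lborel. norm (a z * v (x + \<rho> *\<^sub>R z)) \<le> norm (a z * (\<bar>v x\<bar> + L * \<bar>\<rho>\<bar>))"
    proof (rule AE_I2)
      fix z
      show "norm (a z * v (x + \<rho> *\<^sub>R z)) \<le> norm (a z * (\<bar>v x\<bar> + L * \<bar>\<rho>\<bar>))"
      proof (cases "norm z < 1")
        case True
        have "\<bar>v (x + \<rho> *\<^sub>R z)\<bar> \<le> \<bar>v x\<bar> + L * norm (\<rho> *\<^sub>R z)" using Lv[of x "\<rho> *\<^sub>R z"] by linarith
        also have "\<dots> \<le> \<bar>v x\<bar> + L * \<bar>\<rho>\<bar>" using True L0 by (auto intro!: mult_left_mono mult_left_le)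
        finally show ?thesis using kernD(2)[OF a, of z] L0 by (auto simp: abs_mult intro!: mult_left_mono)
      next
        case False thus ?thesis using kernD(3)[OF a, of z] by simp
      qed
    qed
  qed measurable
  have der: "DERIV \<psi> \<rho> :> \<psi>' \<rho>" for \<rho>
    unfolding DERIV_def tendsto_at_iff_sequentially comp_def
  proof safe
    fix X :: "nat \<Rightarrow> real" assume X: "\<forall>i. X i \<in> UNIV - {0}" "X \<longlonglongrightarrow> 0"
    have eq: "(\<psi> (\<rho> + X n) - \<psi> \<rho>) / X n = (LBINT z. a z * ((v (x + (\<rho> + X n) *\<^sub>R z) - v (x + \<rho> *\<^sub>R z)) / X n))" for n
    proof -
      have "(LBINT z. a z * ((v (x + (\<rho> + X n) *\<^sub>R z) - v (x + \<rho> *\<^sub>R z)) / X n))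
         = (LBINT z. (a z * v (x + (\<rho> + X n) *\<^sub>R z) - a z * v (x + \<rho> *\<^sub>R z)) / X n)"
        by (simp add: right_diff_distrib)
      also have "\<dots> = (\<psi> (\<rho> + X n) - \<psi> \<rho>) / X n"
        unfolding \<psi>_def using avi by simp
      finally show ?thesis by (rule sym)
    qed
    show "(\<lambda>n. (\<psi> (\<rho> + X n) - \<psi> \<rho>) / X n) \<longlonglongrightarrow> \<psi>' \<rho>"
      unfolding eq \<psi>'_def
    proof (rule integral_dominated_convergence[where w="\<lambda>z. a z * L"])
      show "integrable lborel (\<lambda>z. a z * L)" using ai by (intro integrable_mult_left)
      show "(\<lambda>z. a z * v' (x + \<rho> *\<^sub>R z) z) \<in> borel_measurable lborel" using v'm2 by simp
      show "AE z in lborel. (\<lambda>n. a z * ((v (x + (\<rho> + X n) *\<^sub>R z) - v (x + \<rho> *\<^sub>R z)) / X n)) \<longlonglongrightarrow> a z * v' (x + \<rho> *\<^sub>R z) z"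
      proof (rule AE_I2, rule tendsto_mult[OF tendsto_const])
        fix z
        have "((\<lambda>t. x + t *\<^sub>R z) has_derivative (\<lambda>t. t *\<^sub>R z)) (at \<rho>)" by (auto intro!: derivative_eq_intros)
        hence "((\<lambda>t. v (x + t *\<^sub>R z)) has_derivative (\<lambda>t. v' (x + \<rho> *\<^sub>R z) (t *\<^sub>R z))) (at \<rho>)"
          by (rule has_derivative_compose[OF _ dv])
        moreover have "v' (x + \<rho> *\<^sub>R z) (t *\<^sub>R z) = t * v' (x + \<rho> *\<^sub>R z) z" for t
          using has_derivative_linear[OF dv] by (simp add: linear_cmul)
        ultimately have "DERIV (\<lambda>t. v (x + t *\<^sub>R z)) \<rho> :> v' (x + \<rho> *\<^sub>R z) z"
          by (simp add: has_field_derivative_def mult_commute_abs)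
        thus "(\<lambda>n. (v (x + (\<rho> + X n) *\<^sub>R z) - v (x + \<rho> *\<^sub>R z)) / X n) \<longlonglongrightarrow> v' (x + \<rho> *\<^sub>R z) z"
          using X unfolding DERIV_def tendsto_at_iff_sequentially comp_def by blast
      qed
      show "AE z in lborel. norm (a z * ((v (x + (\<rho> + X n) *\<^sub>R z) - v (x + \<rho> *\<^sub>R z)) / X n)) \<le> a z * L" for n
      proof (rule AE_I2)
        fix z
        have Xn: "\<bar>X n\<bar> > 0" using X by auto
        show "norm (a z * ((v (x + (\<rho> + X n) *\<^sub>R z) - v (x + \<rho> *\<^sub>R z)) / X n)) \<le> a z * L"
        proof (cases "norm z < 1")
          case True
          have "\<bar>v (x + (\<rho> + X n) *\<^sub>R z) - v (x + \<rho> *\<^sub>R z)\<bar> \<le> L * norm (X n *\<^sub>R z)"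
            using Lv[of "x + \<rho> *\<^sub>R z" "X n *\<^sub>R z"] by (simp add: algebra_simps)
          also have "\<dots> \<le> L * \<bar>X n\<bar>" using True L0 by (auto intro!: mult_left_mono mult_left_le)
          finally have "\<bar>v (x + (\<rho> + X n) *\<^sub>R z) - v (x + \<rho> *\<^sub>R z)\<bar> / \<bar>X n\<bar> \<le> L"
            using Xn by (simp add: pos_divide_le_eq)
          hence "a z * (\<bar>v (x + (\<rho> + X n) *\<^sub>R z) - v (x + \<rho> *\<^sub>R z)\<bar> / \<bar>X n\<bar>) \<le> a z * L"
            using kernD(2)[OF a] by (rule mult_left_mono)
          thus ?thesis using kernD(2)[OF a, of z] by (simp add: abs_mult)
        next
          case False thus ?thesis using kernD(3)[OF a, of z] by simp
        qed
      qed
    qed measurable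
  qed
  obtain b where b: "\<And>x. 0 \<le> b x" "\<And>x. norm x \<ge> 1 \<Longrightarrow> b x = 0"
    and db: "\<And>x. (b has_derivative (\<lambda>h. - a x * (x \<bullet> h))) (at x)"
    using radial_potential[OF a rad] by blast
  obtain A where A: "\<And>x. a x \<le> A" "A > 0" using kern_bound[OF a] by metis
  have nonneg: "0 \<le> \<psi>' \<rho>" if r0: "0 < \<rho>" "\<rho> \<le> r" for \<rho>
  proof -
    \<comment> \<open>Rescaled to the unit ball, \<open>V\<close> has partial derivatives bounded by
      \<open>\<rho> * B\<close>, the potential by \<open>A\<close>, and steps below
      \<open>S / \<rho>\<close> are admissible.\<close>
    define V where "V = (\<lambda>z. v (x + \<rho> *\<^sub>R z))"
    define V' where "V' = (\<lambda>z h. v' (x + \<rho> *\<^sub>R z) (\<rho> *\<^sub>R h))"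
    have lin: "v' y (t *\<^sub>R z) = t * v' y z" for t y z
      using has_derivative_linear[OF dv] by (simp add: linear_cmul)
    have "(LBINT z. (\<Sum>i\<in>Basis. V' z i * (- a z * (z \<bullet> i)))) \<le> 0"
    proof (rule dirichlet_nonpos[where V=V and b=b and B="max (\<rho> * B) A" and ?\<delta>0.0="S / \<rho>"])
      show "(V has_derivative V' z) (at z)" for z
      proof -
        have "((\<lambda>z. x + \<rho> *\<^sub>R z) has_derivative (\<lambda>h. \<rho> *\<^sub>R h)) (at z)" by (auto intro!: derivative_eq_intros)
        thus ?thesis unfolding V_def V'_def by (rule has_derivative_compose[OF _ dv])
      qed
      show "\<bar>V' z i\<bar> \<le> max (\<rho> * B) A" if "i \<in> Basis" for z i
      proof -
        have "\<rho> * \<bar>v' (x + \<rho> *\<^sub>R z) i\<bar> \<le> \<rho> * B" using v'B[OF that] r0(1) by (intro mult_left_mono) auto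
        thus ?thesis using r0(1) by (simp add: V'_def lin abs_mult le_max_iff_disj)
      qed
      show "(\<lambda>z. V' z i) \<in> borel_measurable borel" if "i \<in> Basis" for i
      proof -
        have "(\<lambda>z. v' (x + \<rho> *\<^sub>R z) i) \<in> borel_measurable borel"
          by (rule measurable_compose[OF _ v'm[OF that]]) measurable
        thus ?thesis unfolding V'_def lin by simp
      qed
      show "(b has_derivative (\<lambda>h. - a z * (z \<bullet> h))) (at z)" for z by (rule db)
      show "\<bar>- a z * (z \<bullet> i)\<bar> \<le> max (\<rho> * B) A" if "i \<in> Basis" for z i
      proof (cases "norm z < 1")
        case True
        have "\<bar>z \<bullet> i\<bar> \<le> 1" using Basis_le_norm[OF that, of z] True by linarith
        hence "a z * \<bar>z \<bullet> i\<bar> \<le> A * 1" using A kernD(2)[OF a] by (intro mult_mono) auto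
        thus ?thesis using kernD(2)[OF a, of z] by (simp add: abs_mult le_max_iff_disj)
      next
        case False
        hence "a z = 0" using kernD(3)[OF a, of z] by simp
        thus ?thesis using A(2) by (simp add: le_max_iff_disj)
      qed
      show "0 \<le> (LBINT z. unit_ball_ind z * (V (y + \<delta> *\<^sub>R z) - V y))"
        if "norm y \<le> 1" "0 < \<delta>" "\<delta> < S / \<rho>" for y \<delta>
      proof -
        have "\<rho> * norm y \<le> \<rho> * 1" using that(1) r0 by (intro mult_left_mono) auto
        hence "\<rho> * norm y \<le> r" using r0(2) by linarith
        hence "norm ((x + \<rho> *\<^sub>R y) - x) \<le> r" using r0(1) by simp
        moreover have "0 < \<rho> * \<delta>" "\<rho> * \<delta> < S" using that r0 by (auto simp: pos_less_divide_eq mult.commute)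
        ultimately have "0 \<le> (LBINT z. unit_ball_ind z * (v ((x + \<rho> *\<^sub>R y) + (\<rho> * \<delta>) *\<^sub>R z) - v (x + \<rho> *\<^sub>R y)))"
          by (rule sub)
        thus ?thesis by (simp add: V_def algebra_simps)
      qed
    qed (use S r0 b in auto)
    moreover have "(\<Sum>i\<in>Basis. V' z i * (- a z * (z \<bullet> i))) = - (\<rho> * (a z * v' (x + \<rho> *\<^sub>R z) z))" for z
    proof -
      have "(\<Sum>i\<in>Basis. V' z i * (- a z * (z \<bullet> i))) = - (\<rho> * (a z * (\<Sum>i\<in>Basis. (z \<bullet> i) * v' (x + \<rho> *\<^sub>R z) i)))"
        by (simp add: V'_def lin sum_distrib_left sum_negf[symmetric] mult_ac)
      thus ?thesis using v'sum[of "x + \<rho> *\<^sub>R z" z] by simp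
    qed
    ultimately have "0 \<le> \<rho> * \<psi>' \<rho>" by (simp add: \<psi>'_def)
    thus ?thesis using r0(1) by (simp add: zero_le_mult_iff)
  qed
  have "\<psi> \<rho>1 \<le> \<psi> \<rho>2"
  proof (rule DERIV_nonneg_imp_increasing_open[OF \<rho>(2)])
    show "\<exists>y. DERIV \<psi> t :> y \<and> 0 \<le> y" if "\<rho>1 < t" "t < \<rho>2" for t
      using der nonneg[of t] that \<rho> by (intro exI[of _ "\<psi>' t"]) auto
    show "continuous_on {\<rho>1..\<rho>2} \<psi>" using der by (intro DERIV_continuous_on) (auto intro: DERIV_subset)
  qed
  thus ?thesis by (simp add: \<psi>_def)
qed

text \<open>The approximants \<open>v n\<close>, regularised with a decreasing kernel, do two jobs:
  their averages are monotone in the radius, and at the centre they lie above \<open>u\<close>.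
  Their averages converge because the regularisation can be moved onto the continuous kernel of
  \<open>a\<close>.\<close>

lemma sbh_cv_limit_aux:
  fixes u :: "'a::euclidean_space \<Rightarrow> ereal"
  assumes u: "u \<in> sbh D" and D: "open D" and L: "locint D (rl u)" and AE: "AE z\<in>D in lborel. \<bar>u z\<bar> \<noteq> \<infinity>"
    and a: "kern a" and rad: "\<forall>x y. norm x = norm y \<longrightarrow> a x = a y"
    and \<rho>: "0 \<le> \<rho>1" "\<rho>1 \<le> \<rho>2" "0 < \<rho>2" "cball x \<rho>2 \<subseteq> D"
  shows "\<exists>v. (\<forall>n. (LBINT z. a z * v n (x + \<rho>1 *\<^sub>R z)) \<le> cv a \<rho>2 (v n) x) \<and>
    (\<forall>\<rho>. 0 < \<rho> \<longrightarrow> \<rho> \<le> \<rho>2 \<longrightarrow> (\<lambda>n. cv a \<rho> (v n) x) \<longlonglongrightarrow> cv a \<rho> (rl u) x) \<and>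
    (\<forall>n. v n \<in> borel_measurable borel) \<and> (\<forall>n::nat. u x \<noteq> - \<infinity> \<longrightarrow> rl u x \<le> v n x)"
proof -
  obtain e where e: "e > 0" "cball x (\<rho>2 + e) \<subseteq> D" using cball_enlarge[OF D \<rho>(4)] \<rho>(3) by (metis less_imp_le)
  define R where "R = \<rho>2 + e"
  have R: "R > 0" "cball x R \<subseteq> D" "\<rho>2 < R" using e \<rho> by (auto simp: R_def)
  obtain j :: "'a \<Rightarrow> real" where j: "kern j" "Ck_on 1 UNIV j" and dec: "\<And>x y. norm x \<le> norm y \<Longrightarrow> j y \<le> j x"
    using decreasing_C1_kernel by blast
  define w where "w = (\<lambda>z. indicator (cball x R) z * rl u z)"
  have wi: "integrable lborel w" using L R(2) unfolding w_def locint_def by auto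
  have wm[measurable]: "w \<in> borel_measurable borel" using wi by auto
  have w0: "\<forall>z. z \<notin> cball x R \<longrightarrow> w z = 0" by (simp add: w_def)
  \<comment> \<open>The margin \<open>e\<close> is shared: less than half of it goes to the
    regularisation radius, less than the other half to the step of the sub-mean value
    property.\<close>
  define \<epsilon> where "\<epsilon> = (\<lambda>n. min (e / 2) 1 / (2 + real n))"
  have \<epsilon>: "0 < \<epsilon> n" "\<epsilon> n \<le> 1" "\<epsilon> n < e / 2" for n
  proof -
    show "0 < \<epsilon> n" using e by (simp add: \<epsilon>_def)
    have "\<epsilon> n \<le> min (e / 2) 1 / 2" unfolding \<epsilon>_def using e by (intro divide_left_mono) auto
    thus "\<epsilon> n \<le> 1" "\<epsilon> n < e / 2" using e by auto
  qed
  have \<epsilon>lim: "\<epsilon> \<longlonglongrightarrow> 0"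
    unfolding \<epsilon>_def
    by (rule tendsto_divide_0[OF tendsto_const filterlim_at_top_imp_at_infinity[OF
          filterlim_tendsto_add_at_top[OF tendsto_const filterlim_real_sequentially]]])
  define v where "v = (\<lambda>n. cv j (\<epsilon> n) w)"
  have vm: "v n \<in> borel_measurable borel" for n
  proof -
    obtain v' where "\<forall>y. (cv j (\<epsilon> n) w has_derivative v' y) (at y)"
      using cv_C1[OF wi w0 j \<epsilon>(1,2)[of n]] by (elim exE conjE) (rule that)
    hence "(v n has_derivative v' y) (at y)" for y by (simp add: v_def)
    hence "continuous_on UNIV (v n)" by (intro has_derivative_continuous_on) auto
    thus ?thesis by (rule borel_measurable_continuous_onI)
  qed
  show ?thesis
  proof (intro exI[of _ v] conjI allI impI)
    show "v n \<in> borel_measurable borel" for n by (rule vm)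
    show "(LBINT z. a z * v n (x + \<rho>1 *\<^sub>R z)) \<le> cv a \<rho>2 (v n) x" for n
    proof -
      have vn: "v n = cv j (\<epsilon> n) w" by (simp add: v_def)
      obtain v' B where v': "\<forall>y. (cv j (\<epsilon> n) w has_derivative v' y) (at y)" "\<forall>y. \<forall>i\<in>Basis. \<bar>v' y i\<bar> \<le> B"
        "\<forall>i\<in>Basis. (\<lambda>y. v' y i) \<in> borel_measurable borel"
        using cv_C1[OF wi w0 j \<epsilon>(1,2)[of n]] by (elim exE conjE) (rule that)
      have "(LBINT z. a z * v n (x + \<rho>1 *\<^sub>R z)) \<le> (LBINT z. a z * v n (x + \<rho>2 *\<^sub>R z))"
      proof (rule radial_average_mono_C1[OF a])
        show "(v n has_derivative v' y) (at y)" for y unfolding vn using v'(1) by blast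
        show "\<bar>v' y i\<bar> \<le> B" if "i \<in> Basis" for y i using v'(2) that by blast
        show "(\<lambda>y. v' y i) \<in> borel_measurable borel" if "i \<in> Basis" for i using v'(3) that by blast
        show "0 \<le> (LBINT z. unit_ball_ind z * (v n (y + \<delta> *\<^sub>R z) - v n y))"
          if "norm (y - x) \<le> \<rho>2" "0 < \<delta>" "\<delta> < e / 2" for y \<delta>
          unfolding v_def w_def using that \<epsilon>[of n] 
          by (intro cv_submean[OF u D L AE R(2) j(1)]) (auto simp: R_def)
        show "a p = a q" if "norm p = norm q" for p q using rad that by blast
      qed (use e \<rho> in auto)
      thus ?thesis using \<rho>(3) by (simp add: cv_eq[OF a _ vm])
    qed
    show "rl u x \<le> v n x" if "u x \<noteq> - \<infinity>" for n
    proof -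
      have "cball x (\<epsilon> n) \<subseteq> cball x R" using \<epsilon>(3)[of n] e \<rho> by (intro subset_cball) (simp add: R_def)
      hence "cball x (\<epsilon> n) \<subseteq> D" using R(2) by blast
      hence "rl u x \<le> cv j (\<epsilon> n) (rl u) x"
        using that by (intro sbh_le_cv_decreasing[OF u D \<epsilon>(1) _ _ j(1) dec])
      also have "\<dots> = v n x"
        unfolding v_def cv_def
      proof (intro Bochner_Integration.integral_cong refl)
        fix y
        show "rl u y * sck j (\<epsilon> n) (y - x) = w y * sck j (\<epsilon> n) (y - x)"
        proof (cases "y \<in> cball x R")
          case False
          hence "\<epsilon> n \<le> norm (y - x)" using \<epsilon>(3)[of n] e \<rho> by (auto simp: R_def dist_norm norm_minus_commute)
          thus ?thesis by (simp add: sck_zero[OF j(1) \<epsilon>(1)])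
        qed (simp add: w_def)
      qed
      finally show ?thesis .
    qed
    show "(\<lambda>n. cv a \<rho> (v n) x) \<longlonglongrightarrow> cv a \<rho> (rl u) x" if r: "0 < \<rho>" "\<rho> \<le> \<rho>2" for \<rho>
    proof -
      define \<phi> where "\<phi> = (\<lambda>p. sck a \<rho> (p - x))"
      have [measurable]: "\<phi> \<in> borel_measurable borel" unfolding \<phi>_def
        by (rule measurable_compose[OF _ sck_measurable[OF a]]) measurable
      obtain A where A: "\<And>x. a x \<le> A" "A > 0" using kern_bound[OF a] by metis
      have \<phi>b: "\<bar>\<phi> p\<bar> \<le> A / \<rho> ^ DIM('a)" for p unfolding \<phi>_def by (rule sck_bound[OF a r(1) A(1)])
      have \<phi>0: "\<phi> p = 0" if "p \<notin> cball x \<rho>" for p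
        unfolding \<phi>_def using that by (intro sck_zero[OF a r(1)]) (auto simp: dist_norm norm_minus_commute)
      have adj: "cv a \<rho> (v n) x = (LBINT y. w y * cv j (\<epsilon> n) \<phi> y)"
        and ai: "integrable lborel (\<lambda>y. w y * cv j (\<epsilon> n) \<phi> y)" for n
      proof -
        have "cv a \<rho> (v n) x = (LBINT p. \<phi> p * v n p)" by (simp add: cv_def \<phi>_def mult.commute)
        thus "cv a \<rho> (v n) x = (LBINT y. w y * cv j (\<epsilon> n) \<phi> y)"
          unfolding v_def using cv_adjoint(1)[OF wi _ \<phi>b \<phi>0 j(1) \<epsilon>(1)] by simp
        show "integrable lborel (\<lambda>y. w y * cv j (\<epsilon> n) \<phi> y)"
          by (rule cv_adjoint(3)[OF wi _ \<phi>b \<phi>0 j(1) \<epsilon>(1)]) measurable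
      qed
      have lim: "cv a \<rho> (rl u) x = (LBINT y. w y * \<phi> y)"
        unfolding cv_def
      proof (intro Bochner_Integration.integral_cong refl)
        fix y
        show "rl u y * sck a \<rho> (y - x) = w y * \<phi> y"
          using \<phi>0[of y] r R(3) by (cases "y \<in> cball x R") (auto simp: w_def \<phi>_def)
      qed
      have i\<phi>: "integrable lborel (\<lambda>y. w y * \<phi> y)"
      proof (rule Bochner_Integration.integrable_bound)
        show "integrable lborel (\<lambda>y. (A / \<rho> ^ DIM('a)) * \<bar>w y\<bar>)" using wi by (intro integrable_mult_right integrable_abs)
        show "AE y in lborel. norm (w y * \<phi> y) \<le> norm ((A / \<rho> ^ DIM('a)) * \<bar>w y\<bar>)"
        proof (rule AE_I2)
          fix y show "norm (w y * \<phi> y) \<le> norm ((A / \<rho> ^ DIM('a)) * \<bar>w y\<bar>)"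
            using mult_right_mono[OF \<phi>b[of y] abs_ge_zero[of "w y"]] A(2) r(1) by (simp add: abs_mult mult_ac)
        qed
      qed measurable
      define W where "W = (LBINT y. \<bar>w y\<bar>)"
      have W0: "0 \<le> W" unfolding W_def by (intro integral_nonneg_AE) auto
      show ?thesis
      proof (rule LIMSEQ_I)
        fix \<eta> :: real assume \<eta>: "0 < \<eta>"
        define \<omega> where "\<omega> = \<eta> / (W + 1)"
        have \<omega>: "\<omega> > 0" using \<eta> W0 by (simp add: \<omega>_def)
        obtain d where d: "d > 0" "\<And>p q. norm (p - q) < d \<Longrightarrow> \<bar>sck a \<rho> p - sck a \<rho> q\<bar> \<le> \<omega>"
          using sck_uniformly_continuous[OF a r(1) \<omega>] by blast
        obtain N where N: "\<And>n. n \<ge> N \<Longrightarrow> \<epsilon> n < d"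
          using order_tendstoD(2)[OF \<epsilon>lim d(1)] unfolding eventually_sequentially by blast
        have "norm (cv a \<rho> (v n) x - cv a \<rho> (rl u) x) < \<eta>" if n: "n \<ge> N" for n
        proof -
          have close: "\<bar>cv j (\<epsilon> n) \<phi> y - \<phi> y\<bar> \<le> \<omega>" for y
          proof (rule cv_approx[OF j(1) \<epsilon>(1)])
            show "\<bar>\<phi> z - \<phi> y\<bar> \<le> \<omega>" if "norm (z - y) < \<epsilon> n" for z
              unfolding \<phi>_def using that N[OF n] by (intro d(2)) simp
          qed measurable
          have "cv a \<rho> (v n) x - cv a \<rho> (rl u) x = (LBINT y. w y * (cv j (\<epsilon> n) \<phi> y - \<phi> y))"
            unfolding adj lim right_diff_distrib by (intro Bochner_Integration.integral_diff[symmetric] ai i\<phi>)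
          also have "\<bar>\<dots>\<bar> \<le> (LBINT y. \<bar>w y * (cv j (\<epsilon> n) \<phi> y - \<phi> y)\<bar>)" by (rule integral_abs_bound)
          also have "\<dots> \<le> (LBINT y. \<omega> * \<bar>w y\<bar>)"
          proof (rule integral_mono)
            show "integrable lborel (\<lambda>y. \<bar>w y * (cv j (\<epsilon> n) \<phi> y - \<phi> y)\<bar>)"
              unfolding right_diff_distrib by (intro integrable_abs Bochner_Integration.integrable_diff ai i\<phi>)
            show "integrable lborel (\<lambda>y. \<omega> * \<bar>w y\<bar>)" using wi by (intro integrable_mult_right integrable_abs)
            show "\<bar>w y * (cv j (\<epsilon> n) \<phi> y - \<phi> y)\<bar> \<le> \<omega> * \<bar>w y\<bar>" for y
              using mult_left_mono[OF close[of y] abs_ge_zero[of "w y"]] by (simp add: abs_mult mult_ac)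
          qed
          also have "\<dots> = \<omega> * W" by (simp add: W_def)
          also have "\<dots> < \<eta>" using \<eta> W0 by (simp add: \<omega>_def pos_divide_less_eq)
          finally show ?thesis by simp
        qed
        thus "\<exists>N. \<forall>n\<ge>N. norm (cv a \<rho> (v n) x - cv a \<rho> (rl u) x) < \<eta>" by blast
      qed
    qed
  qed
qed

text \<open>Holds for the approximants and passes to the limit at both radii.\<close>

theorem sbh_radial_average_mono:
  fixes u :: "'a::euclidean_space \<Rightarrow> ereal"
  assumes u: "u \<in> sbh D" and D: "open D" and L: "locint D (rl u)" and AE: "AE z\<in>D in lborel. \<bar>u z\<bar> \<noteq> \<infinity>"
    and a: "kern a" and rad: "\<forall>x y. norm x = norm y \<longrightarrow> a x = a y"
    and \<rho>: "0 < \<rho>1" "\<rho>1 \<le> \<rho>2" "cball x \<rho>2 \<subseteq> D"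
  shows "cv a \<rho>1 (rl u) x \<le> cv a \<rho>2 (rl u) x"
proof -
  have r: "0 \<le> \<rho>1" "0 < \<rho>2" using \<rho> by auto
  obtain v where v: "\<forall>n. (LBINT z. a z * v n (x + \<rho>1 *\<^sub>R z)) \<le> cv a \<rho>2 (v n) x"
    "\<forall>\<rho>. 0 < \<rho> \<longrightarrow> \<rho> \<le> \<rho>2 \<longrightarrow> (\<lambda>n. cv a \<rho> (v n) x) \<longlonglongrightarrow> cv a \<rho> (rl u) x"
    "\<forall>n. v n \<in> borel_measurable borel"
    using sbh_cv_limit_aux[OF u D L AE a rad r(1) \<rho>(2) r(2) \<rho>(3)] by (elim exE conjE) (rule that)
  have "cv a \<rho>1 (v n) x \<le> cv a \<rho>2 (v n) x" for n
    using spec[OF v(1), of n] cv_eq[OF a \<rho>(1) spec[OF v(3)]] by simp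
  moreover have "(\<lambda>n. cv a \<rho>1 (v n) x) \<longlonglongrightarrow> cv a \<rho>1 (rl u) x" "(\<lambda>n. cv a \<rho>2 (v n) x) \<longlonglongrightarrow> cv a \<rho>2 (rl u) x"
    using v(2) \<rho> r by blast+
  ultimately show ?thesis using LIMSEQ_le by blast
qed

text \<open>The case of inner radius 0: the average of \<open>v n\<close> is then
  \<open>v n x\<close> itself, which dominates \<open>rl u x\<close>.\<close>

theorem sbh_le_radial_average:
  fixes u :: "'a::euclidean_space \<Rightarrow> ereal"
  assumes u: "u \<in> sbh D" and D: "open D" and L: "locint D (rl u)" and AE: "AE z\<in>D in lborel. \<bar>u z\<bar> \<noteq> \<infinity>"
    and a: "kern a" and rad: "\<forall>x y. norm x = norm y \<longrightarrow> a x = a y"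
    and \<rho>: "0 < \<rho>" "cball x \<rho> \<subseteq> D" and fin: "u x \<noteq> - \<infinity>"
  shows "rl u x \<le> cv a \<rho> (rl u) x"
proof -
  have r: "(0::real) \<le> 0" "0 \<le> \<rho>" using \<rho> by auto
  obtain v where v: "\<forall>n. (LBINT z. a z * v n (x + 0 *\<^sub>R z)) \<le> cv a \<rho> (v n) x"
    "\<forall>\<rho>'. 0 < \<rho>' \<longrightarrow> \<rho>' \<le> \<rho> \<longrightarrow> (\<lambda>n. cv a \<rho>' (v n) x) \<longlonglongrightarrow> cv a \<rho>' (rl u) x"
    "\<forall>n::nat. u x \<noteq> - \<infinity> \<longrightarrow> rl u x \<le> v n x"
    using sbh_cv_limit_aux[OF u D L AE a rad r \<rho>] by (elim exE conjE) (rule that)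
  have le: "rl u x \<le> cv a \<rho> (v n) x" for n
    using spec[OF v(1), of n] spec[OF v(3), of n] fin kernD(5)[OF a] by simp
  have "(\<lambda>n. cv a \<rho> (v n) x) \<longlonglongrightarrow> cv a \<rho> (rl u) x" using v(2) \<rho>(1) by blast
  thus ?thesis using le by (intro LIMSEQ_le_const) auto
qed

subsection \<open>Separation in the Hilbert space of square integrable functions\<close>

text \<open>The positive parts of a minimising sequence converge in mean, and their limit is the
  separating functional; only bounded functions and a finite measure are involved.\<close>

lemma convex_L2_separation:
  fixes VV :: "('b \<Rightarrow> real) set"
  assumes fin: "finite_measure M" and ne: "VV \<noteq> {}"
    and meas: "\<And>V. V \<in> VV \<Longrightarrow> V \<in> borel_measurable M"
    and bdd: "\<And>V. V \<in> VV \<Longrightarrow> \<exists>c. \<forall>x\<in>space M. \<bar>V x\<bar> \<le> c"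
    and conv: "\<And>V W t. V \<in> VV \<Longrightarrow> W \<in> VV \<Longrightarrow> 0 < t \<Longrightarrow> t < 1 \<Longrightarrow> (\<lambda>x. (1 - t) * V x + t * W x) \<in> VV"
    and d0: "d0 > 0" and low: "\<And>V. V \<in> VV \<Longrightarrow> d0 \<le> (\<integral>x. (max 0 (V x))\<^sup>2 \<partial>M)"
  shows "\<exists>t d. 0 < d \<and> integrable M t \<and> (\<forall>x. 0 \<le> t x) \<and> (\<forall>V\<in>VV. d \<le> (\<integral>x. t x * V x \<partial>M))"
proof -
  interpret finite_measure M by (rule fin)
  define bm where "bm = (\<lambda>f :: 'b \<Rightarrow> real. f \<in> borel_measurable M \<and> (\<exists>c. \<forall>x\<in>space M. \<bar>f x\<bar> \<le> c))"
  have bm_int: "integrable M f" if "bm f" for f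
  proof -
    obtain c where "\<forall>x\<in>space M. \<bar>f x\<bar> \<le> c" using \<open>bm f\<close> unfolding bm_def by blast
    thus ?thesis using \<open>bm f\<close> unfolding bm_def by (intro integrable_const_bound[of _ c]) auto
  qed
  have bm_add: "bm (\<lambda>x. f x + g x)" if fg: "bm f" "bm g" for f g
  proof -
    obtain c e where c: "\<forall>x\<in>space M. \<bar>f x\<bar> \<le> c" "\<forall>x\<in>space M. \<bar>g x\<bar> \<le> e" using fg unfolding bm_def by blast
    have "\<forall>x\<in>space M. \<bar>f x + g x\<bar> \<le> c + e" using c abs_triangle_ineq by (meson add_mono order.trans)
    thus ?thesis using fg unfolding bm_def by (intro conjI exI[of _ "c + e"]) auto
  qed
  have bm_mult: "bm (\<lambda>x. f x * g x)" if fg: "bm f" "bm g" for f g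
  proof -
    obtain c e where c: "\<forall>x\<in>space M. \<bar>f x\<bar> \<le> c" "\<forall>x\<in>space M. \<bar>g x\<bar> \<le> e" using fg unfolding bm_def by blast
    have "\<bar>f x * g x\<bar> \<le> c * e" if "x \<in> space M" for x
    proof -
      have "\<bar>f x\<bar> * \<bar>g x\<bar> \<le> c * e" using c that order.trans[OF abs_ge_zero, of "f x" c] by (intro mult_mono) auto
      thus ?thesis by (simp add: abs_mult)
    qed
    thus ?thesis using fg unfolding bm_def by (intro conjI exI[of _ "c * e"]) auto
  qed
  have bm_const: "bm (\<lambda>x. c)" for c by (auto simp: bm_def)
  have bm_max: "bm (\<lambda>x. max 0 (f x))" if bf: "bm f" for f
  proof -
    obtain c where c: "\<forall>x\<in>space M. \<bar>f x\<bar> \<le> c" using bf unfolding bm_def by blast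
    hence "\<forall>x\<in>space M. \<bar>max 0 (f x)\<bar> \<le> c" by (auto simp: max_def)
    thus ?thesis using bf unfolding bm_def by (intro conjI exI[of _ c]) auto
  qed
  have bm_sq: "bm (\<lambda>x. (f x)\<^sup>2)" if "bm f" for f unfolding power2_eq_square by (rule bm_mult[OF that that])
  have bm_diff: "bm (\<lambda>x. f x - g x)" if "bm f" "bm g" for f g
    using bm_add[OF that(1) bm_mult[OF bm_const[of "-1"] that(2)]] by simp
  have bmV: "bm V" if "V \<in> VV" for V using meas[OF that] bdd[OF that] by (simp add: bm_def)
  define N where "N = (\<lambda>V :: 'b \<Rightarrow> real. \<integral>x. (max 0 (V x))\<^sup>2 \<partial>M)"
  define d where "d = Inf (N ` VV)"
  have bddb: "bdd_below (N ` VV)" using low by (intro bdd_belowI[of _ d0]) (auto simp: N_def)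
  have dle: "d \<le> N V" if "V \<in> VV" for V unfolding d_def using that bddb by (intro cInf_lower) auto
  have dd0: "d0 \<le> d" unfolding d_def using ne low by (intro cInf_greatest) (auto simp: N_def)
  \<comment> \<open>The rate \<open>(1/4) ^ k\<close> makes consecutive positive parts differ by the
    order of \<open>(1/2) ^ k\<close> in L2, so that their differences are summable.\<close>
  have "\<exists>V\<in>VV. N V < d + (1/4) ^ k" for k :: nat
  proof -
    have "Inf (N ` VV) < d + (1/4) ^ k" by (simp add: d_def)
    thus ?thesis using cInf_lessD[of "N ` VV" "d + (1/4) ^ k"] ne by blast
  qed
  then obtain Vs where Vs: "\<And>k. Vs k \<in> VV" "\<And>k. N (Vs k) < d + (1/4) ^ k" by metis
  define P where "P = (\<lambda>k x. max 0 (Vs k x))"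
  have bP: "bm (P k)" for k unfolding P_def by (intro bm_max bmV Vs)
  have NP: "N (Vs k) = (\<integral>x. (P k x)\<^sup>2 \<partial>M)" for k by (simp add: N_def P_def)
  \<comment> \<open>Parallelogram identity: the midpoint belongs to the convex family, and its
    positive part is at most the mean of the two positive parts.\<close>
  have par: "(\<integral>x. (P i x - P k x)\<^sup>2 \<partial>M) \<le> 2 * (1/4) ^ i + 2 * (1/4) ^ k" for i k
  proof -
    define W where "W = (\<lambda>x. (1 - 1/2) * Vs i x + (1/2) * Vs k x)"
    have W: "W \<in> VV" unfolding W_def by (rule conv) (use Vs in auto)
    have pt: "(P i x - P k x)\<^sup>2 \<le> 2 * (P i x)\<^sup>2 + 2 * (P k x)\<^sup>2 - 4 * (max 0 (W x))\<^sup>2" for x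
    proof -
      have "max 0 (W x) \<le> (P i x + P k x) / 2" unfolding P_def W_def max_def by (auto simp: field_simps)
      hence "(max 0 (W x))\<^sup>2 \<le> ((P i x + P k x) / 2)\<^sup>2" by (intro power_mono) auto
      moreover have "(P i x - P k x)\<^sup>2 = 2 * (P i x)\<^sup>2 + 2 * (P k x)\<^sup>2 - 4 * ((P i x + P k x) / 2)\<^sup>2"
        by (simp add: power2_eq_square field_simps)
      ultimately show ?thesis by linarith
    qed
    have i1: "integrable M (\<lambda>x. (P i x - P k x)\<^sup>2)" by (intro bm_int bm_sq bm_diff bP)
    have i2: "integrable M (\<lambda>x. (P i x)\<^sup>2)" "integrable M (\<lambda>x. (P k x)\<^sup>2)" "integrable M (\<lambda>x. (max 0 (W x))\<^sup>2)"
      by (intro bm_int bm_sq bP bm_max bmV W)+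
    have "(\<integral>x. (P i x - P k x)\<^sup>2 \<partial>M) \<le> (\<integral>x. 2 * (P i x)\<^sup>2 + 2 * (P k x)\<^sup>2 - 4 * (max 0 (W x))\<^sup>2 \<partial>M)"
      using i1 i2 pt by (intro integral_mono) auto
    also have "\<dots> = 2 * N (Vs i) + 2 * N (Vs k) - 4 * N W"
      unfolding NP using i2 by (simp add: N_def)
    finally show ?thesis using Vs(2)[of i] Vs(2)[of k] dle[OF W] by linarith
  qed
  define Dk where "Dk = (\<lambda>k x. P (Suc k) x - P k x)"
  have bD: "bm (Dk k)" for k unfolding Dk_def by (intro bm_diff bP)
  define C where "C = (4 + measure M (space M)) / 2"
  \<comment> \<open>The L2 bound becomes an L1 bound through
    \<open>2 * \<bar>D\<bar> \<le> 2 ^ k * D^2 + (1/2) ^ k\<close>.\<close>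
  have D1: "(\<integral>x. \<bar>Dk k x\<bar> \<partial>M) \<le> (1/2) ^ k * C" for k
  proof -
    have pt: "\<bar>Dk k x\<bar> \<le> (2 ^ k * (Dk k x)\<^sup>2 + (1/2) ^ k) / 2" for x
    proof -
      have "0 \<le> (2 ^ k * \<bar>Dk k x\<bar> - 1)\<^sup>2" by simp
      also have "\<dots> = 2 ^ k * (2 ^ k * (Dk k x)\<^sup>2 + (1/2) ^ k - 2 * \<bar>Dk k x\<bar>)"
        by (simp add: power2_diff power2_eq_square algebra_simps power_one_over abs_mult_self_eq)
      finally have "0 \<le> 2 ^ k * (Dk k x)\<^sup>2 + (1/2) ^ k - 2 * \<bar>Dk k x\<bar>"
        by (metis not_le mult_pos_neg zero_less_power zero_less_numeral)
      thus ?thesis by simp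
    qed
    have i1: "integrable M (\<lambda>x. (Dk k x)\<^sup>2)" by (intro bm_int bm_sq bD)
    have i2: "integrable M (\<lambda>x. \<bar>Dk k x\<bar>)" by (intro integrable_abs bm_int bD)
    have "(\<integral>x. \<bar>Dk k x\<bar> \<partial>M) \<le> (\<integral>x. (2 ^ k * (Dk k x)\<^sup>2 + (1/2) ^ k) / 2 \<partial>M)"
      using i1 i2 pt by (intro integral_mono) auto
    also have "\<dots> = (2 ^ k * (\<integral>x. (Dk k x)\<^sup>2 \<partial>M) + (1/2) ^ k * measure M (space M)) / 2"
      using i1 by simp
    also have "\<dots> \<le> (2 ^ k * (4 * (1/4) ^ k) + (1/2) ^ k * measure M (space M)) / 2"
    proof -
      have "(\<integral>x. (Dk k x)\<^sup>2 \<partial>M) \<le> 2 * (1/4) ^ Suc k + 2 * (1/4) ^ k" unfolding Dk_def by (rule par)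
      also have "\<dots> \<le> 4 * (1/4) ^ k" by simp
      finally show ?thesis by (intro divide_right_mono add_right_mono mult_left_mono) auto
    qed
    also have "2 ^ k * (4 * (1/4) ^ k) = 4 * (1/2 :: real) ^ k"
      by (simp add: power_mult_distrib[symmetric])
    also have "(4 * (1/2) ^ k + (1/2) ^ k * measure M (space M)) / 2 = (1/2) ^ k * C"
      by (simp add: C_def algebra_simps)
    finally show ?thesis .
  qed
  have sumC: "summable (\<lambda>k. (1/2 :: real) ^ k * C)" by (intro summable_mult2 summable_geometric) simp
  have sumD: "summable (\<lambda>k. \<integral>x. \<bar>Dk k x\<bar> \<partial>M)"
    by (rule summable_comparison_test'[OF sumC, of 0]) (use D1 in \<open>auto intro!: integral_nonneg_AE\<close>)
  have mD: "Dk k \<in> borel_measurable M" for k using bD by (simp add: bm_def)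
  have AEs: "AE x in M. summable (\<lambda>k. \<bar>Dk k x\<bar>)"
  proof -
    note [measurable] = mD
    have "(\<integral>\<^sup>+ x. (\<Sum>k. ennreal \<bar>Dk k x\<bar>) \<partial>M) = (\<Sum>k. \<integral>\<^sup>+ x. ennreal \<bar>Dk k x\<bar> \<partial>M)"
      by (intro nn_integral_suminf) measurable
    also have "\<dots> = (\<Sum>k. ennreal (\<integral>x. \<bar>Dk k x\<bar> \<partial>M))"
      using bm_int[OF bD] by (intro suminf_cong nn_integral_eq_integral integrable_abs) auto
    also have "\<dots> \<noteq> \<infinity>" unfolding infinity_ennreal_def using sumD by (intro ennreal_suminf_neq_top) (auto intro!: integral_nonneg_AE)
    finally have "AE x in M. (\<Sum>k. ennreal \<bar>Dk k x\<bar>) \<noteq> \<infinity>"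
      by (intro nn_integral_PInf_AE) auto
    thus ?thesis
      by eventually_elim (auto intro: summable_suminf_not_top)
  qed
  \<comment> \<open>The limit is taken as a telescoping series. Where the series diverges
    \<open>s\<close> is a default value; the maximum with 0 makes \<open>t\<close> nonnegative
    everywhere and changes \<open>s\<close> only on a null set.\<close>
  define s where "s = (\<lambda>x. P 0 x + (\<Sum>k. Dk k x))"
  define t where "t = (\<lambda>x. max 0 (s x))"
  have tele: "(\<Sum>k<n. Dk k x) = P n x - P 0 x" for n x
    unfolding Dk_def by (rule sum_lessThan_telescope)
  have AEt: "AE x in M. t x = s x"
    using AEs
  proof eventually_elim
    case (elim x)
    have "(\<lambda>n. \<Sum>k<n. Dk k x) \<longlonglongrightarrow> (\<Sum>k. Dk k x)" by (rule summable_LIMSEQ[OF summable_rabs_cancel[OF elim]])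
    hence "(\<lambda>n. P 0 x + (P n x - P 0 x)) \<longlonglongrightarrow> s x" unfolding tele s_def by (intro tendsto_intros)
    hence "(\<lambda>n. P n x) \<longlonglongrightarrow> s x" by simp
    hence "0 \<le> s x" by (rule LIMSEQ_le_const) (auto simp: P_def)
    thus ?case by (simp add: t_def)
  qed
  have ints: "integrable M s"
    unfolding s_def using bm_int[OF bP] bm_int[OF bD] AEs sumD
    by (intro Bochner_Integration.integrable_add integrable_suminf) auto
  hence it: "integrable M t" unfolding t_def by (intro integrable_max) auto
  have lim: "(\<lambda>n. \<integral>x. P n x * V x \<partial>M) \<longlonglongrightarrow> (\<integral>x. t x * V x \<partial>M)" if V: "V \<in> VV" for V
  proof -
    obtain c where c: "\<forall>x\<in>space M. \<bar>V x\<bar> \<le> c" using bdd[OF V] by blast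
    have iDV: "integrable M (\<lambda>x. Dk k x * V x)" for k by (intro bm_int bm_mult bD bmV V)
    have iPV: "integrable M (\<lambda>x. P k x * V x)" for k by (intro bm_int bm_mult bP bmV V)
    have AE2: "AE x in M. summable (\<lambda>k. norm (Dk k x * V x))"
      using AEs by eventually_elim (simp add: abs_mult summable_mult2)
    have sum2: "summable (\<lambda>k. \<integral>x. norm (Dk k x * V x) \<partial>M)"
    proof (rule summable_comparison_test'[OF summable_mult2[OF sumD, of c], of 0])
      fix k
      have "(\<integral>x. norm (Dk k x * V x) \<partial>M) \<le> (\<integral>x. \<bar>Dk k x\<bar> * c \<partial>M)"
      proof (rule integral_mono[OF integrable_norm[OF iDV] integrable_mult_left[OF integrable_abs[OF bm_int[OF bD]]]])
        show "norm (Dk k x * V x) \<le> \<bar>Dk k x\<bar> * c" if "x \<in> space M" for x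
          using c that by (auto simp: abs_mult intro!: mult_left_mono)
      qed
      thus "norm (\<integral>x. norm (Dk k x * V x) \<partial>M) \<le> (\<integral>x. \<bar>Dk k x\<bar> \<partial>M) * c"
        by (simp add: integral_nonneg_AE)
    qed
    have S: "(\<lambda>k. \<integral>x. Dk k x * V x \<partial>M) sums (\<integral>x. (\<Sum>k. Dk k x * V x) \<partial>M)"
      by (rule sums_integral[OF iDV AE2 sum2])
    have iS: "integrable M (\<lambda>x. \<Sum>k. Dk k x * V x)" by (rule integrable_suminf[OF iDV AE2 sum2])
    have part: "(\<Sum>k<n. \<integral>x. Dk k x * V x \<partial>M) = (\<integral>x. P n x * V x \<partial>M) - (\<integral>x. P 0 x * V x \<partial>M)" for n
    proof -
      have "(\<integral>x. Dk k x * V x \<partial>M) = (\<integral>x. P (Suc k) x * V x \<partial>M) - (\<integral>x. P k x * V x \<partial>M)" for k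
        unfolding Dk_def left_diff_distrib by (intro Bochner_Integration.integral_diff iPV)
      thus ?thesis by (simp add: sum_lessThan_telescope[of "\<lambda>k. \<integral>x. P k x * V x \<partial>M"])
    qed
    have "(\<integral>x. t x * V x \<partial>M) = (\<integral>x. P 0 x * V x + (\<Sum>k. Dk k x * V x) \<partial>M)"
    proof (rule integral_cong_AE)
      show "(\<lambda>x. t x * V x) \<in> borel_measurable M" using it meas[OF V] by auto
      show "(\<lambda>x. P 0 x * V x + (\<Sum>k. Dk k x * V x)) \<in> borel_measurable M" using iPV iS by auto
      show "AE x in M. t x * V x = P 0 x * V x + (\<Sum>k. Dk k x * V x)"
        using AEt AEs
      proof eventually_elim
        case (elim x)
        have "summable (\<lambda>k. Dk k x)" using elim(2) by (rule summable_rabs_cancel)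
        thus ?case using elim(1) by (simp add: s_def distrib_right suminf_mult2)
      qed
    qed
    also have "\<dots> = (\<integral>x. P 0 x * V x \<partial>M) + (\<integral>x. (\<Sum>k. Dk k x * V x) \<partial>M)"
      using iPV iS by (rule Bochner_Integration.integral_add)
    finally have tV: "(\<integral>x. t x * V x \<partial>M) = (\<integral>x. P 0 x * V x \<partial>M) + (\<integral>x. (\<Sum>k. Dk k x * V x) \<partial>M)" .
    have "(\<lambda>n. (\<integral>x. P 0 x * V x \<partial>M) + ((\<integral>x. P n x * V x \<partial>M) - (\<integral>x. P 0 x * V x \<partial>M))) \<longlonglongrightarrow> (\<integral>x. t x * V x \<partial>M)"
      using S unfolding sums_def part tV by (intro tendsto_intros)
    thus ?thesis by simp
  qed
  have Nlim: "(\<lambda>k. N (Vs k)) \<longlonglongrightarrow> d"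
  proof (rule tendsto_sandwich[of "\<lambda>_. d" _ _ "\<lambda>k. d + (1/4) ^ k"])
    show "eventually (\<lambda>k. d \<le> N (Vs k)) sequentially" using dle Vs(1) by auto
    show "eventually (\<lambda>k. N (Vs k) \<le> d + (1/4) ^ k) sequentially" by (intro always_eventually allI less_imp_le Vs(2))
    have "(\<lambda>k. d + (1/4 :: real) ^ k) \<longlonglongrightarrow> d + 0" by (intro tendsto_intros LIMSEQ_power_zero) auto
    thus "(\<lambda>k. d + (1/4) ^ k) \<longlonglongrightarrow> d" by simp
  qed auto
  have main: "d \<le> (\<integral>x. t x * V x \<partial>M)" if V: "V \<in> VV" for V
  proof -
    define I where "I = (\<integral>x. t x * V x \<partial>M)"
    define K where "K = (\<integral>x. (V x)\<^sup>2 \<partial>M)"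
    \<comment> \<open>First variation at the minimum: the mixture of \<open>Vs k\<close> with the
      portion \<open>\<tau>\<close> of \<open>V\<close> is in the family, so the square integral of
      its positive part is at least \<open>d\<close>; then \<open>k\<close> tends to
      infinity.\<close>
    have ineq: "d \<le> (1 - \<tau>)\<^sup>2 * d + 2 * \<tau> * (1 - \<tau>) * I + \<tau>\<^sup>2 * K" if \<tau>: "0 < \<tau>" "\<tau> < 1" for \<tau>
    proof -
      have "d \<le> (1 - \<tau>)\<^sup>2 * N (Vs k) + 2 * \<tau> * (1 - \<tau>) * (\<integral>x. P k x * V x \<partial>M) + \<tau>\<^sup>2 * K" for k
      proof -
        define W where "W = (\<lambda>x. (1 - \<tau>) * Vs k x + \<tau> * V x)"
        have W: "W \<in> VV" unfolding W_def by (rule conv) (use Vs V \<tau> in auto)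
        have pt: "(max 0 (W x))\<^sup>2 \<le> (1 - \<tau>)\<^sup>2 * (P k x)\<^sup>2 + 2 * \<tau> * (1 - \<tau>) * (P k x * V x) + \<tau>\<^sup>2 * (V x)\<^sup>2" for x
        proof -
          have "(1 - \<tau>) * Vs k x \<le> (1 - \<tau>) * P k x" using \<tau> by (intro mult_left_mono) (auto simp: P_def)
          hence "max 0 (W x) \<le> \<bar>(1 - \<tau>) * P k x + \<tau> * V x\<bar>" by (auto simp: W_def)
          hence "(max 0 (W x))\<^sup>2 \<le> \<bar>(1 - \<tau>) * P k x + \<tau> * V x\<bar>\<^sup>2" by (intro power_mono) auto
          also have "\<dots> = (1 - \<tau>)\<^sup>2 * (P k x)\<^sup>2 + 2 * \<tau> * (1 - \<tau>) * (P k x * V x) + \<tau>\<^sup>2 * (V x)\<^sup>2"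
            unfolding power2_abs by (simp add: power2_eq_square algebra_simps)
          finally show ?thesis .
        qed
        have i: "integrable M (\<lambda>x. (P k x)\<^sup>2)" "integrable M (\<lambda>x. P k x * V x)" "integrable M (\<lambda>x. (V x)\<^sup>2)"
          "integrable M (\<lambda>x. (max 0 (W x))\<^sup>2)"
          by (intro bm_int bm_sq bm_mult bP bm_max bmV W V)+
        have "d \<le> N W" by (rule dle[OF W])
        also have "\<dots> \<le> (\<integral>x. (1 - \<tau>)\<^sup>2 * (P k x)\<^sup>2 + 2 * \<tau> * (1 - \<tau>) * (P k x * V x) + \<tau>\<^sup>2 * (V x)\<^sup>2 \<partial>M)"
          unfolding N_def using i pt by (intro integral_mono) auto
        also have "\<dots> = (1 - \<tau>)\<^sup>2 * N (Vs k) + 2 * \<tau> * (1 - \<tau>) * (\<integral>x. P k x * V x \<partial>M) + \<tau>\<^sup>2 * K"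
          unfolding NP K_def using i by simp
        finally show ?thesis .
      qed
      thus ?thesis
        unfolding I_def by (intro LIMSEQ_le_const[OF tendsto_add[OF tendsto_add[OF tendsto_mult[OF tendsto_const Nlim]
             tendsto_mult[OF tendsto_const lim[OF V]]] tendsto_const]]) auto
    qed
    show ?thesis
    proof (rule ccontr)
      assume "\<not> ?thesis"
      hence lt: "I < d" by (simp add: I_def)
      define E where "E = \<bar>d - 2 * I + K\<bar> + 1"
      \<comment> \<open>After cancelling one factor \<open>\<tau>\<close>, the second order term is
        at most \<open>d - I\<close>, while the inequality demands at least
        \<open>2 * (d - I)\<close>.\<close>
      define \<tau> where "\<tau> = min (1/2) ((d - I) / E)"
      have E: "E > 0" by (simp add: E_def)
      have \<tau>: "0 < \<tau>" "\<tau> < 1" "\<tau> \<le> (d - I) / E" using lt E by (auto simp: \<tau>_def)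
      have "\<tau> * (2 * (d - I)) \<le> \<tau> * (\<tau> * (d - 2 * I + K))"
        using ineq[OF \<tau>(1,2)] by (simp add: power2_eq_square algebra_simps)
      hence "2 * (d - I) \<le> \<tau> * (d - 2 * I + K)" using \<tau>(1) by simp
      also have "\<dots> \<le> \<tau> * E" using \<tau>(1) by (intro mult_left_mono) (auto simp: E_def)
      also have "\<dots> \<le> d - I" using \<tau>(3) E by (simp add: pos_le_divide_eq)
      finally show False using lt by simp
    qed
  qed
  show ?thesis
    using main it d0 dd0 by (intro exI[of _ t] exI[of _ d]) (auto simp: t_def)
qed

subsection \<open>Sweeping a measure out of a compact set\<close>

lemma cv_measurable:
  fixes a v :: "'a::euclidean_space \<Rightarrow> real"
  assumes a: "kern a" and [measurable]: "v \<in> borel_measurable borel"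
  shows "cv a \<rho> v \<in> borel_measurable borel"
proof -
  note [measurable] = sck_measurable[OF a]
  have "(\<lambda>(x, y). v y * sck a \<rho> (y - x)) \<in> borel_measurable (borel \<Otimes>\<^sub>M lborel)" by measurable
  hence "(\<lambda>x. LBINT y. v y * sck a \<rho> (y - x)) \<in> borel_measurable borel"
    by (rule lborel.borel_measurable_lebesgue_integral)
  thus ?thesis unfolding cv_def .
qed

lemma cv_indicator:
  assumes a: "kern a" and \<rho>: "0 < \<rho>" "cball x \<rho> \<subseteq> S"
  shows "cv a \<rho> (\<lambda>y. indicator S y * u y) x = cv a \<rho> u x"
  unfolding cv_def
proof (intro Bochner_Integration.integral_cong refl)
  fix y
  show "indicator S y * u y * sck a \<rho> (y - x) = u y * sck a \<rho> (y - x)"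
  proof (cases "y \<in> S")
    case False
    hence "\<not> norm (x - y) \<le> \<rho>" using \<rho>(2) by (auto simp: dist_norm)
    hence "\<rho> \<le> norm (y - x)" by (simp add: norm_minus_commute)
    thus ?thesis by (simp add: sck_zero[OF a \<rho>(1)])
  qed simp
qed

lemma cv_nonneg:
  assumes "kern a" "0 < \<rho>" "\<And>y. 0 \<le> u y"
  shows "0 \<le> cv a \<rho> u x"
  unfolding cv_def using assms(3) sck_nonneg[OF assms(1,2)] by (intro integral_nonneg_AE AE_I2) simp

lemma cv_const: "kern a \<Longrightarrow> 0 < \<rho> \<Longrightarrow> cv a \<rho> (\<lambda>_. c) x = c"
  using sck_integral(1)[of a \<rho> x] by (simp add: cv_def)

lemma locint_continuous:
  assumes "continuous_on UNIV (u :: 'a::euclidean_space \<Rightarrow> real)"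
  shows "locint D u"
  unfolding locint_def
proof safe
  show "u \<in> borel_measurable borel" by (rule borel_measurable_continuous_onI[OF assms])
  fix K :: "'a set" assume "compact K"
  hence "integrable lborel (\<lambda>y. indicator K y *\<^sub>R u y)"
    by (intro borel_integrable_compact continuous_on_subset[OF assms]) auto
  thus "integrable lborel (\<lambda>y. indicator K y * u y)" by simp
qed

text \<open>The first moment of the even kernel vanishes, so averaging raises the squared norm by a
  constant independent of the point. This constant controls the number of steps of the walk.\<close>

lemma cv_norm_sq:
  fixes a :: "'a::euclidean_space \<Rightarrow> real"
  assumes a: "kern a" and \<rho>: "0 < \<rho>"
  obtains \<kappa> where "0 < \<kappa>" "\<And>x. cv a \<rho> (\<lambda>y. (norm y)\<^sup>2) x = (norm x)\<^sup>2 + \<kappa>"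
proof -
  note [measurable] = kernD(6)[OF a]
  note ai = kern_integrable[OF a]
  define \<kappa> where "\<kappa> = (LBINT z. a z * (norm z)\<^sup>2)"
  have i1: "integrable lborel (\<lambda>z. a z * (norm z)\<^sup>2)"
  proof (rule Bochner_Integration.integrable_bound[OF ai])
    show "AE z in lborel. norm (a z * (norm z)\<^sup>2) \<le> norm (a z)"
    proof (rule AE_I2)
      fix z show "norm (a z * (norm z)\<^sup>2) \<le> norm (a z)"
        using kernD(3)[OF a, of z] kernD(2)[OF a, of z]
        by (cases "norm z < 1") (auto simp: abs_mult intro!: mult_left_le power_le_one)
    qed
  qed measurable
  have i2: "integrable lborel (\<lambda>z. a z * (x \<bullet> z))" for x
  proof (rule Bochner_Integration.integrable_bound[OF integrable_mult_left[OF ai, of "norm x"]])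
    show "AE z in lborel. norm (a z * (x \<bullet> z)) \<le> norm (a z * norm x)"
    proof (rule AE_I2)
      fix z
      show "norm (a z * (x \<bullet> z)) \<le> norm (a z * norm x)"
      proof (cases "norm z < 1")
        case True
        have "\<bar>x \<bullet> z\<bar> \<le> norm x * norm z" by (rule Cauchy_Schwarz_ineq2)
        also have "\<dots> \<le> norm x" using True by (intro mult_left_le) auto
        finally show ?thesis using kernD(2)[OF a, of z] by (auto simp: abs_mult intro!: mult_left_mono)
      qed (use kernD(3)[OF a, of z] in simp)
    qed
  qed measurable
  have odd: "(LBINT z. a z * (x \<bullet> z)) = 0" for x
  proof -
    have "(\<lambda>z. a z * (x \<bullet> z)) \<in> borel_measurable borel" by measurable
    from lborel_integral_minus[OF this] show ?thesis by (simp add: kernD(4)[OF a])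
  qed
  have eq: "cv a \<rho> (\<lambda>y. (norm y)\<^sup>2) x = (norm x)\<^sup>2 + \<rho>\<^sup>2 * \<kappa>" for x
  proof -
    have "cv a \<rho> (\<lambda>y. (norm y)\<^sup>2) x = (LBINT z. a z * (norm (x + \<rho> *\<^sub>R z))\<^sup>2)" by (rule cv_eq[OF a \<rho>]) measurable
    also have "\<dots> = (LBINT z. a z * (norm x)\<^sup>2 + (2 * \<rho>) * (a z * (x \<bullet> z)) + \<rho>\<^sup>2 * (a z * (norm z)\<^sup>2))"
    proof (intro Bochner_Integration.integral_cong refl)
      fix z
      have "(norm (x + \<rho> *\<^sub>R z))\<^sup>2 = (norm x)\<^sup>2 + (2 * \<rho>) * (x \<bullet> z) + \<rho>\<^sup>2 * (norm z)\<^sup>2"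
        unfolding power2_norm_eq_inner by (simp add: inner_add_left inner_add_right inner_commute power2_eq_square algebra_simps)
      thus "a z * (norm (x + \<rho> *\<^sub>R z))\<^sup>2 = a z * (norm x)\<^sup>2 + (2 * \<rho>) * (a z * (x \<bullet> z)) + \<rho>\<^sup>2 * (a z * (norm z)\<^sup>2)"
        by (simp add: distrib_left mult_ac)
    qed
    also have "\<dots> = (norm x)\<^sup>2 + \<rho>\<^sup>2 * \<kappa>"
      using ai i1 i2[of x] odd[of x] kernD(5)[OF a] by (simp add: \<kappa>_def)
    finally show ?thesis .
  qed
  have "\<kappa> \<noteq> 0"
  proof
    assume "\<kappa> = 0"
    hence "AE z in lborel. a z * (norm z)\<^sup>2 = 0"
      using integral_nonneg_eq_0_iff_AE[OF i1] kernD(2)[OF a] by (simp add: \<kappa>_def)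
    moreover have "AE z in lborel. z \<noteq> (0::'a)" by (rule AE_lborel_singleton)
    ultimately have "AE z in lborel. a z = 0" by eventually_elim auto
    hence "integral\<^sup>L lborel a = (\<integral>z. 0 \<partial>(lborel :: 'a measure))" by (intro integral_cong_AE) auto
    thus False using kernD(5)[OF a] by simp
  qed
  moreover have "0 \<le> \<kappa>" unfolding \<kappa>_def using kernD(2)[OF a] by (intro integral_nonneg_AE AE_I2) simp
  ultimately have "0 < \<rho>\<^sup>2 * \<kappa>" using \<rho> by simp
  thus ?thesis using eq by (rule that)
qed


lemma cv_smooth:
  fixes a w :: "'a::euclidean_space \<Rightarrow> real"
  assumes "mollifier a" and w: "integrable lborel w" and \<rho>: "0 < \<rho>"
  shows "smooth_on UNIV (cv a \<rho> w)"
  unfolding smooth_on_def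
proof
  fix k
  have eq: "cv a \<rho> w = (\<lambda>y. LBINT z. (w z / \<rho> ^ DIM('a)) * a ((- 1 / \<rho>) *\<^sub>R y + z /\<^sub>R \<rho>))"
    unfolding cv_def sck_def by (simp add: scaleR_diff_right divide_inverse mult_ac)
  show "Ck_on k UNIV (cv a \<rho> w)"
    unfolding eq
  proof (rule Ck_on_superposition)
    show "integrable lborel (\<lambda>z. \<bar>w z / \<rho> ^ DIM('a)\<bar> * \<bar>- 1 / \<rho>\<bar> ^ n)" for n
      using w by (intro integrable_mult_left integrable_abs integrable_divide)
    show "Ck_on k UNIV a" using assms(1) by (simp add: mollifier_def smooth_on_def)
    show "a z = 0" if "norm z > 1" for z using kernD(3)[OF mollifier_kern[OF assms(1)]] that by auto
    show "(\<lambda>z. w z / \<rho> ^ DIM('a)) \<in> borel_measurable lborel" using w by auto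
  qed auto
qed

text \<open>A walk with steps distributed as \<open>sck a \<eta>\<close>, stopped on leaving a neighbourhood of \<open>Q\<close>:
  the second moment grows by a fixed amount at each step, so the expected number of steps is finite.\<close>

lemma sweep_out:
  fixes Q :: "'a::euclidean_space set"
  assumes moll: "mollifier a" and fin: "finite_measure \<nu>" and sets: "sets \<nu> = sets borel"
    and Q: "compact Q" "Q \<noteq> {}" and \<nu>Q: "AE x in \<nu>. x \<in> Q" and \<eta>: "0 < \<eta>"
  shows "\<exists>g0. smooth_on UNIV g0 \<and> (\<forall>x. 0 \<le> g0 x) \<and>
     (\<forall>x. g0 x \<noteq> 0 \<longrightarrow> \<eta> / 2 \<le> infdist x Q \<and> infdist x Q \<le> 3 * \<eta>) \<and>
     (\<forall>H. locint {x. infdist x Q \<le> 4 * \<eta>} H \<and>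
        (AE x in lborel. infdist x Q \<le> 3 * \<eta> \<longrightarrow> (\<forall>\<rho>. 0 < \<rho> \<and> \<rho> \<le> \<eta> \<longrightarrow> H x \<le> cv a \<rho> H x)) \<and>
        integrable \<nu> H \<and> (AE x in \<nu>. H x \<le> cv a \<eta> H x) \<longrightarrow>
        (\<integral>x. H x \<partial>\<nu>) \<le> (LBINT x. H x * g0 x))"
proof -
  interpret \<nu>: finite_measure \<nu> by (rule fin)
  note a = mollifier_kern[OF moll]
  note [measurable] = sck_measurable[OF a]
  have [measurable_cong]: "sets \<nu> = sets borel" by (rule sets)
  let ?m = "DIM('a)"
  define N where "N = (\<lambda>r. {x. infdist x Q \<le> r})"
  have Nc: "compact (N r)" if "r > 0" for r unfolding N_def by (rule compact_infdist_le[OF Q(2,1) that])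
  have Nb[measurable]: "N r \<in> sets borel" for r
  proof -
    have "closed (N r)" unfolding N_def by (intro closed_Collect_le continuous_intros)
    thus ?thesis by simp
  qed
  have Nball: "cball x s \<subseteq> N (r + s)" if "x \<in> N r" for x r s
  proof
    fix y assume "y \<in> cball x s"
    thus "y \<in> N (r + s)" using that infdist_triangle[of y Q x] by (auto simp: N_def dist_commute)
  qed
  obtain A where A: "\<And>x. a x \<le> A" "A > 0" using kern_bound[OF a] by metis
  define A' where "A' = A / \<eta> ^ ?m"
  have A': "A' > 0" using A \<eta> by (simp add: A'_def)
  have kb: "\<bar>sck a \<eta> z\<bar> \<le> A'" for z unfolding A'_def by (rule sck_bound[OF a \<eta> A(1)])
  define U where "U = N \<eta>"
  have Um[measurable]: "U \<in> sets borel" by (simp add: U_def)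
  \<comment> \<open>\<open>w n\<close> is the density of the mass moved by step
    \<open>n + 1\<close>, seen after that step: the first step starts from \<open>\<nu>\<close>,
    each later one from the mass still inside \<open>U\<close>.\<close>
  define w where "w = rec_nat (\<lambda>y. \<integral>x. sck a \<eta> (y - x) \<partial>\<nu>) (\<lambda>_ v. cv a \<eta> (\<lambda>x. indicator U x * v x))"
  have w0: "w 0 = (\<lambda>y. \<integral>x. sck a \<eta> (y - x) \<partial>\<nu>)" and wS: "w (Suc n) = cv a \<eta> (\<lambda>x. indicator U x * w n x)" for n
    by (simp_all add: w_def)
  have kpm[measurable]: "(\<lambda>p. sck a \<eta> (snd p - fst p)) \<in> borel_measurable (borel \<Otimes>\<^sub>M borel)" by measurable
  have wm[measurable]: "w n \<in> borel_measurable borel" for n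
  proof (induction n)
    case 0
    have "(\<lambda>(y, x). sck a \<eta> (y - x)) \<in> borel_measurable (borel \<Otimes>\<^sub>M \<nu>)" by measurable
    thus ?case unfolding w0 by (rule \<nu>.borel_measurable_lebesgue_integral)
  next
    case (Suc n)
    note [measurable] = Suc
    show ?case unfolding wS by (intro cv_measurable[OF a]) measurable
  qed
  have wnn: "0 \<le> w n y" for n y
  proof (induction n arbitrary: y)
    case 0
    show ?case unfolding w0 using sck_nonneg[OF a \<eta>] by (intro integral_nonneg_AE AE_I2) simp
  next
    case (Suc n)
    thus ?case unfolding wS by (intro cv_nonneg[OF a \<eta>]) simp
  qed
  have wsupp: "w n y = 0" if "y \<notin> N (2 * \<eta>)" for n y
  proof (cases n)
    case 0
    have "AE x in \<nu>. sck a \<eta> (y - x) = 0"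
      using \<nu>Q
    proof eventually_elim
      case (elim x)
      hence "x \<in> N 0" by (simp add: N_def)
      hence "y \<notin> cball x \<eta>" using Nball[of x 0 \<eta>] that \<eta> by (auto simp: N_def)
      thus ?case by (intro sck_zero[OF a \<eta>]) (simp add: dist_norm norm_minus_commute)
    qed
    hence "(\<integral>x. sck a \<eta> (y - x) \<partial>\<nu>) = (\<integral>x. 0 \<partial>\<nu>)" by (intro integral_cong_AE) auto
    thus ?thesis using 0 by (simp add: w0)
  next
    case (Suc k)
    have z: "indicator U x * w k x * sck a \<eta> (x - y) = 0" for x
    proof (cases "x \<in> U")
      case True
      hence "y \<notin> cball x \<eta>" using Nball[of x \<eta> \<eta>] that unfolding U_def by auto
      hence "\<eta> \<le> norm (x - y)" by (simp add: dist_norm)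
      thus ?thesis by (simp add: sck_zero[OF a \<eta>])
    qed simp
    show ?thesis unfolding Suc wS cv_def z by simp
  qed
  have wb0: "w 0 y \<le> A' * measure \<nu> (space \<nu>)" for y
  proof -
    have "w 0 y \<le> (\<integral>x. A' \<partial>\<nu>)" unfolding w0
    proof (rule integral_mono)
      show "integrable \<nu> (\<lambda>x. sck a \<eta> (y - x))"
        by (rule \<nu>.integrable_const_bound[of _ A']) (use kb in auto)
      show "sck a \<eta> (y - x) \<le> A'" for x using kb[of "y - x"] by linarith
    qed auto
    thus ?thesis by (simp add: mult.commute)
  qed
  have iN: "integrable lborel (\<lambda>y::'a. c * indicator (N r) y)" if "r > 0" for r c :: real
    using emeasure_compact_finite[OF Nc[OF that]] by (intro integrable_mult_right integrable_real_indicator) auto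
  have wbd: "\<exists>B. \<forall>y. \<bar>w n y\<bar> \<le> B" for n
  proof (induction n)
    case 0
    thus ?case using wb0 wnn[of 0] by (intro exI[of _ "A' * measure \<nu> (space \<nu>)"]) auto
  next
    case (Suc n)
    then obtain B where B: "\<forall>y. \<bar>w n y\<bar> \<le> B" by blast
    have B0: "0 \<le> B" using B order.trans[OF abs_ge_zero] by blast
    have "w (Suc n) y \<le> B" for y
    proof -
      have "w (Suc n) y \<le> (LBINT x. B * sck a \<eta> (x - y))"
        unfolding wS cv_def
      proof (rule integral_mono)
        have i: "integrable lborel (\<lambda>x. B * sck a \<eta> (x - y))" by (intro integrable_mult_right sck_integral(2)[OF a \<eta>])
        have le: "indicator U x * w n x * sck a \<eta> (x - y) \<le> B * sck a \<eta> (x - y)" for x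
          using B B0 sck_nonneg[OF a \<eta>, of "x - y"] abs_le_D1[of "w n x" B]
          by (intro mult_right_mono) (auto simp: indicator_def)
        show "integrable lborel (\<lambda>x. indicator U x * w n x * sck a \<eta> (x - y))"
          by (rule Bochner_Integration.integrable_bound[OF i])
            (use le wnn sck_nonneg[OF a \<eta>] B0 in \<open>auto intro!: AE_I2 simp: abs_mult\<close>)
        show "integrable lborel (\<lambda>x. B * sck a \<eta> (x - y))" by (rule i)
        show "indicator U x * w n x * sck a \<eta> (x - y) \<le> B * sck a \<eta> (x - y)" for x by (rule le)
      qed
      also have "\<dots> = B" using sck_integral(1)[OF a \<eta>] by simp
      finally show ?thesis .
    qed
    thus ?case using wnn[of "Suc n"] by (intro exI[of _ B]) auto
  qed
  have wi: "integrable lborel (\<lambda>y. S y * w n y)" if Hi: "locint (N (2 * \<eta>)) S" for S n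
  proof -
    obtain B where B: "\<forall>y. \<bar>w n y\<bar> \<le> B" using wbd by blast
    show ?thesis
      by (rule locint_mult(1)[OF Hi Nc[of "2 * \<eta>"] order.refl wm[of n], of B]) (use B wsupp \<eta> in auto)
  qed
  have UN: "U \<subseteq> N (2 * \<eta>)" using \<eta> by (auto simp: U_def N_def)
  have step: "(LBINT y. H y * w (Suc n) y) = (LBINT x. indicator U x * w n x * cv a \<eta> H x)"
    and stepi: "integrable lborel (\<lambda>x. indicator U x * w n x * cv a \<eta> H x)"
    if H: "locint (N (2 * \<eta>)) H" for H n
  proof -
    obtain B where B: "\<forall>y. \<bar>w n y\<bar> \<le> B" using wbd by blast
    have B0: "0 \<le> B" using B order.trans[OF abs_ge_zero] by blast
    obtain c R where cR: "U \<subseteq> cball c R"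
      using compact_imp_bounded[OF Nc[OF \<eta>]] unfolding U_def bounded_subset_cball by blast
    have H1: "integrable lborel (\<lambda>y. indicator (N (2 * \<eta>)) y * H y)" using H Nc[of "2 * \<eta>"] \<eta> by (auto simp: locint_def)
    have \<phi>1: "\<bar>indicator U x * w n x\<bar> \<le> B" for x using B B0 by (auto simp: indicator_def)
    have \<phi>2: "indicator U x * w n x = 0" if "x \<notin> cball c R" for x using that cR by (auto simp: indicator_def)
    have \<phi>m: "(\<lambda>x. indicator U x * w n x) \<in> borel_measurable borel" by measurable
    note adj = cv_adjoint[OF H1 \<phi>m \<phi>1 \<phi>2 a \<eta>]
    have eq: "indicator U x * w n x * cv a \<eta> (\<lambda>y. indicator (N (2 * \<eta>)) y * H y) x = indicator U x * w n x * cv a \<eta> H x" for x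
    proof (cases "x \<in> U")
      case True
      hence "cball x \<eta> \<subseteq> N (2 * \<eta>)" using Nball[of x \<eta> \<eta>] unfolding U_def by simp
      thus ?thesis by (simp add: cv_indicator[OF a \<eta>])
    qed simp
    have eq2: "indicator (N (2 * \<eta>)) y * H y * cv a \<eta> (\<lambda>x. indicator U x * w n x) y = H y * w (Suc n) y" for y
      using wsupp[of y "Suc n"] by (cases "y \<in> N (2 * \<eta>)") (auto simp: wS)
    show "(LBINT y. H y * w (Suc n) y) = (LBINT x. indicator U x * w n x * cv a \<eta> H x)"
      using adj(1) unfolding eq eq2 by simp
    show "integrable lborel (\<lambda>x. indicator U x * w n x * cv a \<eta> H x)"
      using adj(2) unfolding eq .
  qed
  have iU: "integrable lborel (\<lambda>x. indicator U x * (H x * w n x))" if "locint (N (2 * \<eta>)) H" for H n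
    using integrable_mult_indicator[OF _ wi[OF that, of n], of U] by simp
  have iUc: "integrable lborel (\<lambda>x. indicator (- U) x * (H x * w n x))" if "locint (N (2 * \<eta>)) H" for H n
    using integrable_mult_indicator[OF _ wi[OF that, of n], of "- U"] by simp
  have split: "(LBINT x. H x * w n x) = (LBINT x. indicator U x * (H x * w n x)) + (LBINT x. indicator (- U) x * (H x * w n x))"
    if "locint (N (2 * \<eta>)) H" for H n
  proof -
    have "(LBINT x. H x * w n x) = (LBINT x. indicator U x * (H x * w n x) + indicator (- U) x * (H x * w n x))"
      by (intro Bochner_Integration.integral_cong) (auto simp: indicator_def)
    thus ?thesis using iU[OF that] iUc[OF that] by simp
  qed
  \<comment> \<open>\<open>Mn n\<close> is the mass moved by step \<open>n + 1\<close> and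
    \<open>m n\<close> the part of it that lands in \<open>U\<close> and goes on, so
    \<open>Mn (Suc n) = m n\<close>.\<close>
  define m where "m = (\<lambda>n. LBINT x. indicator U x * w n x)"
  define Mn where "Mn = (\<lambda>n. LBINT x. w n x)"
  have l1: "locint (N (2 * \<eta>)) (\<lambda>_. 1)" by (intro locint_continuous continuous_intros)
  have l2: "locint (N (2 * \<eta>)) (\<lambda>y. (norm y)\<^sup>2)" by (intro locint_continuous continuous_intros)
  have mM: "Mn (Suc n) = m n" for n
    using step[OF l1, of n] unfolding cv_const[OF a \<eta>] by (simp add: Mn_def m_def)
  have mnn: "0 \<le> m n" for n unfolding m_def using wnn by (intro integral_nonneg_AE AE_I2) simp
  have Mnn: "0 \<le> Mn n" for n unfolding Mn_def using wnn by (intro integral_nonneg_AE AE_I2) simp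
  obtain \<kappa> where \<kappa>: "0 < \<kappa>" "\<And>x. cv a \<eta> (\<lambda>y. (norm y)\<^sup>2) x = (norm x)\<^sup>2 + \<kappa>"
    using cv_norm_sq[OF a \<eta>] by blast
  obtain R where R: "\<forall>x\<in>N (2 * \<eta>). norm x \<le> R"
    using compact_imp_bounded[OF Nc[of "2 * \<eta>"]] \<eta> unfolding bounded_iff by auto
  define q where "q = (\<lambda>n. LBINT x. (norm x)\<^sup>2 * w n x)"
  define qo where "qo = (\<lambda>n. LBINT x. indicator (- U) x * ((norm x)\<^sup>2 * w n x))"
  have iw: "integrable lborel (w n)" "integrable lborel (\<lambda>x. indicator U x * w n x)" "integrable lborel (\<lambda>x. indicator (- U) x * w n x)" for n
    using wi[OF l1, of n] iU[OF l1, of n] iUc[OF l1, of n] by simp_all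
  have nR: "(norm x)\<^sup>2 * w n x \<le> R\<^sup>2 * w n x" for x n
  proof (cases "x \<in> N (2 * \<eta>)")
    case True
    hence "(norm x)\<^sup>2 \<le> R\<^sup>2" using R by (intro power_mono) auto
    thus ?thesis by (rule mult_right_mono[OF _ wnn])
  qed (simp add: wsupp)
  have qle: "q n \<le> R\<^sup>2 * Mn n" for n
  proof -
    have "q n \<le> (LBINT x. R\<^sup>2 * w n x)" unfolding q_def
      using wi[OF l2, of n] iw nR by (intro integral_mono integrable_mult_right) auto
    thus ?thesis by (simp add: Mn_def)
  qed
  have Mm: "Mn n - m n = (LBINT x. indicator (- U) x * w n x)" for n
    using split[OF l1, of n] by (simp add: Mn_def m_def)
  have qole: "qo n \<le> R\<^sup>2 * (Mn n - m n)" for n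
  proof -
    have "qo n \<le> (LBINT x. R\<^sup>2 * (indicator (- U) x * w n x))" unfolding qo_def
    proof (rule integral_mono[OF iUc[OF l2] integrable_mult_right[OF iw(3)]])
      show "indicator (- U) x * ((norm x)\<^sup>2 * w n x) \<le> R\<^sup>2 * (indicator (- U) x * w n x)" for x
        using nR[of x n] by (cases "x \<in> U") auto
    qed
    thus ?thesis unfolding Mm by simp
  qed
  have q0: "0 \<le> q n" for n unfolding q_def using wnn by (intro integral_nonneg_AE AE_I2) simp
  \<comment> \<open>Balance of second moments: the mass that left \<open>U\<close> takes
    \<open>qo n\<close> away, and each surviving unit of mass gains \<open>\<kappa>\<close> in the
    next step.\<close>
  have qstep: "q (Suc n) = q n - qo n + \<kappa> * m n" for n
  proof -
    have "q (Suc n) = (LBINT x. indicator U x * ((norm x)\<^sup>2 * w n x) + \<kappa> * (indicator U x * w n x))"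
      unfolding q_def step[OF l2] \<kappa>(2) by (intro Bochner_Integration.integral_cong) (auto simp: algebra_simps)
    also have "\<dots> = (LBINT x. indicator U x * ((norm x)\<^sup>2 * w n x)) + \<kappa> * m n"
      using iU[OF l2, of n] iw(2)[of n] by (simp add: m_def)
    finally show ?thesis using split[OF l2, of n] by (simp add: q_def qo_def)
  qed
  \<comment> \<open>The balance telescopes once the departing second moment is bounded by
    \<open>R\<^sup>2\<close> times the departing mass \<open>Mn n - Mn (Suc n)\<close>. As
    \<open>q n \<le> R\<^sup>2 * Mn n\<close>, the sum of all \<open>m n\<close> is finite.\<close>
  have "\<kappa> * (\<Sum>i<n. m i) \<le> q n - q 0 + R\<^sup>2 * (Mn 0 - Mn n)" for n
  proof (induction n)
    case (Suc n)
    have "\<kappa> * (\<Sum>i<Suc n. m i) = \<kappa> * (\<Sum>i<n. m i) + \<kappa> * m n" by (simp add: distrib_left)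
    also have "\<dots> \<le> q n - q 0 + R\<^sup>2 * (Mn 0 - Mn n) + (q (Suc n) - q n + qo n)" using Suc qstep[of n] by simp
    also have "\<dots> \<le> q (Suc n) - q 0 + R\<^sup>2 * (Mn 0 - Mn n) + R\<^sup>2 * (Mn n - m n)" using qole[of n] by simp
    also have "\<dots> = q (Suc n) - q 0 + R\<^sup>2 * (Mn 0 - Mn (Suc n))" by (simp add: mM algebra_simps)
    finally show ?case .
  qed simp
  hence "\<kappa> * (\<Sum>i<n. m i) \<le> R\<^sup>2 * Mn 0" for n
    using qle[of n] q0[of 0] by (smt (verit) right_diff_distrib)
  hence mb: "(\<Sum>i<n. m i) \<le> R\<^sup>2 * Mn 0 / \<kappa>" for n using \<kappa>(1) by (simp add: pos_le_divide_eq mult.commute)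
  have msum: "summable m" by (rule summableI_nonneg_bounded[OF mnn mb])
  hence mlim: "m \<longlonglongrightarrow> 0" by (rule summable_LIMSEQ_zero)
  \<comment> \<open>The kernel is bounded, so the density after a step is bounded by a multiple of
    the mass before it; summable masses therefore give a uniform bound for the sum of the
    densities.\<close>
  have wSb: "w (Suc n) y \<le> A' * m n" for n y
  proof -
    have "w (Suc n) y \<le> (LBINT x. A' * (indicator U x * w n x))"
      unfolding wS cv_def
    proof (rule integral_mono)
      show i: "integrable lborel (\<lambda>x. A' * (indicator U x * w n x))" by (intro integrable_mult_right iw)
      have le: "indicator U x * w n x * sck a \<eta> (x - y) \<le> A' * (indicator U x * w n x)" for x
      proof -
        have "(indicator U x * w n x) * sck a \<eta> (x - y) \<le> (indicator U x * w n x) * A'"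
          using kb[of "x - y"] wnn[of n x] by (intro mult_left_mono) auto
        thus ?thesis by (simp add: mult_ac)
      qed
      thus "indicator U x * w n x * sck a \<eta> (x - y) \<le> A' * (indicator U x * w n x)" for x .
      show "integrable lborel (\<lambda>x. indicator U x * w n x * sck a \<eta> (x - y))"
      proof (rule Bochner_Integration.integrable_bound[OF i])
        show "AE x in lborel. norm (indicator U x * w n x * sck a \<eta> (x - y)) \<le> norm (A' * (indicator U x * w n x))"
        proof (rule AE_I2)
          fix x
          have "0 \<le> indicator U x * w n x * sck a \<eta> (x - y)" using wnn[of n x] sck_nonneg[OF a \<eta>, of "x - y"] by simp
          thus "norm (indicator U x * w n x * sck a \<eta> (x - y)) \<le> norm (A' * (indicator U x * w n x))"
            using le[of x] by (simp only: real_norm_def)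
        qed
      qed measurable
    qed
    thus ?thesis by (simp add: m_def)
  qed
  define G where "G = (\<lambda>n y. indicator (- U) y * (\<Sum>i<n. w i y))"
  have Gmeas[measurable]: "G n \<in> borel_measurable borel" for n unfolding G_def by measurable
  define Cg where "Cg = A' * measure \<nu> (space \<nu>) + A' * (R\<^sup>2 * Mn 0 / \<kappa>)"
  have sumw: "(\<Sum>i<n. w i y) \<le> Cg" for n y
  proof (cases n)
    case 0 thus ?thesis using A' \<kappa>(1) Mnn[of 0] by (simp add: Cg_def)
  next
    case (Suc k)
    have "(\<Sum>i<n. w i y) = w 0 y + (\<Sum>i<k. w (Suc i) y)" unfolding Suc by (rule sum.lessThan_Suc_shift)
    also have "\<dots> \<le> A' * measure \<nu> (space \<nu>) + (\<Sum>i<k. A' * m i)" by (intro add_mono wb0 sum_mono wSb)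
    also have "\<dots> \<le> Cg" unfolding Cg_def sum_distrib_left[symmetric] using mb[of k] A' by (intro add_left_mono mult_left_mono) auto
    finally show ?thesis .
  qed
  have Gnn: "0 \<le> G n y" for n y using wnn by (simp add: G_def sum_nonneg)
  have Gle: "G n y \<le> Cg" for n y using sumw[of y n] order.trans[OF sum_nonneg sumw] wnn by (auto simp: G_def indicator_def)
  have sw: "summable (\<lambda>i. w i y)" for y by (rule summableI_nonneg_bounded[OF wnn sumw])
  \<comment> \<open>Density of the exit points. It is bounded and supported at distances between
    \<open>\<eta>\<close> and \<open>2 * \<eta>\<close> from \<open>Q\<close>; smoothness is still
    missing.\<close>
  define g1 where "g1 = (\<lambda>y. indicator (- U) y * (\<Sum>i. w i y))"
  have Glim: "(\<lambda>n. G n y) \<longlonglongrightarrow> g1 y" for y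
    unfolding G_def g1_def by (intro tendsto_mult tendsto_const summable_LIMSEQ sw)
  have g1m[measurable]: "g1 \<in> borel_measurable borel"
    by (rule borel_measurable_LIMSEQ_metric[OF Gmeas Glim])
  have g1nn: "0 \<le> g1 y" for y by (rule LIMSEQ_le_const[OF Glim]) (use Gnn in auto)
  have g1le: "g1 y \<le> Cg" for y by (rule LIMSEQ_le_const2[OF Glim]) (use Gle in auto)
  have g1supp: "g1 y = 0" if "y \<notin> N (2 * \<eta>) \<or> y \<in> U" for y
    using that wsupp[of y] by (auto simp: g1_def)
  have ig1: "integrable lborel g1"
  proof (rule Bochner_Integration.integrable_bound[OF iN[of "2 * \<eta>" Cg]])
    show "AE y in lborel. norm (g1 y) \<le> norm (Cg * indicator (N (2 * \<eta>)) y)"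
    proof (rule AE_I2)
      fix y show "norm (g1 y) \<le> norm (Cg * indicator (N (2 * \<eta>)) y)"
        using g1supp[of y] g1nn[of y] g1le[of y] by (cases "y \<in> N (2 * \<eta>)") auto
    qed
  qed (use \<eta> in auto)
  have \<eta>2: "0 < \<eta> / 2" using \<eta> by simp
  \<comment> \<open>One more average, with the small radius \<open>\<eta> / 2\<close>, gives
    smoothness and keeps a gap to \<open>Q\<close>; it can only increase the integral of
    \<open>H\<close>.\<close>
  define g0 where "g0 = cv a (\<eta> / 2) g1"
  show ?thesis
  proof (intro exI[of _ g0] conjI allI impI)
    show "smooth_on UNIV g0" unfolding g0_def by (rule cv_smooth[OF moll ig1 \<eta>2])
    show "0 \<le> g0 x" for x unfolding g0_def by (rule cv_nonneg[OF a \<eta>2 g1nn])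
    have supp: "\<eta> / 2 \<le> infdist x Q \<and> infdist x Q \<le> 3 * \<eta>" if nz: "g0 x \<noteq> 0" for x
    proof -
      have "\<exists>y. g1 y * sck a (\<eta> / 2) (y - x) \<noteq> 0"
      proof (rule ccontr)
        assume "\<nexists>y. g1 y * sck a (\<eta> / 2) (y - x) \<noteq> 0"
        hence z: "g1 y * sck a (\<eta> / 2) (y - x) = 0" for y by blast
        show False using nz unfolding g0_def cv_def z by simp
      qed
      then obtain y where y: "g1 y \<noteq> 0" "sck a (\<eta> / 2) (y - x) \<noteq> 0" by auto
      have "norm (y - x) < \<eta> / 2" using sck_zero[OF a \<eta>2, of "y - x"] y(2) by (meson not_le)
      hence d: "dist x y < \<eta> / 2" "dist y x < \<eta> / 2" by (simp_all add: dist_norm norm_minus_commute)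
      have "y \<in> N (2 * \<eta>)" "y \<notin> U" using g1supp[of y] y(1) by blast+
      hence "\<eta> < infdist y Q" "infdist y Q \<le> 2 * \<eta>" unfolding N_def U_def by auto
      thus ?thesis using infdist_triangle[of y Q x] infdist_triangle[of x Q y] d \<eta> by auto
    qed
    show "\<eta> / 2 \<le> infdist x Q" "infdist x Q \<le> 3 * \<eta>" if "g0 x \<noteq> 0" for x using supp[OF that] by auto
    fix H assume "locint {x. infdist x Q \<le> 4 * \<eta>} H \<and>
        (AE x in lborel. infdist x Q \<le> 3 * \<eta> \<longrightarrow> (\<forall>\<rho>. 0 < \<rho> \<and> \<rho> \<le> \<eta> \<longrightarrow> H x \<le> cv a \<rho> H x)) \<and>
        integrable \<nu> H \<and> (AE x in \<nu>. H x \<le> cv a \<eta> H x)"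
    hence H4: "locint (N (4 * \<eta>)) H"
      and sub: "AE x in lborel. x \<in> N (3 * \<eta>) \<longrightarrow> (\<forall>\<rho>. 0 < \<rho> \<and> \<rho> \<le> \<eta> \<longrightarrow> H x \<le> cv a \<rho> H x)"
      and H\<nu>: "integrable \<nu> H" and sub\<nu>: "AE x in \<nu>. H x \<le> cv a \<eta> H x" by (auto simp: N_def)
    have Hmono: "locint (N r) H" if "r \<le> 4 * \<eta>" for r
    proof -
      have "N r \<subseteq> N (4 * \<eta>)" using that by (auto simp: N_def)
      thus ?thesis using H4 unfolding locint_def by blast
    qed
    have [measurable]: "H \<in> borel_measurable borel" using H4 by (simp add: locint_def)
    have H2: "locint (N (2 * \<eta>)) H" using \<eta> by (intro Hmono) auto
    have sub2: "AE x in lborel. x \<in> N (2 * \<eta>) \<longrightarrow> H x \<le> cv a \<eta> H x \<and> H x \<le> cv a (\<eta> / 2) H x"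
      using sub
    proof eventually_elim
      case (elim x)
      thus ?case using \<eta> by (auto simp: N_def)
    qed
    define HN where "HN = (\<lambda>y. indicator (N (2 * \<eta>)) y * H y)"
    have iHN: "integrable lborel HN" unfolding HN_def using H2 Nc[of "2 * \<eta>"] \<eta> by (auto simp: locint_def)
    \<comment> \<open>\<open>\<nu>\<close> may be singular, so for the first step the inequality
      between \<open>H\<close> and its average is used almost everywhere with respect to
      \<open>\<nu>\<close> instead of Lebesgue measure.\<close>
    have base: "(\<integral>x. H x \<partial>\<nu>) \<le> (LBINT y. H y * w 0 y)"
    proof -
      define f where "f = (\<lambda>x y. HN y * sck a \<eta> (y - x))"
      have [measurable]: "HN \<in> borel_measurable borel" using iHN by auto
      have fm: "case_prod f \<in> borel_measurable (\<nu> \<Otimes>\<^sub>M lborel)" unfolding f_def by measurable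
      have ic: "integrable \<nu> (\<lambda>x. A')" by simp
      have dom: "\<bar>f x y\<bar> \<le> A' * \<bar>HN y\<bar>" for x y
        unfolding f_def abs_mult using mult_right_mono[OF kb[of "y - x"] abs_ge_zero[of "HN y"]] by (simp add: mult_ac)
      note fub = fubini_dominated[OF \<nu>.sigma_finite_measure_axioms lborel_sigma_finite fm ic integrable_abs[OF iHN] dom]
      have f1: "(LBINT y. f x y) = cv a \<eta> HN x" for x by (simp add: f_def cv_def)
      have f2: "(\<integral>x. f x y \<partial>\<nu>) = H y * w 0 y" for y
        using wsupp[of y 0] by (cases "y \<in> N (2 * \<eta>)") (auto simp: f_def HN_def w0)
      have "(\<integral>x. H x \<partial>\<nu>) \<le> (\<integral>x. cv a \<eta> HN x \<partial>\<nu>)"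
      proof (rule integral_mono_AE[OF H\<nu>])
        show "integrable \<nu> (\<lambda>x. cv a \<eta> HN x)" using fub(2) unfolding f1 .
        show "AE x in \<nu>. H x \<le> cv a \<eta> HN x"
          using sub\<nu> \<nu>Q
        proof eventually_elim
          case (elim x)
          hence "x \<in> N \<eta>" using \<eta> by (simp add: N_def)
          hence "cball x \<eta> \<subseteq> N (2 * \<eta>)" using Nball[of x \<eta> \<eta>] by simp
          thus ?case using elim unfolding HN_def by (simp add: cv_indicator[OF a \<eta>])
        qed
      qed
      thus ?thesis using fub(1) unfolding f1 f2 by simp
    qed
    have iHG: "integrable lborel (\<lambda>y. H y * G n y)" for n
      by (rule locint_mult(1)[OF H2 Nc[of "2 * \<eta>"] order.refl, of _ Cg])
        (use Gnn Gle wsupp \<eta> in \<open>auto simp: G_def\<close>)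
    \<comment> \<open>Invariant of the stopped walk: the mass that has left, together with the mass
      just moved, dominates the integral against \<open>\<nu>\<close>.\<close>
    have ind: "(\<integral>x. H x \<partial>\<nu>) \<le> (LBINT y. H y * G n y) + (LBINT y. H y * w n y)" for n
    proof (induction n)
      case 0 thus ?case using base by (simp add: G_def)
    next
      case (Suc n)
      have "(LBINT x. indicator U x * (H x * w n x)) \<le> (LBINT x. indicator U x * w n x * cv a \<eta> H x)"
      proof (rule integral_mono_AE[OF iU[OF H2] stepi[OF H2]])
        show "AE x in lborel. indicator U x * (H x * w n x) \<le> indicator U x * w n x * cv a \<eta> H x"
          using sub2
        proof eventually_elim
          case (elim x)
          show ?case
          proof (cases "x \<in> U")
            case True
            hence "H x \<le> cv a \<eta> H x" using elim UN by auto
            hence "w n x * H x \<le> w n x * cv a \<eta> H x" using wnn by (rule mult_left_mono)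
            thus ?thesis using True by (simp add: mult_ac)
          qed simp
        qed
      qed
      hence le: "(LBINT x. indicator U x * (H x * w n x)) \<le> (LBINT y. H y * w (Suc n) y)"
        unfolding step[OF H2] .
      have "(LBINT y. H y * G (Suc n) y) = (LBINT y. H y * G n y + indicator (- U) y * (H y * w n y))"
        by (intro Bochner_Integration.integral_cong) (auto simp: G_def algebra_simps)
      also have "\<dots> = (LBINT y. H y * G n y) + (LBINT y. indicator (- U) y * (H y * w n y))"
        by (rule Bochner_Integration.integral_add[OF iHG iUc[OF H2]])
      finally show ?case using Suc le split[OF H2, of n] by linarith
    qed
    have lim1: "(\<lambda>n. LBINT y. H y * G n y) \<longlonglongrightarrow> (LBINT y. H y * g1 y)"
    proof (rule integral_dominated_convergence[where w="\<lambda>y. Cg * \<bar>HN y\<bar>"])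
      show "integrable lborel (\<lambda>y. Cg * \<bar>HN y\<bar>)" using iHN by (intro integrable_mult_right integrable_abs)
      show "AE y in lborel. (\<lambda>n. H y * G n y) \<longlonglongrightarrow> H y * g1 y" by (intro AE_I2 tendsto_mult tendsto_const Glim)
      show "AE y in lborel. norm (H y * G n y) \<le> Cg * \<bar>HN y\<bar>" for n
      proof (rule AE_I2)
        fix y
        show "norm (H y * G n y) \<le> Cg * \<bar>HN y\<bar>"
        proof (cases "y \<in> N (2 * \<eta>)")
          case True
          have "\<bar>H y\<bar> * \<bar>G n y\<bar> \<le> \<bar>H y\<bar> * Cg" using Gnn[of n y] Gle[of n y] by (intro mult_left_mono) auto
          thus ?thesis using True by (simp add: HN_def abs_mult mult_ac)
        qed (simp add: G_def wsupp HN_def)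
      qed
    qed measurable
    \<comment> \<open>The mass still in motion disappears in the limit, uniformly as a density,
      because \<open>m n\<close> tends to 0.\<close>
    have lim2: "(\<lambda>n. LBINT y. H y * w (Suc n) y) \<longlonglongrightarrow> 0"
    proof (rule Lim_null_comparison)
      show "(\<lambda>n. (A' * m n) * (LBINT y. indicator (N (2 * \<eta>)) y * \<bar>H y\<bar>)) \<longlonglongrightarrow> 0"
        using mlim by (auto intro!: tendsto_eq_intros)
      show "eventually (\<lambda>n. norm (LBINT y. H y * w (Suc n) y) \<le> (A' * m n) * (LBINT y. indicator (N (2 * \<eta>)) y * \<bar>H y\<bar>)) sequentially"
      proof (intro always_eventually allI)
        fix n
        show "norm (LBINT y. H y * w (Suc n) y) \<le> (A' * m n) * (LBINT y. indicator (N (2 * \<eta>)) y * \<bar>H y\<bar>)"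
          unfolding real_norm_def using \<eta> wSb[of n] wnn[of "Suc n"] wsupp[of _ "Suc n"]
          by (intro locint_mult(2)[OF H2 Nc]) auto
      qed
    qed
    have lim3: "(\<lambda>n. (LBINT y. H y * G (Suc n) y) + (LBINT y. H y * w (Suc n) y)) \<longlonglongrightarrow> (LBINT y. H y * g1 y) + 0"
      by (intro tendsto_add LIMSEQ_Suc[OF lim1] lim2)
    have A1: "(\<integral>x. H x \<partial>\<nu>) \<le> (LBINT y. H y * g1 y)"
      using LIMSEQ_le_const[OF lim3, of "\<integral>x. H x \<partial>\<nu>"] ind by auto
    define H3 where "H3 = (\<lambda>y. indicator (N (3 * \<eta>)) y * H y)"
    have iH3: "integrable lborel H3" unfolding H3_def using Hmono[of "3 * \<eta>"] Nc[of "3 * \<eta>"] \<eta> by (auto simp: locint_def)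
    obtain c Rr where cR: "N (2 * \<eta>) \<subseteq> cball c Rr"
      using compact_imp_bounded[OF Nc[of "2 * \<eta>"]] \<eta> unfolding bounded_subset_cball by auto
    have g1b: "\<bar>g1 y\<bar> \<le> Cg" for y using g1nn[of y] g1le[of y] by simp
    have g1c: "g1 y = 0" if "y \<notin> cball c Rr" for y using that cR by (intro g1supp) auto
    note adj = cv_adjoint[OF iH3 g1m g1b g1c a \<eta>2]
    have eq1: "g1 y * cv a (\<eta> / 2) H3 y = g1 y * cv a (\<eta> / 2) H y" for y
    proof (cases "y \<in> N (2 * \<eta>)")
      case True
      have "N (2 * \<eta> + \<eta> / 2) \<subseteq> N (3 * \<eta>)" using \<eta> by (auto simp: N_def)
      hence "cball y (\<eta> / 2) \<subseteq> N (3 * \<eta>)" using Nball[OF True, of "\<eta> / 2"] by blast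
      thus ?thesis unfolding H3_def by (simp add: cv_indicator[OF a \<eta>2])
    qed (simp add: g1supp)
    have eq2: "H3 y * cv a (\<eta> / 2) g1 y = H y * g0 y" for y
      using supp[of y] by (cases "y \<in> N (3 * \<eta>)") (auto simp: H3_def g0_def N_def)
    have "(LBINT y. H y * g1 y) \<le> (LBINT y. g1 y * cv a (\<eta> / 2) H y)"
    proof (rule integral_mono_AE)
      show "integrable lborel (\<lambda>y. H y * g1 y)"
        by (rule locint_mult(1)[OF H2 Nc[of "2 * \<eta>"] order.refl g1m g1b]) (use g1supp \<eta> in auto)
      show "integrable lborel (\<lambda>y. g1 y * cv a (\<eta> / 2) H y)" using adj(2) unfolding eq1 .
      show "AE y in lborel. H y * g1 y \<le> g1 y * cv a (\<eta> / 2) H y"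
        using sub2
      proof eventually_elim
        case (elim y)
        show ?case
        proof (cases "y \<in> N (2 * \<eta>)")
          case True
          hence "g1 y * H y \<le> g1 y * cv a (\<eta> / 2) H y" using elim g1nn by (intro mult_left_mono) auto
          thus ?thesis by (simp add: mult.commute)
        qed (simp add: g1supp)
      qed
    qed
    also have "\<dots> = (LBINT y. H y * g0 y)" using adj(1) unfolding eq1 eq2 .
    finally show "(\<integral>x. H x \<partial>\<nu>) \<le> (LBINT x. H x * g0 x)" using A1 by linarith
  qed
qed

subsection \<open>Superpositions of averaging kernels of variable radius\<close>

text \<open>Fubini turns a weighted family of averages of \<open>H\<close> into one integral of
  \<open>H\<close> against a density. On the compact set \<open>X\<close> the radii are bounded
  below, which keeps all derivatives of the kernels integrable against \<open>T\<close>.\<close>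

lemma superposed_kernel:
  fixes a T :: "'a::euclidean_space \<Rightarrow> real" and \<rho> :: "'a \<Rightarrow> real"
  assumes moll: "mollifier a" and X: "compact X" and \<rho>: "continuous_on X \<rho>" "\<forall>x\<in>X. 0 < \<rho> x"
    and T: "integrable lborel T" "\<forall>x. 0 \<le> T x" "\<forall>x. x \<notin> X \<longrightarrow> T x = 0"
    and L: "compact L" "\<forall>x\<in>X. cball x (\<rho> x) \<subseteq> L"
  shows "\<exists>g. smooth_on UNIV g \<and> (\<forall>y. 0 \<le> g y) \<and> (\<forall>y. y \<notin> L \<longrightarrow> g y = 0) \<and>
    (\<forall>H. locint L H \<longrightarrow> (LBINT x. T x * cv a (\<rho> x) H x) = (LBINT y. H y * g y) \<and>
       integrable lborel (\<lambda>x. T x * cv a (\<rho> x) H x) \<and> integrable lborel (\<lambda>y. H y * g y))"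
proof -
  note a = mollifier_kern[OF moll]
  note [measurable] = kernD(6)[OF a]
  obtain A where A: "\<And>x. a x \<le> A" "A > 0" using kern_bound[OF a] by metis
  have [measurable]: "T \<in> borel_measurable borel" using T(1) by auto
  have Xb[measurable]: "X \<in> sets borel" using X by (rule borel_compact)
  have Lb[measurable]: "L \<in> sets borel" using L(1) by (rule borel_compact)
  obtain c where c: "c > 0" "\<forall>x\<in>X. c \<le> \<rho> x"
  proof (cases "X = {}")
    case False
    then obtain x0 where "x0 \<in> X" "\<forall>y\<in>X. \<rho> x0 \<le> \<rho> y"
      using continuous_attains_inf[OF X _ \<rho>(1)] by blast
    thus ?thesis using \<rho>(2) that[of "\<rho> x0"] by blast
  qed (use that[of 1] in auto)
  \<comment> \<open>Outside \<open>X\<close> the radius is replaced by the lower bound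
    \<open>c\<close>, which makes it measurable and positive everywhere; \<open>T\<close> vanishes
    there.\<close>
  define r where "r = (\<lambda>x. if x \<in> X then \<rho> x else c)"
  have rX: "r x = \<rho> x" if "x \<in> X" for x using that by (simp add: r_def)
  have rc: "c \<le> r x" for x using c by (simp add: r_def)
  have rpos: "0 < r x" for x using rc[of x] c(1) by linarith
  have [measurable]: "r \<in> borel_measurable borel"
  proof -
    have "(\<lambda>x. indicator X x *\<^sub>R \<rho> x) \<in> borel_measurable borel"
      by (rule borel_measurable_continuous_on_indicator[OF Xb \<rho>(1)])
    hence "(\<lambda>x. indicator X x *\<^sub>R \<rho> x + indicator (- X) x * c) \<in> borel_measurable borel" by measurable
    also have "(\<lambda>x. indicator X x *\<^sub>R \<rho> x + indicator (- X) x * c) = r" by (auto simp: r_def fun_eq_iff)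
    finally show ?thesis .
  qed
  define k where "k = (\<lambda>x y. sck a (r x) (y - x))"
  have km[measurable]: "(\<lambda>(x, y). k x y) \<in> borel_measurable (borel \<Otimes>\<^sub>M borel)" unfolding k_def sck_def by measurable
  define B where "B = A / c ^ DIM('a)"
  have kb: "\<bar>k x y\<bar> \<le> B" for x y
  proof -
    have "\<bar>k x y\<bar> \<le> A / r x ^ DIM('a)" unfolding k_def by (rule sck_bound[OF a rpos A(1)])
    also have "\<dots> \<le> B" unfolding B_def using rc[of x] c(1) A(2) rpos[of x] by (intro divide_left_mono power_mono) auto
    finally show ?thesis .
  qed
  have knn: "0 \<le> k x y" for x y unfolding k_def by (rule sck_nonneg[OF a rpos])
  have k0: "T x * k x y = 0" if "y \<notin> L" for x y
  proof (cases "x \<in> X")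
    case True
    hence "y \<notin> cball x (\<rho> x)" using L(2) that by blast
    hence "r x \<le> norm (y - x)" using rX[OF True] by (simp add: dist_norm norm_minus_commute)
    thus ?thesis by (simp add: k_def sck_zero[OF a rpos])
  qed (use T(3) in simp)
  define g where "g = (\<lambda>y. LBINT x. T x * k x y)"
  show ?thesis
  proof (intro exI[of _ g] conjI allI impI)
    show "smooth_on UNIV g"
      unfolding smooth_on_def
    proof
      fix n
      have eq: "g = (\<lambda>y. LBINT x. (T x / r x ^ DIM('a)) * a ((1 / r x) *\<^sub>R y + (- x /\<^sub>R r x)))"
        unfolding g_def k_def sck_def by (simp add: scaleR_diff_right divide_inverse mult_ac)
      show "Ck_on n UNIV g"
        unfolding eq
      proof (rule Ck_on_superposition)
        show "Ck_on n UNIV a" using moll by (simp add: mollifier_def smooth_on_def)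
        show "a z = 0" if "norm z > 1" for z using kernD(3)[OF a] that by auto
        show "integrable lborel (\<lambda>x. \<bar>T x / r x ^ DIM('a)\<bar> * \<bar>1 / r x\<bar> ^ n)" for n
        proof (rule Bochner_Integration.integrable_bound)
          show "integrable lborel (\<lambda>x. T x * (1 / (c ^ DIM('a) * c ^ n)))" using T(1) by (intro integrable_mult_left)
          show "AE x in lborel. norm (\<bar>T x / r x ^ DIM('a)\<bar> * \<bar>1 / r x\<bar> ^ n) \<le> norm (T x * (1 / (c ^ DIM('a) * c ^ n)))"
          proof (rule AE_I2)
            fix x
            have le: "c ^ DIM('a) * c ^ n \<le> r x ^ DIM('a) * r x ^ n"
              using c(1) rc[of x] rpos[of x] by (intro mult_mono power_mono) auto
            have "norm (\<bar>T x / r x ^ DIM('a)\<bar> * \<bar>1 / r x\<bar> ^ n) = T x * (1 / (r x ^ DIM('a) * r x ^ n))"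
              using T(2) rpos[of x] by (simp add: power_divide)
            also have "\<dots> \<le> T x * (1 / (c ^ DIM('a) * c ^ n))"
              using T(2) c(1) le rpos[of x] by (intro mult_left_mono divide_left_mono) auto
            also have "\<dots> \<le> norm (T x * (1 / (c ^ DIM('a) * c ^ n)))" unfolding real_norm_def by (rule abs_ge_self)
            finally show "norm (\<bar>T x / r x ^ DIM('a)\<bar> * \<bar>1 / r x\<bar> ^ n) \<le> norm (T x * (1 / (c ^ DIM('a) * c ^ n)))" .
          qed
        qed measurable
      qed measurable
    qed
    show "0 \<le> g y" for y unfolding g_def using T(2) knn by (intro integral_nonneg_AE AE_I2) simp
    show g0: "g y = 0" if "y \<notin> L" for y unfolding g_def k0[OF that] by simp
    fix H assume H: "locint L H"
    have [measurable]: "H \<in> borel_measurable borel" using H by (simp add: locint_def)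
    have iHL: "integrable lborel (\<lambda>y. indicator L y * H y)" using H L(1) by (auto simp: locint_def)
    define f where "f = (\<lambda>x y. T x * (indicator L y * H y * k x y))"
    have fm: "case_prod f \<in> borel_measurable (lborel \<Otimes>\<^sub>M lborel)" unfolding f_def by measurable
    have iT: "integrable lborel (\<lambda>x. B * T x)" using T(1) by simp
    have dom: "\<bar>f x y\<bar> \<le> (B * T x) * \<bar>indicator L y * H y\<bar>" for x y
    proof -
      have "\<bar>f x y\<bar> = (T x * \<bar>indicator L y * H y\<bar>) * \<bar>k x y\<bar>" using T(2) by (simp add: f_def abs_mult)
      also have "\<dots> \<le> (T x * \<bar>indicator L y * H y\<bar>) * B" using T(2) by (intro mult_left_mono kb) simp
      finally show ?thesis by (simp add: mult_ac)
    qed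
    note fub = fubini_dominated[OF lborel_sigma_finite lborel_sigma_finite fm iT integrable_abs[OF iHL] dom]
    have f1: "(LBINT y. f x y) = T x * cv a (\<rho> x) H x" for x
    proof (cases "x \<in> X")
      case True
      have "f x y = T x * (H y * sck a (\<rho> x) (y - x))" for y
        using k0[of y x] by (cases "y \<in> L") (auto simp: f_def k_def rX[OF True])
      thus ?thesis by (simp add: cv_def)
    qed (simp add: f_def T(3))
    have f2: "(LBINT x. f x y) = H y * g y" for y
    proof -
      have "f x y = (indicator L y * H y) * (T x * k x y)" for x by (simp add: f_def mult_ac)
      hence "(LBINT x. f x y) = (indicator L y * H y) * g y" by (simp add: g_def)
      thus ?thesis using g0[of y] by (cases "y \<in> L") auto
    qed
    show "(LBINT x. T x * cv a (\<rho> x) H x) = (LBINT y. H y * g y)"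
      "integrable lborel (\<lambda>x. T x * cv a (\<rho> x) H x)" "integrable lborel (\<lambda>y. H y * g y)"
      using fub unfolding f1 f2 by auto
  qed
qed

subsection \<open>A maximum principle\<close>

text \<open>Among the points where the supremum over \<open>N\<close> is attained, take one that is
  extreme in a coordinate direction. Its \<open>\<eta>\<close>-ball lies in \<open>N\<close>, and
  equality in the mean makes \<open>u\<close> maximal almost everywhere on that ball, also beyond
  the extreme point. The boundary of \<open>N\<close> takes the form of a layer: the points whose
  \<open>\<eta>\<close>-ball leaves \<open>N\<close>.\<close>

lemma sbh_max_principle:
  fixes u :: "'a::euclidean_space \<Rightarrow> ereal"
  assumes u: "u \<in> sbh D" and D: "open D" and N: "compact N" "N \<subseteq> D" and \<eta>: "0 < \<eta>"
    and bd: "\<And>x. x \<in> N \<Longrightarrow> \<not> cball x \<eta> \<subseteq> N \<Longrightarrow> u x \<le> ereal m"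
    and x0: "x0 \<in> N"
  shows "u x0 \<le> ereal m"
proof (rule ccontr)
  assume "\<not> u x0 \<le> ereal m"
  hence gt: "ereal m < u x0" by simp
  obtain M where M: "\<And>x. x \<in> N \<Longrightarrow> u x \<le> ereal M" using sbh_bounded_above[OF u D N] by blast
  define s where "s = (SUP x\<in>N. u x)"
  have us: "u x \<le> s" if "x \<in> N" for x unfolding s_def using that by (rule SUP_upper)
  have sM: "s \<le> ereal M" unfolding s_def using M by (rule SUP_least)
  have sm: "ereal m < s" using gt us[OF x0] by (rule less_le_trans)
  obtain sr where sr: "s = ereal sr" using sM sm by (cases s) auto
  \<comment> \<open>The set where the supremum is attained. Upper semicontinuity makes it compact
    and, through a finite cover by sets \<open>u x < c\<close> with \<open>c < s\<close>, also
    nonempty.\<close>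
  define Z where "Z = N - {x\<in>D. u x < s}"
  have Zu: "u x = s" if "x \<in> Z" for x
  proof -
    have "x \<in> N" "\<not> u x < s" using that N(2) by (auto simp: Z_def)
    thus ?thesis using us[of x] by (simp add: not_less antisym)
  qed
  have opn: "open {x\<in>D. u x < c}" for c by (rule usc_on_open[OF sbhD(2)[OF u] D])
  have Zc: "compact Z" unfolding Z_def by (intro compact_diff N opn)
  have "Z \<noteq> {}"
  proof
    assume "Z = {}"
    hence cov: "N \<subseteq> (\<Union>c\<in>{c. c < s}. {x\<in>D. u x < c})"
    proof -
      have "\<exists>c<s. u x < c" if "x \<in> N" for x
      proof -
        have "u x < s" using \<open>Z = {}\<close> that by (auto simp: Z_def)
        thus ?thesis using dense by blast
      qed
      thus ?thesis using N(2) by blast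
    qed
    obtain I where I: "I \<subseteq> {c. c < s}" "finite I" "N \<subseteq> (\<Union>c\<in>I. {x\<in>D. u x < c})"
      by (rule compactE_image[OF N(1) opn cov]) (rule that)
    have "I \<noteq> {}" using I(3) x0 by auto
    have "u x \<le> Max I" if xN: "x \<in> N" for x
    proof -
      obtain c where c: "c \<in> I" "u x < c" using I(3) xN by blast
      hence "c \<le> Max I" using I(2) by (intro Max_ge)
      with c(2) show ?thesis by (meson less_imp_le order.trans)
    qed
    hence "s \<le> Max I" unfolding s_def by (rule SUP_least)
    moreover have "Max I < s" using Max_in[OF I(2) \<open>I \<noteq> {}\<close>] I(1) by blast
    ultimately show False by simp
  qed
  obtain i :: 'a where i: "i \<in> Basis" using nonempty_Basis by blast
  obtain z where z: "z \<in> Z" "\<And>y. y \<in> Z \<Longrightarrow> y \<bullet> i \<le> z \<bullet> i"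
    using continuous_attains_sup[OF Zc \<open>Z \<noteq> {}\<close>, of "\<lambda>y. y \<bullet> i"] continuous_on_inner[OF continuous_on_id continuous_on_const] by metis
  have uz: "u z = s" by (rule Zu[OF z(1)])
  have zN: "z \<in> N" using z(1) by (simp add: Z_def)
  have zb: "cball z \<eta> \<subseteq> N" using bd[OF zN] uz sm by (meson not_le)
  have fin: "u z \<noteq> - \<infinity>" using uz sr by simp
  have zD: "cball z \<eta> \<subseteq> D" using zb N(2) by blast
  note bm = sbh_ball_mean[OF u D \<eta> zD fin]
  let ?B = "ball z \<eta>"
  have ic: "integrable lborel (\<lambda>y. indicator ?B y * sr)"
    using emeasure_lborel_ball_finite by (intro integrable_mult_left integrable_real_indicator) auto
  have iD: "integrable lborel (\<lambda>y. indicator ?B y * sr - indicator ?B y * rl u y)" using ic bm(2) by (rule Bochner_Integration.integrable_diff)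
  have le: "AE y in lborel. y \<in> ?B \<longrightarrow> rl u y \<le> sr"
    using bm(1)
  proof eventually_elim
    case (elim y)
    show ?case
    proof
      assume y: "y \<in> ?B"
      hence "y \<in> N" using zb ball_subset_cball by blast
      hence "u y \<le> s" by (rule us)
      thus "rl u y \<le> sr" using elim y sr by (cases "u y") auto
    qed
  qed
  have nn: "AE y in lborel. 0 \<le> indicator ?B y * sr - indicator ?B y * rl u y"
    using le by eventually_elim (auto simp: indicator_def)
  have "(LBINT y. indicator ?B y * sr - indicator ?B y * rl u y) = sr * measure lborel ?B - (LBINT y. indicator ?B y * rl u y)"
    using ic bm(2) by simp
  also have "\<dots> \<le> 0" using bm(3) uz sr by simp
  finally have "(LBINT y. indicator ?B y * sr - indicator ?B y * rl u y) = 0"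
    using integral_nonneg_AE[OF nn] by linarith
  hence AE0: "AE y in lborel. indicator ?B y * sr - indicator ?B y * rl u y = 0"
    using integral_nonneg_eq_0_iff_AE[OF iD nn] by simp
  \<comment> \<open>A ball inside \<open>ball z \<eta>\<close> and strictly beyond \<open>z\<close>
    in direction \<open>i\<close>: its radius \<open>\<eta> / 4\<close> is less than the shift
    \<open>\<eta> / 2\<close>.\<close>
  let ?C = "ball (z + (\<eta> / 2) *\<^sub>R i) (\<eta> / 4)"
  have C: "y \<in> ?B \<and> z \<bullet> i < y \<bullet> i" if "y \<in> ?C" for y
  proof -
    define p where "p = y - (z + (\<eta> / 2) *\<^sub>R i)"
    have p: "norm p < \<eta> / 4" using that by (simp add: p_def dist_norm norm_minus_commute)
    have y: "y = z + (\<eta> / 2) *\<^sub>R i + p" by (simp add: p_def)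
    have "norm (y - z) \<le> norm ((\<eta> / 2) *\<^sub>R i) + norm p" unfolding y using norm_triangle_ineq[of "(\<eta> / 2) *\<^sub>R i" p] by (simp add: add.assoc)
    hence "norm (y - z) < \<eta>" using p i \<eta> by simp
    moreover have "\<bar>p \<bullet> i\<bar> < \<eta> / 4" using Basis_le_norm[OF i, of p] p by linarith
    hence "z \<bullet> i < y \<bullet> i" using i \<eta> by (simp add: y inner_add_left)
    ultimately show ?thesis by (simp add: dist_norm norm_minus_commute)
  qed
  have "AE y in lborel. y \<notin> ?C"
    using AE0 bm(1)
  proof eventually_elim
    case (elim y)
    show ?case
    proof
      assume yC: "y \<in> ?C"
      hence yB: "y \<in> ?B" and yi: "z \<bullet> i < y \<bullet> i" using C by auto
      hence "rl u y = sr" "\<bar>u y\<bar> \<noteq> \<infinity>" using elim by auto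
      hence "u y = s" using sr by (cases "u y") auto
      moreover have "y \<in> N" using yB zb by auto
      ultimately have "y \<in> Z" by (simp add: Z_def)
      thus False using z(2) yi by fastforce
    qed
  qed
  hence "emeasure lborel ?C = 0" by (subst (asm) AE_iff_measurable[of ?C]) auto
  moreover have "measure lborel ?C > 0" using \<eta> by (simp add: content_ball_pos)
  ultimately show False by (simp add: measure_def)
qed

section \<open>Linear combinations and averages up to null sets\<close>

lemma rl_mix:
  assumes "\<bar>h1 x\<bar> \<noteq> \<infinity>" "\<bar>h2 x\<bar> \<noteq> \<infinity>"
  shows "real_of_ereal (ereal s * h1 x + ereal t * h2 x) = s * rl h1 x + t * rl h2 x"
  using assms by (cases "h1 x"; cases "h2 x") auto

lemma cv_cong_AE:
  fixes a u v :: "'a::euclidean_space \<Rightarrow> real"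
  assumes a: "kern a" and [measurable]: "u \<in> borel_measurable borel" "v \<in> borel_measurable borel"
    and \<rho>: "0 < \<rho>" "cball x \<rho> \<subseteq> D" and AE: "AE y\<in>D in lborel. u y = v y"
  shows "cv a \<rho> u x = cv a \<rho> v x"
proof -
  note [measurable] = sck_measurable[OF a]
  show ?thesis
    unfolding cv_def
  proof (rule integral_cong_AE)
    show "AE y in lborel. u y * sck a \<rho> (y - x) = v y * sck a \<rho> (y - x)"
      using AE
    proof eventually_elim
      case (elim y)
      show ?case
      proof (cases "y \<in> cball x \<rho>")
        case False
        hence "\<rho> \<le> norm (y - x)" by (simp add: dist_norm norm_minus_commute)
        thus ?thesis by (simp add: sck_zero[OF a \<rho>(1)])
      qed (use elim \<rho>(2) in auto)
    qed
  qed measurable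
qed

lemma cv_linear:
  assumes a: "kern a" and "locint D u" "locint D v" and \<rho>: "0 < \<rho>" "cball x \<rho> \<subseteq> D"
  shows "cv a \<rho> (\<lambda>y. s * u y + t * v y) x = s * cv a \<rho> u x + t * cv a \<rho> v x"
proof -
  note i = cv_integrable[OF assms(2) a \<rho>] cv_integrable[OF assms(3) a \<rho>]
  have "cv a \<rho> (\<lambda>y. s * u y + t * v y) x = (LBINT y. s * (u y * sck a \<rho> (y - x)) + t * (v y * sck a \<rho> (y - x)))"
    by (simp add: cv_def algebra_simps)
  thus ?thesis using i by (simp add: cv_def)
qed

subsection \<open>Envelopes on compact sets by duality\<close>

text \<open>The test functions \<open>V h\<close> combine the constraints \<open>h \<le> F\<close> in the mean, on \<open>X\<close>, with the lower bound
  for the integral against \<open>\<nu>\<close>, stored as a constant value on \<open>U0\<close>.\<close>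

lemma envelope_L2:
  fixes D U0 X :: "'a::euclidean_space set" and \<nu> :: "'a measure" and \<rho> F :: "'a \<Rightarrow> real"
  assumes moll: "mollifier a" and D: "open D" "connected D"
    and HR: "HR \<subseteq> sbh_star D" "HR \<noteq> {}"
    and conv: "\<forall>h1\<in>HR. \<forall>h2\<in>HR. \<forall>t. 0 < t \<and> t < 1 \<longrightarrow> (\<lambda>x. ereal t * h1 x + ereal (1 - t) * h2 x) \<in> HR"
    and h\<nu>: "\<forall>h\<in>HR. integrable \<nu> (rl h) \<and> (AE x in \<nu>. \<bar>h x\<bar> \<noteq> \<infinity>)"
    and F: "locint D F" and \<rho>: "continuous_on D \<rho>" "\<forall>x\<in>D. 0 < \<rho> x \<and> cball x (\<rho> x) \<subseteq> D"
    and X: "compact X" "X \<subseteq> D" and XU: "\<forall>x\<in>X. cball x (\<rho> x) \<inter> U0 = {}"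
    and U0: "open U0" "U0 \<noteq> {}" "bounded U0"
    and g0: "smooth_on UNIV g0" "\<forall>x. 0 \<le> g0 x" "compact L0" "L0 \<subseteq> D - U0" "\<forall>x. x \<notin> L0 \<longrightarrow> g0 x = 0"
      "\<forall>h\<in>HR. (\<integral>x. rl h x \<partial>\<nu>) \<le> (LBINT x. rl h x * g0 x)"
    and Hyp: "\<And>g c. smooth_on UNIV g \<Longrightarrow> \<forall>x. 0 \<le> g x \<Longrightarrow> \<exists>L. compact L \<and> L \<subseteq> D - U0 \<and> (\<forall>x. x \<notin> L \<longrightarrow> g x = 0) \<Longrightarrow>
      \<forall>h\<in>HR. (\<integral>x. rl h x \<partial>\<nu>) \<le> (LBINT x. rl h x * g x) + c \<Longrightarrow> I \<le> (LBINT x. F x * g x) + c"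
    and e: "0 < (e::real)"
  shows "\<exists>h\<in>HR. (LBINT x. indicator X x * (max 0 (cv a (\<rho> x) (rl h) x - cv a (\<rho> x) F x))\<^sup>2) < e
     \<and> I - 1 \<le> (\<integral>x. rl h x \<partial>\<nu>)"
proof -
  note a = mollifier_kern[OF moll]
  have li: "locint D (rl h)" and fin: "AE x\<in>D in lborel. \<bar>h x\<bar> \<noteq> \<infinity>" if "h \<in> HR" for h
    using sbh_star_locint[OF D] that HR(1) by blast+
  define E where "E = X \<union> U0"
  have Xb[measurable]: "X \<in> sets borel" using X(1) by (rule borel_compact)
  have Ub[measurable]: "U0 \<in> sets borel" using U0(1) by simp
  have Eb[measurable]: "E \<in> sets borel" by (simp add: E_def)
  have disj: "x \<notin> U0" if "x \<in> X" for x
  proof -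
    have "0 < \<rho> x" using \<rho>(2) that X(2) by blast
    hence "x \<in> cball x (\<rho> x)" by simp
    thus ?thesis using XU that by blast
  qed
  \<comment> \<open>The set is bounded, hence the measure finite; \<open>U0\<close> is disjoint from
    \<open>X\<close>, so the two kinds of constraint do not interfere.\<close>
  define M where "M = restrict_space lborel E"
  have spM: "space M = E" by (simp add: M_def space_restrict_space)
  have "bounded E" using X(1) U0(3) by (simp add: E_def compact_imp_bounded)
  then obtain c R where "E \<subseteq> cball c R" unfolding bounded_subset_cball by blast
  hence "emeasure lborel E \<le> emeasure lborel (cball c R)" by (intro emeasure_mono) auto
  hence emE: "emeasure lborel E < \<infinity>" using emeasure_lborel_cball_finite[of c R] by (rule le_less_trans)
  have finM: "finite_measure M"
    unfolding M_def using emE by (intro finite_measureI) (simp add: space_restrict_space emeasure_restrict_space)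
  define f where "f = (\<lambda>x. cv a (\<rho> x) F x)"
  define hs where "hs = (\<lambda>h x. cv a (\<rho> x) (rl h) x)"
  have contf: "continuous_on X f"
    unfolding f_def by (rule continuous_on_subset[OF continuous_on_cv[OF D(1) F a \<rho>(1)] X(2)]) (use \<rho>(2) in blast)
  have conth: "continuous_on X (hs h)" if "h \<in> HR" for h
    unfolding hs_def by (rule continuous_on_subset[OF continuous_on_cv[OF D(1) li[OF that] a \<rho>(1)] X(2)]) (use \<rho>(2) in blast)
  define nu where "nu = (\<lambda>h. \<integral>x. rl h x \<partial>\<nu>)"
  \<comment> \<open>A positive value is a violation on either part. \<open>V\<close> respects convex
    combinations although the members of \<open>HR\<close> may be infinite on null sets.\<close>
  define V where "V = (\<lambda>h x. indicator X x * (hs h x - f x) + indicator (- X) x * (I - nu h))"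
  have Vm: "V h \<in> borel_measurable borel" if "h \<in> HR" for h
  proof -
    have "(\<lambda>x. indicator X x *\<^sub>R (hs h x - f x)) \<in> borel_measurable borel"
      by (intro borel_measurable_continuous_on_indicator Xb continuous_on_diff conth that contf)
    thus ?thesis unfolding V_def by simp
  qed
  have Vbd: "\<exists>c. \<forall>x\<in>space M. \<bar>V h x\<bar> \<le> c" if "h \<in> HR" for h
  proof -
    have "compact ((\<lambda>x. hs h x - f x) ` X)"
      by (intro compact_continuous_image continuous_on_diff conth that contf X(1))
    then obtain c where c: "\<forall>y\<in>(\<lambda>x. hs h x - f x) ` X. norm y \<le> c" using compact_imp_bounded bounded_iff by blast
    have "\<bar>V h x\<bar> \<le> max c \<bar>I - nu h\<bar>" for x
      using c by (cases "x \<in> X") (auto simp: V_def le_max_iff_disj)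
    thus ?thesis by blast
  qed
  have Vconv: "(\<lambda>x. (1 - t) * V h1 x + t * V h2 x) \<in> V ` HR" if h: "h1 \<in> HR" "h2 \<in> HR" and t: "0 < t" "t < 1" for h1 h2 t
  proof -
    define h where "h = (\<lambda>x. ereal (1 - t) * h1 x + ereal (1 - (1 - t)) * h2 x)"
    have hH: "h \<in> HR" unfolding h_def using conv[rule_format, OF h, of "1 - t"] t by simp
    have AEm: "AE y\<in>D in lborel. rl h y = (1 - t) * rl h1 y + t * rl h2 y"
      using fin[OF h(1)] fin[OF h(2)]
      by eventually_elim (auto simp: h_def rl_mix)
    have AE\<nu>: "AE y in \<nu>. rl h y = (1 - t) * rl h1 y + t * rl h2 y"
      using h\<nu>[rule_format, OF h(1), THEN conjunct2] h\<nu>[rule_format, OF h(2), THEN conjunct2]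
      by eventually_elim (auto simp: h_def rl_mix)
    have bm: "rl h1 \<in> borel_measurable borel" "rl h2 \<in> borel_measurable borel" "rl h \<in> borel_measurable borel"
      using li h hH by (auto simp: locint_def)
    have hsm: "hs h x = (1 - t) * hs h1 x + t * hs h2 x" if "x \<in> X" for x
    proof -
      have r: "0 < \<rho> x" "cball x (\<rho> x) \<subseteq> D" using \<rho>(2) X(2) that by auto
      have "hs h x = cv a (\<rho> x) (\<lambda>y. (1 - t) * rl h1 y + t * rl h2 y) x"
        unfolding hs_def by (rule cv_cong_AE[OF a _ _ r AEm]) (use bm in auto)
      thus ?thesis unfolding hs_def using cv_linear[OF a li[OF h(1)] li[OF h(2)] r] by simp
    qed
    have num: "nu h = (1 - t) * nu h1 + t * nu h2"
    proof -
      have i: "integrable \<nu> (rl h1)" "integrable \<nu> (rl h2)" "integrable \<nu> (rl h)" using h\<nu> h hH by auto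
      have "nu h = (\<integral>y. (1 - t) * rl h1 y + t * rl h2 y \<partial>\<nu>)"
        unfolding nu_def by (rule integral_cong_AE) (use i AE\<nu> in auto)
      thus ?thesis using i by (simp add: nu_def)
    qed
    have "(\<lambda>x. (1 - t) * V h1 x + t * V h2 x) = V h"
    proof
      fix x
      show "(1 - t) * V h1 x + t * V h2 x = V h x"
        by (cases "x \<in> X") (simp_all add: V_def hsm num algebra_simps)
    qed
    thus ?thesis using hH by blast
  qed
  have intM: "(\<integral>x. p x \<partial>M) = (LBINT x. indicator E x * p x)" for p :: "'a \<Rightarrow> real"
    unfolding M_def by (subst integral_restrict_space) auto
  \<comment> \<open>The bound by the volume of \<open>U0\<close> encodes the second requirement: a
    deficit \<open>I - nu h \<ge> 1\<close> would by itself contribute that volume to the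
    integral.\<close>
  define e' where "e' = min e (measure lborel U0)"
  have volU: "0 < measure lborel U0"
  proof -
    obtain x r where "0 < r" "ball x r \<subseteq> U0" using U0(1,2) open_contains_ball by blast
    moreover have "emeasure lborel U0 < \<infinity>" using emE by (rule le_less_trans[rotated]) (auto intro!: emeasure_mono simp: E_def)
    ultimately have "measure lborel (ball x r) \<le> measure lborel U0"
      by (intro measure_mono_fmeasurable) (auto simp: fmeasurable_def)
    moreover have "0 < measure lborel (ball x r)" by (rule content_ball_pos[OF \<open>0 < r\<close>])
    ultimately show ?thesis by linarith
  qed
  have e': "0 < e'" using e volU by (simp add: e'_def)
  have "\<exists>h\<in>HR. (\<integral>x. (max 0 (V h x))\<^sup>2 \<partial>M) < e'"
  proof (rule ccontr)
    assume neg: "\<not> ?thesis"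
    have "\<exists>t d. 0 < d \<and> integrable M t \<and> (\<forall>x. 0 \<le> t x) \<and> (\<forall>W\<in>V ` HR. d \<le> (\<integral>x. t x * W x \<partial>M))"
    proof (rule convex_L2_separation[OF finM _ _ _ _ e'])
      show "V ` HR \<noteq> {}" using HR(2) by simp
      show "W \<in> borel_measurable M" if "W \<in> V ` HR" for W
        using that Vm unfolding M_def by (auto intro!: measurable_restrict_space1)
      show "\<exists>c. \<forall>x\<in>space M. \<bar>W x\<bar> \<le> c" if "W \<in> V ` HR" for W using that Vbd by blast
      show "(\<lambda>x. (1 - t) * W1 x + t * W2 x) \<in> V ` HR" if "W1 \<in> V ` HR" "W2 \<in> V ` HR" "0 < t" "t < 1" for W1 W2 t
        using that Vconv by blast
      show "e' \<le> (\<integral>x. (max 0 (W x))\<^sup>2 \<partial>M)" if "W \<in> V ` HR" for W using that neg by fastforce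
    qed
    then obtain t d where d: "0 < d" and ti: "integrable M t" and tnn: "\<forall>x. 0 \<le> t x"
      and tV: "\<forall>h\<in>HR. d \<le> (\<integral>x. t x * V h x \<partial>M)" by blast
    have tE: "integrable lborel (\<lambda>x. indicator E x * t x)"
      using ti unfolding M_def by (subst (asm) integrable_restrict_space) auto
    \<comment> \<open>The separating density splits into a weight \<open>T\<close> for the averages
      and one number \<open>s\<close>, the weight of the constraint for
      \<open>\<nu>\<close>.\<close>
    define T where "T = (\<lambda>x. indicator X x * t x)"
    define s where "s = (LBINT x. indicator U0 x * t x)"
    have iT: "integrable lborel T"
    proof -
      have "integrable lborel (\<lambda>x. indicator X x *\<^sub>R (indicator E x * t x))" by (intro integrable_mult_indicator tE) simp
      also have "(\<lambda>x. indicator X x *\<^sub>R (indicator E x * t x)) = T" by (auto simp: T_def E_def indicator_def fun_eq_iff)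
      finally show ?thesis .
    qed
    have iU: "integrable lborel (\<lambda>x. indicator U0 x * t x)"
    proof -
      have "integrable lborel (\<lambda>x. indicator U0 x *\<^sub>R (indicator E x * t x))" by (intro integrable_mult_indicator tE) simp
      also have "(\<lambda>x. indicator U0 x *\<^sub>R (indicator E x * t x)) = (\<lambda>x. indicator U0 x * t x)" by (auto simp: E_def indicator_def fun_eq_iff)
      finally show ?thesis .
    qed
    have s0: "0 \<le> s" unfolding s_def using tnn by (intro integral_nonneg_AE AE_I2) simp
    \<comment> \<open>The union of the closed balls of averaging, as a continuous image of a compact
      set; it carries the density \<open>g\<close>.\<close>
    define L where "L = (\<lambda>(x, z). x + \<rho> x *\<^sub>R z) ` (X \<times> cball 0 1)"
    have contL: "continuous_on (X \<times> cball 0 1) (\<lambda>(x, z). x + \<rho> x *\<^sub>R z)"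
    proof -
      have "continuous_on (X \<times> cball (0::'a) 1) (\<lambda>p. \<rho> (fst p))"
        by (rule continuous_on_compose2[OF continuous_on_subset[OF \<rho>(1) X(2)] continuous_on_fst[OF continuous_on_id]]) auto
      thus ?thesis unfolding case_prod_beta by (intro continuous_intros)
    qed
    have Lc: "compact L" unfolding L_def by (intro compact_continuous_image contL compact_Times X(1) compact_cball)
    have Lin: "y \<in> L \<Longrightarrow> \<exists>x\<in>X. y \<in> cball x (\<rho> x)" for y
    proof -
      assume "y \<in> L"
      then obtain x z where xz: "x \<in> X" "norm z \<le> 1" "y = x + \<rho> x *\<^sub>R z" by (auto simp: L_def)
      have "0 < \<rho> x" using \<rho>(2) X(2) xz(1) by auto
      hence "\<rho> x * norm z \<le> \<rho> x * 1" using xz(2) by (intro mult_left_mono) auto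
      hence "y \<in> cball x (\<rho> x)" using xz(3) \<open>0 < \<rho> x\<close> by (simp add: dist_norm)
      thus ?thesis using xz(1) by blast
    qed
    have LD: "L \<subseteq> D - U0" using Lin \<rho>(2) X(2) XU by blast
    have Lcov: "\<forall>x\<in>X. cball x (\<rho> x) \<subseteq> L"
    proof (intro ballI subsetI)
      fix x y assume x: "x \<in> X" and y: "y \<in> cball x (\<rho> x)"
      have p: "0 < \<rho> x" using \<rho>(2) X(2) x by auto
      have "norm (y - x) \<le> \<rho> x" using y by (simp add: dist_norm norm_minus_commute)
      moreover have "norm ((y - x) /\<^sub>R \<rho> x) = norm (y - x) / \<rho> x" using p by (simp only: norm_scaleR abs_inverse abs_of_pos divide_inverse mult.commute)
      ultimately have "norm ((y - x) /\<^sub>R \<rho> x) \<le> 1" using p by simp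
      moreover have "y = x + \<rho> x *\<^sub>R ((y - x) /\<^sub>R \<rho> x)" using p by simp
      ultimately show "y \<in> L" unfolding L_def using x by (intro image_eqI[of _ _ "(x, (y - x) /\<^sub>R \<rho> x)"]) auto
    qed
    have "\<exists>g. smooth_on UNIV g \<and> (\<forall>y. 0 \<le> g y) \<and> (\<forall>y. y \<notin> L \<longrightarrow> g y = 0) \<and>
      (\<forall>H. locint L H \<longrightarrow> (LBINT x. T x * cv a (\<rho> x) H x) = (LBINT y. H y * g y) \<and>
       integrable lborel (\<lambda>x. T x * cv a (\<rho> x) H x) \<and> integrable lborel (\<lambda>y. H y * g y))"
      using \<rho>(2) X(2) tnn
      by (intro superposed_kernel[OF moll X(1) continuous_on_subset[OF \<rho>(1) X(2)] _ iT _ _ Lc Lcov]) (auto simp: T_def)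
    then obtain g where g: "smooth_on UNIV g" "\<forall>y. 0 \<le> g y" "\<forall>y. y \<notin> L \<longrightarrow> g y = 0"
      and gH: "\<forall>H. locint L H \<longrightarrow> (LBINT x. T x * cv a (\<rho> x) H x) = (LBINT y. H y * g y) \<and>
       integrable lborel (\<lambda>x. T x * cv a (\<rho> x) H x) \<and> integrable lborel (\<lambda>y. H y * g y)" by blast
    have Lsub: "locint L H" if "locint D H" for H using that LD unfolding locint_def by blast
    define Fg where "Fg = (LBINT y. F y * g y)"
    have main: "d \<le> (LBINT y. rl h y * g y) - Fg + (I - nu h) * s" if h: "h \<in> HR" for h
    proof -
      have ih: "(LBINT x. T x * hs h x) = (LBINT y. rl h y * g y)" "integrable lborel (\<lambda>x. T x * hs h x)"
        using gH Lsub[OF li[OF h]] unfolding hs_def by blast+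
      have iF: "(LBINT x. T x * f x) = Fg" "integrable lborel (\<lambda>x. T x * f x)"
        using gH Lsub[OF F] unfolding f_def Fg_def by blast+
      have "d \<le> (LBINT x. indicator E x * (t x * V h x))" using tV h unfolding intM by blast
      also have "\<dots> = (LBINT x. (T x * hs h x - T x * f x) + (indicator U0 x * t x) * (I - nu h))"
      proof (intro Bochner_Integration.integral_cong refl)
        fix x
        show "indicator E x * (t x * V h x) = (T x * hs h x - T x * f x) + (indicator U0 x * t x) * (I - nu h)"
          using disj[of x] by (cases "x \<in> X"; cases "x \<in> U0") (auto simp: T_def V_def E_def algebra_simps)
      qed
      also have "\<dots> = (LBINT y. rl h y * g y) - Fg + (I - nu h) * s"
        using ih iF iU by (simp add: s_def)
      finally show ?thesis .
    qed
    have Lex: "\<exists>L. compact L \<and> L \<subseteq> D - U0 \<and> (\<forall>x. x \<notin> L \<longrightarrow> g x = 0)" using Lc LD g(3) by blast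
    have ghi: "integrable lborel (\<lambda>y. rl h y * g y)" if "h \<in> HR" for h using gH Lsub[OF li[OF that]] by blast
    have Fgi: "integrable lborel (\<lambda>y. F y * g y)" using gH Lsub[OF F] by blast
    have g0c: "continuous_on UNIV g0" using g0(1) Ck_on_imp_continuous_on[of 0 UNIV g0] unfolding smooth_on_def by blast
    have g0i: "integrable lborel (\<lambda>y. H y * g0 y)" if "locint D H" for H
    proof -
      have "compact (g0 ` L0)" by (intro compact_continuous_image continuous_on_subset[OF g0c] g0(3)) auto
      then obtain B where B: "\<forall>y\<in>g0 ` L0. norm y \<le> B" using compact_imp_bounded bounded_iff by blast
      show ?thesis
      proof (rule locint_mult(1)[OF that g0(3)])
        show "L0 \<subseteq> D" using g0(4) by blast
        show "g0 \<in> borel_measurable borel" by (rule borel_measurable_continuous_onI[OF g0c])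
        show "\<bar>g0 y\<bar> \<le> max B 0" for y using B g0(5) by (cases "y \<in> L0") (auto simp: le_max_iff_disj)
        show "g0 y = 0" if "y \<notin> L0" for y using g0(5) that by blast
      qed
    qed
    have smooth_comb: "smooth_on UNIV (\<lambda>x. p * g0 x + q * g x)" for p q
    proof -
      have Ck: "Ck_on n UNIV (\<lambda>x. p * u x + q * v x)" if "Ck_on n UNIV u" "Ck_on n UNIV v" for n and u v :: "'a \<Rightarrow> real"
        using that
      proof (induction n arbitrary: u v)
        case 0 thus ?case by (auto intro!: continuous_intros)
      next
        case (Suc n)
        have "u differentiable (at x)" "v differentiable (at x)" for x using Suc.prems by simp_all
        hence du: "(u has_derivative frechet_derivative u (at x)) (at x)" and dv: "(v has_derivative frechet_derivative v (at x)) (at x)" for x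
          unfolding frechet_derivative_works by blast+
        have d: "((\<lambda>x. p * u x + q * v x) has_derivative (\<lambda>h. p * frechet_derivative u (at x) h + q * frechet_derivative v (at x) h)) (at x)" for x
          by (intro has_derivative_add has_derivative_mult_right du dv)
        have fr: "frechet_derivative (\<lambda>x. p * u x + q * v x) (at x) = (\<lambda>h. p * frechet_derivative u (at x) h + q * frechet_derivative v (at x) h)" for x
          using frechet_derivative_at[OF d] by simp
        have "(\<lambda>x. p * u x + q * v x) differentiable (at x)" for x using d unfolding differentiable_def by blast
        moreover have "Ck_on n UNIV (\<lambda>x. p * frechet_derivative u (at x) i + q * frechet_derivative v (at x) i)" if "i \<in> Basis" for i
          using Suc.prems that by (intro Suc.IH) auto
        ultimately show ?case by (simp add: fr)
      qed
      show ?thesis using Ck g0(1) g(1) unfolding smooth_on_def by blast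
    qed
    show False
    proof (cases "s = 0")
      case False
      hence sp: "0 < s" using s0 by simp
      \<comment> \<open>If the constraint for \<open>\<nu>\<close> has positive weight, division by
        \<open>s\<close> gives a swept density, and the strict gain \<open>d\<close> contradicts the
        choice of \<open>I\<close>.\<close>
      define g' where "g' = (\<lambda>x. 0 * g0 x + (1 / s) * g x)"
      have i1: "(LBINT y. H y * g' y) = (LBINT y. H y * g y) / s" for H by (simp add: g'_def)
      have "I \<le> (LBINT x. F x * g' x) + (- (d + Fg - I * s) / s)"
      proof (rule Hyp)
        show "smooth_on UNIV g'" unfolding g'_def by (rule smooth_comb)
        show "\<forall>x. 0 \<le> g' x" using g(2) sp by (simp add: g'_def)
        show "\<exists>L. compact L \<and> L \<subseteq> D - U0 \<and> (\<forall>x. x \<notin> L \<longrightarrow> g' x = 0)" using Lc LD g(3) by (intro exI[of _ L]) (simp add: g'_def)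
        show "\<forall>h\<in>HR. (\<integral>x. rl h x \<partial>\<nu>) \<le> (LBINT x. rl h x * g' x) + (- (d + Fg - I * s) / s)"
        proof
          fix h assume "h \<in> HR"
          hence "nu h * s \<le> (LBINT y. rl h y * g y) - (d + Fg - I * s)" using main[of h] by (simp add: algebra_simps)
          hence "nu h \<le> ((LBINT y. rl h y * g y) - (d + Fg - I * s)) / s" using sp by (simp add: pos_le_divide_eq)
          thus "(\<integral>x. rl h x \<partial>\<nu>) \<le> (LBINT x. rl h x * g' x) + (- (d + Fg - I * s) / s)"
            unfolding i1 nu_def by (simp add: diff_divide_distrib add_divide_distrib)
        qed
      qed
      hence "I * s \<le> ((LBINT y. F y * g y) / s + (- (d + Fg - I * s) / s)) * s"
        unfolding i1 using sp by (intro mult_right_mono) auto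
      also have "\<dots> = Fg - (d + Fg - I * s)" using sp by (simp add: Fg_def distrib_right)
      finally show False using d by simp
    next
      case True
      define F0 where "F0 = (LBINT y. F y * g0 y)"
      \<comment> \<open>With weight 0 the functional says nothing about \<open>\<nu>\<close>, so the
        swept density \<open>g0\<close> is the base. Adding \<open>k\<close> times \<open>g\<close>
        keeps the sweeping with constant \<open>- k * (d + Fg)\<close> and lowers the bound by
        \<open>k * d\<close>, for every \<open>k \<ge> 0\<close>.\<close>
      have ineq: "I \<le> F0 - k * d" if k: "0 \<le> k" for k
      proof -
        define g' where "g' = (\<lambda>x. 1 * g0 x + k * g x)"
        have i1: "(LBINT y. H y * g' y) = (LBINT y. H y * g0 y) + k * (LBINT y. H y * g y)"
          if "locint D H" "integrable lborel (\<lambda>y. H y * g y)" for H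
        proof -
          have "(LBINT y. H y * g' y) = (LBINT y. H y * g0 y + k * (H y * g y))"
            by (simp add: g'_def algebra_simps)
          thus ?thesis using g0i[OF that(1)] that(2) by simp
        qed
        have "I \<le> (LBINT x. F x * g' x) + (- k * (d + Fg))"
        proof (rule Hyp)
          show "smooth_on UNIV g'" unfolding g'_def by (rule smooth_comb)
          show "\<forall>x. 0 \<le> g' x" using g(2) g0(2) k by (simp add: g'_def)
          show "\<exists>L. compact L \<and> L \<subseteq> D - U0 \<and> (\<forall>x. x \<notin> L \<longrightarrow> g' x = 0)"
            using Lc LD g(3) g0(3,4,5) by (intro exI[of _ "L \<union> L0"]) (auto simp: g'_def)
          show "\<forall>h\<in>HR. (\<integral>x. rl h x \<partial>\<nu>) \<le> (LBINT x. rl h x * g' x) + (- k * (d + Fg))"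
          proof
            fix h assume h: "h \<in> HR"
            have "d + Fg \<le> (LBINT y. rl h y * g y)" using main[OF h] True by simp
            hence "k * (d + Fg) \<le> k * (LBINT y. rl h y * g y)" using k by (rule mult_left_mono)
            moreover have "(\<integral>x. rl h x \<partial>\<nu>) \<le> (LBINT x. rl h x * g0 x)" using g0(6) h by blast
            ultimately show "(\<integral>x. rl h x \<partial>\<nu>) \<le> (LBINT x. rl h x * g' x) + (- k * (d + Fg))"
              unfolding i1[OF li[OF h] ghi[OF h]] by simp
          qed
        qed
        thus ?thesis unfolding i1[OF F Fgi] by (simp add: F0_def Fg_def algebra_simps)
      qed
      have "I \<le> F0 - ((\<bar>F0 - I\<bar> + 1) / d) * d" using d by (intro ineq) simp
      thus False using d by simp
    qed
  qed
  then obtain h where h: "h \<in> HR" and hl: "(\<integral>x. (max 0 (V h x))\<^sup>2 \<partial>M) < e'" by blast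
  obtain c where c: "\<forall>x\<in>space M. \<bar>V h x\<bar> \<le> c" using Vbd[OF h] by blast
  have c0: "0 \<le> c" using c spM U0(2) unfolding E_def by fastforce
  have iV: "integrable lborel (\<lambda>x. indicator S x * (max 0 (V h x))\<^sup>2)" if S: "S \<subseteq> E" "S \<in> sets borel" for S
  proof (rule Bochner_Integration.integrable_bound)
    show "integrable lborel (\<lambda>x. c\<^sup>2 * indicator E x)" using emE by (intro integrable_mult_right integrable_real_indicator) auto
    show "(\<lambda>x. indicator S x * (max 0 (V h x))\<^sup>2) \<in> borel_measurable lborel" using Vm[OF h] S(2) by simp
    show "AE x in lborel. norm (indicator S x * (max 0 (V h x))\<^sup>2) \<le> norm (c\<^sup>2 * indicator E x)"
    proof (rule AE_I2)
      fix x
      show "norm (indicator S x * (max 0 (V h x))\<^sup>2) \<le> norm (c\<^sup>2 * indicator E x)"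
      proof (cases "x \<in> S")
        case True
        hence xE: "x \<in> E" using S by blast
        hence "\<bar>V h x\<bar> \<le> c" using c spM by simp
        hence "(max 0 (V h x))\<^sup>2 \<le> c\<^sup>2" using c0 by (intro power_mono) auto
        thus ?thesis using True xE by simp
      qed simp
    qed
  qed
  have less: "(LBINT x. indicator S x * (max 0 (V h x))\<^sup>2) < e'" if S: "S \<subseteq> E" "S \<in> sets borel" for S
  proof -
    have "(LBINT x. indicator S x * (max 0 (V h x))\<^sup>2) \<le> (LBINT x. indicator E x * (max 0 (V h x))\<^sup>2)"
      using S by (intro integral_mono iV Eb order.refl) (auto simp: indicator_def)
    thus ?thesis using hl unfolding intM by simp
  qed
  have "(LBINT x. indicator X x * (max 0 (cv a (\<rho> x) (rl h) x - cv a (\<rho> x) F x))\<^sup>2)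
      = (LBINT x. indicator X x * (max 0 (V h x))\<^sup>2)"
    by (intro Bochner_Integration.integral_cong refl) (auto simp: V_def hs_def f_def indicator_def)
  also have "\<dots> < e" using less[of X] by (simp add: E_def e'_def)
  finally have A: "(LBINT x. indicator X x * (max 0 (cv a (\<rho> x) (rl h) x - cv a (\<rho> x) F x))\<^sup>2) < e" .
  have "I - 1 \<le> nu h"
  proof (rule ccontr)
    assume "\<not> I - 1 \<le> nu h"
    hence gt: "1 \<le> I - nu h" by simp
    have "(LBINT x. indicator U0 x * (1::real)) \<le> (LBINT x. indicator U0 x * (max 0 (V h x))\<^sup>2)"
    proof (rule integral_mono)
      have "emeasure lborel U0 < \<infinity>" using emE by (rule le_less_trans[rotated]) (auto intro!: emeasure_mono simp: E_def)
      thus "integrable lborel (\<lambda>x. indicator U0 x * (1::real))" by (intro integrable_mult_left integrable_real_indicator) auto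
      show "integrable lborel (\<lambda>x. indicator U0 x * (max 0 (V h x))\<^sup>2)" by (intro iV) (auto simp: E_def)
      show "indicator U0 x * (1::real) \<le> indicator U0 x * (max 0 (V h x))\<^sup>2" for x
      proof (cases "x \<in> U0")
        case True
        hence "x \<notin> X" using disj by blast
        hence "V h x = I - nu h" by (simp add: V_def)
        hence "1 \<le> (max 0 (V h x))\<^sup>2" using gt by (intro one_le_power) auto
        thus ?thesis using True by simp
      qed simp
    qed
    also have "\<dots> < e'" by (intro less) (auto simp: E_def)
    also have "\<dots> \<le> measure lborel U0" by (simp add: e'_def)
    finally show False by simp
  qed
  thus ?thesis using A h unfolding nu_def by blast
qed

text \<open>\<open>C\<close> is fixed before \<open>K\<close>. For a given \<open>K\<close> the
  square mean is made small on a neighbourhood \<open>X\<close> of the points away from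
  \<open>Q\<close>; as \<open>h\<close> lies below its averages, its ball means are then bounded.
  Near \<open>Q\<close>, where balls of averaging could meet \<open>U0\<close>, the bound comes from
  an outer layer by the maximum principle.\<close>

lemma envelope_compact:
  fixes D U0 Q :: "'a::euclidean_space set" and \<nu> :: "'a measure" and \<rho> F :: "'a \<Rightarrow> real"
  assumes moll: "mollifier a" and D: "open D" "connected D"
    and HR: "HR \<subseteq> sbh_star D" "HR \<noteq> {}"
    and conv: "\<forall>h1\<in>HR. \<forall>h2\<in>HR. \<forall>t. 0 < t \<and> t < 1 \<longrightarrow> (\<lambda>x. ereal t * h1 x + ereal (1 - t) * h2 x) \<in> HR"
    and h\<nu>: "\<forall>h\<in>HR. integrable \<nu> (rl h) \<and> (AE x in \<nu>. \<bar>h x\<bar> \<noteq> \<infinity>)"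
    and F: "locint D F" and \<rho>: "continuous_on D \<rho>" "\<forall>x\<in>D. 0 < \<rho> x \<and> cball x (\<rho> x) \<subseteq> D" "\<forall>x\<in>D. \<rho> x \<le> \<eta>"
    and U0: "open U0" "U0 \<noteq> {}" "U0 \<subseteq> Q" and Q: "compact Q" and \<eta>: "0 < \<eta>" "{x. infdist x Q \<le> 5 * \<eta>} \<subseteq> D"
    and \<nu>: "finite_measure \<nu>" "sets \<nu> = sets borel" "AE x in \<nu>. x \<in> Q"
    and Hyp: "\<And>g c. smooth_on UNIV g \<Longrightarrow> \<forall>x. 0 \<le> g x \<Longrightarrow> \<exists>L. compact L \<and> L \<subseteq> D - U0 \<and> (\<forall>x. x \<notin> L \<longrightarrow> g x = 0) \<Longrightarrow>
      \<forall>h\<in>HR. (\<integral>x. rl h x \<partial>\<nu>) \<le> (LBINT x. rl h x * g x) + c \<Longrightarrow> I \<le> (LBINT x. F x * g x) + c"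
  shows "\<exists>C. \<forall>K. compact K \<and> K \<subseteq> D \<longrightarrow> (\<exists>h\<in>HR. (\<forall>x\<in>K. h x \<le> ereal (cv a (\<rho> x) F x + C)) \<and> - C \<le> (\<integral>x. rl h x \<partial>\<nu>))"
proof -
  note a = mollifier_kern[OF moll]
  have rad: "\<forall>x y. norm x = norm y \<longrightarrow> a x = a y" using moll unfolding mollifier_def by blast
  have Q0: "Q \<noteq> {}" using U0 by blast
  have HRD: "h \<in> HR \<Longrightarrow> h \<in> sbh_star D" for h using HR(1) by blast
  have us: "h \<in> sbh D" if "h \<in> HR" for h using HRD[OF that] by (simp add: sbh_star_def)
  have li: "locint D (rl h)" and fin: "AE x\<in>D in lborel. \<bar>h x\<bar> \<noteq> \<infinity>" if "h \<in> HR" for h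
    using sbh_star_locint[OF D HRD[OF that]] by blast+
  have avg: "rl h x \<le> cv a r (rl h) x" if "h \<in> HR" "0 < r" "cball x r \<subseteq> D" "\<bar>h x\<bar> \<noteq> \<infinity>" for h x r
    by (rule sbh_le_radial_average[OF us[OF that(1)] D(1) li[OF that(1)] fin[OF that(1)] a rad that(2,3)]) (use that(4) in auto)
  define N where "N = (\<lambda>r. {x. infdist x Q \<le> r})"
  have Nc: "compact (N r)" if "r > 0" for r unfolding N_def by (rule compact_infdist_le[OF Q0 Q that])
  have N5: "N r \<subseteq> D" if "r \<le> 5 * \<eta>" for r using \<eta>(2) that by (auto simp: N_def)
  have Nball: "cball x s \<subseteq> N (r + s)" if "x \<in> N r" for x r s
  proof
    fix y assume "y \<in> cball x s"
    thus "y \<in> N (r + s)" using that infdist_triangle[of y Q x] by (auto simp: N_def dist_commute)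
  qed
  \<comment> \<open>The shell that carries \<open>g0\<close>; its inner gap
    \<open>\<eta> / 2\<close> separates it from \<open>Q\<close> and so from
    \<open>U0\<close>.\<close>
  define L0 where "L0 = N (3 * \<eta>) \<inter> {x. \<eta> / 2 \<le> infdist x Q}"
  have L0: "compact L0" "L0 \<subseteq> D - U0"
  proof -
    have "closed {x. \<eta> / 2 \<le> infdist x Q}" by (intro closed_Collect_le continuous_intros)
    thus "compact L0" unfolding L0_def using Nc[of "3 * \<eta>"] \<eta>(1) by (intro compact_Int_closed) auto
    show "L0 \<subseteq> D - U0" using N5[of "3 * \<eta>"] \<eta>(1) U0(3) by (auto simp: L0_def)
  qed
  have "\<exists>g0. smooth_on UNIV g0 \<and> (\<forall>x. 0 \<le> g0 x) \<and>
     (\<forall>x. g0 x \<noteq> 0 \<longrightarrow> \<eta> / 2 \<le> infdist x Q \<and> infdist x Q \<le> 3 * \<eta>) \<and>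
     (\<forall>H. locint {x. infdist x Q \<le> 4 * \<eta>} H \<and>
        (AE x in lborel. infdist x Q \<le> 3 * \<eta> \<longrightarrow> (\<forall>\<rho>. 0 < \<rho> \<and> \<rho> \<le> \<eta> \<longrightarrow> H x \<le> cv a \<rho> H x)) \<and>
        integrable \<nu> H \<and> (AE x in \<nu>. H x \<le> cv a \<eta> H x) \<longrightarrow>
        (\<integral>x. H x \<partial>\<nu>) \<le> (LBINT x. H x * g0 x))"
    by (rule sweep_out[OF moll \<nu>(1,2) Q Q0 \<nu>(3) \<eta>(1)])
  then obtain g0 where g0: "smooth_on UNIV g0" "\<forall>x. 0 \<le> g0 x"
    and g0s: "\<forall>x. g0 x \<noteq> 0 \<longrightarrow> \<eta> / 2 \<le> infdist x Q \<and> infdist x Q \<le> 3 * \<eta>"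
    and g0H: "\<forall>H. locint {x. infdist x Q \<le> 4 * \<eta>} H \<and>
        (AE x in lborel. infdist x Q \<le> 3 * \<eta> \<longrightarrow> (\<forall>\<rho>. 0 < \<rho> \<and> \<rho> \<le> \<eta> \<longrightarrow> H x \<le> cv a \<rho> H x)) \<and>
        integrable \<nu> H \<and> (AE x in \<nu>. H x \<le> cv a \<eta> H x) \<longrightarrow>
        (\<integral>x. H x \<partial>\<nu>) \<le> (LBINT x. H x * g0 x)" by blast
  have g0L: "\<forall>x. x \<notin> L0 \<longrightarrow> g0 x = 0" using g0s by (auto simp: L0_def N_def)
  have g0h: "\<forall>h\<in>HR. (\<integral>x. rl h x \<partial>\<nu>) \<le> (LBINT x. rl h x * g0 x)"
  proof
    fix h assume h: "h \<in> HR"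
    have "{x. infdist x Q \<le> 4 * \<eta>} \<subseteq> D" using N5[of "4 * \<eta>"] \<eta>(1) by (auto simp: N_def)
    hence 1: "locint {x. infdist x Q \<le> 4 * \<eta>} (rl h)" using li[OF h] unfolding locint_def by blast
    have 2: "AE x in lborel. infdist x Q \<le> 3 * \<eta> \<longrightarrow> (\<forall>\<rho>. 0 < \<rho> \<and> \<rho> \<le> \<eta> \<longrightarrow> rl h x \<le> cv a \<rho> (rl h) x)"
      using fin[OF h]
    proof eventually_elim
      case (elim x)
      show ?case
      proof (intro impI allI)
        fix r assume x: "infdist x Q \<le> 3 * \<eta>" and r: "0 < r \<and> r \<le> \<eta>"
        have "cball x r \<subseteq> N (3 * \<eta> + r)" using x by (intro Nball) (simp add: N_def)
        also have "\<dots> \<subseteq> D" using r by (intro N5) simp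
        finally have s: "cball x r \<subseteq> D" .
        hence "x \<in> D" using r by auto
        thus "rl h x \<le> cv a r (rl h) x" using avg[OF h _ s] r elim by auto
      qed
    qed
    have 3: "AE x in \<nu>. rl h x \<le> cv a \<eta> (rl h) x"
      using \<nu>(3) h\<nu>[rule_format, OF h, THEN conjunct2]
    proof eventually_elim
      case (elim x)
      have "cball x \<eta> \<subseteq> N (0 + \<eta>)" using elim by (intro Nball) (simp add: N_def)
      also have "\<dots> \<subseteq> D" using \<eta>(1) by (intro N5) simp
      finally have s: "cball x \<eta> \<subseteq> D" .
      show ?case by (rule avg[OF h \<eta>(1) s elim(2)])
    qed
    show "(\<integral>x. rl h x \<partial>\<nu>) \<le> (LBINT x. rl h x * g0 x)"
      using g0H 1 2 3 h\<nu> h by blast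
  qed
  define f where "f = (\<lambda>x. cv a (\<rho> x) F x)"
  have contf: "continuous_on D f"
    unfolding f_def by (rule continuous_on_cv[OF D(1) F a \<rho>(1)]) (use \<rho>(2) in blast)
  have "compact (f ` N (4 * \<eta>))" using \<eta>(1) N5[of "4 * \<eta>"]
    by (intro compact_continuous_image continuous_on_subset[OF contf] Nc) auto
  hence "bounded (f ` N (4 * \<eta>))" by (rule compact_imp_bounded)
  then obtain Cf where "\<forall>y\<in>f ` N (4 * \<eta>). norm y \<le> Cf" unfolding bounded_iff by blast
  hence Cf: "\<forall>x\<in>N (4 * \<eta>). \<bar>f x\<bar> \<le> Cf" by simp
  have Cf0: "0 \<le> Cf" 
  proof -
    obtain x where "x \<in> Q" using Q0 by blast
    hence "x \<in> N (4 * \<eta>)" using \<eta>(1) by (simp add: N_def)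
    thus ?thesis using Cf order.trans[OF abs_ge_zero] by blast
  qed
  \<comment> \<open>On \<open>N (4 * \<eta>)\<close> the maximum principle gives
    \<open>Cf + 2\<close> while \<open>f\<close> may be as low as \<open>- Cf\<close>, hence
    \<open>2 * Cf\<close>. The other summands cover the loss 2 and the lower bound
    \<open>I - 1\<close>.\<close>
  define C where "C = 2 * Cf + 3 + \<bar>I\<bar>"
  have main: "\<exists>h\<in>HR. (\<forall>x\<in>K. h x \<le> ereal (cv a (\<rho> x) F x + C)) \<and> - C \<le> (\<integral>x. rl h x \<partial>\<nu>)"
    if K: "compact K" "K \<subseteq> D" for K
  proof -
    \<comment> \<open>Distance \<open>3 * \<eta>\<close> leaves room: a
      \<open>\<delta>\<close>-neighbourhood stays beyond \<open>2 * \<eta>\<close>, and balls of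
      radius at most \<open>\<eta>\<close> about its points miss \<open>U0\<close>.\<close>
    define Y where "Y = (K \<union> N (4 * \<eta>)) \<inter> {x. 3 * \<eta> \<le> infdist x Q}"
    have "closed {x. 3 * \<eta> \<le> infdist x Q}" by (intro closed_Collect_le continuous_intros)
    hence Yc: "compact Y" unfolding Y_def using K(1) Nc[of "4 * \<eta>"] \<eta>(1) by (intro compact_Int_closed compact_Un) auto
    have YD: "Y \<subseteq> D" using K(2) N5[of "4 * \<eta>"] \<eta>(1) by (auto simp: Y_def)
    define W where "W = D \<inter> {x. 2 * \<eta> < infdist x Q}"
    have "open {x. 2 * \<eta> < infdist x Q}" by (intro open_Collect_less continuous_intros)
    hence Wo: "open W" unfolding W_def using D(1) by (intro open_Int)
    have YW: "Y \<subseteq> W" using YD \<eta>(1) by (auto simp: Y_def W_def)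
    obtain \<delta> where \<delta>: "\<delta> > 0" "(\<Union>y\<in>Y. cball y \<delta>) \<subseteq> W"
      using compact_subset_open_imp_cball_epsilon_subset[OF Yc Wo YW] by metis
    define X where "X = {y + z | y z. y \<in> Y \<and> z \<in> cball 0 \<delta>}"
    have Xc: "compact X" unfolding X_def by (rule compact_sums[OF Yc compact_cball])
    have Xball: "cball y \<delta> \<subseteq> X" if "y \<in> Y" for y
    proof
      fix z assume "z \<in> cball y \<delta>"
      hence "z = y + (z - y)" "z - y \<in> cball 0 \<delta>" by (auto simp: dist_norm norm_minus_commute)
      thus "z \<in> X" unfolding X_def using that by blast
    qed
    have XW: "X \<subseteq> W"
    proof
      fix x assume "x \<in> X"
      then obtain y z where yz: "y \<in> Y" "norm z \<le> \<delta>" "x = y + z" by (auto simp: X_def)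
      hence "x \<in> cball y \<delta>" by (simp add: dist_norm)
      thus "x \<in> W" using \<delta>(2) yz(1) by blast
    qed
    have XD: "X \<subseteq> D" using XW by (auto simp: W_def)
    have XU: "\<forall>x\<in>X. cball x (\<rho> x) \<inter> U0 = {}"
    proof (intro ballI equals0I)
      fix x y assume x: "x \<in> X" and y: "y \<in> cball x (\<rho> x) \<inter> U0"
      have "infdist y Q = 0" using y U0(3) by auto
      moreover have "dist x y \<le> \<eta>" using y \<rho>(3) x XD by force
      ultimately have "infdist x Q \<le> \<eta>" using infdist_triangle[of x Q y] by simp
      moreover have "2 * \<eta> < infdist x Q" using x XW by (auto simp: W_def)
      ultimately show False using \<eta>(1) by simp
    qed
    have "uniformly_continuous_on X f" by (rule compact_uniformly_continuous[OF continuous_on_subset[OF contf XD] Xc])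
    then obtain d where d: "d > 0" "\<And>p q. p \<in> X \<Longrightarrow> q \<in> X \<Longrightarrow> dist q p < d \<Longrightarrow> dist (f q) (f p) < 1"
      unfolding uniformly_continuous_on_def by (metis zero_less_one)
    define r where "r = min \<delta> (d / 2)"
    have r: "0 < r" "r \<le> \<delta>" "r < d" using \<delta>(1) d(1) by (auto simp: r_def)
    define vol where "vol = measure lborel (ball (0::'a) r)"
    have vol: "0 < vol" unfolding vol_def using r(1) by (rule content_ball_pos)
    have volx: "measure lborel (ball x r) = vol" for x :: 'a using r(1) by (simp add: vol_def content_ball)
    define mX where "mX = measure lborel X"
    \<comment> \<open>Constants for \<open>t \<le> (c / 2) * t^2 + 1 / (2 * c)\<close>, applied to
      the excess of the average: this \<open>c\<close> makes the constant term over \<open>X\<close>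
      at most half of \<open>vol\<close>, and \<open>e = vol / c\<close> does the same for the
      square mean.\<close>
    define c where "c = (mX + 1) / vol"
    have mX0: "0 \<le> mX" by (simp add: mX_def)
    have c: "0 < c" using mX0 vol by (simp add: c_def)
    have mXc: "mX / c \<le> vol" using mX0 vol by (simp add: c_def field_simps)
    define e where "e = vol / c"
    have e: "0 < e" using vol c by (simp add: e_def)
    have bU0: "bounded U0" using Q U0(3) compact_imp_bounded bounded_subset by blast
    have r2: "\<forall>x\<in>D. 0 < \<rho> x \<and> cball x (\<rho> x) \<subseteq> D" using \<rho>(2) .
    have "\<exists>h\<in>HR. (LBINT x. indicator X x * (max 0 (cv a (\<rho> x) (rl h) x - cv a (\<rho> x) F x))\<^sup>2) < e
       \<and> I - 1 \<le> (\<integral>x. rl h x \<partial>\<nu>)"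
      by (rule envelope_L2[OF moll D HR conv h\<nu> F \<rho>(1) r2 Xc XD XU U0(1,2) bU0 g0 L0 g0L g0h Hyp e])
    then obtain h where h: "h \<in> HR"
      and he: "(LBINT x. indicator X x * (max 0 (cv a (\<rho> x) (rl h) x - f x))\<^sup>2) < e"
      and hI: "I - 1 \<le> (\<integral>x. rl h x \<partial>\<nu>)" unfolding f_def by blast
    define hs where "hs = (\<lambda>x. cv a (\<rho> x) (rl h) x)"
    have conth: "continuous_on D hs"
      unfolding hs_def by (rule continuous_on_cv[OF D(1) li[OF h] a \<rho>(1)]) (use \<rho>(2) in blast)
    define q where "q = (\<lambda>x. (max 0 (hs x - f x))\<^sup>2)"
    have contq: "continuous_on X q" unfolding q_def
      by (intro continuous_intros continuous_on_subset[OF conth XD] continuous_on_subset[OF contf XD])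
    have iq: "integrable lborel (\<lambda>x. indicator X x * q x)"
      using borel_integrable_compact[OF Xc contq] by simp
    have iX: "integrable lborel (indicator X :: 'a \<Rightarrow> real)"
      using emeasure_compact_finite[OF Xc] Xc by (intro integrable_real_indicator) (auto intro: borel_compact)
    \<comment> \<open>The loss 2 consists of 1 for the oscillation of \<open>f\<close> over the ball
      and 1 for the mean excess.\<close>
    have onY: "h x \<le> ereal (f x + 2)" if x: "x \<in> Y" for x
    proof (cases "h x = - \<infinity>")
      case False
      have xD: "x \<in> D" using x YD by blast
      have bX: "ball x r \<subseteq> X" using Xball[OF x] r(2) ball_subset_cball subset_cball by fastforce
      have "cball x r \<subseteq> X" using Xball[OF x] r(2) subset_cball[OF r(2)] by blast
      hence cD: "cball x r \<subseteq> D" using XD by blast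
      have xX: "x \<in> X" using bX r(1) by auto
      note bm = sbh_ball_mean[OF us[OF h] D(1) r(1) cD False]
      let ?B = "indicator (ball x r) :: 'a \<Rightarrow> real"
      have iB: "integrable lborel ?B" using emeasure_lborel_ball_finite by (intro integrable_real_indicator) auto
      have "rl h x * vol \<le> (LBINT y. ?B y * rl h y)" using bm(3) by (simp add: volx)
      also have "\<dots> \<le> (LBINT y. (f x + 1) * ?B y + ((c / 2) * (indicator X y * q y) + (1 / (2 * c)) * indicator X y))"
      proof (rule integral_mono_AE[OF bm(2)])
        show "integrable lborel (\<lambda>y. (f x + 1) * ?B y + ((c / 2) * (indicator X y * q y) + (1 / (2 * c)) * indicator X y))"
          using iB iq iX by (intro Bochner_Integration.integrable_add integrable_mult_right)
        show "AE y in lborel. ?B y * rl h y \<le> (f x + 1) * ?B y + ((c / 2) * (indicator X y * q y) + (1 / (2 * c)) * indicator X y)"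
          using fin[OF h]
        proof eventually_elim
          case (elim y)
          show ?case
          proof (cases "y \<in> ball x r")
            case True
            hence yX: "y \<in> X" using bX by blast
            hence yD: "y \<in> D" using XD by blast
            have "\<bar>h y\<bar> \<noteq> \<infinity>" using elim yD by (rule mp)
            hence "rl h y \<le> hs y" unfolding hs_def using \<rho>(2) yD by (intro avg[OF h]) auto
            moreover have "dist (f y) (f x) < 1" using True r(3) by (intro d(2) xX yX) (simp add: dist_commute)
            hence "f y \<le> f x + 1" by (simp add: dist_real_def)
            moreover have "hs y - f y \<le> max 0 (hs y - f y)" by simp
            moreover have "max 0 (hs y - f y) \<le> (c / 2) * q y + 1 / (2 * c)"
            proof -
              have "0 \<le> (c * max 0 (hs y - f y) - 1)\<^sup>2" by simp
              also have "\<dots> = 2 * c * ((c / 2) * q y + 1 / (2 * c) - max 0 (hs y - f y))"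
                using c unfolding q_def by (simp add: power2_diff power_mult_distrib) (simp add: field_simps power2_eq_square)
              finally show ?thesis using c by (simp add: zero_le_mult_iff)
            qed
            ultimately have "rl h y \<le> (f x + 1) + ((c / 2) * q y + 1 / (2 * c))" by linarith
            thus ?thesis using True yX by simp
          next
            case False
            thus ?thesis using c by (auto simp: q_def indicator_def)
          qed
        qed
      qed
      also have "\<dots> = (f x + 1) * vol + ((c / 2) * (LBINT y. indicator X y * q y) + (1 / (2 * c)) * mX)"
      proof -
        have i1: "integrable lborel (\<lambda>y. (f x + 1) * ?B y)" using iB by (intro integrable_mult_right)
        have i2: "integrable lborel (\<lambda>y. (c / 2) * (indicator X y * q y))" using iq by (intro integrable_mult_right)
        have i3: "integrable lborel (\<lambda>y. (1 / (2 * c)) * indicator X y)" using iX by (intro integrable_mult_right)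
        have m: "(LBINT y. (1 / (2 * c)) * indicator X y) = (1 / (2 * c)) * mX" by (simp add: mX_def)
        have m2: "(LBINT y. (f x + 1) * ?B y) = (f x + 1) * vol" by (simp add: volx)
        show ?thesis
          unfolding Bochner_Integration.integral_add[OF i1 Bochner_Integration.integrable_add[OF i2 i3]]
            Bochner_Integration.integral_add[OF i2 i3] m m2 by simp
      qed
      also have "\<dots> \<le> (f x + 1) * vol + ((c / 2) * e + (1 / 2) * vol)"
      proof -
        have "(c / 2) * (LBINT y. indicator X y * q y) \<le> (c / 2) * e"
          using he c unfolding q_def hs_def by (intro mult_left_mono) auto
        moreover have "(1 / (2 * c)) * mX \<le> (1 / 2) * vol" using mXc by simp
        ultimately show ?thesis by linarith
      qed
      also have "(c / 2) * e = (1 / 2) * vol" using c by (simp add: e_def)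
      finally have "rl h x * vol \<le> (f x + 2) * vol" by (simp add: algebra_simps)
      hence "rl h x \<le> f x + 2" using vol by simp
      moreover have "h x \<noteq> \<infinity>" by (rule sbhD(1)[OF us[OF h] xD])
      ultimately show ?thesis using False by (cases "h x") auto
    qed simp
    \<comment> \<open>A point of \<open>N (4 * \<eta>)\<close> whose \<open>\<eta>\<close>-ball
      leaves this set is farther than \<open>3 * \<eta>\<close> from \<open>Q\<close> and so belongs
      to \<open>Y\<close>, where the bound is known.\<close>
    have onN: "h x \<le> ereal (Cf + 2)" if x: "x \<in> N (4 * \<eta>)" for x
    proof (rule sbh_max_principle[OF us[OF h] D(1) _ _ \<eta>(1) _ x])
      show "compact (N (4 * \<eta>))" using \<eta>(1) by (intro Nc) simp
      show "N (4 * \<eta>) \<subseteq> D" using \<eta>(1) by (intro N5) simp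
      show "h y \<le> ereal (Cf + 2)" if y: "y \<in> N (4 * \<eta>)" "\<not> cball y \<eta> \<subseteq> N (4 * \<eta>)" for y
      proof -
        have "y \<notin> N (3 * \<eta>)"
        proof
          assume "y \<in> N (3 * \<eta>)"
          from Nball[OF this, of \<eta>] show False using y(2) by simp
        qed
        hence "y \<in> Y" using y(1) by (simp add: Y_def N_def)
        hence "h y \<le> ereal (f y + 2)" by (rule onY)
        also have "\<dots> \<le> ereal (Cf + 2)" using Cf y(1) by (auto simp: abs_le_iff)
        finally show ?thesis .
      qed
    qed
    have "h x \<le> ereal (f x + C)" if x: "x \<in> K" for x
    proof (cases "x \<in> N (4 * \<eta>)")
      case True
      hence "h x \<le> ereal (Cf + 2)" by (rule onN)
      also have "\<dots> \<le> ereal (f x + C)"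
      proof -
        have "- Cf \<le> f x" using Cf True by (auto simp: abs_le_iff)
        thus ?thesis by (simp add: C_def)
      qed
      finally show ?thesis .
    next
      case False
      hence "x \<in> Y" using x \<eta>(1) by (simp add: Y_def N_def)
      hence "h x \<le> ereal (f x + 2)" by (rule onY)
      also have "\<dots> \<le> ereal (f x + C)" using Cf0 by (simp add: C_def)
      finally show ?thesis .
    qed
    moreover have "- C \<le> (\<integral>x. rl h x \<partial>\<nu>)" using hI Cf0 by (simp add: C_def)
    ultimately show ?thesis using h unfolding f_def by blast
  qed
  thus ?thesis by blast
qed

subsection \<open>Compactness in the local L1 topology\<close>

text \<open>The average exceeds \<open>u\<close> almost everywhere, so the L1 distance is a plain
  integral and can be tested with a cutoff \<open>\<phi>\<close>; self-adjointness moves the average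
  onto \<open>\<phi>\<close>, whose Lipschitz constant is \<open>1 / \<tau>\<close>. The error is
  thus uniform over families bounded in L1.\<close>

lemma sbh_average_L1_error:
  fixes u :: "'a::euclidean_space \<Rightarrow> ereal"
  assumes u: "u \<in> sbh D" and D: "open D" and L: "locint D (rl u)" and AE: "AE z\<in>D in lborel. \<bar>u z\<bar> \<noteq> \<infinity>"
    and a: "kern a" and rad: "\<forall>x y. norm x = norm y \<longrightarrow> a x = a y"
    and K: "compact K" "K \<noteq> {}" and \<tau>: "0 < \<tau>" "{x. infdist x K \<le> 2 * \<tau>} \<subseteq> D" and \<delta>: "0 < \<delta>" "\<delta> \<le> \<tau>"
  shows "AE x\<in>K in lborel. rl u x \<le> cv a \<delta> (rl u) x"
    and "(\<integral>\<^sup>+x. ennreal (cv a \<delta> (rl u) x - rl u x) * indicator K x \<partial>lborel)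
      \<le> ennreal (\<delta> / \<tau> * (LBINT y. indicator {x. infdist x K \<le> 2 * \<tau>} y * \<bar>rl u y\<bar>))"
proof -
  define N where "N = {x. infdist x K \<le> 2 * \<tau>}"
  have Nc: "compact N" unfolding N_def using \<tau>(1) by (intro compact_infdist_le K) simp
  have ND: "N \<subseteq> D" using \<tau>(2) by (simp add: N_def)
  have [measurable]: "N \<in> sets borel" "K \<in> sets borel" using Nc K(1) by (auto intro: borel_compact)
  have near: "cball x \<delta> \<subseteq> N" if "infdist x K \<le> \<tau>" for x
  proof
    fix y assume "y \<in> cball x \<delta>"
    thus "y \<in> N" using that \<delta>(2) infdist_triangle[of y K x] by (auto simp: N_def dist_commute)
  qed
  have sub: "AE x in lborel. infdist x K \<le> \<tau> \<longrightarrow> rl u x \<le> cv a \<delta> (rl u) x"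
    using AE
  proof eventually_elim
    case (elim x)
    show ?case
    proof
      assume x: "infdist x K \<le> \<tau>"
      have s: "cball x \<delta> \<subseteq> D" using near[OF x] ND by blast
      hence "x \<in> D" using \<delta>(1) by auto
      hence "u x \<noteq> - \<infinity>" using elim by auto
      thus "rl u x \<le> cv a \<delta> (rl u) x" by (rule sbh_le_radial_average[OF u D L AE a rad \<delta>(1) s])
    qed
  qed
  show "AE x\<in>K in lborel. rl u x \<le> cv a \<delta> (rl u) x"
    using sub by eventually_elim (use \<tau>(1) in auto)
  define w where "w = (\<lambda>y. indicator N y * rl u y)"
  have iw: "integrable lborel w" using L Nc ND unfolding locint_def w_def by blast
  hence [measurable]: "w \<in> borel_measurable borel" by auto
  have cvw: "cv a \<delta> w x = cv a \<delta> (rl u) x" if "infdist x K \<le> \<tau>" for x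
  proof -
    have "w y * sck a \<delta> (y - x) = rl u y * sck a \<delta> (y - x)" for y
    proof (cases "y \<in> cball x \<delta>")
      case True
      hence "y \<in> N" using near[OF that] by blast
      thus ?thesis by (simp add: w_def)
    next
      case False
      thus ?thesis by (simp add: sck_zero[OF a \<delta>(1)] dist_norm norm_minus_commute)
    qed
    thus ?thesis unfolding cv_def by presburger
  qed
  \<comment> \<open>Equal to 1 on \<open>K\<close> and to 0 beyond distance \<open>\<tau>\<close>,
    so that averages of radius \<open>\<delta> \<le> \<tau>\<close> remain within the
    \<open>2 * \<tau>\<close>-neighbourhood.\<close>
  define \<phi> where "\<phi> = (\<lambda>x. max 0 (1 - infdist x K / \<tau>))"
  have contphi: "continuous_on UNIV \<phi>" unfolding \<phi>_def using \<tau>(1) by (intro continuous_intros) auto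
  hence \<phi>m[measurable]: "\<phi> \<in> borel_measurable borel" by (rule borel_measurable_continuous_onI)
  have \<phi>b: "0 \<le> \<phi> x" "\<phi> x \<le> 1" for x using \<tau>(1) infdist_nonneg[of x K] by (auto simp: \<phi>_def)
  have \<phi>a: "\<bar>\<phi> x\<bar> \<le> 1" for x using \<phi>b[of x] by simp
  have \<phi>z: "\<phi> x = 0" if "\<not> infdist x K \<le> \<tau>" for x using that \<tau>(1) by (auto simp: \<phi>_def field_simps)
  obtain R where "\<forall>x\<in>N. norm x \<le> R" using compact_imp_bounded[OF Nc] unfolding bounded_iff by blast
  hence R: "N \<subseteq> cball 0 R" by (auto simp: dist_norm)
  have \<phi>R: "\<phi> x = 0" if "x \<notin> cball 0 R" for x
  proof (rule \<phi>z)
    have "x \<notin> N" using that R by blast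
    thus "\<not> infdist x K \<le> \<tau>" using \<tau>(1) by (simp add: N_def)
  qed
  note adj = cv_adjoint[where c=0 and R=R, OF iw \<phi>m \<phi>a \<phi>R a \<delta>(1)]
  have adj1: "(LBINT x. \<phi> x * cv a \<delta> w x) = (LBINT y. w y * cv a \<delta> \<phi> y)" by (rule adj(1)) assumption
  have lip: "\<bar>\<phi> z - \<phi> x\<bar> \<le> \<delta> / \<tau>" if "norm (z - x) < \<delta>" for x z
  proof -
    have "\<bar>infdist z K - infdist x K\<bar> \<le> dist z x" by (rule infdist_triangle_abs)
    hence "\<bar>infdist z K - infdist x K\<bar> / \<tau> \<le> \<delta> / \<tau>"
      using that \<tau>(1) by (intro divide_right_mono) (auto simp: dist_norm)
    moreover have "\<bar>\<phi> z - \<phi> x\<bar> \<le> \<bar>infdist z K - infdist x K\<bar> / \<tau>"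
    proof -
      have "\<bar>\<phi> z - \<phi> x\<bar> \<le> \<bar>infdist z K / \<tau> - infdist x K / \<tau>\<bar>" unfolding \<phi>_def by linarith
      thus ?thesis using \<tau>(1) by (simp add: diff_divide_distrib[symmetric])
    qed
    ultimately show ?thesis by linarith
  qed
  have app: "\<bar>cv a \<delta> \<phi> x - \<phi> x\<bar> \<le> \<delta> / \<tau>" for x by (rule cv_approx[OF a \<delta>(1) \<phi>m lip])
  have ipw: "integrable lborel (\<lambda>x. w x * \<phi> x)"
    by (rule Bochner_Integration.integrable_bound[OF iw])
      (use \<phi>a in \<open>auto simp: abs_mult intro!: AE_I2 mult_left_le\<close>)
  have iL: "integrable lborel (\<lambda>x. \<phi> x * (cv a \<delta> w x - w x))"
    using Bochner_Integration.integrable_diff[OF adj(2) ipw] by (simp add: algebra_simps)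
  have "(LBINT x. \<phi> x * (cv a \<delta> w x - w x)) = (LBINT x. \<phi> x * cv a \<delta> w x) - (LBINT x. w x * \<phi> x)"
    using Bochner_Integration.integral_diff[OF adj(2) ipw] by (simp add: algebra_simps)
  also have "\<dots> = (LBINT x. w x * (cv a \<delta> \<phi> x - \<phi> x))"
    unfolding adj1 using Bochner_Integration.integral_diff[OF adj(3) ipw] by (simp add: algebra_simps)
  also have "\<dots> \<le> (LBINT x. \<delta> / \<tau> * \<bar>w x\<bar>)"
  proof (rule integral_mono)
    show "integrable lborel (\<lambda>x. w x * (cv a \<delta> \<phi> x - \<phi> x))"
      using Bochner_Integration.integrable_diff[OF adj(3) ipw] by (simp add: algebra_simps)
    show "integrable lborel (\<lambda>x. \<delta> / \<tau> * \<bar>w x\<bar>)" using integrable_abs[OF iw] by (intro integrable_mult_right)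
    show "w x * (cv a \<delta> \<phi> x - \<phi> x) \<le> \<delta> / \<tau> * \<bar>w x\<bar>" for x
    proof -
      have "w x * (cv a \<delta> \<phi> x - \<phi> x) \<le> \<bar>w x\<bar> * \<bar>cv a \<delta> \<phi> x - \<phi> x\<bar>"
        unfolding abs_mult[symmetric] by (rule abs_ge_self)
      also have "\<dots> \<le> \<bar>w x\<bar> * (\<delta> / \<tau>)" by (rule mult_left_mono[OF app]) simp
      finally show ?thesis by (simp add: mult.commute)
    qed
  qed
  also have "\<dots> = \<delta> / \<tau> * (LBINT y. indicator N y * \<bar>rl u y\<bar>)" by (simp add: w_def abs_mult)
  finally have le: "(LBINT x. \<phi> x * (cv a \<delta> w x - w x)) \<le> \<delta> / \<tau> * (LBINT y. indicator N y * \<bar>rl u y\<bar>)" .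
  have nn: "AE x in lborel. 0 \<le> \<phi> x * (cv a \<delta> w x - w x)"
    using sub
  proof eventually_elim
    case (elim x)
    show ?case
    proof (cases "infdist x K \<le> \<tau>")
      case True
      hence "x \<in> N" using \<tau>(1) by (simp add: N_def)
      hence "w x = rl u x" by (simp add: w_def)
      thus ?thesis using elim True \<phi>b(1)[of x] by (simp add: cvw)
    next
      case False thus ?thesis by (simp add: \<phi>z)
    qed
  qed
  have "(\<integral>\<^sup>+x. ennreal (cv a \<delta> (rl u) x - rl u x) * indicator K x \<partial>lborel)
      \<le> (\<integral>\<^sup>+x. ennreal (\<phi> x * (cv a \<delta> w x - w x)) \<partial>lborel)"
  proof (rule nn_integral_mono)
    fix x
    show "ennreal (cv a \<delta> (rl u) x - rl u x) * indicator K x \<le> ennreal (\<phi> x * (cv a \<delta> w x - w x))"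
    proof (cases "x \<in> K")
      case True
      hence "\<phi> x = 1" "x \<in> N" "infdist x K \<le> \<tau>" using \<tau>(1) by (auto simp: \<phi>_def N_def)
      moreover have "w x = rl u x" using \<open>x \<in> N\<close> by (simp add: w_def)
      ultimately show ?thesis using True by (simp add: cvw)
    qed simp
  qed
  also have "\<dots> = ennreal (LBINT x. \<phi> x * (cv a \<delta> w x - w x))" by (rule nn_integral_eq_integral[OF iL nn])
  also have "\<dots> \<le> ennreal (\<delta> / \<tau> * (LBINT y. indicator N y * \<bar>rl u y\<bar>))" by (rule ennreal_leI[OF le])
  finally show "(\<integral>\<^sup>+x. ennreal (cv a \<delta> (rl u) x - rl u x) * indicator K x \<partial>lborel)
      \<le> ennreal (\<delta> / \<tau> * (LBINT y. indicator {x. infdist x K \<le> 2 * \<tau>} y * \<bar>rl u y\<bar>))"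
    unfolding N_def .
qed

text \<open>For fixed \<open>j\<close> the averages of a locally L1-bounded sequence are
  equicontinuous, since the kernel is uniformly continuous. A diagonal subsequence over a countable
  dense set of centres and all \<open>j\<close> then converges at every centre; the factor 2 in the
  radius leaves room to move to a nearby dense point.\<close>

lemma averages_convergent_subsequence:
  fixes V :: "nat \<Rightarrow> 'a::euclidean_space \<Rightarrow> real" and \<delta> :: "nat \<Rightarrow> real"
  assumes a: "kern a" and V: "\<And>n. locint D (V n)"
    and bd: "\<forall>K. compact K \<and> K \<subseteq> D \<longrightarrow> (\<exists>B. \<forall>n. (LBINT y. indicator K y * \<bar>V n y\<bar>) \<le> B)"
    and \<delta>: "\<And>j. 0 < \<delta> j"
  shows "\<exists>k. strict_mono (k :: nat \<Rightarrow> nat) \<and>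
    (\<forall>j x. cball x (2 * \<delta> j) \<subseteq> D \<longrightarrow> convergent (\<lambda>n. cv a (\<delta> j) (V (k n)) x))"
proof -
  note [measurable] = sck_measurable[OF a]
  obtain A where A: "\<And>x. a x \<le> A" "A > 0" using kern_bound[OF a] by metis
  obtain T :: "'a set" where T: "countable T" "\<forall>X. open X \<longrightarrow> X \<noteq> {} \<longrightarrow> (\<exists>d\<in>T. d \<in> X)"
    using countable_dense_exists by blast
  define S where "S = {p. snd p \<in> T \<and> cball (snd p) (\<delta> (fst p)) \<subseteq> D}"
  have "S \<subseteq> UNIV \<times> T" by (auto simp: S_def)
  moreover have "countable ((UNIV :: nat set) \<times> T)" using T(1) by (intro countable_SIGMA) auto
  ultimately have Sc: "countable S" by (rule countable_subset)
  have ex: "\<exists>M. \<forall>n. \<bar>cv a (\<delta> (fst p)) (V n) (snd p)\<bar> \<le> M" if p: "p \<in> S" for p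
  proof -
    obtain j q where pq: "p = (j, q)" using prod.exhaust[of p] by metis
    have s: "cball q (\<delta> j) \<subseteq> D" using p by (simp add: S_def pq)
    obtain B where B: "\<And>n. (LBINT y. indicator (cball q (\<delta> j)) y * \<bar>V n y\<bar>) \<le> B" using bd[rule_format, OF conjI[OF compact_cball s]] by blast
    have "\<bar>cv a (\<delta> j) (V n) q\<bar> \<le> A / \<delta> j ^ DIM('a) * B" for n
    proof -
      have z: "sck a (\<delta> j) (y - q) = 0" if "y \<notin> cball q (\<delta> j)" for y
        using that by (intro sck_zero[OF a \<delta>]) (simp add: dist_norm norm_minus_commute)
      have m: "(\<lambda>y. sck a (\<delta> j) (y - q)) \<in> borel_measurable borel" by measurable
      have "\<bar>cv a (\<delta> j) (V n) q\<bar> \<le> A / \<delta> j ^ DIM('a) * (LBINT y. indicator (cball q (\<delta> j)) y * \<bar>V n y\<bar>)"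
        unfolding cv_def by (rule locint_mult(2)[OF V compact_cball s m sck_bound[OF a \<delta> A(1)] z])
      also have "\<dots> \<le> A / \<delta> j ^ DIM('a) * B" using A(2) \<delta>[of j] by (intro mult_left_mono B) auto
      finally show ?thesis .
    qed
    thus ?thesis unfolding pq by auto
  qed
  obtain M where M: "\<forall>p\<in>S. \<forall>n. \<bar>cv a (\<delta> (fst p)) (V n) (snd p)\<bar> \<le> M p"
    using bchoice[of S "\<lambda>p M. \<forall>n. \<bar>cv a (\<delta> (fst p)) (V n) (snd p)\<bar> \<le> M"] ex by blast
  \<comment> \<open>Different centres have different bounds; division by
    \<open>1 + \<bar>M p\<bar>\<close> gives the common bound 1 required for the diagonal
    selection.\<close>
  have Mn: "norm (cv a (\<delta> (fst p)) (V n) (snd p) / (1 + \<bar>M p\<bar>)) \<le> 1" if "p \<in> S" for p n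
  proof -
    have "\<bar>cv a (\<delta> (fst p)) (V n) (snd p)\<bar> \<le> M p" using M that by blast
    thus ?thesis by (simp add: field_simps)
  qed
  obtain k where k: "strict_mono k"
    and lim: "\<And>p. p \<in> S \<Longrightarrow> \<exists>l. (\<lambda>n. cv a (\<delta> (fst p)) (V (k n)) (snd p) / (1 + \<bar>M p\<bar>)) \<longlonglongrightarrow> l"
    using function_convergent_subsequence[of S "\<lambda>n p. cv a (\<delta> (fst p)) (V n) (snd p) / (1 + \<bar>M p\<bar>)" 1, OF Sc Mn] by metis
  have conv: "convergent (\<lambda>n. cv a (\<delta> j) (V (k n)) x)" if x: "cball x (2 * \<delta> j) \<subseteq> D" for j x
  proof -
    have "Cauchy (\<lambda>n. cv a (\<delta> j) (V (k n)) x)"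
    proof (rule metric_CauchyI)
      fix e :: real assume e: "0 < e"
      obtain B where B: "\<And>n. (LBINT y. indicator (cball x (2 * \<delta> j)) y * \<bar>V n y\<bar>) \<le> B" using bd[rule_format, OF conjI[OF compact_cball x]] by blast
      have "0 \<le> (LBINT y. indicator (cball x (2 * \<delta> j)) y * \<bar>V 0 y\<bar>)" by (intro integral_nonneg_AE AE_I2) simp
      hence B0: "0 \<le> B" using B[of 0] by linarith
      \<comment> \<open>With this modulus moving the centre costs less than \<open>e / 3\<close>,
        twice; the Cauchy estimate at \<open>q\<close> supplies the remaining third.\<close>
      define \<omega> where "\<omega> = e / (3 * (B + 1))"
      have \<omega>: "0 < \<omega>" "\<omega> * B < e / 3" using e B0 by (auto simp: \<omega>_def field_simps)
      obtain d where d: "d > 0" "\<And>p q. norm (p - q) < d \<Longrightarrow> \<bar>sck a (\<delta> j) p - sck a (\<delta> j) q\<bar> \<le> \<omega>"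
        using sck_uniformly_continuous[OF a \<delta>[of j] \<omega>(1)] by blast
      have "open (ball x (min d (\<delta> j)))" "ball x (min d (\<delta> j)) \<noteq> {}" using d(1) \<delta>[of j] by auto
      then obtain q where q: "q \<in> T" "q \<in> ball x (min d (\<delta> j))" using T(2) by blast
      have qs: "cball q (\<delta> j) \<subseteq> cball x (2 * \<delta> j)"
      proof
        fix y assume "y \<in> cball q (\<delta> j)"
        thus "y \<in> cball x (2 * \<delta> j)" using q(2) dist_triangle[of x y q] by auto
      qed
      hence qD: "cball q (\<delta> j) \<subseteq> D" using x by blast
      hence "(j, q) \<in> S" using q(1) by (simp add: S_def)
      then obtain l where "(\<lambda>n. cv a (\<delta> j) (V (k n)) q / (1 + \<bar>M (j, q)\<bar>)) \<longlonglongrightarrow> l" using lim by fastforce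
      hence "(\<lambda>n. (1 + \<bar>M (j, q)\<bar>) * (cv a (\<delta> j) (V (k n)) q / (1 + \<bar>M (j, q)\<bar>))) \<longlonglongrightarrow> (1 + \<bar>M (j, q)\<bar>) * l"
        by (intro tendsto_intros)
      hence "(\<lambda>n. cv a (\<delta> j) (V (k n)) q) \<longlonglongrightarrow> (1 + \<bar>M (j, q)\<bar>) * l" by (simp add: add_nonneg_eq_0_iff)
      hence "Cauchy (\<lambda>n. cv a (\<delta> j) (V (k n)) q)" by (rule LIMSEQ_imp_Cauchy)
      then obtain n0 where n0: "\<And>m n. m \<ge> n0 \<Longrightarrow> n \<ge> n0 \<Longrightarrow> dist (cv a (\<delta> j) (V (k m)) q) (cv a (\<delta> j) (V (k n)) q) < e / 3"
        using e by (metis metric_CauchyD divide_pos_pos zero_less_numeral)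
      have close: "\<bar>cv a (\<delta> j) (V n) q - cv a (\<delta> j) (V n) x\<bar> < e / 3" for n
      proof -
        have i: "integrable lborel (\<lambda>y. V n y * sck a (\<delta> j) (y - q))" by (rule cv_integrable[OF V a \<delta> qD])
        have "cball x (\<delta> j) \<subseteq> cball x (2 * \<delta> j)" using \<delta>[of j] by (intro subset_cball) simp
        hence "cball x (\<delta> j) \<subseteq> D" using x by blast
        hence i2: "integrable lborel (\<lambda>y. V n y * sck a (\<delta> j) (y - x))" by (rule cv_integrable[OF V a \<delta>])
        have m: "(\<lambda>y. sck a (\<delta> j) (y - q) - sck a (\<delta> j) (y - x)) \<in> borel_measurable borel" by measurable
        have bb: "\<bar>sck a (\<delta> j) (y - q) - sck a (\<delta> j) (y - x)\<bar> \<le> \<omega>" for y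
        proof (rule d(2))
          have "norm (y - q - (y - x)) = dist x q" by (simp add: dist_norm)
          thus "norm (y - q - (y - x)) < d" using q(2) by simp
        qed
        have zz: "sck a (\<delta> j) (y - q) - sck a (\<delta> j) (y - x) = 0" if y: "y \<notin> cball x (2 * \<delta> j)" for y
        proof -
          have "y \<notin> cball q (\<delta> j)" "y \<notin> cball x (\<delta> j)" using y qs \<delta>[of j] by auto
          thus ?thesis by (simp add: sck_zero[OF a \<delta>] dist_norm norm_minus_commute)
        qed
        have "cv a (\<delta> j) (V n) q - cv a (\<delta> j) (V n) x = (LBINT y. V n y * (sck a (\<delta> j) (y - q) - sck a (\<delta> j) (y - x)))"
          unfolding cv_def right_diff_distrib by (rule Bochner_Integration.integral_diff[OF i i2, symmetric])
        hence "\<bar>cv a (\<delta> j) (V n) q - cv a (\<delta> j) (V n) x\<bar> \<le> \<omega> * (LBINT y. indicator (cball x (2 * \<delta> j)) y * \<bar>V n y\<bar>)"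
          using locint_mult(2)[OF V compact_cball x m bb zz, of n] by simp
        also have "\<dots> \<le> \<omega> * B" using \<omega>(1) by (intro mult_left_mono B) simp
        finally show ?thesis using \<omega>(2) by linarith
      qed
      show "\<exists>N. \<forall>m\<ge>N. \<forall>n\<ge>N. dist (cv a (\<delta> j) (V (k m)) x) (cv a (\<delta> j) (V (k n)) x) < e"
      proof (intro exI allI impI)
        fix m n assume mn: "m \<ge> n0" "n \<ge> n0"
        show "dist (cv a (\<delta> j) (V (k m)) x) (cv a (\<delta> j) (V (k n)) x) < e"
          using n0[OF mn] close[of "k m"] close[of "k n"] unfolding dist_real_def by linarith
      qed
    qed
    thus ?thesis by (rule Cauchy_convergent)
  qed
  thus ?thesis using k by blast
qed

text \<open>The averages over shrinking balls converge along a subsequence, their limits decrease with the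
  radius, and averaging changes a subharmonic function little in L1, uniformly over the sequence.\<close>

theorem sbh_L1_compactness:
  fixes hs :: "nat \<Rightarrow> 'a::euclidean_space \<Rightarrow> ereal" and a :: "'a \<Rightarrow> real"
  assumes a: "kern a" and rad: "\<forall>x y. norm x = norm y \<longrightarrow> a x = a y"
    and D: "open D" "connected D" and hs: "\<And>n. hs n \<in> sbh_star D"
    and bd: "\<And>K. compact K \<Longrightarrow> K \<subseteq> D \<Longrightarrow> unif_L1 (range hs) K"
  shows "\<exists>k g. strict_mono (k :: nat \<Rightarrow> nat) \<and> g \<in> borel_measurable borel \<and>
    (\<forall>K. compact K \<and> K \<subseteq> D \<longrightarrow> (\<integral>\<^sup>+x. ennreal \<bar>g x\<bar> * indicator K x \<partial>lborel) < \<infinity> \<and>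
       (\<lambda>n. \<integral>\<^sup>+x. ennreal \<bar>rl (hs (k n)) x - g x\<bar> * indicator K x \<partial>lborel) \<longlonglongrightarrow> 0)"
proof -
  have us: "hs n \<in> sbh D" for n using hs[of n] by (simp add: sbh_star_def)
  have li: "locint D (rl (hs n))" and fin: "AE x\<in>D in lborel. \<bar>hs n x\<bar> \<noteq> \<infinity>" for n
    using sbh_star_locint[OF D hs[of n]] by blast+
  have bd': "\<exists>B. \<forall>n. (LBINT y. indicator K y * \<bar>rl (hs n) y\<bar>) \<le> B" if K: "compact K" "K \<subseteq> D" for K
    using bd[OF K] L1onD(3) unfolding unif_L1_def by blast
  define \<delta> :: "nat \<Rightarrow> real" where "\<delta> = (\<lambda>j. inverse (real (Suc j)))"
  have \<delta>: "0 < \<delta> j" for j by (simp add: \<delta>_def)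
  have \<delta>0: "\<delta> \<longlonglongrightarrow> 0" unfolding \<delta>_def by (rule LIMSEQ_inverse_real_of_nat)
  have \<delta>mono: "\<delta> i \<le> \<delta> j" if "j \<le> i" for i j using that by (simp add: \<delta>_def field_simps)
  have "\<exists>k. strict_mono (k :: nat \<Rightarrow> nat) \<and>
    (\<forall>j x. cball x (2 * \<delta> j) \<subseteq> D \<longrightarrow> convergent (\<lambda>n. cv a (\<delta> j) (rl (hs (k n))) x))"
    by (rule averages_convergent_subsequence[OF a, where D=D and V="\<lambda>n. rl (hs n)"]) (use li bd' \<delta> in blast)+
  then obtain k where k: "strict_mono (k :: nat \<Rightarrow> nat)"
    and kc: "\<forall>j x. cball x (2 * \<delta> j) \<subseteq> D \<longrightarrow> convergent (\<lambda>n. cv a (\<delta> j) (rl (hs (k n))) x)" by blast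
  define V where "V = (\<lambda>n. rl (hs (k n)))"
  have Vm[measurable]: "V n \<in> borel_measurable borel" for n using li unfolding V_def locint_def by blast
  define A where "A = (\<lambda>j n x. cv a (\<delta> j) (V n) x)"
  have Am[measurable]: "A j n \<in> borel_measurable borel" for j n
    using cv_measurable[OF a Vm, of "\<delta> j" n] unfolding A_def .
  \<comment> \<open>\<open>lim\<close> is unspecified where no limit exists. On a compact
    \<open>K\<close> only indices \<open>j \<ge> J\<close> matter; there \<open>w j\<close> is a
    true limit, and \<open>g\<close> is one almost everywhere.\<close>
  define w where "w = (\<lambda>j x. lim (\<lambda>n. A j n x))"
  have wm[measurable]: "w j \<in> borel_measurable borel" for j
    unfolding w_def by (rule borel_measurable_lim_metric) (rule Am)
  define g where "g = (\<lambda>x. lim (\<lambda>j. w j x))"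
  have gm[measurable]: "g \<in> borel_measurable borel"
    unfolding g_def by (rule borel_measurable_lim_metric) (rule wm)
  have main: "(\<integral>\<^sup>+x. ennreal \<bar>g x\<bar> * indicator K x \<partial>lborel) < \<infinity> \<and>
       (\<lambda>n. \<integral>\<^sup>+x. ennreal \<bar>V n x - g x\<bar> * indicator K x \<partial>lborel) \<longlonglongrightarrow> 0" if K: "compact K" "K \<subseteq> D" "K \<noteq> {}" for K
  proof -
    have [measurable]: "K \<in> sets borel" using K(1) by (rule borel_compact)
    obtain \<tau>0 where \<tau>0: "\<tau>0 > 0" "(\<Union>y\<in>K. cball y \<tau>0) \<subseteq> D"
      using compact_subset_open_imp_cball_epsilon_subset[OF K(1) D(1) K(2)] by metis
    define \<tau> where "\<tau> = \<tau>0 / 2"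
    have \<tau>: "0 < \<tau>" using \<tau>0(1) by (simp add: \<tau>_def)
    define N where "N = {x. infdist x K \<le> 2 * \<tau>}"
    have Nc: "compact N" unfolding N_def using \<tau> K by (intro compact_infdist_le) auto
    have ND: "N \<subseteq> D"
    proof
      fix x assume "x \<in> N"
      moreover obtain y where "y \<in> K" "infdist x K = dist x y"
        using infdist_attains_inf[OF compact_imp_closed[OF K(1)] K(3)] by blast
      ultimately have "x \<in> cball y \<tau>0" "y \<in> K" by (auto simp: N_def \<tau>_def dist_commute)
      thus "x \<in> D" using \<tau>0(2) by blast
    qed
    obtain B where B: "\<And>n. (LBINT y. indicator N y * \<bar>V n y\<bar>) \<le> B" using bd'[OF Nc ND] unfolding V_def by blast
    have "0 \<le> (LBINT y. indicator N y * \<bar>V 0 y\<bar>)" by (intro integral_nonneg_AE AE_I2) simp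
    hence B0: "0 \<le> B" using B[of 0] by linarith
    have "eventually (\<lambda>j. \<delta> j < \<tau> / 2) sequentially" using \<delta>0 by (rule order_tendstoD(2)) (use \<tau> in simp)
    then obtain J where J: "\<And>j. j \<ge> J \<Longrightarrow> \<delta> j < \<tau> / 2" unfolding eventually_sequentially by blast
    \<comment> \<open>Bounds the L1 distance between \<open>V n\<close> and its average of radius
      \<open>\<delta> j\<close>, the same for all \<open>n\<close>.\<close>
    define \<epsilon> where "\<epsilon> = (\<lambda>j. \<delta> j / \<tau> * B)"
    have \<epsilon>0: "\<epsilon> \<longlonglongrightarrow> 0"
    proof -
      have "(\<lambda>j. \<delta> j / \<tau> * B) \<longlonglongrightarrow> 0 / \<tau> * B" using \<tau> by (intro tendsto_intros \<delta>0) simp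
      thus ?thesis by (simp add: \<epsilon>_def)
    qed
    have \<epsilon>nn: "0 \<le> \<epsilon> j" for j using \<delta>[of j] \<tau> B0 by (simp add: \<epsilon>_def)
    have KbN: "cball x (2 * \<tau>) \<subseteq> D" if "x \<in> K" for x
    proof -
      have "cball x (2 * \<tau>) = cball x \<tau>0" by (simp add: \<tau>_def)
      thus ?thesis using \<tau>0(2) that by blast
    qed
    have KbD: "cball x (2 * \<delta> j) \<subseteq> D" if "x \<in> K" "j \<ge> J" for x j
      using KbN[OF that(1)] subset_cball[of "2 * \<delta> j" "2 * \<tau>" x] J[OF that(2)] \<tau> by force
    have e1: "AE x\<in>K in lborel. V n x \<le> A j n x"
      and e2: "(\<integral>\<^sup>+x. ennreal (A j n x - V n x) * indicator K x \<partial>lborel) \<le> ennreal (\<epsilon> j)" if j: "j \<ge> J" for j n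
    proof -
      have dt: "\<delta> j \<le> \<tau>" using J[OF j] \<tau> by simp
      have ND': "{x. infdist x K \<le> 2 * \<tau>} \<subseteq> D" using ND unfolding N_def .
      note er = sbh_average_L1_error[OF us D(1) li fin a rad K(1,3) \<tau> ND' \<delta> dt, of "k n"]
      show "AE x\<in>K in lborel. V n x \<le> A j n x" using er(1) unfolding V_def A_def .
      have "(\<integral>\<^sup>+x. ennreal (A j n x - V n x) * indicator K x \<partial>lborel) \<le> ennreal (\<delta> j / \<tau> * (LBINT y. indicator N y * \<bar>V n y\<bar>))"
        using er(2) unfolding V_def A_def N_def .
      also have "\<dots> \<le> ennreal (\<epsilon> j)" unfolding \<epsilon>_def using \<delta>[of j] \<tau> by (intro ennreal_leI mult_left_mono B) simp
      finally show "(\<integral>\<^sup>+x. ennreal (A j n x - V n x) * indicator K x \<partial>lborel) \<le> ennreal (\<epsilon> j)" .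
    qed
    have Amono: "A i n x \<le> A j n x" if "x \<in> K" "J \<le> j" "j \<le> i" for i j n x
    proof -
      have "cball x (\<delta> j) \<subseteq> cball x (2 * \<delta> j)" using \<delta>[of j] by (intro subset_cball) simp
      hence s: "cball x (\<delta> j) \<subseteq> D" using KbD[OF that(1,2)] by blast
      show ?thesis unfolding A_def V_def
        by (rule sbh_radial_average_mono[OF us D(1) li fin a rad \<delta> \<delta>mono[OF that(3)] s])
    qed
    have Alim: "(\<lambda>n. A j n x) \<longlonglongrightarrow> w j x" if "x \<in> K" "J \<le> j" for j x
    proof -
      have "convergent (\<lambda>n. A j n x)" using kc KbD[OF that] unfolding A_def V_def by blast
      thus ?thesis unfolding w_def by (simp add: convergent_LIMSEQ_iff)
    qed
    have wmono: "w i x \<le> w j x" if "x \<in> K" "J \<le> j" "j \<le> i" for i j x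
      using Alim[of x j] Alim[of x i] that Amono by (intro LIMSEQ_le[of "\<lambda>n. A i n x" _ "\<lambda>n. A j n x"]) auto
    \<comment> \<open>Fatou in \<open>n\<close>. As \<open>A i n\<close> lies above
      \<open>V n\<close>, the difference of two averages is at most the error of the coarser
      one.\<close>
    have wdiff: "(\<integral>\<^sup>+x. ennreal (w j x - w i x) * indicator K x \<partial>lborel) \<le> ennreal (\<epsilon> j)" if "J \<le> j" "j \<le> i" for i j
    proof -
      have "(\<integral>\<^sup>+x. ennreal (w j x - w i x) * indicator K x \<partial>lborel)
         = (\<integral>\<^sup>+x. liminf (\<lambda>n. ennreal (A j n x - A i n x) * indicator K x) \<partial>lborel)"
      proof (rule nn_integral_cong)
        fix x
        show "ennreal (w j x - w i x) * indicator K x = liminf (\<lambda>n. ennreal (A j n x - A i n x) * indicator K x)"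
        proof (cases "x \<in> K")
          case True
          have "(\<lambda>n. A j n x - A i n x) \<longlonglongrightarrow> w j x - w i x" using True that by (intro tendsto_diff Alim) auto
          hence "(\<lambda>n. ennreal (A j n x - A i n x)) \<longlonglongrightarrow> ennreal (w j x - w i x)" by (rule tendsto_ennrealI)
          thus ?thesis using True by (simp add: lim_imp_Liminf)
        qed (simp add: Liminf_const)
      qed
      also have "\<dots> \<le> liminf (\<lambda>n. \<integral>\<^sup>+x. ennreal (A j n x - A i n x) * indicator K x \<partial>lborel)"
        by (rule nn_integral_liminf) measurable
      also have "\<dots> \<le> liminf (\<lambda>n. ennreal (\<epsilon> j))"
      proof (rule Liminf_mono, rule always_eventually, rule allI)
        fix n
        have "(\<integral>\<^sup>+x. ennreal (A j n x - A i n x) * indicator K x \<partial>lborel) \<le> (\<integral>\<^sup>+x. ennreal (A j n x - V n x) * indicator K x \<partial>lborel)"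
        proof (rule nn_integral_mono_AE)
          show "AE x in lborel. ennreal (A j n x - A i n x) * indicator K x \<le> ennreal (A j n x - V n x) * indicator K x"
            using e1[OF order.trans[OF that], of n]
            by eventually_elim (auto simp: indicator_def intro!: ennreal_leI)
        qed
        also have "\<dots> \<le> ennreal (\<epsilon> j)" by (rule e2[OF that(1)])
        finally show "(\<integral>\<^sup>+x. ennreal (A j n x - A i n x) * indicator K x \<partial>lborel) \<le> ennreal (\<epsilon> j)" .
      qed
      also have "\<dots> = ennreal (\<epsilon> j)" by (simp add: Liminf_const)
      finally show ?thesis .
    qed
    define P where "P = (\<lambda>j i x. ennreal (w j x - w (j + i) x) * indicator K x)"
    have Pm[measurable]: "P j i \<in> borel_measurable lborel" for j i unfolding P_def by measurable
    have Pinc: "incseq (\<lambda>i. P j i x)" if "J \<le> j" for j x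
    proof (rule incseq_SucI)
      fix i
      show "P j i x \<le> P j (Suc i) x"
      proof (cases "x \<in> K")
        case True
        have "w (j + Suc i) x \<le> w (j + i) x" using True that by (intro wmono) auto
        thus ?thesis using True unfolding P_def by (auto intro!: ennreal_leI)
      qed (simp add: P_def)
    qed
    have Psup: "(\<integral>\<^sup>+x. (SUP i. P j i x) \<partial>lborel) \<le> ennreal (\<epsilon> j)" if "J \<le> j" for j
    proof -
      have "(\<integral>\<^sup>+x. (SUP i. P j i x) \<partial>lborel) = (SUP i. \<integral>\<^sup>+x. P j i x \<partial>lborel)"
        using Pinc[OF that] by (intro nn_integral_monotone_convergence_SUP) (auto simp: incseq_def le_fun_def)
      also have "\<dots> \<le> ennreal (\<epsilon> j)" unfolding P_def using that by (intro SUP_least wdiff) auto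
      finally show ?thesis .
    qed
    \<comment> \<open>The total decrease has finite integral, so for almost every \<open>x\<close>
      the decreasing sequence \<open>w j x\<close> is bounded below.\<close>
    have "AE x in lborel. (SUP i. P J i x) \<noteq> \<infinity>"
    proof (rule nn_integral_PInf_AE)
      show "(\<integral>\<^sup>+x. (SUP i. P J i x) \<partial>lborel) \<noteq> \<infinity>" using Psup[of J] by (auto simp: top_unique)
    qed measurable
    hence wlim: "AE x\<in>K in lborel. (\<lambda>j. w j x) \<longlonglongrightarrow> g x"
    proof eventually_elim
      case (elim x)
      show ?case
      proof
        assume x: "x \<in> K"
        obtain b where b: "(SUP i. P J i x) = ennreal b" "0 \<le> b" using elim by (cases "SUP i. P J i x") auto
        have low: "w J x - b \<le> w (J + i) x" for i
        proof -
          have "P J i x \<le> (SUP i. P J i x)" by (rule SUP_upper) simp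
          hence "ennreal (w J x - w (J + i) x) \<le> ennreal b" unfolding b(1) using x by (simp add: P_def)
          thus ?thesis using b(2) by (simp add: ennreal_le_iff)
        qed
        have "decseq (\<lambda>i. w (i + J) x)" using x wmono by (auto simp: decseq_def)
        moreover have "bdd_below (range (\<lambda>i. w (i + J) x))"
          using low by (intro bdd_belowI2[of _ "w J x - b"]) (simp add: add.commute)
        ultimately have "convergent (\<lambda>i. w (i + J) x)" using LIMSEQ_decseq_INF convergentI by blast
        hence "convergent (\<lambda>i. w i x)" by (rule convergent_ignore_initial_segment[THEN iffD1])
        thus "(\<lambda>j. w j x) \<longlonglongrightarrow> g x" unfolding g_def by (simp add: convergent_LIMSEQ_iff)
      qed
    qed
    have e3: "(\<integral>\<^sup>+x. ennreal \<bar>w j x - g x\<bar> * indicator K x \<partial>lborel) \<le> ennreal (\<epsilon> j)" if j: "J \<le> j" for j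
    proof -
      have "(\<integral>\<^sup>+x. ennreal \<bar>w j x - g x\<bar> * indicator K x \<partial>lborel) \<le> (\<integral>\<^sup>+x. (SUP i. P j i x) \<partial>lborel)"
      proof (rule nn_integral_mono_AE)
        show "AE x in lborel. ennreal \<bar>w j x - g x\<bar> * indicator K x \<le> (SUP i. P j i x)"
          using wlim
        proof eventually_elim
          case (elim x)
          show ?case
          proof (cases "x \<in> K")
            case True
            hence l: "(\<lambda>i. w i x) \<longlonglongrightarrow> g x" using elim by blast
            hence "(\<lambda>i. w (i + j) x) \<longlonglongrightarrow> g x" by (rule LIMSEQ_ignore_initial_segment)
            hence l2: "(\<lambda>i. w (j + i) x) \<longlonglongrightarrow> g x" by (simp add: add.commute)
            hence "g x \<le> w j x" using True j by (intro LIMSEQ_le_const2[OF l2]) (auto intro!: wmono)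
            hence ab: "\<bar>w j x - g x\<bar> = w j x - g x" by simp
            have "(\<lambda>i. ennreal (w j x - w (j + i) x)) \<longlonglongrightarrow> ennreal (w j x - g x)"
              by (intro tendsto_ennrealI tendsto_intros l2)
            hence "(\<lambda>i. P j i x) \<longlonglongrightarrow> ennreal (w j x - g x)" using True by (simp add: P_def)
            hence "ennreal (w j x - g x) = (SUP i. P j i x)"
              using LIMSEQ_SUP[OF Pinc[OF j]] LIMSEQ_unique by blast
            thus ?thesis using True by (simp add: ab)
          qed simp
        qed
      qed
      also have "\<dots> \<le> ennreal (\<epsilon> j)" by (rule Psup[OF j])
      finally show ?thesis .
    qed
    \<comment> \<open>For a fixed radius the averages are uniformly bounded on \<open>K\<close>, so
      their pointwise convergence is convergence in L1.\<close>
    have mid: "(\<lambda>n. \<integral>\<^sup>+x. ennreal \<bar>A j n x - w j x\<bar> * indicator K x \<partial>lborel) \<longlonglongrightarrow> 0" if j: "J \<le> j" for j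
    proof -
      obtain M where M: "\<And>x. a x \<le> M" "M > 0" using kern_bound[OF a] by metis
      define b where "b = M / \<delta> j ^ DIM('a) * B"
      have b: "\<bar>A j n x\<bar> \<le> b" if x: "x \<in> K" for n x
      proof -
        have z: "sck a (\<delta> j) (y - x) = 0" if "y \<notin> N" for y
        proof (rule sck_zero[OF a \<delta>])
          have "2 * \<tau> < infdist y K" using that by (simp add: N_def)
          also have "\<dots> \<le> dist y x" using x by (rule infdist_le)
          finally show "\<delta> j \<le> norm (y - x)" using J[OF j] \<tau> by (simp add: dist_norm)
        qed
        have m: "(\<lambda>y. sck a (\<delta> j) (y - x)) \<in> borel_measurable borel" using sck_measurable[OF a] by measurable
        have "\<bar>A j n x\<bar> \<le> M / \<delta> j ^ DIM('a) * (LBINT y. indicator N y * \<bar>V n y\<bar>)"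
          unfolding A_def cv_def V_def by (rule locint_mult(2)[OF li Nc ND m sck_bound[OF a \<delta> M(1)] z])
        also have "\<dots> \<le> b" unfolding b_def using M(2) \<delta>[of j] by (intro mult_left_mono B) auto
        finally show ?thesis .
      qed
      have wb: "\<bar>w j x\<bar> \<le> b" if "x \<in> K" for x
        using tendsto_rabs[OF Alim[OF that j]] b[OF that] by (intro LIMSEQ_le_const2) auto
      have "(\<lambda>n. \<integral>\<^sup>+x. ennreal \<bar>A j n x - w j x\<bar> * indicator K x \<partial>lborel) \<longlonglongrightarrow> (\<integral>\<^sup>+x. 0 \<partial>(lborel :: 'a measure))"
      proof (rule nn_integral_dominated_convergence[where w="\<lambda>x. ennreal (2 * b) * indicator K x"])
        show "(\<integral>\<^sup>+x. ennreal (2 * b) * indicator K x \<partial>lborel) < \<infinity>"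
          using emeasure_compact_finite[OF K(1)] by (simp add: nn_integral_cmult ennreal_mult_less_top)
        show "AE x in lborel. ennreal \<bar>A j n x - w j x\<bar> * indicator K x \<le> ennreal (2 * b) * indicator K x" for n
        proof (rule AE_I2)
          fix x
          show "ennreal \<bar>A j n x - w j x\<bar> * indicator K x \<le> ennreal (2 * b) * indicator K x"
          proof (cases "x \<in> K")
            case True
            hence "\<bar>A j n x - w j x\<bar> \<le> 2 * b" using b[OF True, of n] wb[OF True] by linarith
            thus ?thesis using True by (simp add: ennreal_leI)
          qed simp
        qed
        show "AE x in lborel. (\<lambda>n. ennreal \<bar>A j n x - w j x\<bar> * indicator K x) \<longlonglongrightarrow> 0"
        proof (rule AE_I2)
          fix x
          show "(\<lambda>n. ennreal \<bar>A j n x - w j x\<bar> * indicator K x) \<longlonglongrightarrow> 0"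
          proof (cases "x \<in> K")
            case True
            have "(\<lambda>n. \<bar>A j n x - w j x\<bar>) \<longlonglongrightarrow> \<bar>w j x - w j x\<bar>" by (intro tendsto_intros Alim True j)
            hence "(\<lambda>n. ennreal \<bar>A j n x - w j x\<bar>) \<longlonglongrightarrow> ennreal \<bar>w j x - w j x\<bar>" by (rule tendsto_ennrealI)
            thus ?thesis using True by simp
          qed simp
        qed
      qed measurable
      thus ?thesis by simp
    qed
    \<comment> \<open>Comparison in three parts: \<open>V n\<close> with its average, the average
      with \<open>w j\<close>, and \<open>w j\<close> with \<open>g\<close>. The first and the last
      are small by the choice of \<open>j\<close>, after which \<open>n\<close> makes the middle one
      small.\<close>
    have tri: "(\<integral>\<^sup>+x. ennreal \<bar>V n x - g x\<bar> * indicator K x \<partial>lborel)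
      \<le> ennreal (2 * \<epsilon> j) + (\<integral>\<^sup>+x. ennreal \<bar>A j n x - w j x\<bar> * indicator K x \<partial>lborel)" if j: "J \<le> j" for j n
    proof -
      have "(\<integral>\<^sup>+x. ennreal \<bar>V n x - g x\<bar> * indicator K x \<partial>lborel)
        \<le> (\<integral>\<^sup>+x. (ennreal (A j n x - V n x) * indicator K x + ennreal \<bar>w j x - g x\<bar> * indicator K x)
            + ennreal \<bar>A j n x - w j x\<bar> * indicator K x \<partial>lborel)"
      proof (rule nn_integral_mono_AE)
        show "AE x in lborel. ennreal \<bar>V n x - g x\<bar> * indicator K x
          \<le> (ennreal (A j n x - V n x) * indicator K x + ennreal \<bar>w j x - g x\<bar> * indicator K x)
            + ennreal \<bar>A j n x - w j x\<bar> * indicator K x"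
          using e1[OF j, of n]
        proof eventually_elim
          case (elim x)
          show ?case
          proof (cases "x \<in> K")
            case True
            hence p: "0 \<le> A j n x - V n x" using elim by simp
            have "\<bar>V n x - g x\<bar> \<le> (A j n x - V n x) + \<bar>w j x - g x\<bar> + \<bar>A j n x - w j x\<bar>" using p by linarith
            hence "ennreal \<bar>V n x - g x\<bar> \<le> ennreal ((A j n x - V n x) + \<bar>w j x - g x\<bar> + \<bar>A j n x - w j x\<bar>)"
              by (rule ennreal_leI)
            also have "\<dots> = ennreal (A j n x - V n x) + ennreal \<bar>w j x - g x\<bar> + ennreal \<bar>A j n x - w j x\<bar>"
              using p by (simp add: ennreal_plus[symmetric] del: ennreal_plus)
            finally show ?thesis using True by simp
          qed simp
        qed
      qed
      also have "\<dots> = ((\<integral>\<^sup>+x. ennreal (A j n x - V n x) * indicator K x \<partial>lborel) + (\<integral>\<^sup>+x. ennreal \<bar>w j x - g x\<bar> * indicator K x \<partial>lborel))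
            + (\<integral>\<^sup>+x. ennreal \<bar>A j n x - w j x\<bar> * indicator K x \<partial>lborel)"
        by (subst nn_integral_add; (subst nn_integral_add)?; measurable)
      also have "\<dots> \<le> (ennreal (\<epsilon> j) + ennreal (\<epsilon> j)) + (\<integral>\<^sup>+x. ennreal \<bar>A j n x - w j x\<bar> * indicator K x \<partial>lborel)"
        by (intro add_mono e2[OF j] e3[OF j] order.refl)
      also have "ennreal (\<epsilon> j) + ennreal (\<epsilon> j) = ennreal (2 * \<epsilon> j)" using \<epsilon>nn[of j] by (simp flip: ennreal_plus)
      finally show ?thesis .
    qed
    have lim0: "(\<lambda>n. \<integral>\<^sup>+x. ennreal \<bar>V n x - g x\<bar> * indicator K x \<partial>lborel) \<longlonglongrightarrow> 0"
    proof (rule order_tendstoI)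
      fix e :: ennreal assume e: "0 < e"
      obtain r where r: "0 < r" "ennreal r < e"
      proof (cases e)
        case (real s)
        thus ?thesis using e that[of "s / 2"] by (auto simp: ennreal_less_iff)
      qed (use that[of 1] in auto)
      have "(\<lambda>j. 2 * \<epsilon> j) \<longlonglongrightarrow> 2 * 0" by (intro tendsto_intros \<epsilon>0)
      hence "eventually (\<lambda>j. 2 * \<epsilon> j < r / 2) sequentially" by (rule order_tendstoD(2)) (use r in simp)
      hence "eventually (\<lambda>j. 2 * \<epsilon> j < r / 2 \<and> J \<le> j) sequentially"
        using eventually_ge_at_top[of J] by eventually_elim simp
      then obtain j where j: "2 * \<epsilon> j < r / 2" "J \<le> j" using eventually_happens'[OF sequentially_bot] by blast
      have "0 < ennreal (r / 2)" using r(1) by simp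
      hence "eventually (\<lambda>n. (\<integral>\<^sup>+x. ennreal \<bar>A j n x - w j x\<bar> * indicator K x \<partial>lborel) < ennreal (r / 2)) sequentially"
        by (rule order_tendstoD(2)[OF mid[OF j(2)]])
      thus "eventually (\<lambda>n. (\<integral>\<^sup>+x. ennreal \<bar>V n x - g x\<bar> * indicator K x \<partial>lborel) < e) sequentially"
      proof eventually_elim
        case (elim n)
        have "(\<integral>\<^sup>+x. ennreal \<bar>V n x - g x\<bar> * indicator K x \<partial>lborel) \<le> ennreal (r / 2) + ennreal (r / 2)"
          by (rule order.trans[OF tri[OF j(2)]]) (intro add_mono ennreal_leI less_imp_le[OF elim] less_imp_le[OF j(1)])
        also have "\<dots> = ennreal r" using r(1) by (simp flip: ennreal_plus)
        finally show ?case using r(2) by simp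
      qed
    qed simp
    moreover have "(\<integral>\<^sup>+x. ennreal \<bar>g x\<bar> * indicator K x \<partial>lborel) < \<infinity>"
    proof -
      have "eventually (\<lambda>n. (\<integral>\<^sup>+x. ennreal \<bar>V n x - g x\<bar> * indicator K x \<partial>lborel) < 1) sequentially"
        by (rule order_tendstoD(2)[OF lim0]) simp
      then obtain n where n: "(\<integral>\<^sup>+x. ennreal \<bar>V n x - g x\<bar> * indicator K x \<partial>lborel) < 1"
        using eventually_happens'[OF sequentially_bot] by blast
      have iV: "integrable lborel (\<lambda>x. indicator K x * V n x)" using li K(1,2) unfolding locint_def V_def by blast
      have "(\<integral>\<^sup>+x. ennreal \<bar>g x\<bar> * indicator K x \<partial>lborel)
         \<le> (\<integral>\<^sup>+x. ennreal \<bar>V n x - g x\<bar> * indicator K x + ennreal (norm (indicator K x * V n x)) \<partial>lborel)"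
      proof (rule nn_integral_mono)
        fix x
        have "ennreal \<bar>g x\<bar> \<le> ennreal (\<bar>V n x - g x\<bar> + \<bar>V n x\<bar>)" by (intro ennreal_leI) linarith
        thus "ennreal \<bar>g x\<bar> * indicator K x \<le> ennreal \<bar>V n x - g x\<bar> * indicator K x + ennreal (norm (indicator K x * V n x))"
          by (auto simp: indicator_def)
      qed
      also have "\<dots> = (\<integral>\<^sup>+x. ennreal \<bar>V n x - g x\<bar> * indicator K x \<partial>lborel) + (\<integral>\<^sup>+x. ennreal (norm (indicator K x * V n x)) \<partial>lborel)"
        by (rule nn_integral_add) measurable
      also have "\<dots> < \<infinity>" using n iV by (auto simp: integrable_iff_bounded intro: less_trans)
      finally show ?thesis .
    qed
    ultimately show ?thesis by blast
  qed
  have "(\<integral>\<^sup>+x. ennreal \<bar>g x\<bar> * indicator K x \<partial>lborel) < \<infinity> \<and>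
       (\<lambda>n. \<integral>\<^sup>+x. ennreal \<bar>rl (hs (k n)) x - g x\<bar> * indicator K x \<partial>lborel) \<longlonglongrightarrow> 0" if "compact K" "K \<subseteq> D" for K
  proof (cases "K = {}")
    case False
    thus ?thesis using main[OF that] unfolding V_def by blast
  qed simp
  thus ?thesis using k gm by blast
qed

text \<open>The mean over a small ball, on which \<open>f\<close> varies by less than
  \<open>c\<close>, upgrades the almost everywhere bound to every point at the cost of
  \<open>c\<close>.\<close>

lemma sbh_le_continuous_bound:
  fixes D :: "'a::euclidean_space set" and f :: "'a \<Rightarrow> real"
  assumes h: "h \<in> sbh D" and D: "open D" and f: "continuous_on D f"
    and AE: "AE y\<in>D in lborel. rl h y \<le> f y" and x: "x \<in> D" and c: "0 < c"
  shows "h x \<le> ereal (f x + c)"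
proof (cases "h x = - \<infinity>")
  case False
  obtain e where e: "e > 0" "\<And>y. y \<in> D \<Longrightarrow> dist y x < e \<Longrightarrow> dist (f y) (f x) < c"
    using f x c unfolding continuous_on_iff by metis
  obtain s where s: "s > 0" "cball x s \<subseteq> D" using open_contains_cball_eq[OF D] x by blast
  define r where "r = min s (e / 2)"
  have r: "0 < r" "r < e" "cball x r \<subseteq> D" using s e(1) subset_cball[of r s x] by (auto simp: r_def)
  note bm = sbh_ball_mean[OF h D r(1) r(3) False]
  let ?B = "indicator (ball x r) :: 'a \<Rightarrow> real"
  have iB: "integrable lborel ?B" using emeasure_lborel_ball_finite by (intro integrable_real_indicator) auto
  have v: "0 < measure lborel (ball x r)" using r(1) by (rule content_ball_pos)
  have "rl h x * measure lborel (ball x r) \<le> (LBINT y. ?B y * rl h y)" by (rule bm(3))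
  also have "\<dots> \<le> (LBINT y. (f x + c) * ?B y)"
  proof (rule integral_mono_AE[OF bm(2) integrable_mult_right[OF iB]])
    show "AE y in lborel. ?B y * rl h y \<le> (f x + c) * ?B y"
      using AE
    proof eventually_elim
      case (elim y)
      show ?case
      proof (cases "y \<in> ball x r")
        case True
        hence y: "y \<in> D" "dist y x < e" using r(2,3) by (auto simp: dist_commute)
        hence "dist (f y) (f x) < c" by (rule e(2))
        thus ?thesis using True elim y(1) by (auto simp: dist_real_def)
      qed simp
    qed
  qed
  also have "\<dots> = (f x + c) * measure lborel (ball x r)" by simp
  finally have "rl h x \<le> f x + c" using v by simp
  thus ?thesis using False sbhD(1)[OF h x] by (cases "h x") auto
qed simp

subsection \<open>Passage to the limit\<close>

text \<open>Alternative (a). The value 0 off \<open>D\<close> keeps the regularised limit within the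
  extensional convention of \<open>sbh\<close>.\<close>

definition limsup_closed :: "'a::euclidean_space set \<Rightarrow> ('a \<Rightarrow> ereal) set \<Rightarrow> bool" where
  "limsup_closed D H \<longleftrightarrow>
     (\<forall>hs. (\<forall>k. hs k \<in> H) \<and>
        (\<forall>K. compact K \<and> K \<subseteq> D \<longrightarrow> (\<exists>M::real. \<forall>k. \<forall>x\<in>K. hs k x \<le> ereal M)) \<and>
        (\<exists>x\<in>D. limsup (\<lambda>k. hs k x) \<noteq> -\<infinity>)
      \<longrightarrow> (\<lambda>x. if x \<in> D then usc_reg (\<lambda>y. limsup (\<lambda>k. hs k y)) x else 0) \<in> H)"

text \<open>Alternative (b). A limit in L1 is determined only up to null sets, so closedness asks
  for a member of \<open>H\<close> that agrees with it almost everywhere.\<close>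

definition L1_closed :: "'a::euclidean_space set \<Rightarrow> ('a \<Rightarrow> ereal) set \<Rightarrow> bool" where
  "L1_closed D H \<longleftrightarrow>
     (\<forall>hs g. (\<forall>k. hs k \<in> H) \<and> L1loc D g \<and> L1loc_tendsto D hs g
      \<longrightarrow> (\<exists>h\<in>H. AE x\<in>D in lebesgue. h x = g x))"

text \<open>The lower bound for the integrals works in two ways. Under limsup-closedness Fatou's
  lemma shows that the upper limit is not identically minus infinity on \<open>Q\<close>. Under
  L1-closedness it provides points of \<open>Q\<close> with values bounded below, hence L1 bounds on
  compact sets and a convergent subsequence. Either way the bound by \<open>f\<close> survives with
  \<open>C + 1\<close>.\<close>

lemma closed_family_limit:
  fixes D Q :: "'a::euclidean_space set" and \<nu> :: "'a measure" and f a :: "'a \<Rightarrow> real"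
  assumes a: "kern a" and rad: "\<forall>x y. norm x = norm y \<longrightarrow> a x = a y"
    and D: "open D" "connected D" and H: "H \<subseteq> sbh_star D"
    and cond_ab: "limsup_closed D H \<or> L1_closed D H"
    and f: "continuous_on D f" and Q: "compact Q" "Q \<subseteq> D"
    and \<nu>: "finite_measure \<nu>" "sets \<nu> = sets borel" "AE x in \<nu>. x \<in> Q" "emeasure \<nu> (space \<nu>) \<noteq> 0"
    and env: "\<forall>K. compact K \<and> K \<subseteq> D \<longrightarrow> (\<exists>h\<in>H. integrable \<nu> (rl h) \<and> (AE x in \<nu>. \<bar>h x\<bar> \<noteq> \<infinity>) \<and>
      (\<forall>x\<in>K. h x \<le> ereal (f x + C)) \<and> - C \<le> (\<integral>x. rl h x \<partial>\<nu>))"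
  shows "\<exists>C'. \<exists>h\<in>H. \<forall>x\<in>D. h x \<le> ereal (f x + C')"
proof -
  interpret \<nu>: finite_measure \<nu> by (rule \<nu>(1))
  obtain X where X: "\<And>n. compact (X n)" "\<And>n. X n \<subseteq> D" and XU: "\<Union>(range X) = D"
    and XK: "\<And>K. compact K \<Longrightarrow> K \<subseteq> D \<Longrightarrow> \<exists>N::nat. \<forall>n\<ge>N. K \<subseteq> X n"
    using open_Union_compact_subsets[OF D(1)] by metis
  have "\<forall>n. \<exists>h. h \<in> H \<and> integrable \<nu> (rl h) \<and> (AE x in \<nu>. \<bar>h x\<bar> \<noteq> \<infinity>) \<and>
      (\<forall>x\<in>X n. h x \<le> ereal (f x + C)) \<and> - C \<le> (\<integral>x. rl h x \<partial>\<nu>)"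
    using env[rule_format, OF conjI[OF X]] unfolding Bex_def by (rule allI)
  then obtain hs where hs: "\<forall>n. hs n \<in> H \<and> integrable \<nu> (rl (hs n)) \<and> (AE x in \<nu>. \<bar>hs n x\<bar> \<noteq> \<infinity>) \<and>
      (\<forall>x\<in>X n. hs n x \<le> ereal (f x + C)) \<and> - C \<le> (\<integral>x. rl (hs n) x \<partial>\<nu>)" unfolding choice_iff by blast
  have hH: "hs n \<in> H" and hi: "integrable \<nu> (rl (hs n))" and hf: "AE x in \<nu>. \<bar>hs n x\<bar> \<noteq> \<infinity>"
    and hX: "\<And>x. x \<in> X n \<Longrightarrow> hs n x \<le> ereal (f x + C)" and hC: "- C \<le> (\<integral>x. rl (hs n) x \<partial>\<nu>)" for n
    using hs by blast+
  have hst: "hs n \<in> sbh_star D" for n using H hH by blast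
  have us: "hs n \<in> sbh D" for n using hst[of n] by (simp add: sbh_star_def)
  have hm[measurable]: "hs n \<in> borel_measurable \<nu>" for n
    using sbh_borel[OF us D(1)] measurable_cong_sets[OF \<nu>(2) refl, of borel] by blast
  \<comment> \<open>From some index on, \<open>K\<close> lies in \<open>X n\<close> and
    \<open>f\<close> gives the bound; the finitely many earlier members contribute their own bounds,
    collected in the sum.\<close>
  have ub: "\<exists>M::real. \<forall>n. \<forall>x\<in>K. hs n x \<le> ereal M" if K: "compact K" "K \<subseteq> D" for K
  proof -
    obtain N where N: "\<And>n. n \<ge> N \<Longrightarrow> K \<subseteq> X n" using XK[OF K] by blast
    have "bounded (f ` K)" by (intro compact_imp_bounded compact_continuous_image continuous_on_subset[OF f] K)
    then obtain A where A: "\<And>x. x \<in> K \<Longrightarrow> \<bar>f x\<bar> \<le> A" unfolding bounded_iff by auto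
    have "\<exists>M. \<forall>x\<in>K. hs n x \<le> ereal M" for n by (rule sbh_bounded_above[OF us[of n] D(1) K]) blast
    then obtain M where M: "\<And>n x. x \<in> K \<Longrightarrow> hs n x \<le> ereal (M n)" by metis
    have "hs n x \<le> ereal (\<bar>A\<bar> + \<bar>C\<bar> + (\<Sum>n<N. \<bar>M n\<bar>))" if x: "x \<in> K" for n x
    proof (cases "n < N")
      case True
      hence "\<bar>M n\<bar> \<le> (\<Sum>n<N. \<bar>M n\<bar>)" by (intro member_le_sum) auto
      hence "M n \<le> \<bar>A\<bar> + \<bar>C\<bar> + (\<Sum>n<N. \<bar>M n\<bar>)" by linarith
      thus ?thesis using M[OF x, of n] by (meson ereal_less_eq(3) order.trans)
    next
      case False
      hence "hs n x \<le> ereal (f x + C)" using x N[of n] by (intro hX) auto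
      moreover have "0 \<le> (\<Sum>n<N. \<bar>M n\<bar>)" by (intro sum_nonneg) simp
      hence "f x + C \<le> \<bar>A\<bar> + \<bar>C\<bar> + (\<Sum>n<N. \<bar>M n\<bar>)" using A[OF x] by linarith
      ultimately show ?thesis by (meson ereal_less_eq(3) order.trans)
    qed
    thus ?thesis by blast
  qed
  obtain MQ where MQ: "\<And>n x. x \<in> Q \<Longrightarrow> hs n x \<le> ereal MQ" using ub[OF Q] by blast
  define m where "m = measure \<nu> (space \<nu>)"
  have m: "0 < m" unfolding m_def using \<nu>(4) by (simp add: \<nu>.emeasure_eq_measure less_le)
  show ?thesis
    using cond_ab
  proof (elim disjE)
    assume A: "limsup_closed D H"
    define L where "L = (\<lambda>y. limsup (\<lambda>k. hs k y))"
    have ex: "\<exists>x\<in>D. L x \<noteq> -\<infinity>"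
    proof (rule ccontr)
      assume "\<not> ?thesis"
      hence L: "L x = -\<infinity>" if "x \<in> Q" for x using that Q(2) by blast
      \<comment> \<open>Fatou is applied to \<open>MQ - hs n\<close>, nonnegative on
        \<open>Q\<close>: were the upper limit minus infinity throughout \<open>Q\<close>, the lower
        limit of these functions would be infinite almost everywhere, while their integrals stay
        below \<open>MQ * m + C\<close>.\<close>
      have "AE x in \<nu>. \<forall>n. \<bar>hs n x\<bar> \<noteq> \<infinity>" using hf by (simp add: AE_all_countable)
      hence top: "AE x in \<nu>. liminf (\<lambda>n. ennreal (MQ - rl (hs n) x)) = \<infinity>"
        using \<nu>(3)
      proof eventually_elim
        case (elim x)
        have fx: "\<bar>hs n x\<bar> \<noteq> \<infinity>" for n using elim(1) by (rule spec)
        have ge: "ennreal (real i) \<le> liminf (\<lambda>n. ennreal (MQ - rl (hs n) x))" for i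
        proof (rule Liminf_bounded)
          have "limsup (\<lambda>k. hs k x) < ereal (MQ - real i)" using L[OF elim(2)] by (simp add: L_def)
          hence "eventually (\<lambda>n. hs n x < ereal (MQ - real i)) sequentially" by (rule Limsup_lessD)
          thus "eventually (\<lambda>n. ennreal (real i) \<le> ennreal (MQ - rl (hs n) x)) sequentially"
          proof eventually_elim
            case (elim n)
            have "rl (hs n) x < MQ - real i" using elim fx[of n] by (cases "hs n x") auto
            thus ?case by (intro ennreal_leI) simp
          qed
        qed
        show ?case
        proof (rule ccontr)
          assume "liminf (\<lambda>n. ennreal (MQ - rl (hs n) x)) \<noteq> \<infinity>"
          then obtain s where s: "liminf (\<lambda>n. ennreal (MQ - rl (hs n) x)) = ennreal s" "0 \<le> s"
            by (cases "liminf (\<lambda>n. ennreal (MQ - rl (hs n) x))") auto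
          obtain i :: nat where "s < real i" using reals_Archimedean2 by blast
          thus False using ge[of i] s by (simp add: ennreal_le_iff)
        qed
      qed
      have bd: "(\<integral>\<^sup>+x. ennreal (MQ - rl (hs n) x) \<partial>\<nu>) \<le> ennreal (MQ * m + C)" for n
      proof -
        have i: "integrable \<nu> (\<lambda>x. MQ - rl (hs n) x)" using hi by (intro Bochner_Integration.integrable_diff) auto
        have nn: "AE x in \<nu>. 0 \<le> MQ - rl (hs n) x"
          using \<nu>(3) hf[of n]
        proof eventually_elim
          case (elim x)
          thus ?case using MQ[OF elim(1), of n] by (cases "hs n x") auto
        qed
        have "(\<integral>x. MQ - rl (hs n) x \<partial>\<nu>) = MQ * m - (\<integral>x. rl (hs n) x \<partial>\<nu>)"
          using hi by (subst Bochner_Integration.integral_diff) (auto simp: m_def mult.commute)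
        hence "(\<integral>x. MQ - rl (hs n) x \<partial>\<nu>) \<le> MQ * m + C" using hC[of n] by linarith
        thus ?thesis unfolding nn_integral_eq_integral[OF i nn] by (rule ennreal_leI)
      qed
      have "(\<integral>\<^sup>+x. liminf (\<lambda>n. ennreal (MQ - rl (hs n) x)) \<partial>\<nu>) \<le> liminf (\<lambda>n. \<integral>\<^sup>+x. ennreal (MQ - rl (hs n) x) \<partial>\<nu>)"
        by (rule nn_integral_liminf) measurable
      also have "\<dots> \<le> liminf (\<lambda>n. ennreal (MQ * m + C))" by (intro Liminf_mono always_eventually allI bd)
      also have "\<dots> < \<infinity>" by (simp add: Liminf_const)
      also have "(\<integral>\<^sup>+x. liminf (\<lambda>n. ennreal (MQ - rl (hs n) x)) \<partial>\<nu>) = (\<integral>\<^sup>+x. \<infinity> \<partial>\<nu>)"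
        by (rule nn_integral_cong_AE[OF top])
      finally show False using \<nu>(4) by (simp add: ennreal_top_mult)
    qed
    let ?h = "\<lambda>x. if x \<in> D then usc_reg L x else 0"
    have "?h \<in> H" using A[unfolded limsup_closed_def, rule_format, of hs] hH ub ex unfolding L_def by blast
    \<comment> \<open>The regularisation looks at nearby points, where \<open>f\<close> may be
      larger; continuity limits the increase to 1.\<close>
    moreover have "?h x \<le> ereal (f x + (C + 1))" if x: "x \<in> D" for x
    proof -
      obtain e where e: "e > 0" "\<And>y. y \<in> D \<Longrightarrow> dist y x < e \<Longrightarrow> dist (f y) (f x) < 1"
        using f x unfolding continuous_on_iff by (metis zero_less_one)
      obtain s where s: "s > 0" "ball x s \<subseteq> D" using openE[OF D(1) x] by blast
      have "eventually (\<lambda>y. y \<in> ball x (min e s)) (nhds x)" using e(1) s(1) by (intro eventually_nhds_in_open) auto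
      hence "eventually (\<lambda>y. L y \<le> ereal (f x + (C + 1))) (nhds x)"
      proof eventually_elim
        case (elim y)
        hence y: "y \<in> D" "dist y x < e" using s(2) by (auto simp: dist_commute)
        have fy: "f y + C \<le> f x + (C + 1)" using e(2)[OF y] by (simp add: dist_real_def)
        obtain N where N: "\<And>n. n \<ge> N \<Longrightarrow> y \<in> X n" using XK[of "{y}"] y(1) by auto
        show ?case unfolding L_def
        proof (rule Limsup_bounded)
          show "eventually (\<lambda>n. hs n y \<le> ereal (f x + (C + 1))) sequentially"
            using eventually_ge_at_top[of N]
          proof eventually_elim
            case (elim n)
            show ?case using hX[OF N[OF elim]] fy by (meson ereal_less_eq(3) order.trans)
          qed
        qed
      qed
      thus ?thesis using x unfolding usc_reg_def by (simp add: Limsup_bounded)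
    qed
    ultimately have "?h \<in> H \<and> (\<forall>x\<in>D. ?h x \<le> ereal (f x + (C + 1)))" by blast
    thus ?thesis by (intro exI[of _ "C + 1"] bexI[of _ ?h]) (erule conjunct2, erule conjunct1)
  next
    assume B: "L1_closed D H"
    \<comment> \<open>If \<open>hs n\<close> were below \<open>- b\<close> on all of
      \<open>Q\<close>, its integral would be at most \<open>- (\<bar>C\<bar> + 1)\<close>, which is
      less than \<open>- C\<close>.\<close>
    define b where "b = (\<bar>C\<bar> + 1) / m"
    have low: "\<exists>z\<in>Q. ereal (- b) \<le> hs n z" for n
    proof (rule ccontr)
      assume "\<not> ?thesis"
      hence lt: "\<And>z. z \<in> Q \<Longrightarrow> hs n z < ereal (- b)" by (auto simp: not_le)
      have "(\<integral>x. rl (hs n) x \<partial>\<nu>) \<le> (\<integral>x. - b \<partial>\<nu>)"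
      proof (rule integral_mono_AE[OF hi])
        show "AE x in \<nu>. rl (hs n) x \<le> - b"
          using \<nu>(3) hf[of n]
        proof eventually_elim
          case (elim x)
          thus ?case using lt[OF elim(1)] by (cases "hs n x") auto
        qed
      qed simp
      also have "\<dots> = - (\<bar>C\<bar> + 1)" using m by (simp add: b_def m_def[symmetric])
      finally show False using hC[of n] by linarith
    qed
    have unif: "unif_L1 (range hs) K" if K: "compact K" "K \<subseteq> D" for K
    proof (rule unif_L1_compact[OF D _ _ Q])
      show "range hs \<subseteq> sbh D" using us by blast
      show "\<exists>M. \<forall>u\<in>range hs. \<forall>y\<in>K. u y \<le> ereal M" if "compact K" "K \<subseteq> D" for K using ub[OF that] by blast
      show "\<exists>z\<in>Q. ereal (- b) \<le> u z" if "u \<in> range hs" for u using that low by blast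
    qed (use K in auto)
    obtain k g where k: "strict_mono (k :: nat \<Rightarrow> nat)" and gm[measurable]: "g \<in> borel_measurable borel"
      and gK: "\<forall>K. compact K \<and> K \<subseteq> D \<longrightarrow> (\<integral>\<^sup>+x. ennreal \<bar>g x\<bar> * indicator K x \<partial>lborel) < \<infinity> \<and>
       (\<lambda>n. \<integral>\<^sup>+x. ennreal \<bar>rl (hs (k n)) x - g x\<bar> * indicator K x \<partial>lborel) \<longlonglongrightarrow> 0"
      using sbh_L1_compactness[OF a rad D hst unif] by blast
    have Db[measurable]: "D \<in> sets borel" using D(1) by simp
    have "(\<lambda>x. if x \<in> D then ereal (g x) else 0) \<in> borel_measurable borel" by measurable
    hence "(\<lambda>x. if x \<in> D then ereal (g x) else 0) \<in> borel_measurable lebesgue" by (intro measurable_completion) simp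
    hence "L1loc D (\<lambda>x. ereal (g x))" using gK unfolding L1loc_def by (simp add: nn_integral_completion)
    moreover have "L1loc_tendsto D (\<lambda>n. hs (k n)) (\<lambda>x. ereal (g x))"
      using gK unfolding L1loc_tendsto_def by (simp add: nn_integral_completion)
    ultimately obtain h where h: "h \<in> H" and "AE x\<in>D in lebesgue. h x = ereal (g x)"
      using B[unfolded L1_closed_def, rule_format, of "\<lambda>n. hs (k n)" "\<lambda>x. ereal (g x)"] hH by blast
    hence hg: "AE x\<in>D in lborel. h x = ereal (g x)" by (simp add: AE_completion_iff)
    have [measurable]: "(\<lambda>x. indicator D x *\<^sub>R f x) \<in> borel_measurable borel"
      by (rule borel_measurable_continuous_on_indicator[OF Db f])
    \<comment> \<open>\<open>f\<close> is continuous on \<open>D\<close> only; cut off by the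
      indicator it is Borel on the whole space.\<close>
    define q where "q = (\<lambda>x. indicator D x *\<^sub>R f x)"
    have qm[measurable]: "q \<in> borel_measurable borel" unfolding q_def by fact
    have gle: "AE x\<in>X j in lborel. g x \<le> f x + C" for j
    proof -
      have [measurable]: "X j \<in> sets borel" using X(1) by (rule borel_compact)
      obtain N where N: "\<And>n. n \<ge> N \<Longrightarrow> X j \<subseteq> X n" using XK[OF X] by blast
      \<comment> \<open>The positive part of \<open>g - f - C\<close> on \<open>X j\<close> is at
        most the distance of \<open>rl (hs (k n))\<close> from \<open>g\<close>, whose integral
        tends to 0.\<close>
      let ?I = "\<integral>\<^sup>+x. ennreal (g x - (q x + C)) * indicator (X j) x \<partial>lborel"
      have "?I \<le> (\<integral>\<^sup>+x. ennreal \<bar>rl (hs (k n)) x - g x\<bar> * indicator (X j) x \<partial>lborel)" if n: "n \<ge> N" for n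
      proof (rule nn_integral_mono_AE)
        have kn: "k n \<ge> N" using seq_suble[OF k, of n] n by simp
        show "AE x in lborel. ennreal (g x - (q x + C)) * indicator (X j) x \<le> ennreal \<bar>rl (hs (k n)) x - g x\<bar> * indicator (X j) x"
          using sbh_star_locint(2)[OF D hst, of "k n"]
        proof eventually_elim
          case (elim x)
          show ?case
          proof (cases "x \<in> X j")
            case True
            hence xD: "x \<in> D" using X(2) by blast
            have "hs (k n) x \<le> ereal (f x + C)" using N[OF kn] True by (intro hX) blast
            hence "rl (hs (k n)) x \<le> f x + C" using elim xD by (cases "hs (k n) x") auto
            hence "g x - (q x + C) \<le> \<bar>rl (hs (k n)) x - g x\<bar>" using xD by (simp add: q_def)
            thus ?thesis using True by (simp add: ennreal_leI)
          qed simp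
        qed
      qed
      moreover have "(\<lambda>n. \<integral>\<^sup>+x. ennreal \<bar>rl (hs (k n)) x - g x\<bar> * indicator (X j) x \<partial>lborel) \<longlonglongrightarrow> 0"
        using gK X by blast
      ultimately have "?I \<le> 0" by (intro LIMSEQ_le_const) auto
      hence "?I = 0" by simp
      hence "AE x in lborel. ennreal (g x - (q x + C)) * indicator (X j) x = 0"
        by (subst (asm) nn_integral_0_iff_AE) measurable
      thus ?thesis
      proof eventually_elim
        case (elim x)
        show ?case
        proof
          assume x: "x \<in> X j"
          hence "x \<in> D" using X(2) by blast
          thus "g x \<le> f x + C" using elim x by (simp add: q_def ennreal_eq_0_iff)
        qed
      qed
    qed
    have "AE x in lborel. \<forall>j. x \<in> X j \<longrightarrow> g x \<le> f x + C" unfolding AE_all_countable using gle by (rule allI)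
    hence hle: "AE x\<in>D in lborel. rl h x \<le> f x + C"
      using hg
    proof eventually_elim
      case (elim x)
      show ?case
      proof
        assume x: "x \<in> D"
        hence "g x \<le> f x + C" using elim(1) XU by blast
        thus "rl h x \<le> f x + C" using elim(2) x by simp
      qed
    qed
    have hsb: "h \<in> sbh D" using h H unfolding sbh_star_def by blast
    have fc: "continuous_on D (\<lambda>x. f x + C)" by (intro continuous_intros f)
    have "h x \<le> ereal (f x + C + 1)" if "x \<in> D" for x
      by (rule sbh_le_continuous_bound[OF hsb D(1) fc hle that]) simp
    hence "\<forall>x\<in>D. h x \<le> ereal (f x + (C + 1))" by (simp add: add.assoc)
    thus ?thesis using h by blast
  qed
qed

subsection \<open>Supports, test measures and admissible radii\<close>

text \<open>The complement of the support is a union of null balls, and countably many of them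
  suffice by the Lindelof property.\<close>

lemma AE_measure_support:
  fixes \<nu> :: "'a::euclidean_space measure"
  assumes "sets \<nu> = sets borel"
  shows "AE x in \<nu>. x \<in> measure_support \<nu>"
proof -
  define \<B> where "\<B> = {ball x e | x e. 0 < e \<and> emeasure \<nu> (ball x e) = 0}"
  obtain \<B>' where \<B>': "\<B>' \<subseteq> \<B>" "countable \<B>'" "\<Union>\<B>' = \<Union>\<B>"
    by (rule Lindelof[of \<B>]) (auto simp: \<B>_def)
  have nl: "b \<in> null_sets \<nu>" if "b \<in> \<B>'" for b
    using that \<B>'(1) assms by (auto simp: \<B>_def null_sets_def)
  have "(\<Union>b\<in>\<B>'. b) \<in> null_sets \<nu>" using \<B>'(2) nl by (rule null_sets_UN')
  hence "AE x in \<nu>. x \<notin> (\<Union>b\<in>\<B>'. b)" by (rule AE_not_in)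
  thus ?thesis
  proof eventually_elim
    case (elim x)
    show ?case
    proof (rule ccontr)
      assume "x \<notin> measure_support \<nu>"
      then obtain e where "0 < e" "emeasure \<nu> (ball x e) = 0" by (auto simp: measure_support_def)
      hence "x \<in> \<Union>\<B>" by (auto simp: \<B>_def intro!: exI[of _ "ball x e"])
      thus False using elim \<B>'(3) by auto
    qed
  qed
qed

lemma closed_measure_support:
  fixes M :: "'a::metric_space measure"
  assumes "sets borel \<subseteq> sets M"
  shows "closed (measure_support M)"
  unfolding closed_def open_dist
proof
  fix x assume "x \<in> - measure_support M"
  then obtain e where e: "0 < e" "emeasure M (ball x e) = 0" by (auto simp: measure_support_def)
  show "\<exists>e>0. \<forall>y. dist y x < e \<longrightarrow> y \<in> - measure_support M"
  proof (intro exI[of _ "e / 2"] conjI allI impI)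
    fix y assume y: "dist y x < e / 2"
    have "ball y (e / 2) \<subseteq> ball x e"
    proof
      fix z assume "z \<in> ball y (e / 2)"
      thus "z \<in> ball x e" using y dist_triangle[of x z y] by (simp add: dist_commute)
    qed
    moreover have "ball x e \<in> sets M" using assms by auto
    ultimately have "emeasure M (ball y (e / 2)) \<le> 0" using emeasure_mono[of "ball y (e / 2)" "ball x e" M] e(2) by simp
    thus "y \<in> - measure_support M" using e(1) by (auto simp: measure_support_def intro!: exI[of _ "e / 2"])
  qed (use e in simp)
qed

lemma smooth_on_borel: "smooth_on UNIV g \<Longrightarrow> g \<in> borel_measurable borel"
  unfolding smooth_on_def by (intro borel_measurable_continuous_onI Ck_on_imp_continuous_on) blast

text \<open>Connects densities with compact support in \<open>D - U0\<close> to the test measures.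
  As \<open>g\<close> vanishes off \<open>L\<close>, only values on \<open>D\<close> matter, and
  almost everywhere agreement with a real Borel function turns extended integrals into Lebesgue
  integrals.\<close>

lemma smooth_density:
  fixes g :: "'a::euclidean_space \<Rightarrow> real"
  assumes g: "smooth_on UNIV g" "\<forall>x. 0 \<le> g x" and L: "compact L" "L \<subseteq> D - U0" "\<forall>x. x \<notin> L \<longrightarrow> g x = 0"
  shows "density lebesgue (\<lambda>x. indicator D x * ennreal (g x)) \<in> test_measures D U0"
    and "AE x\<in>D in lborel. \<phi> x = ereal (\<Psi> x) \<Longrightarrow> \<Psi> \<in> borel_measurable borel \<Longrightarrow> integrable lborel (\<lambda>x. \<Psi> x * g x) \<Longrightarrow>
      ereal_integral (density lebesgue (\<lambda>x. indicator D x * ennreal (g x))) \<phi> = ereal (LBINT x. \<Psi> x * g x)"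
proof -
  let ?\<mu> = "density lebesgue (\<lambda>x. indicator D x * ennreal (g x))"
  have eq: "(\<lambda>x. indicator D x * ennreal (g x)) = (\<lambda>x. ennreal (g x))"
  proof
    fix x
    show "indicator D x * ennreal (g x) = ennreal (g x)"
      using L(2,3) by (cases "x \<in> L") (auto simp: indicator_def)
  qed
  have gb[measurable]: "g \<in> borel_measurable borel" by (rule smooth_on_borel[OF g(1)])
  have gl[measurable]: "g \<in> borel_measurable lebesgue" by (intro measurable_completion) simp
  have "measure_support ?\<mu> \<subseteq> L"
  proof
    fix x assume x: "x \<in> measure_support ?\<mu>"
    show "x \<in> L"
    proof (rule ccontr)
      assume "x \<notin> L"
      then obtain e where e: "0 < e" "ball x e \<subseteq> - L"
        using openE[of "- L" x] compact_imp_closed[OF L(1)] by (auto simp: open_Compl)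
      have "emeasure ?\<mu> (ball x e) = (\<integral>\<^sup>+y. ennreal (g y) * indicator (ball x e) y \<partial>lebesgue)"
        unfolding eq by (rule emeasure_density) auto
      also have "\<dots> = (\<integral>\<^sup>+(y::'a). 0 \<partial>lebesgue)"
      proof (rule nn_integral_cong)
        fix y
        show "ennreal (g y) * indicator (ball x e) y = 0"
        proof (cases "y \<in> ball x e")
          case True
          hence "y \<notin> L" using e(2) by blast
          thus ?thesis using L(3) by simp
        qed simp
      qed
      finally show False using x e(1) by (auto simp: measure_support_def)
    qed
  qed
  moreover have "closed (measure_support ?\<mu>)"
    by (rule closed_measure_support) (auto intro: sets_completionI_sets)
  ultimately have "compact (measure_support ?\<mu>)" "measure_support ?\<mu> \<subseteq> D - U0"
    using L(1,2) compact_Int_closed[of L "measure_support ?\<mu>"] by (auto simp: Int_absorb1)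
  moreover have "smooth_on D g" using g(1) Ck_on_mono[of _ UNIV g D] by (auto simp: smooth_on_def)
  ultimately show "?\<mu> \<in> test_measures D U0" unfolding test_measures_def using g(2) by blast
  assume AE: "AE x\<in>D in lborel. \<phi> x = ereal (\<Psi> x)" and [measurable]: "\<Psi> \<in> borel_measurable borel"
    and i: "integrable lborel (\<lambda>x. \<Psi> x * g x)"
  have \<Psi>l[measurable]: "\<Psi> \<in> borel_measurable lebesgue" by (intro measurable_completion) simp
  have gnn: "AE x in lebesgue. 0 \<le> g x" using g(2) by simp
  have "AE x\<in>D in lebesgue. \<phi> x = ereal (\<Psi> x)" using AE by (rule AE_completion)
  hence "AE x in lebesgue. 0 < ennreal (g x) \<longrightarrow> \<phi> x = ereal (\<Psi> x)"
  proof eventually_elim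
    case (elim x)
    thus ?case using L(2,3) by (cases "x \<in> L") auto
  qed
  hence 1: "AE x in ?\<mu>. \<phi> x = ereal (\<Psi> x)" unfolding eq by (subst AE_density) auto
  have il: "integrable lebesgue (\<lambda>x. \<Psi> x * g x)" by (subst integrable_completion) (use i in auto)
  have 2: "integrable ?\<mu> \<Psi>" unfolding eq
    by (subst integrable_real_density[OF gl gnn \<Psi>l]) (use il in \<open>simp add: mult.commute\<close>)
  have "(\<integral>x. \<Psi> x \<partial>?\<mu>) = (\<integral>x. g x * \<Psi> x \<partial>lebesgue)" unfolding eq by (rule integral_real_density[OF gl gnn \<Psi>l])
  also have "\<dots> = (LBINT x. g x * \<Psi> x)" by (rule integral_completion) measurable
  finally show "ereal_integral ?\<mu> \<phi> = ereal (LBINT x. \<Psi> x * g x)"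
    using ereal_integral_eq[OF 1 2] by (simp add: mult.commute)
qed

text \<open>\<open>F\<close> is extended-valued and only Lebesgue measurable; a real Borel version
  makes it accessible to product measures, and averages do not see the null set.\<close>

lemma L1loc_borel_version:
  fixes D :: "'a::euclidean_space set"
  assumes D: "open D" and F: "L1loc D F"
  obtains F' where "locint D F'" "AE x\<in>D in lborel. F x = ereal (F' x)"
proof -
  let ?f = "\<lambda>x. if x \<in> D then F x else 0"
  have [measurable]: "?f \<in> borel_measurable lebesgue" using F by (simp add: L1loc_def)
  have "(\<lambda>x. real_of_ereal (?f x)) \<in> borel_measurable lebesgue" by measurable
  then obtain F' where F'm[measurable]: "F' \<in> borel_measurable borel" and F': "AE x in lborel. real_of_ereal (?f x) = F' x"
    using completion_ex_borel_measurable_real[of "\<lambda>x. real_of_ereal (?f x)" lborel] by auto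
  obtain X where X: "\<And>n::nat. compact (X n)" "\<And>n. X n \<subseteq> D" "\<Union>(range X) = D"
    using open_Union_compact_subsets[OF D] by metis
  have finK: "AE x\<in>K in lborel. \<bar>F x\<bar> \<noteq> \<infinity>" if K: "compact K" "K \<subseteq> D" for K
  proof -
    have [measurable]: "K \<in> sets lebesgue" using borel_compact[OF K(1)] by simp
    have "(\<integral>\<^sup>+x. e2ennreal \<bar>F x\<bar> * indicator K x \<partial>lebesgue) < \<infinity>" using F K by (simp add: L1loc_def)
    also have "(\<integral>\<^sup>+x. e2ennreal \<bar>F x\<bar> * indicator K x \<partial>lebesgue) = (\<integral>\<^sup>+x. e2ennreal \<bar>?f x\<bar> * indicator K x \<partial>lebesgue)"
      using K(2) by (intro nn_integral_cong) (auto simp: indicator_def)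
    finally have "AE x in lebesgue. e2ennreal \<bar>?f x\<bar> * indicator K x \<noteq> \<infinity>"
      by (intro nn_integral_PInf_AE) auto
    hence "AE x in lborel. e2ennreal \<bar>?f x\<bar> * indicator K x \<noteq> \<infinity>" by (simp add: AE_completion_iff)
    thus ?thesis
    proof eventually_elim
      case (elim x)
      show ?case
      proof
        assume "x \<in> K"
        hence "e2ennreal \<bar>F x\<bar> \<noteq> \<infinity>" using elim K(2) by auto
        thus "\<bar>F x\<bar> \<noteq> \<infinity>" by (cases "F x") (auto simp: e2ennreal_infty)
      qed
    qed
  qed
  have "AE x in lborel. \<forall>n. x \<in> X n \<longrightarrow> \<bar>F x\<bar> \<noteq> \<infinity>" unfolding AE_all_countable using finK X by blast
  hence FF': "AE x\<in>D in lborel. F x = ereal (F' x)"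
    using F'
  proof eventually_elim
    case (elim x)
    show ?case
    proof
      assume x: "x \<in> D"
      then obtain n where "x \<in> X n" using X(3) by blast
      hence "\<bar>F x\<bar> \<noteq> \<infinity>" by (rule elim(1)[rule_format])
      thus "F x = ereal (F' x)" using elim(2) x by (cases "F x") auto
    qed
  qed
  moreover have "locint D F'"
    unfolding locint_def
  proof safe
    fix K :: "'a set" assume K: "compact K" "K \<subseteq> D"
    have [measurable]: "K \<in> sets borel" using K(1) by (rule borel_compact)
    have "(\<integral>\<^sup>+x. ennreal (norm (indicator K x * F' x)) \<partial>lborel) = (\<integral>\<^sup>+x. e2ennreal \<bar>F x\<bar> * indicator K x \<partial>lborel)"
    proof (rule nn_integral_cong_AE)
      show "AE x in lborel. ennreal (norm (indicator K x * F' x)) = e2ennreal \<bar>F x\<bar> * indicator K x"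
        using FF'
      proof eventually_elim
        case (elim x)
        thus ?case using K(2) by (cases "x \<in> K") auto
      qed
    qed
    also have "\<dots> < \<infinity>" using F K by (simp add: L1loc_def nn_integral_completion)
    finally show "integrable lborel (\<lambda>x. indicator K x * F' x)" by (intro integrableI_bounded) measurable
  qed simp
  ultimately show ?thesis using that by blast
qed

text \<open>The integrand of \<open>moll_avg\<close> is only almost everywhere equal to a Borel
  function; completeness makes it measurable as well.\<close>

lemma borel_measurable_completion_AE:
  fixes f g :: "'a \<Rightarrow> 'b::topological_space"
  assumes f: "f \<in> borel_measurable (completion M)" and AE: "AE x in M. g x = f x"
  shows "g \<in> borel_measurable (completion M)"
proof (rule measurableI)
  fix A :: "'b set" assume A: "A \<in> sets borel"
  have n: "Measurable.pred (completion M) (\<lambda>x. g x \<noteq> f x)" "Measurable.pred (completion M) (\<lambda>x. g x \<in> A \<and> g x \<noteq> f x)"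
    by (rule sets_completion_AE, use AE in eventually_elim, simp)+
  have "Measurable.pred (completion M) (\<lambda>x. f x \<in> A)" using f A by measurable
  hence "Measurable.pred (completion M) (\<lambda>x. f x \<in> A \<and> \<not> g x \<noteq> f x \<or> g x \<in> A \<and> g x \<noteq> f x)"
    using n by measurable
  moreover have "(\<lambda>x. f x \<in> A \<and> \<not> g x \<noteq> f x \<or> g x \<in> A \<and> g x \<noteq> f x) = (\<lambda>x. g x \<in> A)" by auto
  ultimately have "Measurable.pred (completion M) (\<lambda>x. g x \<in> A)" by simp
  thus "g -` A \<inter> space (completion M) \<in> sets (completion M)"
    by (simp add: pred_def vimage_def Int_def conj_commute)
qed simp

text \<open>A shift by \<open>x\<close> preserves null sets, so the Borel version may replace
  \<open>F\<close> although \<open>moll_avg\<close> integrates in the shifted variable; the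
  completed measure then gives the same integral as \<open>lborel\<close>.\<close>

lemma moll_avg_eq_cv:
  fixes D :: "'a::euclidean_space set"
  assumes moll: "mollifier a" and F': "locint D F'" "AE x\<in>D in lborel. F x = ereal (F' x)"
    and r: "0 < r x" "cball x (r x) \<subseteq> D"
  shows "moll_avg a F r x = cv a (r x) F' x"
proof -
  note a = mollifier_kern[OF moll]
  note [measurable] = sck_measurable[OF a]
  have [measurable]: "F' \<in> borel_measurable borel" using F'(1) by (simp add: locint_def)
  let ?G = "\<lambda>z. indicator (ball x (r x)) z * real_of_ereal (F z) * sck a (r x) (z - x)"
  let ?G' = "\<lambda>z. F' z * sck a (r x) (z - x)"
  have "AE z in lborel. ?G z = ?G' z"
    using F'(2)
  proof eventually_elim
    case (elim z)
    show ?case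
    proof (cases "z \<in> ball x (r x)")
      case True
      hence "z \<in> D" using r(2) by auto
      thus ?thesis using True elim by simp
    next
      case False
      thus ?thesis by (simp add: sck_zero[OF a r(1)] dist_norm norm_minus_commute)
    qed
  qed
  hence "AE z in distr lborel borel ((+) x). ?G z = ?G' z" unfolding lborel_distr_plus .
  hence AE: "AE y in lborel. ?G (x + y) = ?G' (x + y)" by (rule AE_distrD[rotated]) simp
  have m': "(\<lambda>y. ?G' (x + y)) \<in> borel_measurable borel" by measurable
  hence ml': "(\<lambda>y. ?G' (x + y)) \<in> borel_measurable lebesgue" by (intro measurable_completion) simp
  have "moll_avg a F r x = (\<integral>y. ?G (x + y) \<partial>lebesgue)"
    unfolding moll_avg_def scaled_moll_eq_sck[OF moll r(1)]
    by (intro Bochner_Integration.integral_cong refl) (simp add: indicator_def dist_norm)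
  also have "\<dots> = (\<integral>y. ?G' (x + y) \<partial>lebesgue)"
    by (rule integral_cong_AE[OF borel_measurable_completion_AE[OF ml' AE] ml' AE_completion[OF AE]])
  also have "\<dots> = (LBINT y. ?G' (x + y))" by (rule integral_completion) (use m' in simp)
  also have "\<dots> = (LBINT z. ?G' z)" by (rule lborel_integral_shift) measurable
  finally show ?thesis by (simp add: cv_def)
qed

text \<open>Prepares the radius for all estimates at once: \<open>r\<close> is lowered to at most
  \<open>\<eta>\<close>, a fifth of a distance by which \<open>Q\<close> can be enlarged inside
  \<open>D\<close>, and the strict bound by the distance to the complement puts the closed balls
  into \<open>D\<close>.\<close>

lemma admissible_radius:
  fixes D Q :: "'a::euclidean_space set"
  assumes moll: "mollifier (a :: 'a \<Rightarrow> real)" and D: "open D" "D \<noteq> {}" and Q: "compact Q" "Q \<noteq> {}" "Q \<subseteq> D"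
    and r: "\<forall>x\<in>D. 0 < r x" "\<forall>K. compact K \<and> K \<subseteq> D \<longrightarrow> (\<exists>e>0. \<forall>x\<in>K. e \<le> r x)"
      "\<forall>x\<in>D. \<forall>y. y \<notin> D \<longrightarrow> r x < dist x y"
    and F': "locint D F'" "AE x\<in>D in lborel. F x = ereal (F' x)"
  shows "\<exists>\<eta> rh. 0 < \<eta> \<and> {x. infdist x Q \<le> 5 * \<eta>} \<subseteq> D \<and> smooth_on D rh \<and> (\<forall>x\<in>D. 0 < rh x \<and> rh x \<le> r x) \<and>
    continuous_on D rh \<and> (\<forall>x\<in>D. 0 < rh x \<and> cball x (rh x) \<subseteq> D) \<and> (\<forall>x\<in>D. rh x \<le> \<eta>) \<and>
    (\<forall>x\<in>D. moll_avg a F rh x = cv a (rh x) F' x)"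
proof -
  obtain e where e: "e > 0" "(\<Union>y\<in>Q. cball y e) \<subseteq> D"
    using compact_subset_open_imp_cball_epsilon_subset[OF Q(1) D(1) Q(3)] by metis
  define \<eta> where "\<eta> = e / 5"
  have \<eta>: "0 < \<eta>" using e(1) by (simp add: \<eta>_def)
  have sub: "{x. infdist x Q \<le> 5 * \<eta>} \<subseteq> D"
  proof
    fix x assume "x \<in> {x. infdist x Q \<le> 5 * \<eta>}"
    moreover obtain y where "y \<in> Q" "infdist x Q = dist x y"
      using infdist_attains_inf[OF compact_imp_closed[OF Q(1)] Q(2)] by blast
    ultimately have "y \<in> Q" "x \<in> cball y e" by (auto simp: \<eta>_def dist_commute)
    thus "x \<in> D" using e(2) by blast
  qed
  define r' where "r' = (\<lambda>x. min (r x) \<eta>)"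
  have r'pos: "0 < r' x" if "x \<in> D" for x using r(1) that \<eta> by (simp add: r'_def)
  have r'loc: "\<exists>e>0. \<forall>x\<in>K. e \<le> r' x" if K: "compact K" "K \<subseteq> D" for K
  proof -
    obtain e where "e > 0" "\<forall>x\<in>K. e \<le> r x" using r(2)[rule_format, OF conjI[OF K]] by blast
    thus ?thesis using \<eta> by (intro exI[of _ "min e \<eta>"]) (auto simp: r'_def)
  qed
  obtain rh where rh: "smooth_on UNIV rh" "\<And>x. x \<in> D \<Longrightarrow> 0 < rh x \<and> rh x \<le> r' x"
    using smooth_minorant[OF moll D r'pos r'loc] by blast
  have "smooth_on D rh" using rh(1) Ck_on_mono[of _ UNIV rh D] by (auto simp: smooth_on_def)
  moreover have "continuous_on D rh"
    using rh(1) Ck_on_imp_continuous_on continuous_on_subset unfolding smooth_on_def by blast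
  moreover have rb: "0 < rh x" "rh x \<le> r x" "rh x \<le> \<eta>" if "x \<in> D" for x using rh(2)[OF that] by (auto simp: r'_def)
  moreover have cb: "cball x (rh x) \<subseteq> D" if x: "x \<in> D" for x
  proof
    fix y assume "y \<in> cball x (rh x)"
    hence "dist x y \<le> r x" using rb(2)[OF x] by simp
    thus "y \<in> D" using r(3) x by force
  qed
  moreover have "moll_avg a F rh x = cv a (rh x) F' x" if "x \<in> D" for x
    by (rule moll_avg_eq_cv[where D=D and r=rh and x=x, OF moll F' rb(1)[OF that] cb[OF that]])
  ultimately show ?thesis using \<eta> sub by (intro exI[of _ \<eta>] exI[of _ rh] conjI ballI) auto
qed

text \<open>Lets a single kernel, when its ball lies in \<open>D - U0\<close>, serve as a test
  density; pairing it with \<open>F'\<close> gives the average of \<open>F'\<close> at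
  \<open>x\<close>. Smoothness is a superposition over a one-point counting space.\<close>

lemma smooth_translated_kernel:
  fixes a :: "'a::euclidean_space \<Rightarrow> real"
  assumes moll: "mollifier a"
  shows "smooth_on UNIV (\<lambda>y. sck a \<rho> (y - x))"
  unfolding smooth_on_def
proof
  fix k
  have eq: "(\<lambda>y. sck a \<rho> (y - x)) = (\<lambda>y. \<integral>u. (1 / \<rho> ^ DIM('a)) * a ((1 / \<rho>) *\<^sub>R y + - x /\<^sub>R \<rho>) \<partial>count_space {()})"
    by (simp add: lebesgue_integral_count_space_finite sck_def scaleR_diff_right divide_inverse mult.commute)
  show "Ck_on k UNIV (\<lambda>y. sck a \<rho> (y - x))"
    unfolding eq
  proof (rule Ck_on_superposition)
    show "Ck_on k UNIV a" using moll by (simp add: mollifier_def smooth_on_def)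
    show "a y = 0" if "1 < norm y" for y using kernD(3)[OF mollifier_kern[OF moll], of y] that by simp
  qed (auto intro: integrable_count_space)
qed

subsection \<open>The lower envelope\<close>

lemma Ck_on_cmult:
  fixes f :: "'a::euclidean_space \<Rightarrow> real"
  assumes "Ck_on k UNIV f"
  shows "Ck_on k UNIV (\<lambda>x. c * f x)"
  using assms
proof (induction k arbitrary: f)
  case 0
  thus ?case by (auto intro!: continuous_intros)
next
  case (Suc k)
  have d: "f differentiable (at x)" for x using Suc.prems by simp
  have "frechet_derivative (\<lambda>x. c * f x) (at x) = (\<lambda>i. c * frechet_derivative f (at x) i)" for x
    using has_derivative_mult_right[OF d[unfolded frechet_derivative_works], of c x]
    by (intro frechet_derivative_at[symmetric])
  thus ?case using Suc d by auto
qed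

text \<open>\<open>\<nu>\<close> lives on the compact set \<open>Q\<close>, where \<open>h\<close>
  is bounded above, so the integral can diverge only towards minus infinity.\<close>

lemma sbh_integral_cases:
  fixes D Q :: "'a::euclidean_space set" and \<nu> :: "'a measure"
  assumes h: "h \<in> sbh D" and D: "open D" and Q: "compact Q" "Q \<subseteq> D"
    and \<nu>: "finite_measure \<nu>" "sets \<nu> = sets borel" "AE x in \<nu>. x \<in> Q"
  shows "ereal_integral \<nu> h = - \<infinity> \<or> (integrable \<nu> (rl h) \<and> (AE x in \<nu>. \<bar>h x\<bar> \<noteq> \<infinity>))"
proof -
  interpret \<nu>: finite_measure \<nu> by (rule \<nu>(1))
  obtain M where M: "\<And>x. x \<in> Q \<Longrightarrow> h x \<le> ereal M" by (rule sbh_bounded_above[OF h D Q]) blast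
  have hm: "h \<in> borel_measurable \<nu>"
    using sbh_borel[OF h D] measurable_cong_sets[OF \<nu>(2) refl, of borel] by blast
  have "(\<integral>\<^sup>+x. e2ennreal (h x) \<partial>\<nu>) \<le> (\<integral>\<^sup>+x. ennreal M \<partial>\<nu>)"
  proof (rule nn_integral_mono_AE)
    show "AE x in \<nu>. e2ennreal (h x) \<le> ennreal M"
      using \<nu>(3)
    proof eventually_elim
      case (elim x)
      have "e2ennreal (h x) \<le> e2ennreal (ereal M)" by (rule e2ennreal_mono[OF M[OF elim]])
      thus ?case by simp
    qed
  qed
  also have "\<dots> < \<infinity>" using \<nu>.emeasure_finite[of "space \<nu>"] by (auto simp: ennreal_mult_eq_top_iff less_top[symmetric])
  finally show ?thesis using ereal_integral_cases[OF hm] by blast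
qed

text \<open>The finite infimum enters through \<open>Hyp\<close>, with the test measure given by its density \<open>g\<close>.\<close>

lemma envelope_from_sweeping:
  fixes D U0 :: "'a::euclidean_space set" and \<nu> :: "'a measure" and H :: "('a \<Rightarrow> ereal) set" and a r :: "'a \<Rightarrow> real"
  assumes moll: "mollifier a" and D: "open D" "connected D" "D \<noteq> {}" and H: "H \<subseteq> sbh_star D"
    and cond_ab: "limsup_closed D H \<or> L1_closed D H"
    and \<nu>: "finite_measure \<nu>" "sets \<nu> = sets borel" "AE x in \<nu>. x \<in> Q" "emeasure \<nu> (space \<nu>) \<noteq> 0"
    and U0: "open U0" "U0 \<noteq> {}" "U0 \<subseteq> Q" and Q: "compact Q" "Q \<subseteq> D"
    and HR: "HR = {h\<in>H. integrable \<nu> (rl h) \<and> (AE x in \<nu>. \<bar>h x\<bar> \<noteq> \<infinity>)}" "HR \<noteq> {}"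
    and conv: "\<forall>h1\<in>HR. \<forall>h2\<in>HR. \<forall>t. 0 < t \<and> t < 1 \<longrightarrow> (\<lambda>x. ereal t * h1 x + ereal (1 - t) * h2 x) \<in> H"
    and F': "locint D F'" "AE x\<in>D in lborel. F x = ereal (F' x)"
    and Hyp: "\<And>g c. smooth_on UNIV g \<Longrightarrow> \<forall>x. 0 \<le> g x \<Longrightarrow> \<exists>L. compact L \<and> L \<subseteq> D - U0 \<and> (\<forall>x. x \<notin> L \<longrightarrow> g x = 0) \<Longrightarrow>
      \<forall>h\<in>HR. (\<integral>x. rl h x \<partial>\<nu>) \<le> (LBINT x. rl h x * g x) + c \<Longrightarrow> I \<le> (LBINT x. F' x * g x) + c"
    and r: "\<forall>x\<in>D. 0 < r x" "\<forall>K. compact K \<and> K \<subseteq> D \<longrightarrow> (\<exists>e>0. \<forall>x\<in>K. e \<le> r x)"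
      "\<forall>x\<in>D. \<forall>y. y \<notin> D \<longrightarrow> r x < dist x y"
  shows "\<exists>rh. smooth_on D rh \<and> (\<forall>x\<in>D. 0 < rh x \<and> rh x \<le> r x) \<and>
    (\<exists>C::real. \<exists>h\<in>H. \<forall>x\<in>D. h x \<le> ereal (moll_avg a F rh x + C))"
proof -
  note a = mollifier_kern[OF moll]
  have rad: "\<forall>x y. norm x = norm y \<longrightarrow> a x = a y" using moll unfolding mollifier_def by blast
  have Q0: "Q \<noteq> {}" using U0 by blast
  obtain \<eta> rh where \<eta>: "0 < \<eta>" "{x. infdist x Q \<le> 5 * \<eta>} \<subseteq> D" and rh: "smooth_on D rh" "\<forall>x\<in>D. 0 < rh x \<and> rh x \<le> r x"
    and rhc: "continuous_on D rh" and rhD: "\<forall>x\<in>D. 0 < rh x \<and> cball x (rh x) \<subseteq> D" and rh\<eta>: "\<forall>x\<in>D. rh x \<le> \<eta>"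
    and avg: "\<forall>x\<in>D. moll_avg a F rh x = cv a (rh x) F' x"
    using admissible_radius[OF moll D(1,3) Q(1) Q0 Q(2) r F'] by (elim exE conjE) (rule that)
  have HRs: "HR \<subseteq> sbh_star D" using H HR(1) by blast
  have hn: "\<forall>h\<in>HR. integrable \<nu> (rl h) \<and> (AE x in \<nu>. \<bar>h x\<bar> \<noteq> \<infinity>)" by (simp add: HR(1))
  \<comment> \<open>The hypothesis places mixtures in \<open>H\<close>; integrability and finiteness
    with respect to \<open>\<nu>\<close> have to be added to stay in \<open>HR\<close>.\<close>
  have conv': "\<forall>h1\<in>HR. \<forall>h2\<in>HR. \<forall>t. 0 < t \<and> t < 1 \<longrightarrow> (\<lambda>x. ereal t * h1 x + ereal (1 - t) * h2 x) \<in> HR"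
  proof (intro ballI allI impI)
    fix h1 h2 and t :: real assume h: "h1 \<in> HR" "h2 \<in> HR" and t: "0 < t \<and> t < 1"
    let ?h = "\<lambda>x. ereal t * h1 x + ereal (1 - t) * h2 x"
    have hH: "?h \<in> H" using conv h t by blast
    have i: "integrable \<nu> (rl h1)" "integrable \<nu> (rl h2)" and f: "AE x in \<nu>. \<bar>h1 x\<bar> \<noteq> \<infinity>" "AE x in \<nu>. \<bar>h2 x\<bar> \<noteq> \<infinity>"
      using h hn by blast+
    have "?h \<in> sbh D" using hH H by (auto simp: sbh_star_def)
    hence "?h \<in> borel_measurable borel" by (rule sbh_borel[OF _ D(1)])
    hence "?h \<in> borel_measurable \<nu>" using measurable_cong_sets[OF \<nu>(2) refl, of borel] by blast
    hence m: "rl ?h \<in> borel_measurable \<nu>" by measurable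
    have eq: "AE x in \<nu>. t * rl h1 x + (1 - t) * rl h2 x = rl ?h x"
      using f by eventually_elim (rule rl_mix[symmetric])
    have i2: "integrable \<nu> (\<lambda>x. t * rl h1 x + (1 - t) * rl h2 x)"
      using i by (intro Bochner_Integration.integrable_add integrable_mult_right)
    have "integrable \<nu> (rl ?h)" using integrable_cong_AE_imp[OF i2 m eq] .
    moreover have "AE x in \<nu>. \<bar>?h x\<bar> \<noteq> \<infinity>"
      using f
    proof eventually_elim
      case (elim x)
      thus ?case by (cases "h1 x"; cases "h2 x") auto
    qed
    ultimately show "?h \<in> HR" unfolding HR(1) using hH by blast
  qed
  have "\<exists>C. \<forall>K. compact K \<and> K \<subseteq> D \<longrightarrow> (\<exists>h\<in>HR. (\<forall>x\<in>K. h x \<le> ereal (cv a (rh x) F' x + C)) \<and> - C \<le> (\<integral>x. rl h x \<partial>\<nu>))"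
    by (rule envelope_compact[OF moll D(1,2) HRs HR(2) conv' hn F'(1) rhc rhD rh\<eta> U0 Q(1) \<eta> \<nu>(1-3) Hyp])
  then obtain C where C: "\<forall>K. compact K \<and> K \<subseteq> D \<longrightarrow>
    (\<exists>h\<in>HR. (\<forall>x\<in>K. h x \<le> ereal (cv a (rh x) F' x + C)) \<and> - C \<le> (\<integral>x. rl h x \<partial>\<nu>))" by blast
  have env: "\<forall>K. compact K \<and> K \<subseteq> D \<longrightarrow> (\<exists>h\<in>H. integrable \<nu> (rl h) \<and> (AE x in \<nu>. \<bar>h x\<bar> \<noteq> \<infinity>) \<and>
      (\<forall>x\<in>K. h x \<le> ereal (cv a (rh x) F' x + C)) \<and> - C \<le> (\<integral>x. rl h x \<partial>\<nu>))"
  proof (intro allI impI)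
    fix K :: "'a set" assume "compact K \<and> K \<subseteq> D"
    then obtain h where "h \<in> HR" "\<forall>x\<in>K. h x \<le> ereal (cv a (rh x) F' x + C)" "- C \<le> (\<integral>x. rl h x \<partial>\<nu>)" using C by blast
    thus "\<exists>h\<in>H. integrable \<nu> (rl h) \<and> (AE x in \<nu>. \<bar>h x\<bar> \<noteq> \<infinity>) \<and>
      (\<forall>x\<in>K. h x \<le> ereal (cv a (rh x) F' x + C)) \<and> - C \<le> (\<integral>x. rl h x \<partial>\<nu>)"
      unfolding HR(1) by blast
  qed
  have fc: "continuous_on D (\<lambda>x. cv a (rh x) F' x)"
    by (rule continuous_on_cv[OF D(1) F'(1) a rhc]) (use rhD in blast)
  have "\<exists>C'. \<exists>h\<in>H. \<forall>x\<in>D. h x \<le> ereal (cv a (rh x) F' x + C')"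
    by (rule closed_family_limit[OF a rad D(1,2) H cond_ab fc Q \<nu> env])
  then obtain C' h where "h \<in> H" "\<forall>x\<in>D. h x \<le> ereal (cv a (rh x) F' x + C')" by blast
  hence "h \<in> H" "\<forall>x\<in>D. h x \<le> ereal (moll_avg a F rh x + C')" using avg by auto
  thus ?thesis using rh by blast
qed

text \<open>If no member of the family is \<open>\<nu>\<close>-integrable, every test measure is swept, so nothing but the sign of
  the averages away from \<open>Q\<close> is needed.\<close>

lemma envelope_nonneg:
  fixes D U0 Q :: "'a::euclidean_space set" and a r :: "'a \<Rightarrow> real"
  assumes moll: "mollifier a" and D: "open D" "D \<noteq> {}" and U0: "U0 \<noteq> {}" "U0 \<subseteq> Q" and Q: "compact Q" "Q \<subseteq> D"
    and h0: "h0 \<in> H" "\<forall>x\<in>D. h0 x \<le> 0"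
    and F': "locint D F'" "AE x\<in>D in lborel. F x = ereal (F' x)"
    and Hyp: "\<And>g. smooth_on UNIV g \<Longrightarrow> \<forall>x. 0 \<le> g x \<Longrightarrow> \<exists>L. compact L \<and> L \<subseteq> D - U0 \<and> (\<forall>x. x \<notin> L \<longrightarrow> g x = 0) \<Longrightarrow>
      0 \<le> (LBINT x. F' x * g x)"
    and r: "\<forall>x\<in>D. 0 < r x" "\<forall>K. compact K \<and> K \<subseteq> D \<longrightarrow> (\<exists>e>0. \<forall>x\<in>K. e \<le> r x)"
      "\<forall>x\<in>D. \<forall>y. y \<notin> D \<longrightarrow> r x < dist x y"
  shows "\<exists>rh. smooth_on D rh \<and> (\<forall>x\<in>D. 0 < rh x \<and> rh x \<le> r x) \<and>
    (\<exists>C::real. \<exists>h\<in>H. \<forall>x\<in>D. h x \<le> ereal (moll_avg a F rh x + C))"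
proof -
  note a = mollifier_kern[OF moll]
  have Q0: "Q \<noteq> {}" using U0 by blast
  obtain \<eta> rh where \<eta>: "0 < \<eta>" "{x. infdist x Q \<le> 5 * \<eta>} \<subseteq> D" and rh: "smooth_on D rh" "\<forall>x\<in>D. 0 < rh x \<and> rh x \<le> r x"
    and rhc: "continuous_on D rh" and rhD: "\<forall>x\<in>D. 0 < rh x \<and> cball x (rh x) \<subseteq> D" and rh\<eta>: "\<forall>x\<in>D. rh x \<le> \<eta>"
    and avg: "\<forall>x\<in>D. moll_avg a F rh x = cv a (rh x) F' x"
    using admissible_radius[OF moll D Q(1) Q0 Q(2) r F'] by (elim exE conjE) (rule that)
  let ?f = "\<lambda>x. cv a (rh x) F' x"
  have fc: "continuous_on D ?f"
    by (rule continuous_on_cv[OF D(1) F'(1) a rhc]) (use rhD in blast)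
  \<comment> \<open>Within \<open>2 * \<eta>\<close> of \<open>Q\<close> continuity bounds the
    averages; farther out the ball of averaging misses \<open>U0\<close>, and the kernel itself is a
    test density.\<close>
  let ?N = "{x. infdist x Q \<le> 2 * \<eta>}"
  have N: "compact ?N" using \<eta>(1) by (intro compact_infdist_le Q0 Q(1)) simp
  have ND: "?N \<subseteq> D" using \<eta> by (auto intro!: subsetD[OF \<eta>(2)])
  have "bounded (?f ` ?N)" by (intro compact_imp_bounded compact_continuous_image continuous_on_subset[OF fc ND] N)
  then obtain B where "\<forall>y\<in>?f ` ?N. norm y \<le> B" unfolding bounded_iff by blast
  hence B: "\<bar>?f x\<bar> \<le> B" if "x \<in> ?N" for x using that by simp
  have "0 \<le> ?f x + \<bar>B\<bar>" if x: "x \<in> D" for x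
  proof (cases "x \<in> ?N")
    case True thus ?thesis using B[OF True] by linarith
  next
    case False
    have r0: "0 < rh x" and s: "cball x (rh x) \<subseteq> D" and re: "rh x \<le> \<eta>" using x rhD rh\<eta> by auto
    have "cball x (rh x) \<subseteq> D - U0"
    proof
      fix y assume y: "y \<in> cball x (rh x)"
      have "y \<notin> U0"
      proof
        assume "y \<in> U0"
        hence "infdist x Q \<le> dist x y" using U0 by (intro infdist_le) blast
        thus False using y re False \<eta>(1) by simp
      qed
      thus "y \<in> D - U0" using y s by blast
    qed
    moreover have "sck a (rh x) (y - x) = 0" if "y \<notin> cball x (rh x)" for y
      using that by (intro sck_zero[OF a r0]) (simp add: dist_norm norm_minus_commute)
    ultimately have "\<exists>L. compact L \<and> L \<subseteq> D - U0 \<and> (\<forall>y. y \<notin> L \<longrightarrow> sck a (rh x) (y - x) = 0)"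
      by (intro exI[of _ "cball x (rh x)"]) auto
    hence "0 \<le> ?f x" unfolding cv_def
      by (intro Hyp smooth_translated_kernel[OF moll] allI sck_nonneg[OF a r0])
    thus ?thesis by linarith
  qed
  hence "\<forall>x\<in>D. h0 x \<le> ereal (moll_avg a F rh x + \<bar>B\<bar>)"
    using h0(2) avg by (auto intro: order.trans)
  thus ?thesis using rh h0(1) by blast
qed

theorem mainTheorem13:
  fixes D U0 :: "'a::euclidean_space set"
    and H :: "('a \<Rightarrow> ereal) set"
    and \<nu> :: "'a measure"
    and F :: "'a \<Rightarrow> ereal"
    and a :: "'a \<Rightarrow> real"
  assumes moll: "mollifier a"
    and D_dom: "open D" "connected D" "D \<noteq> {}"
    and H_ne: "H \<noteq> {}" and H_sub: "H \<subseteq> sbh_star D"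
    and nu_borel: "sets \<nu> = sets borel" and nu_fin: "finite_measure \<nu>"
    and nu_ne: "emeasure \<nu> (space \<nu>) \<noteq> 0"
    and nu_supp: "compact (measure_support \<nu>)" "measure_support \<nu> \<subseteq> D"
    and F_loc: "L1loc D F"
    and cond_c: "\<forall>K c. compact K \<and> K \<subseteq> D \<longrightarrow> (\<exists>h\<in>H. \<forall>x\<in>K. h x \<le> ereal c)"
    and cond_ab:
      "(\<forall>hs. (\<forall>k. hs k \<in> H) \<and>
              (\<forall>K. compact K \<and> K \<subseteq> D \<longrightarrow> (\<exists>M::real. \<forall>k. \<forall>x\<in>K. hs k x \<le> ereal M)) \<and>
              (\<exists>x\<in>D. limsup (\<lambda>k. hs k x) \<noteq> -\<infinity>)
            \<longrightarrow> (\<lambda>x. if x \<in> D then usc_reg (\<lambda>y. limsup (\<lambda>k. hs k y)) x else 0) \<in> H)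
       \<or> (\<forall>hs g. (\<forall>k. hs k \<in> H) \<and> L1loc D g \<and> L1loc_tendsto D hs g
            \<longrightarrow> (\<exists>h\<in>H. AE x in lebesgue. x \<in> D \<longrightarrow> h x = g x))"
    and U0: "open U0" "connected U0" "measure_support \<nu> \<subseteq> U0"
            "compact (closure U0)" "closure U0 \<subseteq> D"
  shows
   "((\<forall>h\<in>H. \<forall>c>0. (\<lambda>x. ereal c * h x) \<in> H) \<and>
     (\<forall>h1\<in>H. \<forall>h2\<in>H. (\<lambda>x. h1 x + h2 x) \<in> H) \<and>
     (\<exists>h\<in>H. \<forall>x\<in>D. h x \<le> 0) \<and>
     -\<infinity> < Inf {ereal_integral \<mu> F | \<mu>. \<mu> \<in> test_measures D U0 \<and> lin_sweep H \<nu> \<mu>}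
     \<longrightarrow>
     (\<forall>r. (\<forall>x\<in>D. 0 < r x) \<and>
          (\<forall>K. compact K \<and> K \<subseteq> D \<longrightarrow> (\<exists>e>0. \<forall>x\<in>K. e \<le> r x)) \<and>
          (\<forall>x\<in>D. \<forall>y. y \<notin> D \<longrightarrow> r x < dist x y)
      \<longrightarrow> (\<exists>rh. smooth_on D rh \<and> (\<forall>x\<in>D. 0 < rh x \<and> rh x \<le> r x) \<and>
               (\<exists>C::real. \<exists>h\<in>H. \<forall>x\<in>D. h x \<le> ereal (moll_avg a F rh x + C)))))
  \<and>
    ((\<forall>h1\<in>H. \<forall>h2\<in>H. \<forall>t\<in>{0..1::real}. (\<lambda>x. ereal t * h1 x + ereal (1 - t) * h2 x) \<in> H) \<and>
     (\<lambda>x. 0) \<in> H \<and>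
     -\<infinity> < Inf {ereal_integral \<mu> F + ereal c | \<mu> c. \<mu> \<in> test_measures D U0 \<and> 0 \<le> c \<and>
                      aff_sweep H \<nu> \<mu> c}
     \<longrightarrow>
     (\<forall>r. (\<forall>x\<in>D. 0 < r x) \<and>
          (\<forall>K. compact K \<and> K \<subseteq> D \<longrightarrow> (\<exists>e>0. \<forall>x\<in>K. e \<le> r x)) \<and>
          (\<forall>x\<in>D. \<forall>y. y \<notin> D \<longrightarrow> r x < dist x y)
      \<longrightarrow> (\<exists>rh. smooth_on D rh \<and> (\<forall>x\<in>D. 0 < rh x \<and> rh x \<le> r x) \<and>
               (\<exists>C::real. \<exists>h\<in>H. \<forall>x\<in>D. h x \<le> ereal (moll_avg a F rh x + C)))))"
proof -
  interpret \<nu>: finite_measure \<nu> by (rule nu_fin)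
  define Q where "Q = closure U0"
  have Q: "compact Q" "Q \<subseteq> D" using U0(4,5) by (auto simp: Q_def)
  have sup: "AE x in \<nu>. x \<in> measure_support \<nu>" by (rule AE_measure_support[OF nu_borel])
  have nuQ: "AE x in \<nu>. x \<in> Q"
    using sup by eventually_elim (use U0(3) closure_subset in \<open>auto simp: Q_def\<close>)
  have "U0 \<noteq> {}"
  proof
    assume "U0 = {}"
    hence "AE x in \<nu>. False" using sup U0(3) by auto
    hence "space \<nu> \<in> null_sets \<nu>" by (simp add: AE_iff_null_sets[OF sets.top] eventually_ae_filter)
    thus False using nu_ne by auto
  qed
  note U = U0(1) this closure_subset[of U0, folded Q_def]
  obtain F' where F': "locint D F'" "AE x\<in>D in lborel. F x = ereal (F' x)"
    using L1loc_borel_version[OF D_dom(1) F_loc] by blast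
  \<comment> \<open>Members with integral minus infinity against \<open>\<nu>\<close> satisfy every
    sweeping inequality, so all constraints come from \<open>HR\<close>.\<close>
  define HR where "HR = {h\<in>H. integrable \<nu> (rl h) \<and> (AE x in \<nu>. \<bar>h x\<bar> \<noteq> \<infinity>)}"
  have us: "h \<in> sbh D" if "h \<in> H" for h using H_sub that by (auto simp: sbh_star_def)
  have out: "ereal_integral \<nu> h = -\<infinity>" if "h \<in> H" "h \<notin> HR" for h
    using sbh_integral_cases[OF us[OF that(1)] D_dom(1) Q nu_fin nu_borel nuQ] that unfolding HR_def by blast
  have inn: "ereal_integral \<nu> h = ereal (\<integral>x. rl h x \<partial>\<nu>)" if "h \<in> HR" for h
  proof (rule ereal_integral_eq)
    have "AE x in \<nu>. \<bar>h x\<bar> \<noteq> \<infinity>" using that by (simp add: HR_def)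
    thus "AE x in \<nu>. h x = ereal (rl h x)" by eventually_elim (simp add: ereal_real)
  qed (use that in \<open>simp add: HR_def\<close>)
  let ?adm = "\<lambda>g. smooth_on UNIV g \<and> (\<forall>x. 0 \<le> g x) \<and> (\<exists>L. compact L \<and> L \<subseteq> D - U0 \<and> (\<forall>x. x \<notin> L \<longrightarrow> g x = 0))"
  define \<mu> where "\<mu> = (\<lambda>g. density lebesgue (\<lambda>x. indicator D x * ennreal (g x)))"
  have li: "integrable lborel (\<lambda>x. v x * g x)" if v: "locint D v" and g: "?adm g" for v g
  proof -
    obtain L where L: "compact L" "L \<subseteq> D - U0" "\<And>x. x \<notin> L \<Longrightarrow> g x = 0" using g by blast
    have gs: "smooth_on UNIV g" using g by blast
    have "continuous_on UNIV g" using gs unfolding smooth_on_def by (blast intro: Ck_on_imp_continuous_on)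
    hence "continuous_on L g" by (rule continuous_on_subset) simp
    hence "bounded (g ` L)" by (intro compact_imp_bounded compact_continuous_image L(1))
    then obtain B where "\<forall>y\<in>g ` L. norm y \<le> B" unfolding bounded_iff by blast
    hence B: "\<bar>g x\<bar> \<le> \<bar>B\<bar>" for x using L(3)[of x] by (cases "x \<in> L") force+
    have "L \<subseteq> D" using L(2) by blast
    thus ?thesis by (rule locint_mult(1)[OF v L(1) _ smooth_on_borel[OF gs] B L(3)])
  qed
  have \<mu>: "\<mu> g \<in> test_measures D U0" if "?adm g" for g
    using that smooth_density(1)[of g] unfolding \<mu>_def by blast
  have \<mu>i: "ereal_integral (\<mu> g) \<phi> = ereal (LBINT x. v x * g x)"
    if g: "?adm g" and v: "locint D v" and AE: "AE x\<in>D in lborel. \<phi> x = ereal (v x)" for g \<phi> v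
  proof -
    obtain L where L: "compact L" "L \<subseteq> D - U0" "\<forall>x. x \<notin> L \<longrightarrow> g x = 0" using g by blast
    have vm: "v \<in> borel_measurable borel" using v by (simp add: locint_def)
    have "smooth_on UNIV g" "\<forall>x. 0 \<le> g x" using g by blast+
    thus ?thesis unfolding \<mu>_def by (rule smooth_density(2)[OF _ _ L AE vm li[OF v g]])
  qed
  have \<mu>F: "ereal_integral (\<mu> g) F = ereal (LBINT x. F' x * g x)" if "?adm g" for g
    by (rule \<mu>i[OF that F'])
  have \<mu>h: "ereal_integral (\<mu> g) h = ereal (LBINT x. rl h x * g x)" if g: "?adm g" and h: "h \<in> H" for g h
  proof -
    have hs: "h \<in> sbh_star D" using h H_sub by blast
    note l = sbh_star_locint[OF D_dom(1,2) hs]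
    have "AE x\<in>D in lborel. h x = ereal (rl h x)" using l(2) by eventually_elim (simp add: ereal_real)
    thus ?thesis by (rule \<mu>i[OF g l(1)])
  qed
  have closed: "limsup_closed D H \<or> L1_closed D H" using cond_ab unfolding limsup_closed_def L1_closed_def .
  show ?thesis
  proof (intro conjI impI allI; elim conjE)
    fix r :: "'a \<Rightarrow> real"
    assume r: "\<forall>x\<in>D. 0 < r x" "\<forall>K. compact K \<and> K \<subseteq> D \<longrightarrow> (\<exists>e>0. \<forall>x\<in>K. e \<le> r x)"
      "\<forall>x\<in>D. \<forall>y. y \<notin> D \<longrightarrow> r x < dist x y"
      and sc: "\<forall>h\<in>H. \<forall>c>0. (\<lambda>x. ereal c * h x) \<in> H" and ad: "\<forall>h1\<in>H. \<forall>h2\<in>H. (\<lambda>x. h1 x + h2 x) \<in> H"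
      and h0: "\<exists>h\<in>H. \<forall>x\<in>D. h x \<le> 0"
      and inf: "-\<infinity> < Inf {ereal_integral \<mu> F | \<mu>. \<mu> \<in> test_measures D U0 \<and> lin_sweep H \<nu> \<mu>}"
    \<comment> \<open>Any real number below the infimum serves as \<open>I\<close>; an infimum equal
      to plus infinity is covered too.\<close>
    obtain I where "ereal I < Inf {ereal_integral \<mu> F | \<mu>. \<mu> \<in> test_measures D U0 \<and> lin_sweep H \<nu> \<mu>}"
      using ereal_dense2[OF inf] by blast
    hence low: "ereal I \<le> ereal_integral \<mu> F" if "\<mu> \<in> test_measures D U0" "lin_sweep H \<nu> \<mu>" for \<mu>
      using that by (intro order.trans[OF less_imp_le Inf_lower]) blast+
    show "\<exists>rh. smooth_on D rh \<and> (\<forall>x\<in>D. 0 < rh x \<and> rh x \<le> r x) \<and>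
               (\<exists>C::real. \<exists>h\<in>H. \<forall>x\<in>D. h x \<le> ereal (moll_avg a F rh x + C))"
    proof (cases "HR = {}")
      case True
      obtain h0 where h0: "h0 \<in> H" "\<forall>x\<in>D. h0 x \<le> 0" using h0 by blast
      show ?thesis
      proof (rule envelope_nonneg[OF moll D_dom(1,3) U(2,3) Q h0 F' _ r])
        fix g assume "smooth_on UNIV g" "\<forall>x. 0 \<le> g x" "\<exists>L. compact L \<and> L \<subseteq> D - U0 \<and> (\<forall>x. x \<notin> L \<longrightarrow> g x = 0)"
        hence g: "?adm g" by blast
        show "0 \<le> (LBINT x. F' x * g x)"
        proof (rule ccontr)
          assume neg: "\<not> ?thesis"
          \<comment> \<open>Rescaling by \<open>t\<close> brings the integral of \<open>F'\<close>
            to \<open>- (\<bar>I\<bar> + 1)\<close>, below \<open>I\<close>; the rescaled measure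
            still sweeps, since no member imposes a condition.\<close>
          define t where "t = (\<bar>I\<bar> + 1) / - (LBINT x. F' x * g x)"
          have t: "0 < t" using neg by (simp add: t_def divide_pos_neg divide_neg_neg)
          have "smooth_on UNIV (\<lambda>x. t * g x)" using g Ck_on_cmult unfolding smooth_on_def by blast
          moreover have "\<exists>L. compact L \<and> L \<subseteq> D - U0 \<and> (\<forall>x. x \<notin> L \<longrightarrow> t * g x = 0)" using g by force
          ultimately have gt: "?adm (\<lambda>x. t * g x)" using g t by simp
          have "lin_sweep H \<nu> (\<mu> (\<lambda>x. t * g x))" unfolding lin_sweep_def using out True by simp
          hence "ereal I \<le> ereal (LBINT x. F' x * (t * g x))" using low[OF \<mu>[OF gt]] \<mu>F[OF gt] by simp
          hence "I \<le> t * (LBINT x. F' x * g x)" by (simp add: mult.left_commute)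
          also have "\<dots> = - (\<bar>I\<bar> + 1)" using neg by (simp add: t_def)
          finally show False by linarith
        qed
      qed
    next
      case False
      show ?thesis
      proof (rule envelope_from_sweeping[OF moll D_dom H_sub closed nu_fin nu_borel nuQ nu_ne U Q HR_def False _ F' _ r])
        show "\<forall>h1\<in>HR. \<forall>h2\<in>HR. \<forall>t. 0 < t \<and> t < 1 \<longrightarrow> (\<lambda>x. ereal t * h1 x + ereal (1 - t) * h2 x) \<in> H"
          using sc ad unfolding HR_def by simp
        fix g c
        assume "smooth_on UNIV g" "\<forall>x. 0 \<le> g x" "\<exists>L. compact L \<and> L \<subseteq> D - U0 \<and> (\<forall>x. x \<notin> L \<longrightarrow> g x = 0)"
        hence g: "?adm g" by blast
        assume le: "\<forall>h\<in>HR. (\<integral>x. rl h x \<partial>\<nu>) \<le> (LBINT x. rl h x * g x) + c"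
        \<comment> \<open>In a cone \<open>h\<close> may be replaced by \<open>l * h\<close> while
          \<open>c\<close> stays: small \<open>l\<close> forces \<open>0 \<le> c\<close>, large
          \<open>l\<close> forces the inequality without \<open>c\<close>. Affine sweeping thus
          becomes linear.\<close>
        have sle: "l * (\<integral>x. rl h x \<partial>\<nu>) \<le> l * (LBINT x. rl h x * g x) + c" if h: "h \<in> HR" and l: "0 < l" for h l
        proof -
          have "(\<lambda>x. ereal l * h x) \<in> HR"
            unfolding HR_def
          proof (intro CollectI conjI)
            show "(\<lambda>x. ereal l * h x) \<in> H" using sc h l by (simp add: HR_def)
            show "integrable \<nu> (\<lambda>x. real_of_ereal (ereal l * h x))" using h by (simp add: HR_def)
            have "AE x in \<nu>. \<bar>h x\<bar> \<noteq> \<infinity>" using h by (simp add: HR_def)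
            thus "AE x in \<nu>. \<bar>ereal l * h x\<bar> \<noteq> \<infinity>" by eventually_elim auto
          qed
          hence "(\<integral>x. real_of_ereal (ereal l * h x) \<partial>\<nu>) \<le> (LBINT x. real_of_ereal (ereal l * h x) * g x) + c"
            by (rule bspec[OF le])
          thus ?thesis by (simp add: mult.assoc)
        qed
        have c: "0 \<le> c"
        proof (rule ccontr)
          assume "\<not> 0 \<le> c"
          obtain h where h: "h \<in> HR" using False by blast
          define d where "d = \<bar>(LBINT x. rl h x * g x) - (\<integral>x. rl h x \<partial>\<nu>)\<bar>"
          \<comment> \<open>Chosen so that the scaled difference is at most \<open>- c / 2\<close>,
            half of what the inequality requires.\<close>
          define l where "l = - c / (2 * (d + 1))"
          have d: "0 \<le> d" by (simp add: d_def)
          have l: "0 < l" using \<open>\<not> 0 \<le> c\<close> d by (simp add: l_def divide_neg_pos)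
          have "- c \<le> l * ((LBINT x. rl h x * g x) - (\<integral>x. rl h x \<partial>\<nu>))" using sle[OF h l] by (simp add: algebra_simps)
          also have "\<dots> \<le> l * (d + 1)" using l by (intro mult_left_mono) (auto simp: d_def)
          also have "\<dots> = - c / 2" using d by (simp add: l_def field_simps)
          finally show False using \<open>\<not> 0 \<le> c\<close> by simp
        qed
        have lin: "(\<integral>x. rl h x \<partial>\<nu>) \<le> (LBINT x. rl h x * g x)" if h: "h \<in> HR" for h
        proof (rule ccontr)
          assume n: "\<not> ?thesis"
          define d where "d = (\<integral>x. rl h x \<partial>\<nu>) - (LBINT x. rl h x * g x)"
          have d: "0 < d" using n by (simp add: d_def)
          have "(c + 1) / d * d \<le> c" using sle[OF h, of "(c + 1) / d"] c d unfolding d_def right_diff_distrib by simp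
          thus False using d by simp
        qed
        have "lin_sweep H \<nu> (\<mu> g)" unfolding lin_sweep_def
        proof
          fix h assume h: "h \<in> H"
          show "ereal_integral \<nu> h \<le> ereal_integral (\<mu> g) h"
            using out[OF h] inn[of h] \<mu>h[OF g h] lin[of h] by (cases "h \<in> HR") simp_all
        qed
        hence "ereal I \<le> ereal (LBINT x. F' x * g x)" using low[OF \<mu>[OF g]] \<mu>F[OF g] by simp
        thus "I \<le> (LBINT x. F' x * g x) + c" using c by simp
      qed
    qed
  next
    fix r :: "'a \<Rightarrow> real"
    assume r: "\<forall>x\<in>D. 0 < r x" "\<forall>K. compact K \<and> K \<subseteq> D \<longrightarrow> (\<exists>e>0. \<forall>x\<in>K. e \<le> r x)"
      "\<forall>x\<in>D. \<forall>y. y \<notin> D \<longrightarrow> r x < dist x y"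
      and cvx: "\<forall>h1\<in>H. \<forall>h2\<in>H. \<forall>t\<in>{0..1::real}. (\<lambda>x. ereal t * h1 x + ereal (1 - t) * h2 x) \<in> H"
      and zero: "(\<lambda>x. 0) \<in> H"
      and inf: "-\<infinity> < Inf {ereal_integral \<mu> F + ereal c | \<mu> c. \<mu> \<in> test_measures D U0 \<and> 0 \<le> c \<and> aff_sweep H \<nu> \<mu> c}"
    obtain I where "ereal I < Inf {ereal_integral \<mu> F + ereal c | \<mu> c. \<mu> \<in> test_measures D U0 \<and> 0 \<le> c \<and> aff_sweep H \<nu> \<mu> c}"
      using ereal_dense2[OF inf] by blast
    hence low: "ereal I \<le> ereal_integral \<mu> F + ereal c" if "\<mu> \<in> test_measures D U0" "0 \<le> c" "aff_sweep H \<nu> \<mu> c" for \<mu> c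
      using that by (intro order.trans[OF less_imp_le Inf_lower]) blast+
    \<comment> \<open>The zero function has integral 0 against every measure; it makes
      \<open>HR\<close> nonempty and forces \<open>0 \<le> c\<close> below.\<close>
    have z: "(\<lambda>x. 0) \<in> HR" using zero by (simp add: HR_def zero_ereal_def[symmetric])
    hence ne: "HR \<noteq> {}" by blast
    show "\<exists>rh. smooth_on D rh \<and> (\<forall>x\<in>D. 0 < rh x \<and> rh x \<le> r x) \<and>
               (\<exists>C::real. \<exists>h\<in>H. \<forall>x\<in>D. h x \<le> ereal (moll_avg a F rh x + C))"
    proof (rule envelope_from_sweeping[OF moll D_dom H_sub closed nu_fin nu_borel nuQ nu_ne U Q HR_def ne _ F' _ r])
      show "\<forall>h1\<in>HR. \<forall>h2\<in>HR. \<forall>t. 0 < t \<and> t < 1 \<longrightarrow> (\<lambda>x. ereal t * h1 x + ereal (1 - t) * h2 x) \<in> H"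
        using cvx unfolding HR_def by simp
      fix g c
      assume "smooth_on UNIV g" "\<forall>x. 0 \<le> g x" "\<exists>L. compact L \<and> L \<subseteq> D - U0 \<and> (\<forall>x. x \<notin> L \<longrightarrow> g x = 0)"
      hence g: "?adm g" by blast
      assume le: "\<forall>h\<in>HR. (\<integral>x. rl h x \<partial>\<nu>) \<le> (LBINT x. rl h x * g x) + c"
      have c: "0 \<le> c" using le[rule_format, OF z] by simp
      have "aff_sweep H \<nu> (\<mu> g) c" unfolding aff_sweep_def
      proof
        fix h assume h: "h \<in> H"
        show "ereal_integral \<nu> h \<le> ereal_integral (\<mu> g) h + ereal c"
          using out[OF h] inn[of h] \<mu>h[OF g h] bspec[OF le, of h] by (cases "h \<in> HR") simp_all
      qed
      thus "I \<le> (LBINT x. F' x * g x) + c" using low[OF \<mu>[OF g] c] \<mu>F[OF g] by simp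
    qed
  qed
qed

end
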